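(* Let $\tau>0$. The quantities $\|w\|_{L^2}$, $\|w_x+w^2+2\tau w\|_{H^{-1}_\tau}$ and the ground state energy of $-\partial^2+w_x+w^2+2\tau w+\tau^2$ are related as follows: $$\|w_x+w^2+2\tau w\|_{H^{-1}_\tau}\le\big(2+\tau^{-1/2}\|w\|_{L^2}\big)\|w\|_{L^2}.$$ For all $\psi\in H^1(\mathbb R)$ $$\big\langle(-\partial^2+w_x+2\tau w+w^2+\tau^2)\psi,\psi\big\rangle\ge\frac{\tau^2}4e^{-\frac1\tau\|w\|_{L^2}^2}\|\psi\|_{L^2}^2 .$$ Let $w\in L^2_{loc}(\mathbb R)$ and let $-\tau_1^2$ be the infimum of the spectrum of $-\partial^2+w_x+w^2+2\tau w$. Then there exists an absolute constant $C>0$ so that $$\|w\|_{L^2}\le C\Big(1+\ln\Big(\frac\tau{\tau-\tau_1}\Big)\Big)^{1/2}\|w_x+2\tau w+w^2\|_{H^{-1}_\tau}.$$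
   Context: Functions are real valued on $\mathbb R$; in the first two estimates $w\in L^2(\mathbb R)$. $\|f\|_{H^{-1}_\tau}=\|(\xi^2+\tau^2)^{-1/2}\hat f\|_{L^2}$ with the unitary Fourier transform. For $u\in H^{-1}(\mathbb R)$ the operator $-\partial^2+u$ is understood through its quadratic form on $H^1(\mathbb R)$, $\langle\cdot,\cdot\rangle$ is the $H^{-1}$–$H^1$ duality pairing, and $\tau_1\ge0$.
   Formalization: The third estimate fails for w = -2τ (left side infinite, right side 0), so w is also assumed square integrable on (-∞,0]; w_x+w²+2τw in H^{-1} and τ_1<τ are assumed so that its terms are defined, and w in L² is concluded. *)

theory Defs
  imports "HOL-Analysis.Analysis"
begin

definition L2 :: "(real \<Rightarrow> real) \<Rightarrow> bool" where
  "L2 f \<longleftrightarrow> f \<in> borel_measurable lborel \<and> integrable lborel (\<lambda>x. (f x)\<^sup>2)"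

definition L2_loc :: "(real \<Rightarrow> real) \<Rightarrow> bool" where
  "L2_loc f \<longleftrightarrow> f \<in> borel_measurable lborel \<and>
     (\<forall>a b. set_integrable lborel {a..b} (\<lambda>x. (f x)\<^sup>2))"

definition l2norm :: "(real \<Rightarrow> real) \<Rightarrow> real" where
  "l2norm f = sqrt (\<integral>x. (f x)\<^sup>2 \<partial>lborel)"

definition test_function :: "(real \<Rightarrow> real) \<Rightarrow> bool" where
  "test_function \<phi> \<longleftrightarrow>
     (\<forall>k x. (deriv ^^ k) \<phi> differentiable (at x)) \<and> (\<exists>R. \<forall>x. R < \<bar>x\<bar> \<longrightarrow> \<phi> x = 0)"

text \<open>Distributions are functionals on real test functions; their values on other functions
  are never used.\<close>

type_synonym distribution = "(real \<Rightarrow> real) \<Rightarrow> real"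

definition regular :: "(real \<Rightarrow> real) \<Rightarrow> distribution" where
  "regular f = (\<lambda>\<phi>. \<integral>x. f x * \<phi> x \<partial>lborel)"

definition ddx :: "distribution \<Rightarrow> distribution" where
  "ddx T = (\<lambda>\<phi>. - T (deriv \<phi>))"

text \<open>The distribution $w_x + w^2 + 2\tau w$.\<close>

definition miura :: "real \<Rightarrow> (real \<Rightarrow> real) \<Rightarrow> distribution" where
  "miura \<tau> w = (\<lambda>\<phi>. ddx (regular w) \<phi> + regular (\<lambda>x. (w x)\<^sup>2 + 2 * \<tau> * w x) \<phi>)"

definition fourier :: "(real \<Rightarrow> real) \<Rightarrow> real \<Rightarrow> complex" where
  "fourier \<phi> \<xi> = (\<integral>x. cis (- (\<xi> * x)) * complex_of_real (\<phi> x) \<partial>lborel) / complex_of_real (sqrt (2 * pi))"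

text \<open>The function \<open>g\<close> is the Fourier transform of \<open>T\<close> in the sense of distributions.
  For real \<open>\<phi>\<close> the conjugate of the transform at \<open>\<xi>\<close> is its value at \<open>-\<xi>\<close>, so this is
  the usual definition by transposition, written in Parseval form.\<close>

definition has_fourier :: "distribution \<Rightarrow> (real \<Rightarrow> complex) \<Rightarrow> bool" where
  "has_fourier T g \<longleftrightarrow> g \<in> borel_measurable lborel \<and>
     (\<forall>\<phi>. test_function \<phi> \<longrightarrow>
        integrable lborel (\<lambda>\<xi>. g \<xi> * cnj (fourier \<phi> \<xi>)) \<and>
        complex_of_real (T \<phi>) = (\<integral>\<xi>. g \<xi> * cnj (fourier \<phi> \<xi>) \<partial>lborel))"

text \<open>The space $H^{-1}$ does not depend on the parameter of its norm, so membership is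
  expressed with parameter 1.\<close>

definition Hneg_transform :: "distribution \<Rightarrow> (real \<Rightarrow> complex) \<Rightarrow> bool" where
  "Hneg_transform T g \<longleftrightarrow>
     has_fourier T g \<and> integrable lborel (\<lambda>\<xi>. (cmod (g \<xi>))\<^sup>2 / (\<xi>\<^sup>2 + 1))"

definition Hneg :: "distribution \<Rightarrow> bool" where
  "Hneg T \<longleftrightarrow> (\<exists>g. Hneg_transform T g)"

text \<open>The choice of \<open>g\<close> is immaterial: it is determined by \<open>T\<close> almost everywhere.  The value
  is meaningful only under \<open>Hneg T\<close>.\<close>

definition Hneg_norm :: "real \<Rightarrow> distribution \<Rightarrow> real" where
  "Hneg_norm \<tau> T =
     (let g = (SOME g. Hneg_transform T g)
      in sqrt (\<integral>\<xi>. (cmod (g \<xi>))\<^sup>2 / (\<xi>\<^sup>2 + \<tau>\<^sup>2) \<partial>lborel))"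

definition has_weak_deriv :: "(real \<Rightarrow> real) \<Rightarrow> (real \<Rightarrow> real) \<Rightarrow> bool" where
  "has_weak_deriv f g \<longleftrightarrow> (\<forall>\<phi>. test_function \<phi> \<longrightarrow> regular g \<phi> = ddx (regular f) \<phi>)"

definition H1 :: "(real \<Rightarrow> real) \<Rightarrow> bool" where
  "H1 f \<longleftrightarrow> L2 f \<and> (\<exists>g. L2 g \<and> has_weak_deriv f g)"

definition weak_deriv :: "(real \<Rightarrow> real) \<Rightarrow> real \<Rightarrow> real" where
  "weak_deriv f = (SOME g. L2 g \<and> has_weak_deriv f g)"

definition H1_norm :: "(real \<Rightarrow> real) \<Rightarrow> real" where
  "H1_norm f = sqrt ((l2norm f)\<^sup>2 + (l2norm (weak_deriv f))\<^sup>2)"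

text \<open>Duality pairing of $H^{-1}$ and $H^1$: the continuous extension of \<open>T\<close> from test functions
  to $H^1$.\<close>

definition pairing :: "distribution \<Rightarrow> (real \<Rightarrow> real) \<Rightarrow> real" where
  "pairing T h = (THE l. \<forall>\<phi>. (\<forall>n. test_function (\<phi> n)) \<and>
       (\<lambda>n. H1_norm (\<lambda>x. \<phi> n x - h x)) \<longlonglongrightarrow> 0 \<longrightarrow> (\<lambda>n. T (\<phi> n)) \<longlonglongrightarrow> l)"

text \<open>The bilinear form on $H^1$ of $-\partial^2 + T$, where $T \in H^{-1}$.\<close>

definition schroedinger_form :: "distribution \<Rightarrow> (real \<Rightarrow> real) \<Rightarrow> (real \<Rightarrow> real) \<Rightarrow> real" where
  "schroedinger_form T \<psi> \<phi> =
     (\<integral>x. weak_deriv \<psi> x * weak_deriv \<phi> x \<partial>lborel) + pairing T (\<lambda>x. \<psi> x * \<phi> x)"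

text \<open>Graph of the self-adjoint operator on $L^2$ that represents this form: \<open>\<psi>\<close> lies in the
  operator domain and is mapped to \<open>f\<close>.\<close>

definition schroedinger_op :: "distribution \<Rightarrow> (real \<Rightarrow> real) \<Rightarrow> (real \<Rightarrow> real) \<Rightarrow> bool" where
  "schroedinger_op T \<psi> f \<longleftrightarrow> H1 \<psi> \<and> L2 f \<and>
     (\<forall>\<phi>. H1 \<phi> \<longrightarrow> schroedinger_form T \<psi> \<phi> = (\<integral>x. f x * \<phi> x \<partial>lborel))"

text \<open>The operator minus \<open>\<mu>\<close> is onto and has a bounded inverse; injectivity is contained in the
  bound.  The operator is self-adjoint with real coefficients, so its spectrum is real and may be
  computed in the real space $L^2$.\<close>

definition resolvent_set :: "distribution \<Rightarrow> real set" where
  "resolvent_set T = {\<mu>.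
     (\<exists>C. \<forall>\<psi> f. schroedinger_op T \<psi> f \<longrightarrow> l2norm \<psi> \<le> C * l2norm (\<lambda>x. f x - \<mu> * \<psi> x)) \<and>
     (\<forall>h. L2 h \<longrightarrow> (\<exists>\<psi> f. schroedinger_op T \<psi> f \<and> (AE x in lborel. f x - \<mu> * \<psi> x = h x)))}"

definition spectrum :: "distribution \<Rightarrow> real set" where
  "spectrum T = - resolvent_set T"

definition is_infimum :: "real \<Rightarrow> real set \<Rightarrow> bool" where
  "is_infimum m S \<longleftrightarrow> S \<noteq> {} \<and> bdd_below S \<and> Inf S = m"

end

theory Submission
  imports Defs "HOL-Probability.Probability"
begin

text \<open>Put \<open>a = w + \<tau>\<close>.  The distribution \<open>w\<^sub>x + w\<^sup>2 + 2 \<tau> w + \<tau>\<^sup>2\<close> equals \<open>a' + a\<^sup>2\<close>, and the operator with this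
potential factors as the product of \<open>\<partial> - a\<close> and its adjoint: its quadratic form at \<open>\<psi>\<close> is the
integral of \<open>(\<psi>' - a \<psi>)\<^sup>2\<close> (\<open>miura_factorization\<close>).  The second and the third estimate rest on this
identity.

The upper bound for the \<open>H\<^sup>-\<^sup>1\<close> norm (\<open>miura_Hneg\<close>) is read off from the Fourier transform.  The linear part has the
symbol \<open>\<i> \<xi> + 2 \<tau>\<close>, which is at most twice the weight \<open>sqrt (\<xi>\<^sup>2 + \<tau>\<^sup>2)\<close>.  The square \<open>w\<^sup>2\<close> is
integrable, so its transform is bounded, and \<open>1 / (\<xi>\<^sup>2 + \<tau>\<^sup>2)\<close> has integral \<open>\<pi> / \<tau>\<close>.

For the lower bound of the energy (\<open>miura_form_ge\<close>) the first order equation \<open>\<psi>' - a \<psi> = f\<close> is solved from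
the right.  The primitive of \<open>a\<close> grows at least like \<open>\<tau> x / 2\<close> up to the additive error
\<open>\<parallel>w\<parallel>\<^sup>2 / (2 \<tau>)\<close> (\<open>primitive_growth\<close>).  Hence \<open>\<psi>\<close> is dominated by a one-sided exponential convolution
of \<open>f\<close>, and Young's inequality bounds \<open>\<psi>\<close> by \<open>f\<close> in \<open>L\<^sup>2\<close>.

The third estimate inverts the nonlinear map from \<open>w\<close> to \<open>T = w\<^sub>x + w\<^sup>2 + 2 \<tau> w\<close>.  Let \<open>v\<close> be the
solution of \<open>v' + \<tau> v = T\<close> for which \<open>w - v\<close> tends to \<open>0\<close> at \<open>-\<infinity>\<close>.  Its \<open>L\<^sup>2\<close> norm is at most the
\<open>H\<^sup>-\<^sup>1\<close> norm of \<open>T\<close> (\<open>duhamel_norm\<close>), because \<open>\<partial> + \<tau>\<close> has a symbol of modulus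
\<open>sqrt (\<xi>\<^sup>2 + \<tau>\<^sup>2)\<close>.  The difference \<open>q = w - v\<close> is absolutely continuous and solves the forced Riccati equation \<open>q' = - q (q + 2 \<tau>) - (2 q + \<tau>) v - v\<^sup>2\<close>.  Without
forcing, \<open>0\<close> is a stable and \<open>-2 \<tau>\<close> an unstable equilibrium.  A Lyapunov function shows that the
squared distance of \<open>q\<close> from the pair of equilibria has an integral of at most a constant times \<open>\<parallel>v\<parallel>\<^sup>2\<close>
(\<open>dissip_integral\<close>); that \<open>q\<close> exists on the whole line excludes escape below \<open>-2 \<tau>\<close>, where
solutions blow up.

It remains to bound the measure of the set where \<open>q\<close> is near \<open>-2 \<tau>\<close>.  There \<open>a\<close> is near \<open>-\<tau>\<close> apart from \<open>v\<close>, so that \<open>exp (2 W)\<close>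
with \<open>W' = a\<close> decays exponentially at a rate of the order of \<open>\<tau>\<close>, while by assumption the form is bounded below by
\<open>\<tau>\<^sup>2 - \<tau>\<^sub>1\<^sup>2\<close> times the square norm (\<open>form_ge_Inf_spectrum\<close>).  After the substitution \<open>\<psi> = exp W \<cdot> h\<close> this is a
Hardy inequality with weight \<open>exp (2 W)\<close>, and it forbids such decay over a distance \<open>\<Lambda>\<close> of the
order of \<open>(1 + ln (\<tau> / (\<tau> - \<tau>\<^sub>1))) / \<tau>\<close>.  So every point of the set is preceded, within distance \<open>\<Lambda>\<close>, by a piece of
the line on which \<open>v\<^sup>2\<close> and the dissipation have integral at least \<open>\<tau> / 20\<close> (\<open>cost_before_left\<close>), and
Tonelli's theorem converts this into a bound of the measure by a multiple of \<open>\<Lambda> \<parallel>v\<parallel>\<^sup>2 / \<tau>\<close>.  On the set \<open>q\<^sup>2\<close> is of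
the order \<open>\<tau>\<^sup>2\<close> apart from the dissipation, which gives the logarithm in the
statement.

The pairing and the spectrum are reached through test functions, so their density in \<open>L\<^sup>p\<close> and in
\<open>H\<^sup>1\<close>, the calculus of absolutely continuous functions, and Fourier inversion with Plancherel's
identity are established as well.\<close>

section \<open>Square integrable functions\<close>

lemma Cauchy_Schwarz_integral:
  fixes f g :: "'a \<Rightarrow> real"
  assumes [measurable]: "f \<in> borel_measurable M" "g \<in> borel_measurable M"
    and f: "integrable M (\<lambda>x. (f x)\<^sup>2)" and g: "integrable M (\<lambda>x. (g x)\<^sup>2)"
  shows "integrable M (\<lambda>x. f x * g x)"
    and "(\<integral>x. \<bar>f x * g x\<bar> \<partial>M) \<le> sqrt (\<integral>x. (f x)\<^sup>2 \<partial>M) * sqrt (\<integral>x. (g x)\<^sup>2 \<partial>M)"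
    and "\<bar>\<integral>x. f x * g x \<partial>M\<bar> \<le> sqrt (\<integral>x. (f x)\<^sup>2 \<partial>M) * sqrt (\<integral>x. (g x)\<^sup>2 \<partial>M)"
proof -
  show i: "integrable M (\<lambda>x. f x * g x)"
  proof (rule Bochner_Integration.integrable_bound)
    show "integrable M (\<lambda>x. (f x)\<^sup>2 + (g x)\<^sup>2)" using f g by simp
    show "AE x in M. norm (f x * g x) \<le> norm ((f x)\<^sup>2 + (g x)\<^sup>2)"
    proof (rule AE_I2)
      fix x
      have "2 * (\<bar>f x\<bar> * \<bar>g x\<bar>) \<le> (f x)\<^sup>2 + (g x)\<^sup>2"
        using sum_squares_bound[of "\<bar>f x\<bar>" "\<bar>g x\<bar>"] by (simp add: mult.assoc)
      moreover have "0 \<le> \<bar>f x\<bar> * \<bar>g x\<bar>" by simp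
      ultimately have "\<bar>f x\<bar> * \<bar>g x\<bar> \<le> (f x)\<^sup>2 + (g x)\<^sup>2" by linarith
      then show "norm (f x * g x) \<le> norm ((f x)\<^sup>2 + (g x)\<^sup>2)"
        by (simp add: abs_mult)
    qed
  qed simp
  have ia: "integrable M (\<lambda>x. \<bar>f x * g x\<bar>)" using i by (rule integrable_abs)
  define I A B where "I = (\<integral>x. \<bar>f x * g x\<bar> \<partial>M)" and "A = (\<integral>x. (f x)\<^sup>2 \<partial>M)"
    and "B = (\<integral>x. (g x)\<^sup>2 \<partial>M)"
  have nn: "0 \<le> I" "0 \<le> A" "0 \<le> B" by (auto simp: I_def A_def B_def intro!: integral_nonneg_AE)
  have "(\<integral>\<^sup>+x. ennreal \<bar>f x\<bar> * ennreal \<bar>g x\<bar> \<partial>M)\<^sup>2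
      \<le> (\<integral>\<^sup>+x. (ennreal \<bar>f x\<bar>)\<^sup>2 \<partial>M) * (\<integral>\<^sup>+x. (ennreal \<bar>g x\<bar>)\<^sup>2 \<partial>M)"
    by (rule Cauchy_Schwarz_nn_integral) auto
  also have "(\<integral>\<^sup>+x. ennreal \<bar>f x\<bar> * ennreal \<bar>g x\<bar> \<partial>M) = ennreal I"
    unfolding I_def using ia
    by (subst nn_integral_eq_integral[symmetric]) (auto simp: abs_mult ennreal_mult)
  also have "(\<integral>\<^sup>+x. (ennreal \<bar>f x\<bar>)\<^sup>2 \<partial>M) = ennreal A"
    unfolding A_def using f
    by (subst nn_integral_eq_integral[symmetric]) (auto simp: ennreal_power)
  also have "(\<integral>\<^sup>+x. (ennreal \<bar>g x\<bar>)\<^sup>2 \<partial>M) = ennreal B"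
    unfolding B_def using g
    by (subst nn_integral_eq_integral[symmetric]) (auto simp: ennreal_power)
  finally have "I\<^sup>2 \<le> A * B"
    using nn by (simp add: ennreal_power ennreal_mult[symmetric])
  then have "I \<le> sqrt (A * B)" by (rule real_le_rsqrt)
  then show *: "(\<integral>x. \<bar>f x * g x\<bar> \<partial>M) \<le> sqrt (\<integral>x. (f x)\<^sup>2 \<partial>M) * sqrt (\<integral>x. (g x)\<^sup>2 \<partial>M)"
    by (simp add: I_def A_def B_def real_sqrt_mult)
  have "\<bar>\<integral>x. f x * g x \<partial>M\<bar> \<le> (\<integral>x. \<bar>f x * g x\<bar> \<partial>M)"
    by (rule integral_abs_bound)
  with * show "\<bar>\<integral>x. f x * g x \<partial>M\<bar> \<le> sqrt (\<integral>x. (f x)\<^sup>2 \<partial>M) * sqrt (\<integral>x. (g x)\<^sup>2 \<partial>M)"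
    by linarith
qed

lemma integrable_square_add:
  fixes f g :: "'a \<Rightarrow> real"
  assumes [measurable]: "f \<in> borel_measurable M" "g \<in> borel_measurable M"
    and f: "integrable M (\<lambda>x. (f x)\<^sup>2)" and g: "integrable M (\<lambda>x. (g x)\<^sup>2)"
  shows "integrable M (\<lambda>x. (f x + g x)\<^sup>2)"
proof -
  have "integrable M (\<lambda>x. (f x)\<^sup>2 + (g x)\<^sup>2 + 2 * (f x * g x))"
    using Cauchy_Schwarz_integral(1)[OF assms] f g by simp
  then show ?thesis by (simp add: power2_sum mult.assoc)
qed

lemma Minkowski_square:
  fixes f g :: "'a \<Rightarrow> real"
  assumes [measurable]: "f \<in> borel_measurable M" "g \<in> borel_measurable M"
    and f: "integrable M (\<lambda>x. (f x)\<^sup>2)" and g: "integrable M (\<lambda>x. (g x)\<^sup>2)"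
  shows "sqrt (\<integral>x. (f x + g x)\<^sup>2 \<partial>M) \<le> sqrt (\<integral>x. (f x)\<^sup>2 \<partial>M) + sqrt (\<integral>x. (g x)\<^sup>2 \<partial>M)"
proof -
  define A B where "A = sqrt (\<integral>x. (f x)\<^sup>2 \<partial>M)" and "B = sqrt (\<integral>x. (g x)\<^sup>2 \<partial>M)"
  have nn: "0 \<le> A" "0 \<le> B" and A2: "A\<^sup>2 = (\<integral>x. (f x)\<^sup>2 \<partial>M)" and B2: "B\<^sup>2 = (\<integral>x. (g x)\<^sup>2 \<partial>M)"
    by (auto simp: A_def B_def)
  have fg: "integrable M (\<lambda>x. f x * g x)" and le: "(\<integral>x. f x * g x \<partial>M) \<le> A * B"
    using Cauchy_Schwarz_integral(1,3)[OF assms] by (auto simp: A_def B_def)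
  have "(\<integral>x. (f x + g x)\<^sup>2 \<partial>M) = (\<integral>x. (f x)\<^sup>2 + (g x)\<^sup>2 + 2 * (f x * g x) \<partial>M)"
    by (simp add: power2_sum mult.assoc)
  also have "\<dots> = A\<^sup>2 + B\<^sup>2 + 2 * (\<integral>x. f x * g x \<partial>M)"
    using fg f g by (simp add: A2 B2)
  also have "\<dots> \<le> (A + B)\<^sup>2" using le by (simp add: power2_sum)
  finally show ?thesis using nn unfolding A_def[symmetric] B_def[symmetric] by (intro real_le_lsqrt) auto
qed

lemma L2_measurable: "L2 f \<Longrightarrow> f \<in> borel_measurable borel"
  by (simp add: L2_def)

lemma L2_integrable: "L2 f \<Longrightarrow> integrable lborel (\<lambda>x. (f x)\<^sup>2)"
  by (simp add: L2_def)

lemma l2norm_nonneg [simp]: "0 \<le> l2norm f"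
  by (simp add: l2norm_def)

lemma l2norm_power2: "(l2norm f)\<^sup>2 = (\<integral>x. (f x)\<^sup>2 \<partial>lborel)"
  by (simp add: l2norm_def)

lemma L2_add: "L2 f \<Longrightarrow> L2 g \<Longrightarrow> L2 (\<lambda>x. f x + g x)"
  unfolding L2_def by (auto intro: integrable_square_add)

lemma L2_cmult: "L2 f \<Longrightarrow> L2 (\<lambda>x. c * f x)"
  unfolding L2_def by (auto simp: power_mult_distrib)

lemma L2_diff: "L2 f \<Longrightarrow> L2 g \<Longrightarrow> L2 (\<lambda>x. f x - g x)"
  using L2_add[of f "\<lambda>x. (-1) * g x"] L2_cmult[of g "-1"] by simp

lemma L2_mult_integrable: "L2 f \<Longrightarrow> L2 g \<Longrightarrow> integrable lborel (\<lambda>x. f x * g x)"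
  unfolding L2_def by (auto intro: Cauchy_Schwarz_integral(1))

lemma L2_Cauchy_Schwarz:
  "L2 f \<Longrightarrow> L2 g \<Longrightarrow> \<bar>\<integral>x. f x * g x \<partial>lborel\<bar> \<le> l2norm f * l2norm g"
  unfolding L2_def l2norm_def by (auto intro: Cauchy_Schwarz_integral(3))

lemma L2_Cauchy_Schwarz_abs:
  "L2 f \<Longrightarrow> L2 g \<Longrightarrow> (\<integral>x. \<bar>f x * g x\<bar> \<partial>lborel) \<le> l2norm f * l2norm g"
  unfolding L2_def l2norm_def by (auto intro: Cauchy_Schwarz_integral(2))

lemma l2norm_triangle: "L2 f \<Longrightarrow> L2 g \<Longrightarrow> l2norm (\<lambda>x. f x + g x) \<le> l2norm f + l2norm g"
  unfolding L2_def l2norm_def by (auto intro: Minkowski_square)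

lemma l2norm_cmult: "l2norm (\<lambda>x. c * f x) = \<bar>c\<bar> * l2norm f"
  by (simp add: l2norm_def power_mult_distrib real_sqrt_mult)

lemma l2norm_minus_commute: "l2norm (\<lambda>x. f x - g x) = l2norm (\<lambda>x. g x - f x)"
  by (simp add: l2norm_def power2_commute)

lemma l2norm_diff_triangle: "L2 f \<Longrightarrow> L2 g \<Longrightarrow> L2 h \<Longrightarrow>
  l2norm (\<lambda>x. f x - h x) \<le> l2norm (\<lambda>x. f x - g x) + l2norm (\<lambda>x. g x - h x)"
  using l2norm_triangle[of "\<lambda>x. f x - g x" "\<lambda>x. g x - h x"] by (simp add: L2_diff)

lemma L2_cong_AE:
  "L2 f \<Longrightarrow> g \<in> borel_measurable borel \<Longrightarrow> AE x in lborel. f x = g x \<Longrightarrow> L2 g"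
  unfolding L2_def by (auto intro: integrable_cong_AE_imp elim!: AE_mp)

lemma l2norm_cong_AE:
  assumes [measurable]: "f \<in> borel_measurable borel" "g \<in> borel_measurable borel"
    and "AE x in lborel. f x = g x"
  shows "l2norm f = l2norm g"
  unfolding l2norm_def using assms(3) by (intro arg_cong[where f=sqrt] integral_cong_AE) auto

lemma L2_tendsto_inner:
  assumes f: "\<And>n. L2 (f n)" "L2 F" "(\<lambda>n. l2norm (\<lambda>x. f n x - F x)) \<longlonglongrightarrow> 0"
    and g: "\<And>n. L2 (g n)" "L2 G" "(\<lambda>n. l2norm (\<lambda>x. g n x - G x)) \<longlonglongrightarrow> 0"
  shows "(\<lambda>n. \<integral>x. f n x * g n x \<partial>lborel) \<longlonglongrightarrow> (\<integral>x. F x * G x \<partial>lborel)"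
proof -
  let ?a = "\<lambda>n. l2norm (\<lambda>x. f n x - F x)" and ?b = "\<lambda>n. l2norm (\<lambda>x. g n x - G x)"
  have bd: "\<bar>(\<integral>x. f n x * g n x \<partial>lborel) - (\<integral>x. F x * G x \<partial>lborel)\<bar>
      \<le> ?a n * ?b n + ?a n * l2norm G + l2norm F * ?b n" for n
  proof -
    have d: "L2 (\<lambda>x. f n x - F x)" "L2 (\<lambda>x. g n x - G x)" using f g by (auto intro: L2_diff)
    have "(\<integral>x. f n x * g n x \<partial>lborel) - (\<integral>x. F x * G x \<partial>lborel)
      = (\<integral>x. f n x * g n x - F x * G x \<partial>lborel)"
      using f g by (simp add: L2_mult_integrable)
    also have "\<dots> = (\<integral>x. ((f n x - F x) * (g n x - G x) + (f n x - F x) * G x) + F x * (g n x - G x) \<partial>lborel)"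
      by (rule Bochner_Integration.integral_cong) (auto simp: algebra_simps)
    also have "\<dots> = (\<integral>x. (f n x - F x) * (g n x - G x) \<partial>lborel) + (\<integral>x. (f n x - F x) * G x \<partial>lborel)
        + (\<integral>x. F x * (g n x - G x) \<partial>lborel)"
      using L2_mult_integrable[OF d(1) d(2)] L2_mult_integrable[OF d(1) g(2)] L2_mult_integrable[OF f(2) d(2)]
      by (simp add: Bochner_Integration.integral_add Bochner_Integration.integrable_add)
    finally show ?thesis
      using L2_Cauchy_Schwarz[OF d(1) d(2)] L2_Cauchy_Schwarz[OF d(1) g(2)] L2_Cauchy_Schwarz[OF f(2) d(2)]
      by linarith
  qed
  have "(\<lambda>n. ?a n * ?b n + ?a n * l2norm G + l2norm F * ?b n) \<longlonglongrightarrow> 0 * 0 + 0 * l2norm G + l2norm F * 0"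
    by (intro tendsto_intros f g)
  then have "(\<lambda>n. ?a n * ?b n + ?a n * l2norm G + l2norm F * ?b n) \<longlonglongrightarrow> 0" by simp
  then have "(\<lambda>n. (\<integral>x. f n x * g n x \<partial>lborel) - (\<integral>x. F x * G x \<partial>lborel)) \<longlonglongrightarrow> 0"
    by (rule Lim_null_comparison[rotated]) (use bd in auto)
  then show ?thesis by (simp add: LIM_zero_iff)
qed

lemma L2_tendsto_integral_square:
  assumes f: "\<And>n. L2 (f n)" "L2 F" "(\<lambda>n. l2norm (\<lambda>x. f n x - F x)) \<longlonglongrightarrow> 0"
  shows "(\<lambda>n. \<integral>x. (f n x)\<^sup>2 \<partial>lborel) \<longlonglongrightarrow> (\<integral>x. (F x)\<^sup>2 \<partial>lborel)"
  using L2_tendsto_inner[OF f f] by (simp add: power2_eq_square)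

section \<open>Smooth functions, bumps and plateaus\<close>

definition smooth :: "(real \<Rightarrow> real) \<Rightarrow> bool" where
  "smooth f \<longleftrightarrow> (\<forall>k x. (deriv ^^ k) f differentiable (at x))"

text \<open>A finite order of differentiability: closure properties of smooth functions are proved by
induction on the order, one derivative at a time.\<close>

definition diff_upto :: "nat \<Rightarrow> (real \<Rightarrow> real) \<Rightarrow> bool" where
  "diff_upto n f \<longleftrightarrow> (\<forall>k<n. \<forall>x. (deriv ^^ k) f differentiable (at x))"

lemma smooth_iff_diff_upto: "smooth f \<longleftrightarrow> (\<forall>n. diff_upto n f)"
  by (auto simp: smooth_def diff_upto_def)

lemma diff_upto_0 [simp]: "diff_upto 0 f"
  by (simp add: diff_upto_def)

lemma diff_upto_Suc: "diff_upto (Suc n) f \<longleftrightarrow> (\<forall>x. f differentiable (at x)) \<and> diff_upto n (deriv f)"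
proof -
  have "(\<forall>k<Suc n. P k) \<longleftrightarrow> P 0 \<and> (\<forall>k<n. P (Suc k))" for P
    by (metis Suc_less_eq less_Suc_eq_0_disj zero_less_Suc)
  from this[of "\<lambda>k. \<forall>x. (deriv ^^ k) f differentiable (at x)"]
  show ?thesis unfolding diff_upto_def by (simp add: funpow_swap1)
qed

lemma diff_upto_mono: "diff_upto n f \<Longrightarrow> m \<le> n \<Longrightarrow> diff_upto m f"
  by (auto simp: diff_upto_def)

lemma DERIV_deriv: "(f :: real \<Rightarrow> real) differentiable (at x) \<Longrightarrow> (f has_real_derivative deriv f x) (at x)"
  by (metis DERIV_imp_deriv real_differentiable_def)

lemma diff_upto_Suc_I:
  assumes "\<And>x. (f has_real_derivative g x) (at x)" "diff_upto n g"
  shows "diff_upto (Suc n) f"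
proof -
  have "deriv f = g" using assms(1) by (auto intro!: ext DERIV_imp_deriv)
  with assms show ?thesis by (auto simp: diff_upto_Suc simp: real_differentiable_def)
qed

lemma diff_upto_add: "diff_upto n f \<Longrightarrow> diff_upto n g \<Longrightarrow> diff_upto n (\<lambda>x. f x + g x)"
proof (induction n arbitrary: f g)
  case (Suc n)
  show ?case
    by (rule diff_upto_Suc_I[where g="\<lambda>x. deriv f x + deriv g x"])
       (use Suc in \<open>auto simp: diff_upto_Suc intro!: DERIV_add DERIV_deriv\<close>)
qed simp

lemma diff_upto_mult: "diff_upto n f \<Longrightarrow> diff_upto n g \<Longrightarrow> diff_upto n (\<lambda>x. f x * g x)"
proof (induction n arbitrary: f g)
  case (Suc n)
  have "diff_upto n f" "diff_upto n g" using Suc.prems by (auto intro: diff_upto_mono)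
  moreover have d: "diff_upto n (deriv f)" "diff_upto n (deriv g)" using Suc.prems by (auto simp: diff_upto_Suc)
  ultimately have "diff_upto n (\<lambda>x. deriv f x * g x + deriv g x * f x)"
    by (intro diff_upto_add Suc.IH)
  then show ?case
    by (rule diff_upto_Suc_I[rotated]) (use Suc.prems in \<open>auto simp: diff_upto_Suc intro!: DERIV_mult DERIV_deriv\<close>)
qed simp

lemma diff_upto_const: "diff_upto n (\<lambda>x. c)"
proof (induction n arbitrary: c)
  case (Suc n) show ?case by (rule diff_upto_Suc_I[where g="\<lambda>x. 0"]) (use Suc in auto)
qed simp

lemma diff_upto_inverse:
  assumes "\<And>x. f x \<noteq> 0"
  shows "diff_upto n f \<Longrightarrow> diff_upto n (\<lambda>x. inverse (f x))"
proof (induction n)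
  case (Suc n)
  have "diff_upto n f" using Suc.prems by (auto intro: diff_upto_mono)
  moreover have "diff_upto n (deriv f)" using Suc.prems by (auto simp: diff_upto_Suc)
  ultimately have "diff_upto n (\<lambda>x. (-1) * (inverse (f x) * deriv f x * inverse (f x)))"
    by (intro diff_upto_mult diff_upto_const Suc.IH)
  then show ?case
    by (rule diff_upto_Suc_I[rotated])
       (use Suc.prems assms in \<open>auto simp: diff_upto_Suc intro!: DERIV_inverse' DERIV_deriv\<close>)
qed simp

lemma diff_upto_affine: "diff_upto n f \<Longrightarrow> diff_upto n (\<lambda>x. f (c * x + t))"
proof (induction n arbitrary: f)
  case (Suc n)
  have d: "((\<lambda>x. f (c * x + t)) has_real_derivative deriv f (c * x + t) * c) (at x)" for x
    by (rule DERIV_chain'[where f="\<lambda>x. c * x + t"])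
       (use Suc.prems in \<open>auto simp: diff_upto_Suc intro!: DERIV_deriv derivative_eq_intros\<close>)
  have "diff_upto n (\<lambda>x. deriv f (c * x + t) * c)"
    using Suc.prems by (intro diff_upto_mult diff_upto_const Suc.IH) (auto simp: diff_upto_Suc)
  with d show ?case by (rule diff_upto_Suc_I)
qed simp

lemma smooth_add: "smooth f \<Longrightarrow> smooth g \<Longrightarrow> smooth (\<lambda>x. f x + g x)"
  and smooth_mult: "smooth f \<Longrightarrow> smooth g \<Longrightarrow> smooth (\<lambda>x. f x * g x)"
  and smooth_const: "smooth (\<lambda>x. c)"
  and smooth_inverse: "smooth f \<Longrightarrow> (\<And>x. f x \<noteq> 0) \<Longrightarrow> smooth (\<lambda>x. inverse (f x))"
  and smooth_affine: "smooth f \<Longrightarrow> smooth (\<lambda>x. f (a * x + t))"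
  by (auto simp: smooth_iff_diff_upto intro: diff_upto_add diff_upto_mult diff_upto_const
      diff_upto_inverse diff_upto_affine)

lemma smooth_deriv: "smooth f \<Longrightarrow> smooth (deriv f)"
  by (metis diff_upto_Suc smooth_iff_diff_upto)

lemma smooth_DERIV: "smooth f \<Longrightarrow> (f has_real_derivative deriv f x) (at x)"
  by (metis DERIV_deriv diff_upto_Suc smooth_iff_diff_upto)

lemma smooth_continuous: "smooth f \<Longrightarrow> continuous_on S f"
  by (meson DERIV_isCont continuous_at_imp_continuous_on smooth_DERIV)

lemma smooth_antideriv:
  assumes "\<And>x. (F has_real_derivative f x) (at x)" "smooth f"
  shows "smooth F"
  unfolding smooth_iff_diff_upto
proof
  fix n
  have "diff_upto (Suc n) F" using assms by (intro diff_upto_Suc_I) (auto simp: smooth_iff_diff_upto)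
  then show "diff_upto n F" by (rule diff_upto_mono) simp
qed

text \<open>A class of functions closed under differentiation consists of smooth functions; this
  settles families whose derivatives are members of the same family.\<close>

lemma smooth_family:
  assumes "\<And>i x. (F i has_real_derivative F (d i) x) (at x)"
  shows "smooth (F i)"
proof -
  have "diff_upto n (F i)" for n i
    by (induction n arbitrary: i) (auto intro: diff_upto_Suc_I assms)
  then show ?thesis by (simp add: smooth_iff_diff_upto)
qed

lemma smooth_exp: "smooth (\<lambda>x. exp (c * x))"
proof -
  have "smooth ((\<lambda>a x. a * exp (c * x)) 1)"
    by (rule smooth_family[where d="\<lambda>a. a * c"]) (auto intro!: derivative_eq_intros)
  then show ?thesis by simp
qed

lemma poly_exp_decay: "((\<lambda>t::real. t ^ k * poly p t * exp (- t)) \<longlongrightarrow> 0) at_top"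
proof (induction p arbitrary: k)
  case 0 show ?case by simp
next
  case (pCons a p)
  have "((\<lambda>t. a * (t ^ k / exp t) + t ^ Suc k * poly p t * exp (- t)) \<longlongrightarrow> a * 0 + 0) at_top"
    by (intro tendsto_intros tendsto_power_div_exp_0 pCons.IH)
  then show ?case by (simp add: algebra_simps exp_minus divide_inverse)
qed

text \<open>The functions \<open>p (1 / x) exp (- 1 / x)\<close>, extended by zero.  Differentiation only changes the
polynomial, so \<open>smooth_family\<close> applies.\<close>

definition flat_exp :: "real poly \<Rightarrow> real \<Rightarrow> real" where
  "flat_exp p x = (if x > 0 then poly p (1 / x) * exp (- (1 / x)) else 0)"

lemma flat_exp_DERIV: "(flat_exp p has_real_derivative flat_exp ([:0, 0, 1:] * (p - pderiv p)) x) (at x)"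
proof -
  consider "x > 0" | "x < 0" | "x = 0" by linarith
  then show ?thesis
  proof cases
    case 1
    have i: "((\<lambda>x. 1 / x) has_real_derivative - (1 / x\<^sup>2)) (at x)"
      using 1 by (auto intro!: derivative_eq_intros simp: power2_eq_square)
    have "((\<lambda>x. poly p (1 / x)) has_real_derivative poly (pderiv p) (1 / x) * - (1 / x\<^sup>2)) (at x)"
      by (rule DERIV_chain2[OF poly_DERIV i])
    moreover have "((\<lambda>x. exp (- (1 / x))) has_real_derivative exp (- (1 / x)) * - (- (1 / x\<^sup>2))) (at x)"
      by (rule DERIV_chain2[OF DERIV_exp DERIV_minus[OF i]])
    ultimately have "((\<lambda>x. poly p (1 / x) * exp (- (1 / x))) has_real_derivative
        poly (pderiv p) (1 / x) * - (1 / x\<^sup>2) * exp (- (1 / x)) + exp (- (1 / x)) * - (- (1 / x\<^sup>2)) * poly p (1 / x)) (at x)"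
      by (rule DERIV_mult)
    also have "poly (pderiv p) (1 / x) * - (1 / x\<^sup>2) * exp (- (1 / x)) + exp (- (1 / x)) * - (- (1 / x\<^sup>2)) * poly p (1 / x)
        = flat_exp ([:0, 0, 1:] * (p - pderiv p)) x"
      using 1 by (simp add: flat_exp_def algebra_simps power2_eq_square)
    finally have "((\<lambda>x. poly p (1 / x) * exp (- (1 / x))) has_real_derivative flat_exp ([:0, 0, 1:] * (p - pderiv p)) x) (at x)" .
    moreover have "\<forall>\<^sub>F y in nhds x. poly p (1 / y) * exp (- (1 / y)) = flat_exp p y"
      by (rule eventually_mono[OF eventually_nhds_in_open[of "{0<..}" x]]) (use 1 in \<open>auto simp: flat_exp_def\<close>)
    ultimately show ?thesis by (simp only: DERIV_cong_ev[OF refl _ refl])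
  next
    case 2
    have "\<forall>\<^sub>F y in nhds x. 0 = flat_exp p y"
      by (rule eventually_mono[OF eventually_nhds_in_open[of "{..<0}" x]]) (use 2 in \<open>auto simp: flat_exp_def\<close>)
    moreover have "((\<lambda>x. 0) has_real_derivative flat_exp ([:0, 0, 1:] * (p - pderiv p)) x) (at x)"
      using 2 by (auto simp: flat_exp_def)
    ultimately show ?thesis by (simp only: DERIV_cong_ev[OF refl _ refl])
  next
    case 3
    have "((\<lambda>h. inverse h ^ 1 * poly p (inverse h) * exp (- inverse h)) \<longlongrightarrow> 0) (at_right (0::real))"
      by (rule filterlim_compose[OF poly_exp_decay filterlim_inverse_at_top_right])
    then have "((\<lambda>h. flat_exp p h / h) \<longlongrightarrow> 0) (at_right 0)"
      by (rule Lim_transform_eventually)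
         (auto simp: flat_exp_def eventually_at_right_field divide_inverse algebra_simps intro!: exI[of _ 1])
    moreover have "((\<lambda>h. flat_exp p h / h) \<longlongrightarrow> 0) (at_left 0)"
      by (rule Lim_transform_eventually[OF tendsto_const])
         (auto simp: flat_exp_def eventually_at_left_field intro!: exI[of _ "-1"])
    ultimately have "((\<lambda>h. flat_exp p h / h) \<longlongrightarrow> 0) (at 0)"
      by (simp add: filterlim_split_at)
    then show ?thesis using 3 by (simp add: DERIV_def flat_exp_def)
  qed
qed

lemma smooth_flat_exp: "smooth (flat_exp p)"
  by (rule smooth_family[where F=flat_exp]) (rule flat_exp_DERIV)

definition smooth_step :: "real \<Rightarrow> real" where
  "smooth_step x = flat_exp 1 x * inverse (flat_exp 1 x + flat_exp 1 (1 - x))"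

lemma flat_exp_1: "0 \<le> flat_exp 1 x" "x \<le> 0 \<Longrightarrow> flat_exp 1 x = 0" "x > 0 \<Longrightarrow> 0 < flat_exp 1 x"
  by (auto simp: flat_exp_def)

lemma smooth_step_denominator_pos: "0 < flat_exp 1 x + flat_exp 1 (1 - x)"
  using flat_exp_1(1)[of x] flat_exp_1(1)[of "1 - x"] flat_exp_1(3)[of x] flat_exp_1(3)[of "1 - x"]
  by (cases "x > 0") auto

lemma smooth_smooth_step: "smooth smooth_step"
proof -
  have "smooth (\<lambda>x. flat_exp 1 x * inverse (flat_exp 1 x + flat_exp 1 ((-1) * x + 1)))"
    by (intro smooth_mult smooth_inverse smooth_add smooth_affine smooth_flat_exp)
       (use smooth_step_denominator_pos in \<open>auto simp: less_le add.commute\<close>)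
  then show ?thesis by (simp add: smooth_step_def[abs_def] add.commute)
qed

lemma smooth_step_range: "0 \<le> smooth_step x" "smooth_step x \<le> 1"
  using flat_exp_1(1)[of x] flat_exp_1(1)[of "1 - x"] smooth_step_denominator_pos[of x]
  by (auto simp: smooth_step_def field_simps)

lemma smooth_step_0: "x \<le> 0 \<Longrightarrow> smooth_step x = 0"
  by (simp add: smooth_step_def flat_exp_1)

lemma smooth_step_1: "x \<ge> 1 \<Longrightarrow> smooth_step x = 1"
  using flat_exp_1(3)[of x] by (simp add: smooth_step_def flat_exp_1(2))

text \<open>A bump with value \<open>1\<close> on the interval from \<open>a\<close> to \<open>b\<close>, which falls to \<open>0\<close> over the distance \<open>r\<close>
on either side.\<close>

definition plateau :: "real \<Rightarrow> real \<Rightarrow> real \<Rightarrow> real \<Rightarrow> real" where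
  "plateau a b r x = smooth_step ((x - a) / r + 1) * smooth_step ((b - x) / r + 1)"

lemma smooth_plateau: "smooth (plateau a b r)"
proof -
  have "smooth (\<lambda>x. smooth_step ((1/r) * x + (1 - a / r)) * smooth_step ((-1/r) * x + (b / r + 1)))"
    by (intro smooth_mult smooth_affine smooth_smooth_step)
  also have "(\<lambda>x. smooth_step ((1/r) * x + (1 - a / r)) * smooth_step ((-1/r) * x + (b / r + 1))) = plateau a b r"
    by (auto simp: plateau_def[abs_def] diff_divide_distrib algebra_simps)
  finally show ?thesis .
qed

lemma plateau_range: "0 \<le> plateau a b r x" "plateau a b r x \<le> 1"
  using smooth_step_range by (auto simp: plateau_def intro: mult_le_one)

lemma plateau_1: "r > 0 \<Longrightarrow> a \<le> x \<Longrightarrow> x \<le> b \<Longrightarrow> plateau a b r x = 1"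
  by (simp add: plateau_def smooth_step_1)

lemma plateau_0: "r > 0 \<Longrightarrow> x \<le> a - r \<or> b + r \<le> x \<Longrightarrow> plateau a b r x = 0"
  by (auto simp: plateau_def smooth_step_0 field_simps)

lemma test_function_iff: "test_function \<phi> \<longleftrightarrow> smooth \<phi> \<and> (\<exists>R. \<forall>x. R < \<bar>x\<bar> \<longrightarrow> \<phi> x = 0)"
  by (simp add: test_function_def smooth_def)

lemma test_function_plateau: "r > 0 \<Longrightarrow> test_function (plateau a b r)"
  unfolding test_function_iff
  by (auto simp: smooth_plateau intro!: exI[of _ "\<bar>a\<bar> + \<bar>b\<bar> + r"] plateau_0)

lemma test_function_support:
  assumes "test_function \<phi>"
  obtains R where "R > 0" "\<And>x. R \<le> \<bar>x\<bar> \<Longrightarrow> \<phi> x = 0" "\<And>x. R \<le> \<bar>x\<bar> \<Longrightarrow> deriv \<phi> x = 0"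
proof -
  from assms obtain R where R: "\<And>x. R < \<bar>x\<bar> \<Longrightarrow> \<phi> x = 0" by (auto simp: test_function_iff)
  have "deriv \<phi> x = 0" if x: "R < \<bar>x\<bar>" for x
  proof -
    have "open {x. R < \<bar>x\<bar>}" by (intro open_Collect_less continuous_intros)
    then have "\<forall>\<^sub>F y in nhds x. \<phi> y = 0"
      using eventually_nhds_in_open[of "{x. R < \<bar>x\<bar>}" x] x R by (auto elim!: eventually_mono)
    then have "(\<phi> has_real_derivative 0) (at x)" using DERIV_cong_ev[of x x \<phi> "\<lambda>_. 0" 0 0] by simp
    then show ?thesis by (rule DERIV_imp_deriv)
  qed
  with R show thesis by (intro that[of "\<bar>R\<bar> + 1"]) auto
qed

lemma test_smooth: "test_function \<phi> \<Longrightarrow> smooth \<phi>" by (simp add: test_function_iff)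

lemma test_function_deriv: "test_function \<phi> \<Longrightarrow> test_function (deriv \<phi>)"
  by (metis (no_types, opaque_lifting) less_imp_le smooth_deriv test_function_iff test_function_support)

lemma test_function_add: "test_function \<phi> \<Longrightarrow> test_function \<theta> \<Longrightarrow> test_function (\<lambda>x. \<phi> x + \<theta> x)"
proof -
  assume a: "test_function \<phi>" "test_function \<theta>"
  obtain R S where "\<And>x. R \<le> \<bar>x\<bar> \<Longrightarrow> \<phi> x = 0" "\<And>x. S \<le> \<bar>x\<bar> \<Longrightarrow> \<theta> x = 0"
    using a test_function_support by metis
  with a show ?thesis by (auto simp: test_function_iff intro!: smooth_add exI[of _ "max R S"])
qed

lemma test_function_smooth_mult: "smooth f \<Longrightarrow> test_function \<phi> \<Longrightarrow> test_function (\<lambda>x. f x * \<phi> x)"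
  by (force simp: test_function_iff intro!: smooth_mult)

lemma test_function_cmult: "test_function \<phi> \<Longrightarrow> test_function (\<lambda>x. c * \<phi> x)"
  by (rule test_function_smooth_mult[OF smooth_const])

lemma test_function_mult: "test_function \<phi> \<Longrightarrow> test_function \<theta> \<Longrightarrow> test_function (\<lambda>x. \<phi> x * \<theta> x)"
  by (rule test_function_smooth_mult[OF test_smooth])

lemma test_function_diff: "test_function \<phi> \<Longrightarrow> test_function \<theta> \<Longrightarrow> test_function (\<lambda>x. \<phi> x - \<theta> x)"
  using test_function_add[of \<phi> "\<lambda>x. (-1) * \<theta> x"] test_function_cmult[of \<theta> "-1"] by simp

lemma test_continuous: "test_function \<phi> \<Longrightarrow> continuous_on S \<phi>"
  by (simp add: smooth_continuous test_smooth)

lemma test_measurable: "test_function \<phi> \<Longrightarrow> \<phi> \<in> borel_measurable borel"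
  by (simp add: borel_measurable_continuous_onI test_continuous)

lemma test_bounded:
  assumes "test_function \<phi>" obtains B where "B > 0" "\<And>x. \<bar>\<phi> x\<bar> \<le> B"
proof -
  obtain R where R: "\<And>x. R \<le> \<bar>x\<bar> \<Longrightarrow> \<phi> x = 0" using test_function_support[OF assms] by metis
  have "compact (\<phi> ` {-R..R})" by (intro compact_continuous_image test_continuous assms) simp
  then obtain B where B: "\<And>x. x \<in> {-R..R} \<Longrightarrow> \<bar>\<phi> x\<bar> \<le> B"
    by (fastforce simp: bounded_real dest!: compact_imp_bounded)
  have "\<bar>\<phi> x\<bar> \<le> \<bar>B\<bar> + 1" for x
    using B[of x] R[of x] by (smt (verit) atLeastAtMost_iff)
  then show thesis by (intro that[of "\<bar>B\<bar> + 1"]) auto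
qed

lemma integrable_compact_support:
  fixes f :: "real \<Rightarrow> real"
  assumes [measurable]: "f \<in> borel_measurable borel" and "\<And>x. \<bar>f x\<bar> \<le> B" "\<And>x. R < \<bar>x\<bar> \<Longrightarrow> f x = 0"
  shows "integrable lborel f"
proof (rule Bochner_Integration.integrable_bound)
  show "integrable lborel (\<lambda>x. B * indicator {-R..R} x)"
    by (intro integrable_mult_right integrable_real_indicator) (auto simp: emeasure_lborel_Icc_eq)
  show "AE x in lborel. norm (f x) \<le> norm (B * indicator {-R..R} x)"
  proof (rule AE_I2)
    fix x show "norm (f x) \<le> norm (B * indicator {-R..R} x)"
      using assms(2)[of x] assms(3)[of x] by (cases "R < \<bar>x\<bar>") (auto simp: indicator_def)
  qed
qed simp

lemma test_integrable: "test_function \<phi> \<Longrightarrow> integrable lborel \<phi>"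
  by (metis integrable_compact_support less_imp_le test_bounded test_function_support test_measurable)

lemma test_L2: "test_function \<phi> \<Longrightarrow> L2 \<phi>"
  using test_integrable[OF test_function_mult[of \<phi> \<phi>]] test_measurable[of \<phi>]
  by (simp add: L2_def power2_eq_square)

lemma deriv_mult_test: "smooth f \<Longrightarrow> smooth g \<Longrightarrow> deriv (\<lambda>x. f x * g x) x = f x * deriv g x + deriv f x * g x"
  using DERIV_mult[OF smooth_DERIV[of f x] smooth_DERIV[of g x]] by (auto intro!: DERIV_imp_deriv simp: algebra_simps)

lemma deriv_add_smooth: "smooth f \<Longrightarrow> smooth g \<Longrightarrow> deriv (\<lambda>x. f x + g x) x = deriv f x + deriv g x"
  using DERIV_add[OF smooth_DERIV[of f x] smooth_DERIV[of g x]] by (auto intro!: DERIV_imp_deriv)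

lemma deriv_cmult_smooth: "smooth f \<Longrightarrow> deriv (\<lambda>x. c * f x) x = c * deriv f x"
  using DERIV_cmult[OF smooth_DERIV[of f x]] by (auto intro!: DERIV_imp_deriv)

section \<open>Density of test functions\<close>

lemma abs_add_power_le:
  fixes a b :: real
  shows "\<bar>a + b\<bar> ^ p \<le> 2 ^ p * (\<bar>a\<bar> ^ p + \<bar>b\<bar> ^ p)"
proof -
  have "\<bar>a + b\<bar> ^ p \<le> (2 * max \<bar>a\<bar> \<bar>b\<bar>) ^ p" by (intro power_mono) auto
  also have "\<dots> = 2 ^ p * (max \<bar>a\<bar> \<bar>b\<bar>) ^ p" by (simp add: power_mult_distrib)
  also have "(max \<bar>a\<bar> \<bar>b\<bar>) ^ p \<le> \<bar>a\<bar> ^ p + \<bar>b\<bar> ^ p" by (auto simp: max_def)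
  finally show ?thesis by simp
qed

text \<open>The \<open>p\<close>-th power of the norm is used without a root, so that sums are controlled by
\<open>\<bar>a + b\<bar>\<^sup>p \<le> 2\<^sup>p (\<bar>a\<bar>\<^sup>p + \<bar>b\<bar>\<^sup>p)\<close> and the cases \<open>p = 1\<close> and \<open>p = 2\<close> are treated together.\<close>

definition test_approximable :: "nat \<Rightarrow> (real \<Rightarrow> real) \<Rightarrow> bool" where
  "test_approximable p f \<longleftrightarrow> f \<in> borel_measurable borel \<and>
     (\<forall>e>0. \<exists>\<phi>. test_function \<phi> \<and> integrable lborel (\<lambda>x. \<bar>f x - \<phi> x\<bar> ^ p) \<and>
        (\<integral>x. \<bar>f x - \<phi> x\<bar> ^ p \<partial>lborel) < e)"

lemma test_approximable_test: "test_function \<phi> \<Longrightarrow> p > 0 \<Longrightarrow> test_approximable p \<phi>"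
  by (auto simp: test_approximable_def test_measurable power_0_left intro!: exI[of _ \<phi>])

lemma test_approximable_zero: "p > 0 \<Longrightarrow> test_approximable p (\<lambda>x. 0)"
  using test_approximable_test[OF test_function_cmult[OF test_function_plateau[of 1 0 0], of 0]] by simp

lemma integral_power_add_le:
  fixes f g :: "real \<Rightarrow> real"
  assumes [measurable]: "f \<in> borel_measurable borel" "g \<in> borel_measurable borel"
    and f: "integrable lborel (\<lambda>x. \<bar>f x\<bar> ^ p)" and g: "integrable lborel (\<lambda>x. \<bar>g x\<bar> ^ p)"
  shows "integrable lborel (\<lambda>x. \<bar>f x + g x\<bar> ^ p)"
    and "(\<integral>x. \<bar>f x + g x\<bar> ^ p \<partial>lborel) \<le> 2 ^ p * ((\<integral>x. \<bar>f x\<bar> ^ p \<partial>lborel) + (\<integral>x. \<bar>g x\<bar> ^ p \<partial>lborel))"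
proof -
  have i: "integrable lborel (\<lambda>x. 2 ^ p * (\<bar>f x\<bar> ^ p + \<bar>g x\<bar> ^ p))" using f g by simp
  show i2: "integrable lborel (\<lambda>x. \<bar>f x + g x\<bar> ^ p)"
    by (rule Bochner_Integration.integrable_bound[OF i]) (auto simp: abs_add_power_le)
  have "(\<integral>x. \<bar>f x + g x\<bar> ^ p \<partial>lborel) \<le> (\<integral>x. 2 ^ p * (\<bar>f x\<bar> ^ p + \<bar>g x\<bar> ^ p) \<partial>lborel)"
    by (rule integral_mono[OF i2 i]) (rule abs_add_power_le)
  then show "(\<integral>x. \<bar>f x + g x\<bar> ^ p \<partial>lborel) \<le> 2 ^ p * ((\<integral>x. \<bar>f x\<bar> ^ p \<partial>lborel) + (\<integral>x. \<bar>g x\<bar> ^ p \<partial>lborel))"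
    using f g by simp
qed

lemma test_approximable_add:
  assumes f: "test_approximable p f" and g: "test_approximable p g"
  shows "test_approximable p (\<lambda>x. f x + g x)"
  unfolding test_approximable_def
proof (intro conjI allI impI)
  have [measurable]: "f \<in> borel_measurable borel" "g \<in> borel_measurable borel"
    using f g by (auto simp: test_approximable_def)
  show "(\<lambda>x. f x + g x) \<in> borel_measurable borel" by simp
  fix e :: real assume e: "e > 0"
  define d where "d = e / (2 * 2 ^ p)"
  have "d > 0" using e by (simp add: d_def)
  then obtain \<phi> \<psi> where \<phi>: "test_function \<phi>" "integrable lborel (\<lambda>x. \<bar>f x - \<phi> x\<bar> ^ p)"
      "(\<integral>x. \<bar>f x - \<phi> x\<bar> ^ p \<partial>lborel) < d"
    and \<psi>: "test_function \<psi>" "integrable lborel (\<lambda>x. \<bar>g x - \<psi> x\<bar> ^ p)"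
      "(\<integral>x. \<bar>g x - \<psi> x\<bar> ^ p \<partial>lborel) < d"
    using f g unfolding test_approximable_def by meson
  have [measurable]: "\<phi> \<in> borel_measurable borel" "\<psi> \<in> borel_measurable borel"
    using \<phi> \<psi> by (auto intro: test_measurable)
  note * = integral_power_add_le[of "\<lambda>x. f x - \<phi> x" "\<lambda>x. g x - \<psi> x" p]
  have i: "integrable lborel (\<lambda>x. \<bar>(f x - \<phi> x) + (g x - \<psi> x)\<bar> ^ p)" using * \<phi> \<psi> by simp
  have "(\<integral>x. \<bar>(f x - \<phi> x) + (g x - \<psi> x)\<bar> ^ p \<partial>lborel)
     \<le> 2 ^ p * ((\<integral>x. \<bar>f x - \<phi> x\<bar> ^ p \<partial>lborel) + (\<integral>x. \<bar>g x - \<psi> x\<bar> ^ p \<partial>lborel))"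
    using * \<phi> \<psi> by simp
  also have "\<dots> < 2 ^ p * (d + d)" using \<phi>(3) \<psi>(3) by simp
  also have "\<dots> = e" by (simp add: d_def)
  finally show "\<exists>\<phi>. test_function \<phi> \<and> integrable lborel (\<lambda>x. \<bar>f x + g x - \<phi> x\<bar> ^ p) \<and>
        (\<integral>x. \<bar>f x + g x - \<phi> x\<bar> ^ p \<partial>lborel) < e"
    using i \<phi>(1) \<psi>(1)
    by (intro exI[of _ "\<lambda>x. \<phi> x + \<psi> x"]) (auto simp: test_function_add algebra_simps)
qed

lemma test_approximable_cmult:
  assumes f: "test_approximable p f" and p: "p > 0"
  shows "test_approximable p (\<lambda>x. c * f x)"
proof (cases "c = 0")
  case True then show ?thesis using test_approximable_zero[OF p] by simp
next
  case False
  have [measurable]: "f \<in> borel_measurable borel" using f by (auto simp: test_approximable_def)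
  show ?thesis unfolding test_approximable_def
  proof (intro conjI allI impI)
    fix e :: real assume e: "e > 0"
    have "0 < e / \<bar>c\<bar> ^ p" using e False by simp
    then obtain \<phi> where \<phi>: "test_function \<phi>" "integrable lborel (\<lambda>x. \<bar>f x - \<phi> x\<bar> ^ p)"
      "(\<integral>x. \<bar>f x - \<phi> x\<bar> ^ p \<partial>lborel) < e / \<bar>c\<bar> ^ p"
      using f unfolding test_approximable_def by meson
    have eq: "\<bar>c * f x - c * \<phi> x\<bar> ^ p = \<bar>c\<bar> ^ p * \<bar>f x - \<phi> x\<bar> ^ p" for x
      by (simp add: abs_mult power_mult_distrib flip: right_diff_distrib)
    show "\<exists>\<phi>. test_function \<phi> \<and> integrable lborel (\<lambda>x. \<bar>c * f x - \<phi> x\<bar> ^ p) \<and>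
        (\<integral>x. \<bar>c * f x - \<phi> x\<bar> ^ p \<partial>lborel) < e"
      using \<phi> False by (intro exI[of _ "\<lambda>x. c * \<phi> x"]) (auto simp: test_function_cmult eq field_simps)
  qed simp
qed

lemma test_approximable_dominated:
  assumes f: "\<And>n. test_approximable p (f n)" and p: "p > 0"
    and [measurable]: "F \<in> borel_measurable borel"
    and lim: "\<And>x. (\<lambda>n. f n x) \<longlonglongrightarrow> F x"
    and G: "integrable lborel G" "\<And>n x. \<bar>F x - f n x\<bar> ^ p \<le> G x"
  shows "test_approximable p F"
  unfolding test_approximable_def
proof (intro conjI allI impI)
  have [measurable]: "f n \<in> borel_measurable borel" for n
    using f by (auto simp: test_approximable_def)
  have i: "integrable lborel (\<lambda>x. \<bar>F x - f n x\<bar> ^ p)" for n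
    by (rule Bochner_Integration.integrable_bound[OF G(1)]) (auto intro!: order_trans[OF G(2) abs_ge_self])
  have "(\<lambda>n. \<integral>x. \<bar>F x - f n x\<bar> ^ p \<partial>lborel) \<longlonglongrightarrow> (\<integral>x. 0 \<partial>(lborel :: real measure))"
  proof (rule integral_dominated_convergence[where w=G])
    show "AE x in lborel. (\<lambda>n. \<bar>F x - f n x\<bar> ^ p) \<longlonglongrightarrow> 0"
    proof (rule AE_I2)
      fix x
      have "(\<lambda>n. \<bar>F x - f n x\<bar> ^ p) \<longlonglongrightarrow> \<bar>F x - F x\<bar> ^ p" by (intro tendsto_intros lim)
      then show "(\<lambda>n. \<bar>F x - f n x\<bar> ^ p) \<longlonglongrightarrow> 0" by (simp only: diff_self abs_zero zero_power[OF p])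
    qed
  qed (use G in auto)
  then have lim0: "(\<lambda>n. \<integral>x. \<bar>F x - f n x\<bar> ^ p \<partial>lborel) \<longlonglongrightarrow> 0" by simp
  show "F \<in> borel_measurable borel" by simp
  fix e :: real assume e: "e > 0"
  define d where "d = e / (2 * 2 ^ p)"
  have d: "d > 0" using e by (simp add: d_def)
  obtain n where n: "(\<integral>x. \<bar>F x - f n x\<bar> ^ p \<partial>lborel) < d"
    using order_tendstoD(2)[OF lim0 d] by (auto simp: eventually_sequentially)
  obtain \<phi> where \<phi>: "test_function \<phi>" "integrable lborel (\<lambda>x. \<bar>f n x - \<phi> x\<bar> ^ p)"
      "(\<integral>x. \<bar>f n x - \<phi> x\<bar> ^ p \<partial>lborel) < d"
    using f[of n] d unfolding test_approximable_def by meson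
  have [measurable]: "\<phi> \<in> borel_measurable borel" using \<phi> by (auto intro: test_measurable)
  note * = integral_power_add_le[of "\<lambda>x. F x - f n x" "\<lambda>x. f n x - \<phi> x" p, OF _ _ i \<phi>(2)]
  have "(\<integral>x. \<bar>F x - \<phi> x\<bar> ^ p \<partial>lborel)
     \<le> 2 ^ p * ((\<integral>x. \<bar>F x - f n x\<bar> ^ p \<partial>lborel) + (\<integral>x. \<bar>f n x - \<phi> x\<bar> ^ p \<partial>lborel))"
    using * by simp
  also have "\<dots> < 2 ^ p * (d + d)" using n \<phi>(3) by simp
  also have "\<dots> = e" by (simp add: d_def)
  finally show "\<exists>\<phi>. test_function \<phi> \<and> integrable lborel (\<lambda>x. \<bar>F x - \<phi> x\<bar> ^ p) \<and>
        (\<integral>x. \<bar>F x - \<phi> x\<bar> ^ p \<partial>lborel) < e"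
    using *(1) \<phi>(1) by auto
qed

lemma plateau_tendsto_indicator:
  "(\<lambda>n. plateau a b (1 / real (Suc n)) x) \<longlonglongrightarrow> indicator {a..b} x"
proof (cases "x \<in> {a..b}")
  case True then show ?thesis by (simp add: plateau_1)
next
  case False
  define d where "d = (if x < a then a - x else x - b)"
  have "d > 0" using False by (auto simp: d_def)
  then obtain N where N: "1 / real (Suc N) < d" by (meson nat_approx_posE)
  have "plateau a b (1 / real (Suc n)) x = 0" if "n \<ge> N" for n
  proof -
    have "1 / real (Suc n) \<le> 1 / real (Suc N)" using that by (intro divide_left_mono) auto
    then show ?thesis using N False by (intro plateau_0) (auto simp: d_def split: if_splits)
  qed
  then have "\<forall>\<^sub>F n in sequentially. 0 = plateau a b (1 / real (Suc n)) x"
    by (auto simp: eventually_sequentially)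
  then show ?thesis using False by (auto intro: Lim_transform_eventually[OF tendsto_const])
qed

lemma integrable_indicator_Icc [simp, intro]: "integrable lborel (indicator {a..b::real} :: real \<Rightarrow> real)"
  by (intro integrable_real_indicator) (auto simp: emeasure_lborel_Icc_eq)

lemma test_approximable_interval:
  assumes "p > 0"
  shows "test_approximable p (indicator {a..b})"
proof (rule test_approximable_dominated[OF _ assms _ plateau_tendsto_indicator])
  show "test_approximable p (plateau a b (1 / real (Suc n)))" for n
    by (intro test_approximable_test test_function_plateau assms) auto
  show "integrable lborel (indicator {a - 1..b + 1} :: real \<Rightarrow> real)" by simp
  fix n x
  have r: "1 / real (Suc n) \<le> 1" by simp
  show "\<bar>indicator {a..b} x - plateau a b (1 / real (Suc n)) x\<bar> ^ p \<le> indicator {a - 1..b + 1} x"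
  proof (cases "x \<in> {a - 1..b + 1}")
    case True
    then show ?thesis using plateau_range[of a b "1 / real (Suc n)" x]
      by (auto simp: indicator_def intro!: power_le_one)
  next
    case False
    then have "x < a - 1 \<or> b + 1 < x" by auto
    then have "x \<le> a - 1 / real (Suc n) \<or> b + 1 / real (Suc n) \<le> x" using r by linarith
    then have "plateau a b (1 / real (Suc n)) x = 0" by (intro plateau_0) auto
    then show ?thesis using False assms by (auto simp: indicator_def power_0_left)
  qed
qed simp

text \<open>Intervals are approximated by plateaus.  The approximable sets inside a bounded interval form a
Dynkin system, so they include all Borel sets.\<close>

lemma test_approximable_bounded_set:
  assumes p: "p > 0" and A: "A \<in> sets borel"
  shows "test_approximable p (indicator (A \<inter> {-R..R}))"
proof -
  have "A \<in> sigma_sets UNIV (range (\<lambda>a::real. {..a}))"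
    using A by (simp add: borel_eq_atMost)
  moreover have "Int_stable (range (\<lambda>a::real. {..a}))" by (auto simp: Int_stable_def)
  moreover have "range (\<lambda>a::real. {..a}) \<subseteq> Pow UNIV" by simp
  ultimately have "Int_stable (range (\<lambda>a::real. {..a}))" "range (\<lambda>a::real. {..a}) \<subseteq> Pow UNIV"
    "A \<in> sigma_sets UNIV (range (\<lambda>a::real. {..a}))" by blast+
  then show ?thesis
  proof (induct rule: sigma_sets_induct_disjoint)
    case (basic A)
    then obtain a where "A = {..a}" by auto
    then have "A \<inter> {-R..R} = {-R..min a R}" by auto
    then show ?case using test_approximable_interval[OF p] by simp
  next
    case empty
    then show ?case using test_approximable_zero[OF p] by (simp add: indicator_def[abs_def])
  next
    case (compl A)
    have "(\<lambda>x. indicator {-R..R} x + (-1) * indicator (A \<inter> {-R..R}) x) = (indicator ((UNIV - A) \<inter> {-R..R}) :: real \<Rightarrow> real)"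
      by (auto simp: indicator_def)
    with test_approximable_add[OF test_approximable_interval[OF p] test_approximable_cmult[OF compl(2) p, of "-1"], of "-R" R]
    show ?case by simp
  next
    case (union A)
    have A: "A i \<in> sets borel" for i using union(2) by (auto simp: borel_eq_atMost)
    define f where "f = (\<lambda>n x. \<Sum>i<n. indicator (A i \<inter> {-R..R}) x :: real)"
    have f_eq: "f n x = indicator ((\<Union>i<n. A i) \<inter> {-R..R}) x" for n x
    proof (induction n)
      case (Suc n)
      have d: "x \<notin> (\<Union>i<n. A i)" if "x \<in> A n"
      proof
        assume "x \<in> (\<Union>i<n. A i)"
        then obtain i where i: "i < n" "x \<in> A i" by auto
        then have "A i \<inter> A n = {}" by (intro disjoint_family_onD[OF union(1)]) auto
        with i that show False by auto
      qed
      have "f (Suc n) x = f n x + indicator (A n \<inter> {-R..R}) x" by (simp add: f_def)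
      moreover have "(\<Union>i<Suc n. A i) = (\<Union>i<n. A i) \<union> A n" by (auto simp: less_Suc_eq)
      ultimately show ?case using Suc d unfolding indicator_def by auto
    qed (simp add: f_def)
    show ?case
    proof (rule test_approximable_dominated[OF _ p])
      show "test_approximable p (f n)" for n
      proof (induction n)
        case 0 show ?case using test_approximable_zero[OF p] by (simp add: f_def)
      next
        case (Suc n) show ?case using test_approximable_add[OF Suc union(3)] by (simp add: f_def)
      qed
      show "(\<lambda>n. f n x) \<longlonglongrightarrow> indicator (\<Union> (range A) \<inter> {-R..R}) x" for x
      proof (cases "\<exists>i. x \<in> A i")
        case True
        then obtain i where "x \<in> A i" by auto
        then have "\<forall>\<^sub>F n in sequentially. indicator (\<Union> (range A) \<inter> {-R..R}) x = f n x"
          unfolding eventually_sequentially by (auto simp: f_eq indicator_def intro!: exI[of _ "Suc i"])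
        then show ?thesis by (rule Lim_transform_eventually[OF tendsto_const])
      next
        case False then show ?thesis by (simp add: f_eq)
      qed
      show "integrable lborel (indicator {-R..R} :: real \<Rightarrow> real)" by simp
      show "\<bar>indicator (\<Union> (range A) \<inter> {-R..R}) x - f n x\<bar> ^ p \<le> indicator {-R..R} x" for n x
        using p by (auto simp: f_eq indicator_def power_0_left)
      show "indicator (\<Union> (range A) \<inter> {-R..R}) \<in> borel_measurable borel"
        using A by (intro borel_measurable_indicator) auto
    qed
  qed
qed

lemma test_approximable_finite_measure:
  assumes p: "p > 0" and [measurable]: "A \<in> sets borel" and fin: "integrable lborel (indicator A :: real \<Rightarrow> real)"
  shows "test_approximable p (indicator A)"
proof (rule test_approximable_dominated[OF _ p])
  show "test_approximable p (indicator (A \<inter> {- real n..real n}))" for n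
    by (rule test_approximable_bounded_set[OF p]) simp
  show "(\<lambda>n. indicator (A \<inter> {- real n..real n}) x :: real) \<longlonglongrightarrow> indicator A x" for x
  proof -
    obtain N where "\<bar>x\<bar> \<le> real N" using real_arch_simple by blast
    then have "\<forall>\<^sub>F n in sequentially. indicator A x = (indicator (A \<inter> {- real n..real n}) x :: real)"
      unfolding eventually_sequentially by (intro exI[of _ N]) (auto simp: indicator_def)
    then show ?thesis by (rule Lim_transform_eventually[OF tendsto_const])
  qed
  show "\<bar>indicator A x - indicator (A \<inter> {- real n..real n}) x\<bar> ^ p \<le> (indicator A x :: real)" for n x
    using p by (auto simp: indicator_def power_0_left)
qed (use fin in auto)

text \<open>Simple functions with support of finite measure are combinations of approximable indicators, and
dominated convergence reaches every \<open>f\<close>.\<close>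

theorem test_functions_dense:
  fixes f :: "real \<Rightarrow> real"
  assumes [measurable]: "f \<in> borel_measurable borel" and f: "integrable lborel (\<lambda>x. \<bar>f x\<bar> ^ p)" and p: "p > 0"
  shows "test_approximable p f"
proof -
  obtain s where s: "\<And>i. simple_function borel (s i)" "\<And>x. (\<lambda>i. s i x) \<longlonglongrightarrow> f x"
    "\<And>i x. \<bar>s i x\<bar> \<le> 2 * \<bar>f x\<bar>"
    using borel_measurable_implies_sequence_metric[OF assms(1), of 0] by (auto simp: dist_real_def)
  have sm [measurable]: "s i \<in> borel_measurable borel" for i
    using s(1) by (rule borel_measurable_simple_function)
  have si: "integrable lborel (\<lambda>x. \<bar>s i x\<bar> ^ p)" for i
  proof (rule Bochner_Integration.integrable_bound)
    show "integrable lborel (\<lambda>x. 2 ^ p * \<bar>f x\<bar> ^ p)" using f by simp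
    have "\<bar>s i x\<bar> ^ p \<le> (2 * \<bar>f x\<bar>) ^ p" for x by (intro power_mono s(3)) auto
    then show "AE x in lborel. norm (\<bar>s i x\<bar> ^ p) \<le> norm (2 ^ p * \<bar>f x\<bar> ^ p)"
      by (auto simp: power_mult_distrib)
  qed simp
  show ?thesis
  proof (rule test_approximable_dominated[OF _ p assms(1) s(2)])
    show "integrable lborel (\<lambda>x. 3 ^ p * \<bar>f x\<bar> ^ p)" using f by simp
    show "\<bar>f x - s n x\<bar> ^ p \<le> 3 ^ p * \<bar>f x\<bar> ^ p" for n x
    proof -
      have "\<bar>f x - s n x\<bar> ^ p \<le> (3 * \<bar>f x\<bar>) ^ p" using s(3)[of n x] by (intro power_mono) auto
      then show ?thesis by (simp add: power_mult_distrib)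
    qed
    fix i
    have fin: "finite (range (s i))" using s(1)[of i] by (simp add: simple_function_def)
    define Y where "Y = range (s i)"
    have ap: "test_approximable p (\<lambda>x. y * indicator (s i -` {y}) x)" for y
    proof (cases "y = 0")
      case True then show ?thesis using test_approximable_zero[OF p] by simp
    next
      case False
      have m: "s i -` {y} \<in> sets borel" using measurable_sets[OF sm, of "{y}" i] by simp
      have "integrable lborel (\<lambda>x. \<bar>y\<bar> ^ p * indicator (s i -` {y}) x)"
        by (rule Bochner_Integration.integrable_bound[OF si[of i]]) (use m in \<open>auto simp: indicator_def\<close>)
      then have "integrable lborel (indicator (s i -` {y}) :: real \<Rightarrow> real)" using False by simp
      then show ?thesis by (intro test_approximable_cmult test_approximable_finite_measure p m)
    qed
    have "finite Z \<Longrightarrow> test_approximable p (\<lambda>x. \<Sum>y\<in>Z. y * indicator (s i -` {y}) x)" for Z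
    proof (induction rule: finite_induct)
      case empty show ?case using test_approximable_zero[OF p] by simp
    next
      case (insert z Z)
      show ?case using test_approximable_add[OF ap[of z] insert.IH] by (simp only: sum.insert[OF insert.hyps])
    qed
    from this[OF fin] have "test_approximable p (\<lambda>x. \<Sum>y\<in>range (s i). y * indicator (s i -` {y}) x)" .
    moreover have "(\<Sum>y\<in>range (s i). y * indicator (s i -` {y}) x) = s i x" for x
      using fin by (subst sum.remove[of _ "s i x"]) (auto simp: indicator_def intro!: sum.neutral)
    ultimately show "test_approximable p (s i)" by simp
  qed
qed

lemma L2_approx:
  assumes "L2 f" "e > 0"
  obtains \<phi> where "test_function \<phi>" "l2norm (\<lambda>x. f x - \<phi> x) < e"
proof -
  have "test_approximable 2 f"
    using assms by (intro test_functions_dense) (auto simp: L2_def)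
  then obtain \<phi> where \<phi>: "test_function \<phi>" "(\<integral>x. \<bar>f x - \<phi> x\<bar> ^ 2 \<partial>lborel) < e\<^sup>2"
    using assms(2) unfolding test_approximable_def by (meson zero_less_power)
  have "l2norm (\<lambda>x. f x - \<phi> x) < e"
    unfolding l2norm_def using \<phi>(2) assms(2) by (intro real_less_lsqrt) auto
  with \<phi>(1) show thesis by (rule that)
qed

lemma L1_approx:
  fixes f :: "real \<Rightarrow> real"
  assumes "integrable lborel f" "e > 0"
  obtains \<phi> where "test_function \<phi>" "(\<integral>x. \<bar>f x - \<phi> x\<bar> \<partial>lborel) < e"
proof -
  have "test_approximable 1 f"
    using assms borel_measurable_integrable[OF assms(1)] by (intro test_functions_dense) auto
  then obtain \<phi> where "test_function \<phi>" "(\<integral>x. \<bar>f x - \<phi> x\<bar> ^ 1 \<partial>lborel) < e"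
    using assms(2) unfolding test_approximable_def by meson
  then show thesis by (intro that) auto
qed

section \<open>Absolutely continuous functions\<close>

definition loc_integrable :: "(real \<Rightarrow> real) \<Rightarrow> bool" where
  "loc_integrable g \<longleftrightarrow> g \<in> borel_measurable borel \<and> (\<forall>a b. set_integrable lborel {a..b} g)"

text \<open>Local absolute continuity of \<open>f\<close> with a named derivative \<open>g\<close>.  Keeping \<open>g\<close> as a parameter makes the
product and chain rules exact identities of integrals, without statements about almost every point.\<close>

definition abs_cont :: "(real \<Rightarrow> real) \<Rightarrow> (real \<Rightarrow> real) \<Rightarrow> bool" where
  "abs_cont f g \<longleftrightarrow> loc_integrable g \<and> (\<forall>a b. a \<le> b \<longrightarrow> f b - f a = (LBINT x:{a..b}. g x))"

lemma loc_integrable_measurable: "loc_integrable g \<Longrightarrow> g \<in> borel_measurable borel"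
  by (simp add: loc_integrable_def)

lemma loc_integrableD: "loc_integrable g \<Longrightarrow> set_integrable lborel {a..b} g"
  by (simp add: loc_integrable_def)

lemma abs_contD: "abs_cont f g \<Longrightarrow> loc_integrable g" "abs_cont f g \<Longrightarrow> a \<le> b \<Longrightarrow> f b - f a = (LBINT x:{a..b}. g x)"
  by (auto simp: abs_cont_def)

lemma loc_integrable_add: "loc_integrable f \<Longrightarrow> loc_integrable g \<Longrightarrow> loc_integrable (\<lambda>x. f x + g x)"
  by (auto simp: loc_integrable_def)

lemma loc_integrable_cmult: "loc_integrable f \<Longrightarrow> loc_integrable (\<lambda>x. c * f x)"
  by (auto simp: loc_integrable_def)

lemma loc_integrable_continuous: "continuous_on UNIV f \<Longrightarrow> loc_integrable f"
  unfolding loc_integrable_def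
  by (auto intro: borel_measurable_continuous_onI borel_integrable_atLeastAtMost' continuous_on_subset)

lemma loc_integrable_bound:
  assumes "loc_integrable g" "f \<in> borel_measurable borel" "\<And>x. \<bar>f x\<bar> \<le> \<bar>g x\<bar>"
  shows "loc_integrable f"
  unfolding loc_integrable_def
proof (intro conjI allI assms(2))
  fix a b
  show "set_integrable lborel {a..b} f"
    by (rule set_integrable_bound[OF loc_integrableD[OF assms(1), of a b]])
       (use assms(2,3) in \<open>auto simp: set_borel_measurable_def\<close>)
qed

lemma loc_integrable_continuous_mult:
  assumes f: "continuous_on UNIV f" and g: "loc_integrable g"
  shows "loc_integrable (\<lambda>x. f x * g x)"
  unfolding loc_integrable_def
proof (intro conjI allI)
  have [measurable]: "f \<in> borel_measurable borel" "g \<in> borel_measurable borel"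
    using assms by (auto intro: borel_measurable_continuous_onI loc_integrable_measurable)
  show "(\<lambda>x. f x * g x) \<in> borel_measurable borel" by simp
  fix a b :: real
  have "compact (f ` {a..b})" by (intro compact_continuous_image continuous_on_subset[OF f]) auto
  then obtain B where B: "\<And>x. x \<in> {a..b} \<Longrightarrow> \<bar>f x\<bar> \<le> B"
    by (fastforce simp: bounded_real dest!: compact_imp_bounded)
  have "set_integrable lborel {a..b} (\<lambda>x. B * g x)"
    using loc_integrableD[OF g] by simp
  then show "set_integrable lborel {a..b} (\<lambda>x. f x * g x)"
  proof (rule set_integrable_bound)
    show "AE x in lborel. x \<in> {a..b} \<longrightarrow> norm (f x * g x) \<le> norm (B * g x)"
      using B by (auto simp: abs_mult intro!: mult_right_mono order_trans[OF B abs_ge_self])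
  qed (auto simp: set_borel_measurable_def)
qed

lemma LBINT_Icc_split:
  assumes "set_integrable lborel {a..c::real} (g :: real \<Rightarrow> real)" "a \<le> b" "b \<le> c"
  shows "(LBINT x:{a..c}. g x) = (LBINT x:{a..b}. g x) + (LBINT x:{b..c}. g x)"
proof -
  have "{a..c} = {a..b} \<union> {b..c}" using assms by auto
  moreover have "(LBINT x:{a..b} \<union> {b..c}. g x) = (LBINT x:{a..b}. g x) + (LBINT x:{b..c}. g x)"
  proof (rule set_integral_Un_AE)
    have "AE x in lborel. x \<noteq> b" by (rule AE_lborel_singleton)
    then show "AE x in lborel. \<not> (x \<in> {a..b} \<and> x \<in> {b..c})" by eventually_elim auto
  qed (use assms in \<open>auto intro: set_integrable_subset[OF assms(1)]\<close>)
  ultimately show ?thesis by simp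
qed

lemma abs_cont_exists:
  assumes g: "loc_integrable g"
  obtains f where "abs_cont f g"
proof
  define F where "F = (\<lambda>x. if 0 \<le> x then (LBINT y:{0..x}. g y) else - (LBINT y:{x..0}. g y))"
  have split: "(LBINT x:{a..c}. g x) = (LBINT x:{a..b}. g x) + (LBINT x:{b..c}. g x)" if "a \<le> b" "b \<le> c" for a b c
    using LBINT_Icc_split[OF loc_integrableD[OF g] that] .
  show "abs_cont F g"
    unfolding abs_cont_def
  proof (intro conjI allI impI g)
    fix a b :: real assume "a \<le> b"
    then show "F b - F a = (LBINT x:{a..b}. g x)"
      using split[of 0 a b] split[of a 0 b] split[of a b 0] by (auto simp: F_def)
  qed
qed

lemma abs_cont_C1:
  assumes d: "\<And>x. (f has_real_derivative g x) (at x)" and g: "continuous_on UNIV g"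
  shows "abs_cont f g"
  unfolding abs_cont_def
proof (intro conjI allI impI loc_integrable_continuous g)
  fix a b :: real assume "a \<le> b"
  have "(\<integral>x. g x * indicator {a..b} x \<partial>lborel) = f b - f a"
    by (rule integral_FTC_Icc_real[OF \<open>a \<le> b\<close> d]) (use g in \<open>auto simp: continuous_on_eq_continuous_at\<close>)
  then show "f b - f a = (LBINT x:{a..b}. g x)"
    by (simp add: set_lebesgue_integral_def mult.commute)
qed

lemma abs_cont_smooth: "smooth f \<Longrightarrow> abs_cont f (deriv f)"
  by (intro abs_cont_C1 smooth_DERIV smooth_continuous smooth_deriv)

lemma abs_cont_continuous:
  assumes "abs_cont f g"
  shows "continuous_on S f"
proof -
  have "isCont f x" for x
  proof -
    define a b where "a = x - 1" and "b = x + 1"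
    have g: "set_integrable lborel {a..b} g" using assms by (simp add: abs_contD loc_integrableD)
    have "continuous_on {a..b} (\<lambda>y. f a + integral {a..y} g)"
      by (intro continuous_intros indefinite_integral_continuous_1 set_borel_integral_eq_integral g)
    moreover have "f a + integral {a..y} g = f y" if "y \<in> {a..b}" for y
    proof -
      have "(LBINT x:{a..y}. g x) = integral {a..y} g"
        using assms by (intro set_borel_integral_eq_integral) (simp add: abs_contD loc_integrableD)
      then show ?thesis using abs_contD(2)[OF assms, of a y] that by simp
    qed
    ultimately have "continuous_on {a..b} f" by (rule continuous_on_eq)
    then have "continuous_on {a<..<b} f" by (rule continuous_on_subset) auto
    then show ?thesis by (subst (asm) continuous_on_eq_continuous_at) (auto simp: a_def b_def)
  qed
  then show ?thesis by (simp add: continuous_at_imp_continuous_on)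
qed

lemma abs_cont_measurable: "abs_cont f g \<Longrightarrow> f \<in> borel_measurable borel"
  by (intro borel_measurable_continuous_onI abs_cont_continuous)

lemma abs_cont_DERIV:
  assumes f: "abs_cont f g" and g: "continuous_on UNIV g"
  shows "(f has_real_derivative g x) (at x)"
proof -
  define a b where "a = x - 1" and "b = x + 1"
  have "((\<lambda>u. integral {a..u} g) has_real_derivative g x) (at x within {a..b})"
    by (rule integral_has_real_derivative) (auto simp: a_def b_def intro: continuous_on_subset[OF g])
  then have "((\<lambda>u. f a + integral {a..u} g) has_real_derivative g x) (at x within {a..b})"
    by (auto intro!: derivative_eq_intros)
  then have D: "((\<lambda>u. f a + integral {a..u} g) has_real_derivative g x) (at x within {a..b})" .
  have eq: "f a + integral {a..y} g = f y" if "y \<in> {a..b}" for y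
  proof -
    have "(LBINT x:{a..y}. g x) = integral {a..y} g"
      using f by (intro set_borel_integral_eq_integral) (simp add: abs_contD loc_integrableD)
    then show ?thesis using abs_contD(2)[OF f, of a y] that by simp
  qed
  have "x \<in> {a..b}" by (simp add: a_def b_def)
  then have "(f has_real_derivative g x) (at x within {a..b})"
    by (intro has_field_derivative_transform_within[OF D zero_less_one] eq)
  moreover have "at x within {a..b} = at x"
    by (rule at_within_interior) (auto simp: a_def b_def)
  ultimately show ?thesis by simp
qed

lemma abs_cont_add: "abs_cont f g \<Longrightarrow> abs_cont h k \<Longrightarrow> abs_cont (\<lambda>x. f x + h x) (\<lambda>x. g x + k x)"
  unfolding abs_cont_def by (auto intro: loc_integrable_add simp: loc_integrableD algebra_simps)

lemma abs_cont_cmult: "abs_cont f g \<Longrightarrow> abs_cont (\<lambda>x. c * f x) (\<lambda>x. c * g x)"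
  unfolding abs_cont_def by (auto intro: loc_integrable_cmult simp flip: right_diff_distrib)

lemma abs_cont_diff: "abs_cont f g \<Longrightarrow> abs_cont h k \<Longrightarrow> abs_cont (\<lambda>x. f x - h x) (\<lambda>x. g x - k x)"
  using abs_cont_add[of f g "\<lambda>x. (-1) * h x" "\<lambda>x. (-1) * k x"] abs_cont_cmult[of h k "-1"] by simp

text \<open>The chain rule holds for continuously differentiable functions.  The general case follows
  by approximating the derivative in \<open>L\<^sup>1\<close> by test functions.\<close>

lemma abs_cont_chain:
  assumes f: "abs_cont f g" and H: "\<And>y. (H has_real_derivative H' y) (at y)" and H': "continuous_on UNIV H'"
  shows "abs_cont (\<lambda>x. H (f x)) (\<lambda>x. H' (f x) * g x)"
  unfolding abs_cont_def
proof (intro conjI allI impI)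
  have gi: "loc_integrable g" using f by (rule abs_contD)
  have [measurable]: "g \<in> borel_measurable borel" using gi by (rule loc_integrable_measurable)
  have [measurable]: "f \<in> borel_measurable borel" using f by (rule abs_cont_measurable)
  have [measurable]: "H' \<in> borel_measurable borel" using H' by (rule borel_measurable_continuous_onI)
  have cH'f: "continuous_on UNIV (\<lambda>x. H' (f x))"
    by (rule continuous_on_compose2[OF H' abs_cont_continuous[OF f]]) simp
  show loc: "loc_integrable (\<lambda>x. H' (f x) * g x)" by (rule loc_integrable_continuous_mult[OF cH'f gi])
  fix a b :: real assume ab: "a \<le> b"
  have gab: "integrable lborel (\<lambda>x. indicator {a..b} x * g x)"
    using loc_integrableD[OF gi] by (simp add: set_integrable_def)
  have "\<exists>\<phi>. test_function \<phi> \<and> (\<integral>x. \<bar>indicator {a..b} x * g x - \<phi> x\<bar> \<partial>lborel) < 1 / real (Suc n)" for n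
    using L1_approx[OF gab, of "1 / real (Suc n)"] by auto
  then obtain \<phi> where \<phi>: "\<And>n. test_function (\<phi> n)"
    "\<And>n. (\<integral>x. \<bar>indicator {a..b} x * g x - \<phi> n x\<bar> \<partial>lborel) < 1 / real (Suc n)" by metis
  have [measurable]: "\<phi> n \<in> borel_measurable borel" for n using \<phi>(1) by (rule test_measurable)
  \<comment> \<open>The primitives of the approximate derivatives are continuously differentiable, and they
    converge to \<open>f\<close> uniformly on the interval.\<close>
  have "\<exists>F. abs_cont F (\<phi> n) \<and> F a = f a" for n
  proof -
    obtain F where F: "abs_cont F (\<phi> n)"
      using abs_cont_exists loc_integrable_continuous test_continuous[OF \<phi>(1)] by blast
    then have "abs_cont (\<lambda>x. F x + (f a - F a)) (\<phi> n)" by (simp add: abs_cont_def)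
    then show ?thesis by (intro exI[of _ "\<lambda>x. F x + (f a - F a)"]) auto
  qed
  then obtain F where F: "\<And>n. abs_cont (F n) (\<phi> n)" "\<And>n. F n a = f a" by metis
  have F_DERIV: "(F n has_real_derivative \<phi> n x) (at x)" for n x
    by (rule abs_cont_DERIV[OF F(1) test_continuous[OF \<phi>(1)]])
  have [measurable]: "F n \<in> borel_measurable borel" for n using F(1) by (rule abs_cont_measurable)
  have L1: "(LBINT x:{a..b}. \<bar>\<phi> n x - g x\<bar>) \<le> 1 / real (Suc n)" 
    and L1i: "set_integrable lborel {a..b} (\<lambda>x. \<phi> n x - g x)" for n
  proof -
    show 1: "set_integrable lborel {a..b} (\<lambda>x. \<phi> n x - g x)"
      using loc_integrableD[OF gi] loc_integrableD[OF abs_contD(1)[OF F(1)]] by (intro set_integral_diff)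
    have "(LBINT x:{a..b}. \<bar>\<phi> n x - g x\<bar>) \<le> (\<integral>x. \<bar>indicator {a..b} x * g x - \<phi> n x\<bar> \<partial>lborel)"
      unfolding set_lebesgue_integral_def
    proof (rule integral_mono)
      show "integrable lborel (\<lambda>x. indicator {a..b} x *\<^sub>R \<bar>\<phi> n x - g x\<bar>)"
        using set_integrable_abs[OF 1] by (simp add: set_integrable_def)
      show "integrable lborel (\<lambda>x. \<bar>indicator {a..b} x * g x - \<phi> n x\<bar>)"
        using gab test_integrable[OF \<phi>(1)] by simp
    qed (auto simp: indicator_def)
    with \<phi>(2)[of n] show "(LBINT x:{a..b}. \<bar>\<phi> n x - g x\<bar>) \<le> 1 / real (Suc n)" by simp
  qed
  have unif: "\<bar>F n x - f x\<bar> \<le> 1 / real (Suc n)" if x: "x \<in> {a..b}" for n x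
  proof -
    have sub: "set_integrable lborel {a..x} (\<lambda>x. \<phi> n x - g x)"
      by (rule set_integrable_subset[OF L1i]) (use x in auto)
    have "F n x - f x = (LBINT y:{a..x}. \<phi> n y) - (LBINT y:{a..x}. g y)"
      using abs_contD(2)[OF F(1), of a x n] abs_contD(2)[OF f, of a x] x F(2)[of n] by simp
    also have "\<dots> = (LBINT y:{a..x}. \<phi> n y - g y)"
      using loc_integrableD[OF gi] loc_integrableD[OF abs_contD(1)[OF F(1)]] by simp
    finally have "\<bar>F n x - f x\<bar> \<le> (LBINT y:{a..x}. \<bar>\<phi> n y - g y\<bar>)"
      using integral_abs_bound[of lborel "\<lambda>y. indicator {a..x} y * (\<phi> n y - g y)"]
      by (simp add: set_lebesgue_integral_def abs_mult)
    also have "\<dots> \<le> (LBINT y:{a..b}. \<bar>\<phi> n y - g y\<bar>)"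
      unfolding set_lebesgue_integral_def
      by (rule integral_mono) (use set_integrable_abs[OF sub] set_integrable_abs[OF L1i] x in
          \<open>auto simp: set_integrable_def indicator_def\<close>)
    finally show ?thesis using L1[of n] by simp
  qed
  have inv0: "(\<lambda>n. 1 / real (Suc n)) \<longlonglongrightarrow> 0" by (rule LIMSEQ_Suc[OF lim_1_over_n])
  have ptw: "(\<lambda>n. F n x) \<longlonglongrightarrow> f x" if "x \<in> {a..b}" for x
  proof -
    have "(\<lambda>n. F n x - f x) \<longlonglongrightarrow> 0" using inv0 by (rule Lim_null_comparison[rotated]) (use unif[OF that] in auto)
    then show ?thesis by (simp add: LIM_zero_iff)
  qed
  have "compact (f ` {a..b})" by (intro compact_continuous_image abs_cont_continuous[OF f]) auto
  then obtain M where M: "\<And>x. x \<in> {a..b} \<Longrightarrow> \<bar>f x\<bar> \<le> M"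
    by (fastforce simp: bounded_real dest!: compact_imp_bounded)
  have FM: "\<bar>F n x\<bar> \<le> M + 1" if "x \<in> {a..b}" for n x
  proof -
    have "1 / real (Suc n) \<le> 1" by simp
    then show ?thesis using unif[OF that, of n] M[OF that] by linarith
  qed
  have "compact (H' ` {-(M+1)..M+1})" by (intro compact_continuous_image continuous_on_subset[OF H']) auto
  then obtain K where K: "\<And>y. y \<in> {-(M+1)..M+1} \<Longrightarrow> \<bar>H' y\<bar> \<le> K"
    by (fastforce simp: bounded_real dest!: compact_imp_bounded)
  have KF: "\<bar>H' (F n x)\<bar> \<le> K" and Kf: "\<bar>H' (f x)\<bar> \<le> K" if "x \<in> {a..b}" for n x
    using FM[OF that, of n] M[OF that] by (intro K; auto)+
  have cHF: "continuous_on UNIV (\<lambda>x. H' (F n x))" for n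
    by (rule continuous_on_compose2[OF H' abs_cont_continuous[OF F(1)]]) simp
  have C1: "abs_cont (\<lambda>x. H (F n x)) (\<lambda>x. H' (F n x) * \<phi> n x)" for n
  proof (rule abs_cont_C1)
    show "((\<lambda>x. H (F n x)) has_real_derivative H' (F n x) * \<phi> n x) (at x)" for x
      by (rule DERIV_chain2[OF H F_DERIV])
    show "continuous_on UNIV (\<lambda>x. H' (F n x) * \<phi> n x)"
      by (intro continuous_on_mult cHF test_continuous[OF \<phi>(1)])
  qed
  have i1: "set_integrable lborel {a..b} (\<lambda>x. H' (F n x) * (\<phi> n x - g x))" for n
    using loc_integrableD[OF loc_integrable_continuous_mult[OF cHF loc_integrable_add[OF abs_contD(1)[OF F(1)] loc_integrable_cmult[OF gi, of "-1"]]]]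
    by simp
  have i2: "set_integrable lborel {a..b} (\<lambda>x. H' (F n x) * g x)" for n
    using loc_integrableD[OF loc_integrable_continuous_mult[OF cHF gi]] .
  \<comment> \<open>The first integral tends to \<open>0\<close> because \<open>\<phi> n - g\<close> does so in \<open>L\<^sup>1\<close>, the second converges by
    dominated convergence.\<close>
  have eq: "H (F n b) - H (f a) = (LBINT x:{a..b}. H' (F n x) * (\<phi> n x - g x)) + (LBINT x:{a..b}. H' (F n x) * g x)" for n
    using abs_contD(2)[OF C1 ab, of n] F(2)[of n] set_integral_add(2)[OF i1[of n] i2[of n]]
    by (simp add: algebra_simps)
  have "(\<lambda>n. (LBINT x:{a..b}. H' (F n x) * (\<phi> n x - g x))) \<longlonglongrightarrow> 0"
  proof (rule Lim_null_comparison)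
    show "\<forall>\<^sub>F n in sequentially. norm (LBINT x:{a..b}. H' (F n x) * (\<phi> n x - g x)) \<le> \<bar>K\<bar> * (1 / real (Suc n))"
    proof (rule always_eventually, rule allI)
      fix n
      have "norm (LBINT x:{a..b}. H' (F n x) * (\<phi> n x - g x)) \<le> (LBINT x:{a..b}. \<bar>H' (F n x) * (\<phi> n x - g x)\<bar>)"
        using integral_abs_bound[of lborel "\<lambda>x. indicator {a..b} x * (H' (F n x) * (\<phi> n x - g x))"]
        by (simp add: set_lebesgue_integral_def abs_mult)
      also have "\<dots> \<le> (LBINT x:{a..b}. \<bar>K\<bar> * \<bar>\<phi> n x - g x\<bar>)"
      proof (rule set_integral_mono)
        show "\<bar>H' (F n x) * (\<phi> n x - g x)\<bar> \<le> \<bar>K\<bar> * \<bar>\<phi> n x - g x\<bar>" if "x \<in> {a..b}" for x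
          unfolding abs_mult by (intro mult_right_mono order_trans[OF KF[OF that] abs_ge_self]) auto
      qed (use set_integrable_abs[OF i1] set_integrable_abs[OF L1i] in auto)
      also have "\<dots> = \<bar>K\<bar> * (LBINT x:{a..b}. \<bar>\<phi> n x - g x\<bar>)" by simp
      also have "\<dots> \<le> \<bar>K\<bar> * (1 / real (Suc n))" by (intro mult_left_mono L1) auto
      finally show "norm (LBINT x:{a..b}. H' (F n x) * (\<phi> n x - g x)) \<le> \<bar>K\<bar> * (1 / real (Suc n))" .
    qed
    show "(\<lambda>n. \<bar>K\<bar> * (1 / real (Suc n))) \<longlonglongrightarrow> 0" using tendsto_mult_right[OF inv0, of "\<bar>K\<bar>"] by simp
  qed
  moreover have "(\<lambda>n. (LBINT x:{a..b}. H' (F n x) * g x)) \<longlonglongrightarrow> (LBINT x:{a..b}. H' (f x) * g x)"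
    unfolding set_lebesgue_integral_def
  proof (rule integral_dominated_convergence[where w="\<lambda>x. \<bar>K\<bar> * \<bar>indicator {a..b} x * g x\<bar>"])
    show "AE x in lborel. (\<lambda>n. indicator {a..b} x *\<^sub>R (H' (F n x) * g x)) \<longlonglongrightarrow> indicator {a..b} x *\<^sub>R (H' (f x) * g x)"
    proof (rule AE_I2)
      fix x
      show "(\<lambda>n. indicator {a..b} x *\<^sub>R (H' (F n x) * g x)) \<longlonglongrightarrow> indicator {a..b} x *\<^sub>R (H' (f x) * g x)"
      proof (cases "x \<in> {a..b}")
        case True
        have "isCont H' (f x)" using H' by (simp add: continuous_on_eq_continuous_at)
        from isCont_tendsto_compose[OF this ptw[OF True]] show ?thesis by (intro tendsto_intros)
      qed simp
    qed
    show "AE x in lborel. norm (indicator {a..b} x *\<^sub>R (H' (F n x) * g x)) \<le> \<bar>K\<bar> * \<bar>indicator {a..b} x * g x\<bar>" for n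
    proof (rule AE_I2)
      fix x show "norm (indicator {a..b} x *\<^sub>R (H' (F n x) * g x)) \<le> \<bar>K\<bar> * \<bar>indicator {a..b} x * g x\<bar>"
        using order_trans[OF KF[of x n] abs_ge_self] by (auto simp: indicator_def abs_mult intro!: mult_right_mono)
    qed
  qed (use gab in auto)
  ultimately have "(\<lambda>n. H (F n b) - H (f a)) \<longlonglongrightarrow> 0 + (LBINT x:{a..b}. H' (f x) * g x)"
    unfolding eq by (rule tendsto_add)
  moreover have "(\<lambda>n. H (F n b) - H (f a)) \<longlonglongrightarrow> H (f b) - H (f a)"
  proof -
    have "isCont H (f b)" using H by (rule DERIV_isCont)
    from isCont_tendsto_compose[OF this ptw[of b]] ab show ?thesis by (intro tendsto_intros) auto
  qed
  ultimately show "H (f b) - H (f a) = (LBINT x:{a..b}. H' (f x) * g x)"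
    using LIMSEQ_unique by fastforce
qed

lemma abs_cont_square: "abs_cont f g \<Longrightarrow> abs_cont (\<lambda>x. (f x)\<^sup>2) (\<lambda>x. 2 * f x * g x)"
  by (rule abs_cont_chain[where H="\<lambda>y. y\<^sup>2" and H'="\<lambda>y. 2 * y"])
     (auto intro!: derivative_eq_intros continuous_intros)

text \<open>By polarization the product rule follows from the chain rule for the square.\<close>

lemma abs_cont_mult:
  assumes f: "abs_cont f g" and h: "abs_cont h k"
  shows "abs_cont (\<lambda>x. f x * h x) (\<lambda>x. f x * k x + g x * h x)"
proof -
  have "abs_cont (\<lambda>x. (1/4) * ((f x + h x)\<^sup>2 - (f x - h x)\<^sup>2))
     (\<lambda>x. (1/4) * (2 * (f x + h x) * (g x + k x) - 2 * (f x - h x) * (g x - k x)))"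
    by (intro abs_cont_cmult abs_cont_diff abs_cont_square abs_cont_add f h)
  then show ?thesis by (simp add: power2_eq_square algebra_simps)
qed

lemma abs_cont_integral_0:
  assumes f: "abs_cont f g" and R: "\<And>x. R \<le> \<bar>x\<bar> \<Longrightarrow> f x = 0" "\<And>x. R < \<bar>x\<bar> \<Longrightarrow> g x = 0"
  shows "(\<integral>x. g x \<partial>lborel) = 0"
proof -
  have "(\<integral>x. g x \<partial>lborel) = (LBINT x:{-\<bar>R\<bar>..\<bar>R\<bar>}. g x)"
    unfolding set_lebesgue_integral_def
  proof (rule Bochner_Integration.integral_cong)
    fix x show "g x = indicator {-\<bar>R\<bar>..\<bar>R\<bar>} x *\<^sub>R g x"
      using R(2)[of x] by (cases "R < \<bar>x\<bar>") (auto simp: indicator_def)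
  qed simp
  also have "\<dots> = f \<bar>R\<bar> - f (-\<bar>R\<bar>)" using abs_contD(2)[OF f, of "-\<bar>R\<bar>" "\<bar>R\<bar>"] by simp
  finally show ?thesis using R(1) by simp
qed

lemma integrable_loc_mult_test:
  assumes "loc_integrable g" "test_function \<phi>"
  shows "integrable lborel (\<lambda>x. g x * \<phi> x)"
proof -
  obtain R where R: "\<And>x. R \<le> \<bar>x\<bar> \<Longrightarrow> \<phi> x = 0" using test_function_support[OF assms(2)] by metis
  have "set_integrable lborel {-R..R} (\<lambda>x. \<phi> x * g x)"
    by (intro loc_integrableD loc_integrable_continuous_mult test_continuous assms)
  moreover have "(\<lambda>x. indicator {-R..R} x *\<^sub>R (\<phi> x * g x)) = (\<lambda>x. g x * \<phi> x)"
  proof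
    fix x show "indicator {-R..R} x *\<^sub>R (\<phi> x * g x) = g x * \<phi> x"
      using R[of x] by (cases "R \<le> \<bar>x\<bar>") (auto simp: indicator_def)
  qed
  ultimately show ?thesis by (simp add: set_integrable_def)
qed

lemma abs_cont_by_parts:
  assumes f: "abs_cont f g" and \<phi>: "test_function \<phi>"
  shows "(\<integral>x. g x * \<phi> x \<partial>lborel) = - (\<integral>x. f x * deriv \<phi> x \<partial>lborel)"
proof -
  obtain R where R: "\<And>x. R \<le> \<bar>x\<bar> \<Longrightarrow> \<phi> x = 0" "\<And>x. R \<le> \<bar>x\<bar> \<Longrightarrow> deriv \<phi> x = 0"
    using test_function_support[OF \<phi>] by metis
  have "abs_cont (\<lambda>x. f x * \<phi> x) (\<lambda>x. f x * deriv \<phi> x + g x * \<phi> x)"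
    by (intro abs_cont_mult f abs_cont_smooth test_smooth \<phi>)
  then have "(\<integral>x. f x * deriv \<phi> x + g x * \<phi> x \<partial>lborel) = 0"
    by (rule abs_cont_integral_0[where R=R]) (auto simp: R)
  moreover have "integrable lborel (\<lambda>x. f x * deriv \<phi> x)"
    by (intro integrable_loc_mult_test loc_integrable_continuous abs_cont_continuous[OF f] test_function_deriv \<phi>)
  moreover have "integrable lborel (\<lambda>x. g x * \<phi> x)"
    by (intro integrable_loc_mult_test abs_contD(1)[OF f] \<phi>)
  ultimately show ?thesis by simp
qed

section \<open>Locally square integrable functions and duality with test functions\<close>

lemma L2_loc_measurable: "L2_loc f \<Longrightarrow> f \<in> borel_measurable borel"
  by (simp add: L2_loc_def)

lemma L2_loc_square: "L2_loc f \<Longrightarrow> loc_integrable (\<lambda>x. (f x)\<^sup>2)"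
  by (auto simp: L2_loc_def loc_integrable_def)

lemma L2_imp_L2_loc: "L2 f \<Longrightarrow> L2_loc f"
  unfolding L2_def L2_loc_def set_integrable_def
  using integrable_real_mult_indicator[of "{a..b}" lborel "\<lambda>x. (f x)\<^sup>2" for a b] by (auto simp: mult.commute)

lemma L2_loc_mult:
  assumes f: "L2_loc f" and g: "L2_loc g"
  shows "loc_integrable (\<lambda>x. f x * g x)"
proof (rule loc_integrable_bound)
  show "loc_integrable (\<lambda>x. (f x)\<^sup>2 + (g x)\<^sup>2)" by (intro loc_integrable_add L2_loc_square f g)
  show "(\<lambda>x. f x * g x) \<in> borel_measurable borel"
    using f g by (intro borel_measurable_times L2_loc_measurable)
  show "\<bar>f x * g x\<bar> \<le> \<bar>(f x)\<^sup>2 + (g x)\<^sup>2\<bar>" for x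
  proof -
    have "2 * (\<bar>f x\<bar> * \<bar>g x\<bar>) \<le> (f x)\<^sup>2 + (g x)\<^sup>2"
      using sum_squares_bound[of "\<bar>f x\<bar>" "\<bar>g x\<bar>"] by (simp add: mult.assoc)
    moreover have "0 \<le> \<bar>f x\<bar> * \<bar>g x\<bar>" by simp
    ultimately show ?thesis unfolding abs_mult by linarith
  qed
qed

lemma L2_loc_continuous: "continuous_on UNIV f \<Longrightarrow> L2_loc f"
  unfolding L2_loc_def
  by (auto intro!: borel_measurable_continuous_onI borel_integrable_atLeastAtMost' continuous_intros intro: continuous_on_subset)

lemma L2_loc_imp_loc_integrable: "L2_loc f \<Longrightarrow> loc_integrable f"
  using L2_loc_mult[of f "\<lambda>x. 1"] L2_loc_continuous[of "\<lambda>x. 1"] by simp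

lemma L2_loc_add: assumes f: "L2_loc f" and g: "L2_loc g" shows "L2_loc (\<lambda>x. f x + g x)"
proof -
  have "loc_integrable (\<lambda>x. (f x)\<^sup>2 + (g x)\<^sup>2 + 2 * (f x * g x))"
    by (intro loc_integrable_add loc_integrable_cmult L2_loc_square L2_loc_mult f g)
  then have "loc_integrable (\<lambda>x. (f x + g x)\<^sup>2)" by (simp add: power2_sum mult.assoc)
  then show ?thesis
    using f g by (auto simp: L2_loc_def loc_integrable_def)
qed

lemma L2_loc_cmult: "L2_loc f \<Longrightarrow> L2_loc (\<lambda>x. c * f x)"
  by (auto simp: L2_loc_def power_mult_distrib)

lemma L2_loc_diff: "L2_loc f \<Longrightarrow> L2_loc g \<Longrightarrow> L2_loc (\<lambda>x. f x - g x)"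
  using L2_loc_add[of f "\<lambda>x. (-1) * g x"] L2_loc_cmult[of g "-1"] by simp

lemma L2_loc_indicator: 
  assumes "L2_loc f" shows "L2 (\<lambda>x. indicator {a..b} x * f x)"
proof -
  have [measurable]: "f \<in> borel_measurable borel" using assms by (rule L2_loc_measurable)
  have "(\<lambda>x. (indicator {a..b} x * f x)\<^sup>2) = (\<lambda>x. indicator {a..b} x *\<^sub>R (f x)\<^sup>2)"
    by (auto simp: indicator_def)
  then show ?thesis using assms by (simp add: L2_def L2_loc_def set_integrable_def)
qed

lemma integrable_of_bounded_Icc:
  assumes f: "loc_integrable f" and nn: "\<And>x. 0 \<le> f x"
    and bd: "\<And>n::nat. (LBINT x:{- real n..real n}. f x) \<le> K"
  shows "integrable lborel f" "(\<integral>x. f x \<partial>lborel) \<le> K"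
proof -
  define I where "I = (\<lambda>n::nat. LBINT x:{- real n..real n}. f x)"
  have [measurable]: "f \<in> borel_measurable borel" using f by (rule loc_integrable_measurable)
  have i: "integrable lborel (\<lambda>x. indicator {- real n..real n} x *\<^sub>R f x)" for n
    using loc_integrableD[OF f] by (simp add: set_integrable_def)
  have "incseq I"
    unfolding I_def set_lebesgue_integral_def
    by (intro incseq_SucI integral_mono i) (auto simp: indicator_def nn)
  then obtain L where L: "I \<longlonglongrightarrow> L" "\<And>n. I n \<le> L"
    using bd incseq_convergent[of I K] by (auto simp: I_def)
  have LK: "L \<le> K" using L(1) by (rule LIMSEQ_le_const2) (use bd in \<open>auto simp: I_def\<close>)
  have mc: "AE x in lborel. mono (\<lambda>n::nat. indicator {- real n..real n} x *\<^sub>R f x)"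
    by (intro AE_I2 monoI) (auto simp: indicator_def nn)
  have lim: "AE x in lborel. (\<lambda>n::nat. indicator {- real n..real n} x *\<^sub>R f x) \<longlonglongrightarrow> f x"
  proof (rule AE_I2)
    fix x :: real
    obtain N where "\<bar>x\<bar> \<le> real N" using real_arch_simple by blast
    then have "\<forall>\<^sub>F n in sequentially. f x = indicator {- real n..real n} x *\<^sub>R f x"
      unfolding eventually_sequentially by (intro exI[of _ N]) (auto simp: indicator_def)
    then show "(\<lambda>n::nat. indicator {- real n..real n} x *\<^sub>R f x) \<longlonglongrightarrow> f x"
      by (rule Lim_transform_eventually[OF tendsto_const])
  qed
  have "has_bochner_integral lborel f L"
    by (rule has_bochner_integral_monotone_convergence[OF i mc lim])
       (use L in \<open>auto simp: I_def set_lebesgue_integral_def\<close>)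
  then show "integrable lborel f" "(\<integral>x. f x \<partial>lborel) \<le> K"
    using LK by (auto simp: has_bochner_integral_iff)
qed

text \<open>Multiplying the approximations by a plateau keeps their supports in a fixed interval and does not
increase the distance to \<open>u\<close>.\<close>

lemma L2_approx_support:
  assumes u: "L2 u" "\<And>x. R < \<bar>x\<bar> \<Longrightarrow> u x = 0" and R: "R \<ge> 0"
  obtains \<theta> :: "nat \<Rightarrow> real \<Rightarrow> real" where "\<And>n. test_function (\<theta> n)" "\<And>n x. R + 1 \<le> \<bar>x\<bar> \<Longrightarrow> \<theta> n x = 0"
    "(\<lambda>n. l2norm (\<lambda>x. \<theta> n x - u x)) \<longlonglongrightarrow> 0"
proof -
  have [measurable]: "u \<in> borel_measurable borel" using u(1) by (rule L2_measurable)
  have "\<exists>\<phi>. test_function \<phi> \<and> l2norm (\<lambda>x. u x - \<phi> x) < 1 / real (Suc n)" for n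
    using L2_approx[OF u(1), of "1 / real (Suc n)"] by auto
  then obtain \<phi> where \<phi>: "\<And>n. test_function (\<phi> n)" "\<And>n. l2norm (\<lambda>x. u x - \<phi> n x) < 1 / real (Suc n)" by metis
  have [measurable]: "\<phi> n \<in> borel_measurable borel" for n using \<phi>(1) by (rule test_measurable)
  define p where "p = plateau (-R) R 1"
  have [measurable]: "p \<in> borel_measurable borel" unfolding p_def by (intro test_measurable test_function_plateau) simp
  define \<theta> where "\<theta> = (\<lambda>n x. p x * \<phi> n x)"
  have 1: "test_function (\<theta> n)" for n
    unfolding \<theta>_def p_def by (intro test_function_smooth_mult smooth_plateau \<phi>)
  have 2: "\<theta> n x = 0" if "R + 1 \<le> \<bar>x\<bar>" for n x
  proof -
    have "x \<le> -R - 1 \<or> R + 1 \<le> x" using that by linarith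
    then have "plateau (-R) R 1 x = 0" by (intro plateau_0) auto
    then show ?thesis by (simp add: \<theta>_def p_def)
  qed
  have pu: "p x * u x = u x" for x
    using u(2)[of x] plateau_1[of 1 "-R" x R] by (cases "R < \<bar>x\<bar>") (auto simp: p_def)
  have le: "l2norm (\<lambda>x. \<theta> n x - u x) \<le> l2norm (\<lambda>x. u x - \<phi> n x)" for n
    unfolding l2norm_def
  proof (intro real_sqrt_le_mono integral_mono)
    show "integrable lborel (\<lambda>x. (\<theta> n x - u x)\<^sup>2)" "integrable lborel (\<lambda>x. (u x - \<phi> n x)\<^sup>2)"
      using L2_diff[OF test_L2[OF 1] u(1)] L2_diff[OF u(1) test_L2[OF \<phi>(1)]] by (auto simp: L2_def)
    fix x
    have eq: "\<theta> n x - u x = p x * (\<phi> n x - u x)" by (simp add: \<theta>_def right_diff_distrib pu)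
    have "\<bar>p x * (\<phi> n x - u x)\<bar> \<le> \<bar>u x - \<phi> n x\<bar>"
      using plateau_range[of "-R" R 1 x] mult_right_mono[of "p x" 1 "\<bar>\<phi> n x - u x\<bar>"]
      by (auto simp: p_def abs_mult)
    then show "(\<theta> n x - u x)\<^sup>2 \<le> (u x - \<phi> n x)\<^sup>2" unfolding eq by (simp add: abs_le_square_iff)
  qed
  have "(\<lambda>n. l2norm (\<lambda>x. \<theta> n x - u x)) \<longlonglongrightarrow> 0"
  proof (rule Lim_null_comparison[OF _ LIMSEQ_Suc[OF lim_1_over_n]])
    show "\<forall>\<^sub>F n in sequentially. norm (l2norm (\<lambda>x. \<theta> n x - u x)) \<le> 1 / real (Suc n)"
      using le \<phi>(2) by (intro always_eventually allI) (simp, meson less_imp_le order_trans)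
  qed
  with 1 2 show thesis by (rule that)
qed

text \<open>The function \<open>v\<close>, cut off to a bounded interval, is itself a limit of admissible \<open>\<theta>\<close>.  Testing
with it bounds the integral of \<open>v\<^sup>2\<close> over the interval by \<open>N\<^sup>2\<close>, uniformly in the interval.\<close>

theorem L2_loc_dual_bound:
  assumes v: "L2_loc v" and N: "N \<ge> 0"
    and bd: "\<And>\<theta>. test_function \<theta> \<Longrightarrow> (\<integral>x. v x * \<theta> x \<partial>lborel) \<le> N * l2norm \<theta>"
  shows "L2 v" "l2norm v \<le> N"
proof -
  have [measurable]: "v \<in> borel_measurable borel" using v by (rule L2_loc_measurable)
  have loc: "(LBINT x:{- real n..real n}. (v x)\<^sup>2) \<le> N\<^sup>2" for n :: nat
  proof -
    define u where "u = (\<lambda>x. indicator {- real n..real n} x * v x)"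
    define v1 where "v1 = (\<lambda>x. indicator {- (real n + 1)..real n + 1} x * v x)"
    have u: "L2 u" and v1: "L2 v1" unfolding u_def v1_def by (intro L2_loc_indicator v)+
    obtain \<theta> where \<theta>: "\<And>k. test_function (\<theta> k)" "\<And>k x. real n + 1 \<le> \<bar>x\<bar> \<Longrightarrow> \<theta> k x = 0"
      "(\<lambda>k. l2norm (\<lambda>x. \<theta> k x - u x)) \<longlonglongrightarrow> 0"
    proof (rule L2_approx_support[OF u, of "real n"])
      show "u x = 0" if "real n < \<bar>x\<bar>" for x using that by (auto simp: u_def indicator_def)
    qed auto
    have [measurable]: "\<theta> k \<in> borel_measurable borel" for k using \<theta>(1) by (rule test_measurable)
    have eq: "(\<integral>x. v1 x * \<theta> k x \<partial>lborel) = (\<integral>x. v x * \<theta> k x \<partial>lborel)" for k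
    proof (rule Bochner_Integration.integral_cong)
      fix x show "v1 x * \<theta> k x = v x * \<theta> k x"
        using \<theta>(2)[of x k] by (cases "real n + 1 \<le> \<bar>x\<bar>") (auto simp: v1_def indicator_def)
    qed simp
    have "(\<lambda>k. \<integral>x. v1 x * \<theta> k x \<partial>lborel) \<longlonglongrightarrow> (\<integral>x. v1 x * u x \<partial>lborel)"
      by (rule L2_tendsto_inner) (use v1 u \<theta> test_L2 in \<open>auto simp: l2norm_def\<close>)
    moreover have "(\<lambda>k. N * l2norm (\<theta> k)) \<longlonglongrightarrow> N * l2norm u"
      using L2_tendsto_integral_square[OF test_L2[OF \<theta>(1)] u \<theta>(3)] unfolding l2norm_def by (intro tendsto_intros)
    ultimately have "(\<integral>x. v1 x * u x \<partial>lborel) \<le> N * l2norm u"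
      by (rule LIMSEQ_le) (use bd[OF \<theta>(1)] in \<open>auto simp: eq\<close>)
    moreover have "(\<integral>x. v1 x * u x \<partial>lborel) = (l2norm u)\<^sup>2"
      unfolding l2norm_power2
      by (rule Bochner_Integration.integral_cong) (auto simp: u_def v1_def indicator_def power2_eq_square)
    ultimately have "l2norm u * l2norm u \<le> N * l2norm u" by (simp add: power2_eq_square)
    then have "l2norm u \<le> N" using N by (cases "l2norm u = 0") (auto simp: less_le)
    then have "(l2norm u)\<^sup>2 \<le> N\<^sup>2" by (intro power_mono) auto
    moreover have "(l2norm u)\<^sup>2 = (LBINT x:{- real n..real n}. (v x)\<^sup>2)"
      unfolding l2norm_power2 set_lebesgue_integral_def
      by (rule Bochner_Integration.integral_cong) (auto simp: u_def indicator_def)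
    ultimately show ?thesis by simp
  qed
  from integrable_of_bounded_Icc[OF L2_loc_square[OF v] _ loc]
  have "integrable lborel (\<lambda>x. (v x)\<^sup>2)" "(\<integral>x. (v x)\<^sup>2 \<partial>lborel) \<le> N\<^sup>2" by auto
  then show "L2 v" "l2norm v \<le> N" using N by (auto simp: L2_def l2norm_def intro: real_le_lsqrt)
qed

corollary L2_loc_eq_0_AE:
  assumes v: "L2_loc v" and "\<And>\<theta>. test_function \<theta> \<Longrightarrow> (\<integral>x. v x * \<theta> x \<partial>lborel) = 0"
  shows "AE x in lborel. v x = 0"
proof -
  have "L2 v" "l2norm v \<le> 0" using L2_loc_dual_bound[OF v, of 0] assms(2) by auto
  then have "(\<integral>x. (v x)\<^sup>2 \<partial>lborel) = 0" by (simp add: l2norm_def antisym)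
  then show ?thesis
    using \<open>L2 v\<close> by (subst (asm) integral_nonneg_eq_0_iff_AE) (auto simp: L2_def)
qed

text \<open>The vanishing integral is what makes the primitive vanish on both sides of the support.\<close>

lemma test_antideriv:
  assumes \<theta>: "test_function \<theta>" "(\<integral>x. \<theta> x \<partial>lborel) = 0" and R: "\<And>x. R \<le> \<bar>x\<bar> \<Longrightarrow> \<theta> x = 0"
  obtains \<phi> where "test_function \<phi>" "deriv \<phi> = \<theta>" "abs_cont \<phi> \<theta>" "\<And>x. R \<le> \<bar>x\<bar> \<Longrightarrow> \<phi> x = 0"
proof -
  obtain F0 where F0: "abs_cont F0 \<theta>"
    using abs_cont_exists loc_integrable_continuous test_continuous[OF \<theta>(1)] by blast
  define \<phi> where "\<phi> = (\<lambda>x. F0 x - F0 (-\<bar>R\<bar>))"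
  have ac: "abs_cont \<phi> \<theta>" using F0 by (simp add: abs_cont_def \<phi>_def)
  have d: "(\<phi> has_real_derivative \<theta> x) (at x)" for x
    by (rule abs_cont_DERIV[OF ac test_continuous[OF \<theta>(1)]])
  have 0: "\<phi> (-\<bar>R\<bar>) = 0" by (simp add: \<phi>_def)
  have l0: "\<phi> x = 0" if "x \<le> -\<bar>R\<bar>" for x
  proof -
    have "(LBINT y:{x..-\<bar>R\<bar>}. \<theta> y) = (LBINT y:{x..-\<bar>R\<bar>}. 0)"
      by (rule set_lebesgue_integral_cong) (auto intro!: R)
    then show ?thesis using abs_contD(2)[OF ac that] 0 by simp
  qed
  have r0: "\<phi> x = 0" if x: "x \<ge> \<bar>R\<bar>" for x
  proof -
    have "(LBINT y:{-\<bar>R\<bar>..x}. \<theta> y) = (\<integral>y. \<theta> y \<partial>lborel)"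
      unfolding set_lebesgue_integral_def
    proof (rule Bochner_Integration.integral_cong)
      fix y show "indicator {-\<bar>R\<bar>..x} y *\<^sub>R \<theta> y = \<theta> y"
        using R[of y] x by (cases "\<bar>R\<bar> \<le> \<bar>y\<bar>") (auto simp: indicator_def)
    qed simp
    then show ?thesis using abs_contD(2)[OF ac, of "-\<bar>R\<bar>" x] x 0 \<theta>(2) by simp
  qed
  have "\<phi> x = 0" if "\<bar>R\<bar> \<le> \<bar>x\<bar>" for x using that l0[of x] r0[of x] by (cases "x \<ge> 0") auto
  moreover have "\<phi> x = 0" if "R < 0" for x
  proof -
    have "\<theta> = (\<lambda>x. 0)" using R that by (intro ext R) auto
    then show ?thesis using abs_contD(2)[OF ac, of "-\<bar>R\<bar>" x] abs_contD(2)[OF ac, of x "-\<bar>R\<bar>"] 0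
      by (cases "x \<le> -\<bar>R\<bar>") auto
  qed
  ultimately have z: "\<phi> x = 0" if "R \<le> \<bar>x\<bar>" for x using that by (cases "R < 0") auto
  have "test_function \<phi>"
    unfolding test_function_iff using z smooth_antideriv[OF d test_smooth[OF \<theta>(1)]] by (auto intro!: exI[of _ R])
  moreover have "deriv \<phi> = \<theta>" using d by (auto intro!: ext DERIV_imp_deriv)
  ultimately show thesis using ac z by (intro that)
qed

lemma unit_test_function:
  obtains \<eta> where "test_function \<eta>" "(\<integral>x. \<eta> x \<partial>lborel) = 1" "\<And>x. 1 \<le> \<bar>x\<bar> \<Longrightarrow> \<eta> x = 0"
proof -
  define p where "p = plateau (-1/4) (1/4) (1/2)"
  have p: "test_function p" by (simp add: p_def test_function_plateau)
  have i: "integrable lborel (indicator {-1/4..1/4::real} :: real \<Rightarrow> real)" by simp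
  have "(\<integral>x. indicator {-1/4..1/4::real} x \<partial>lborel) \<le> (\<integral>x. p x \<partial>lborel)"
    by (rule integral_mono[OF i test_integrable[OF p]])
       (use plateau_range[of "-1/4" "1/4" "1/2"] in \<open>auto simp: indicator_def p_def plateau_1\<close>)
  then have pos: "(\<integral>x. p x \<partial>lborel) > 0" by simp
  show thesis
  proof
    show "test_function (\<lambda>x. (1 / (\<integral>x. p x \<partial>lborel)) * p x)" by (rule test_function_cmult[OF p])
    show "(\<integral>x. (1 / (\<integral>x. p x \<partial>lborel)) * p x \<partial>lborel) = 1" using pos by simp
    show "(1 / (\<integral>x. p x \<partial>lborel)) * p x = 0" if "1 \<le> \<bar>x\<bar>" for x
      using that by (auto simp: p_def plateau_0 abs_if split: if_splits)
  qed
qed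

text \<open>The lemma of du Bois-Reymond.  Subtracting a multiple of a fixed bump \<open>\<eta>\<close> of integral one turns
every test function into the derivative of a test function, and \<open>c\<close> is the value of \<open>u\<close> on \<open>\<eta>\<close>.\<close>

lemma weakly_constant_AE:
  assumes u: "L2_loc u" and 0: "\<And>\<phi>. test_function \<phi> \<Longrightarrow> (\<integral>x. u x * deriv \<phi> x \<partial>lborel) = 0"
  obtains c where "AE x in lborel. u x = c"
proof -
  obtain \<eta> where \<eta>: "test_function \<eta>" "(\<integral>x. \<eta> x \<partial>lborel) = 1" using unit_test_function by metis
  define c where "c = (\<integral>x. u x * \<eta> x \<partial>lborel)"
  have ui: "loc_integrable u" using u by (rule L2_loc_imp_loc_integrable)
  have "AE x in lborel. u x - c = 0"
  proof (rule L2_loc_eq_0_AE)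
    show "L2_loc (\<lambda>x. u x - c)" by (intro L2_loc_diff u L2_loc_continuous continuous_intros)
    fix \<theta> assume \<theta>: "test_function \<theta>"
    define m where "m = (\<integral>x. \<theta> x \<partial>lborel)"
    have k: "test_function (\<lambda>x. \<theta> x - m * \<eta> x)" by (intro test_function_diff test_function_cmult \<theta> \<eta>)
    have "(\<integral>x. \<theta> x - m * \<eta> x \<partial>lborel) = 0" using \<eta> \<theta> by (simp add: test_integrable m_def)
    moreover obtain R where "\<And>x. R \<le> \<bar>x\<bar> \<Longrightarrow> \<theta> x - m * \<eta> x = 0" using test_function_support[OF k] by metis
    ultimately obtain \<phi> where \<phi>: "test_function \<phi>" "deriv \<phi> = (\<lambda>x. \<theta> x - m * \<eta> x)"
      using test_antideriv[OF k] by metis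
    have i: "integrable lborel (\<lambda>x. u x * \<theta> x)" "integrable lborel (\<lambda>x. u x * \<eta> x)"
      by (intro integrable_loc_mult_test ui \<theta> \<eta>)+
    have "0 = (\<integral>x. u x * \<theta> x - m * (u x * \<eta> x) \<partial>lborel)"
      using 0[OF \<phi>(1)] \<phi>(2) by (simp add: algebra_simps)
    also have "\<dots> = (\<integral>x. u x * \<theta> x \<partial>lborel) - m * c"
      using i by (simp add: c_def)
    finally show "(\<integral>x. (u x - c) * \<theta> x \<partial>lborel) = 0"
      using i test_integrable[OF \<theta>] by (simp add: left_diff_distrib m_def)
  qed
  then show thesis by (intro that[of c]) auto
qed

section \<open>The space \<open>H\<^sup>1\<close>\<close>

lemma weak_deriv_unique:
  assumes "L2_loc g" "L2_loc h" "has_weak_deriv f g" "has_weak_deriv f h"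
  shows "AE x in lborel. g x = h x"
proof -
  have "AE x in lborel. g x - h x = 0"
  proof (rule L2_loc_eq_0_AE)
    show "L2_loc (\<lambda>x. g x - h x)" by (intro L2_loc_diff assms)
    fix \<theta> assume \<theta>: "test_function \<theta>"
    have "(\<integral>x. g x * \<theta> x \<partial>lborel) = (\<integral>x. h x * \<theta> x \<partial>lborel)"
      using assms(3,4) \<theta> by (simp add: has_weak_deriv_def regular_def)
    moreover have "integrable lborel (\<lambda>x. g x * \<theta> x)" "integrable lborel (\<lambda>x. h x * \<theta> x)"
      by (intro integrable_loc_mult_test L2_loc_imp_loc_integrable assms \<theta>)+
    ultimately show "(\<integral>x. (g x - h x) * \<theta> x \<partial>lborel) = 0" by (simp add: left_diff_distrib)
  qed
  then show ?thesis by simp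
qed

text \<open>The difference of \<open>f\<close> and a primitive of \<open>g\<close> has weak derivative zero, hence is constant.\<close>

lemma has_weak_deriv_abs_cont:
  assumes f: "L2_loc f" and g: "L2_loc g" and w: "has_weak_deriv f g"
  obtains F where "abs_cont F g" "AE x in lborel. f x = F x"
proof -
  obtain F where F: "abs_cont F g" using abs_cont_exists L2_loc_imp_loc_integrable[OF g] by blast
  have FL: "L2_loc F" by (intro L2_loc_continuous abs_cont_continuous[OF F])
  obtain c where c: "AE x in lborel. f x - F x = c"
  proof (rule weakly_constant_AE)
    show "L2_loc (\<lambda>x. f x - F x)" by (intro L2_loc_diff f FL)
    fix \<phi> assume \<phi>: "test_function \<phi>"
    have "(\<integral>x. f x * deriv \<phi> x \<partial>lborel) = (\<integral>x. F x * deriv \<phi> x \<partial>lborel)"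
      using w abs_cont_by_parts[OF F \<phi>] \<phi> by (auto simp: has_weak_deriv_def regular_def ddx_def)
    moreover have "integrable lborel (\<lambda>x. f x * deriv \<phi> x)" "integrable lborel (\<lambda>x. F x * deriv \<phi> x)"
      by (intro integrable_loc_mult_test L2_loc_imp_loc_integrable f FL test_function_deriv \<phi>)+
    ultimately show "(\<integral>x. (f x - F x) * deriv \<phi> x \<partial>lborel) = 0" by (simp add: left_diff_distrib)
  qed
  show thesis
  proof
    show "abs_cont (\<lambda>x. F x + c) g" using F by (simp add: abs_cont_def)
    show "AE x in lborel. f x = F x + c" using c by eventually_elim auto
  qed
qed

text \<open>\<open>F\<close> is the absolutely continuous representative of an element of \<open>H\<^sup>1\<close> and \<open>g\<close> is its derivative.  The
classes of \<open>H\<^sup>1\<close> functions up to null sets are handled through such pairs.\<close>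

definition H1_pair :: "(real \<Rightarrow> real) \<Rightarrow> (real \<Rightarrow> real) \<Rightarrow> bool" where
  "H1_pair F g \<longleftrightarrow> abs_cont F g \<and> L2 F \<and> L2 g"

lemma weak_deriv_props: "H1 f \<Longrightarrow> L2 (weak_deriv f)" "H1 f \<Longrightarrow> has_weak_deriv f (weak_deriv f)"
  unfolding H1_def weak_deriv_def using someI_ex[of "\<lambda>g. L2 g \<and> has_weak_deriv f g"] by auto

lemma H1_L2: "H1 f \<Longrightarrow> L2 f"
  by (simp add: H1_def)

lemma H1_representative:
  assumes "H1 f" obtains F where "H1_pair F (weak_deriv f)" "AE x in lborel. f x = F x"
proof -
  obtain F where F: "abs_cont F (weak_deriv f)" "AE x in lborel. f x = F x"
    using has_weak_deriv_abs_cont L2_imp_L2_loc weak_deriv_props[OF assms] H1_L2[OF assms] by metis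
  have "L2 F" by (rule L2_cong_AE[OF H1_L2[OF assms] abs_cont_measurable[OF F(1)] F(2)])
  with F weak_deriv_props[OF assms] show thesis by (intro that[of F]) (auto simp: H1_pair_def)
qed

lemma H1_pairD: "H1_pair F g \<Longrightarrow> abs_cont F g" "H1_pair F g \<Longrightarrow> L2 F" "H1_pair F g \<Longrightarrow> L2 g"
  by (auto simp: H1_pair_def)

lemma H1_I:
  assumes F: "H1_pair F g" and f: "f \<in> borel_measurable borel" "AE x in lborel. f x = F x"
  shows "H1 f" and "AE x in lborel. weak_deriv f x = g x"
proof -
  have [measurable]: "F \<in> borel_measurable borel" using H1_pairD(1)[OF F] by (rule abs_cont_measurable)
  note [measurable] = f(1)
  have L2f: "L2 f" using f H1_pairD(2)[OF F] by (intro L2_cong_AE[of F f]) (auto elim: AE_mp)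
  have w: "has_weak_deriv f g"
    unfolding has_weak_deriv_def
  proof (intro allI impI)
    fix \<phi> assume \<phi>: "test_function \<phi>"
    have [measurable]: "deriv \<phi> \<in> borel_measurable borel" by (intro test_measurable test_function_deriv \<phi>)
    have "(\<integral>x. f x * deriv \<phi> x \<partial>lborel) = (\<integral>x. F x * deriv \<phi> x \<partial>lborel)"
      by (rule integral_cong_AE) (use f(2) in auto)
    then show "regular g \<phi> = ddx (regular f) \<phi>"
      using abs_cont_by_parts[OF H1_pairD(1)[OF F] \<phi>] by (simp add: regular_def ddx_def)
  qed
  show H1: "H1 f" using L2f H1_pairD(3)[OF F] w by (auto simp: H1_def)
  show "AE x in lborel. weak_deriv f x = g x"
    by (rule weak_deriv_unique[OF _ _ weak_deriv_props(2)[OF H1] w])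
       (use weak_deriv_props[OF H1] H1_pairD(3)[OF F] in \<open>auto intro: L2_imp_L2_loc\<close>)
qed

lemma H1_pair_H1: "H1_pair F g \<Longrightarrow> H1 F" "H1_pair F g \<Longrightarrow> AE x in lborel. weak_deriv F x = g x"
  using H1_I[of F g F] abs_cont_measurable[of F g] by (auto simp: H1_pair_def)

lemma H1_norm_nonneg [simp]: "0 \<le> H1_norm f" by (simp add: H1_norm_def)

lemma l2norm_le_H1_norm: "l2norm f \<le> H1_norm f" "l2norm (weak_deriv f) \<le> H1_norm f"
  by (auto simp: H1_norm_def intro!: real_le_rsqrt)

lemma H1_norm_le: "H1_norm f \<le> l2norm f + l2norm (weak_deriv f)"
  unfolding H1_norm_def by (rule sqrt_sum_squares_le_sum) auto

lemma H1_pair_norm: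
  assumes "H1_pair F g"  "f \<in> borel_measurable borel" "AE x in lborel. f x = F x"
  shows "H1_norm f = sqrt ((l2norm F)\<^sup>2 + (l2norm g)\<^sup>2)"
proof -
  have "l2norm f = l2norm F"
    using assms by (intro l2norm_cong_AE) (auto dest: H1_pairD intro: abs_cont_measurable)
  moreover have "l2norm (weak_deriv f) = l2norm g"
    using H1_I[OF assms] weak_deriv_props(1)[of f] H1_pairD(3)[OF assms(1)]
    by (intro l2norm_cong_AE) (auto intro: L2_measurable)
  ultimately show ?thesis by (simp add: H1_norm_def)
qed

lemma H1_pair_add: "H1_pair F g \<Longrightarrow> H1_pair G h \<Longrightarrow> H1_pair (\<lambda>x. F x + G x) (\<lambda>x. g x + h x)"
  by (auto simp: H1_pair_def intro: abs_cont_add L2_add)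

lemma H1_pair_cmult: "H1_pair F g \<Longrightarrow> H1_pair (\<lambda>x. c * F x) (\<lambda>x. c * g x)"
  by (auto simp: H1_pair_def intro: abs_cont_cmult L2_cmult)

lemma H1_pair_test: "test_function \<phi> \<Longrightarrow> H1_pair \<phi> (deriv \<phi>)"
  by (auto simp: H1_pair_def intro: abs_cont_smooth test_smooth test_L2 test_function_deriv)

lemma H1_test: "test_function \<phi> \<Longrightarrow> H1 \<phi>"
  by (rule H1_pair_H1(1)[OF H1_pair_test])

lemma H1_add: "H1 f \<Longrightarrow> H1 h \<Longrightarrow> H1 (\<lambda>x. f x + h x)"
  and weak_deriv_add: "H1 f \<Longrightarrow> H1 h \<Longrightarrow> AE x in lborel. weak_deriv (\<lambda>x. f x + h x) x = weak_deriv f x + weak_deriv h x"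
proof -
  have "H1 (\<lambda>x. f x + h x) \<and> (AE x in lborel. weak_deriv (\<lambda>x. f x + h x) x = weak_deriv f x + weak_deriv h x)"
    if f: "H1 f" and h: "H1 h"
  proof -
    obtain F where F: "H1_pair F (weak_deriv f)" "AE x in lborel. f x = F x" by (rule H1_representative[OF f])
    obtain H where H: "H1_pair H (weak_deriv h)" "AE x in lborel. h x = H x" by (rule H1_representative[OF h])
    have "(\<lambda>x. f x + h x) \<in> borel_measurable borel"
      by (intro borel_measurable_add L2_measurable H1_L2 f h)
    moreover have "AE x in lborel. f x + h x = F x + H x" using F(2) H(2) by eventually_elim simp
    ultimately show ?thesis using H1_I[OF H1_pair_add[OF F(1) H(1)]] by blast
  qed
  then show "H1 f \<Longrightarrow> H1 h \<Longrightarrow> H1 (\<lambda>x. f x + h x)"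
    "H1 f \<Longrightarrow> H1 h \<Longrightarrow> AE x in lborel. weak_deriv (\<lambda>x. f x + h x) x = weak_deriv f x + weak_deriv h x" by blast+
qed

lemma H1_cmult: "H1 f \<Longrightarrow> H1 (\<lambda>x. c * f x)"
  and weak_deriv_cmult: "H1 f \<Longrightarrow> AE x in lborel. weak_deriv (\<lambda>x. c * f x) x = c * weak_deriv f x"
proof -
  have "H1 (\<lambda>x. c * f x) \<and> (AE x in lborel. weak_deriv (\<lambda>x. c * f x) x = c * weak_deriv f x)" if f: "H1 f"
  proof -
    obtain F where F: "H1_pair F (weak_deriv f)" "AE x in lborel. f x = F x" by (rule H1_representative[OF f])
    have "(\<lambda>x. c * f x) \<in> borel_measurable borel"
      by (intro borel_measurable_times borel_measurable_const L2_measurable H1_L2 f)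
    moreover have "AE x in lborel. c * f x = c * F x" using F(2) by eventually_elim simp
    ultimately show ?thesis using H1_I[OF H1_pair_cmult[OF F(1)]] by blast
  qed
  then show "H1 f \<Longrightarrow> H1 (\<lambda>x. c * f x)"
    "H1 f \<Longrightarrow> AE x in lborel. weak_deriv (\<lambda>x. c * f x) x = c * weak_deriv f x" by blast+
qed

lemma H1_diff: "H1 f \<Longrightarrow> H1 h \<Longrightarrow> H1 (\<lambda>x. f x - h x)"
  using H1_add[of f "\<lambda>x. (-1) * h x"] H1_cmult[of h "-1"] by simp

lemma weak_deriv_diff:
  "H1 f \<Longrightarrow> H1 h \<Longrightarrow> AE x in lborel. weak_deriv (\<lambda>x. f x - h x) x = weak_deriv f x - weak_deriv h x"
  using weak_deriv_add[of f "\<lambda>x. (-1) * h x"] weak_deriv_cmult[of h "-1"] H1_cmult[of h "-1"]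
  by (auto elim: AE_mp)

lemma weak_deriv_test: "test_function \<phi> \<Longrightarrow> AE x in lborel. weak_deriv \<phi> x = deriv \<phi> x"
  by (rule H1_pair_H1(2)[OF H1_pair_test])

lemma l2norm_weak_deriv_diff:
  assumes "H1 f" "H1 h"
  shows "l2norm (weak_deriv (\<lambda>x. f x - h x)) = l2norm (\<lambda>x. weak_deriv f x - weak_deriv h x)"
  by (rule l2norm_cong_AE[OF _ _ weak_deriv_diff[OF assms]])
     (use assms in \<open>auto intro!: L2_measurable L2_diff weak_deriv_props(1) H1_diff\<close>)

lemma H1_norm_triangle:
  assumes f: "H1 f" and h: "H1 h"
  shows "H1_norm (\<lambda>x. f x + h x) \<le> H1_norm f + H1_norm h"
proof -
  have "l2norm (weak_deriv (\<lambda>x. f x + h x)) = l2norm (\<lambda>x. weak_deriv f x + weak_deriv h x)"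
    by (rule l2norm_cong_AE[OF _ _ weak_deriv_add[OF assms]])
       (use assms in \<open>auto intro!: L2_measurable L2_add weak_deriv_props(1) H1_add\<close>)
  also have "\<dots> \<le> l2norm (weak_deriv f) + l2norm (weak_deriv h)"
    by (intro l2norm_triangle weak_deriv_props f h)
  finally have 1: "l2norm (weak_deriv (\<lambda>x. f x + h x)) \<le> l2norm (weak_deriv f) + l2norm (weak_deriv h)" .
  have 2: "l2norm (\<lambda>x. f x + h x) \<le> l2norm f + l2norm h" by (intro l2norm_triangle H1_L2 f h)
  have "H1_norm (\<lambda>x. f x + h x)
      \<le> sqrt ((l2norm f + l2norm h)\<^sup>2 + (l2norm (weak_deriv f) + l2norm (weak_deriv h))\<^sup>2)"
    unfolding H1_norm_def by (intro real_sqrt_le_mono add_mono power_mono 1 2) auto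
  also have "\<dots> \<le> H1_norm f + H1_norm h"
    unfolding H1_norm_def by (rule real_sqrt_sum_squares_triangle_ineq)
  finally show ?thesis .
qed

lemma H1_norm_minus_commute: "H1 f \<Longrightarrow> H1 h \<Longrightarrow> H1_norm (\<lambda>x. f x - h x) = H1_norm (\<lambda>x. h x - f x)"
  using l2norm_weak_deriv_diff[of f h] l2norm_weak_deriv_diff[of h f]
    l2norm_minus_commute[of f h] l2norm_minus_commute[of "weak_deriv f" "weak_deriv h"]
  by (simp add: H1_norm_def)

section \<open>Density of test functions in \<open>H\<^sup>1\<close>\<close>

definition cutoff :: "nat \<Rightarrow> real \<Rightarrow> real" where
  "cutoff N x = plateau (-1) 1 1 (x / real (Suc N))"

lemma cutoff_smooth: "smooth (cutoff N)"
  using smooth_affine[OF smooth_plateau, of "-1" 1 1 "1 / real (Suc N)" 0]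
  by (simp add: cutoff_def[abs_def] del: of_nat_Suc)

lemma cutoff_range: "0 \<le> cutoff N x" "cutoff N x \<le> 1"
  by (simp_all add: cutoff_def plateau_range)

lemma cutoff_1: "\<bar>x\<bar> \<le> real (Suc N) \<Longrightarrow> cutoff N x = 1"
  unfolding cutoff_def by (rule plateau_1) (auto simp: field_simps simp del: of_nat_Suc)

lemma cutoff_0: "2 * real (Suc N) \<le> \<bar>x\<bar> \<Longrightarrow> cutoff N x = 0"
  unfolding cutoff_def by (rule plateau_0) (auto simp: field_simps abs_if simp del: of_nat_Suc split: if_splits)

lemma test_function_cutoff: "test_function (cutoff N)"
  unfolding test_function_iff
  by (auto simp: cutoff_smooth simp del: of_nat_Suc intro!: exI[of _ "2 * real (Suc N)"] cutoff_0)

lemma cutoff_deriv_bound: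
  obtains K where "K > 0" "\<And>N x. \<bar>deriv (cutoff N) x\<bar> \<le> K / real (Suc N)"
proof -
  define p where "p = plateau (-1) 1 1"
  have p: "test_function p" by (simp add: p_def test_function_plateau)
  obtain K where K: "K > 0" "\<And>x. \<bar>deriv p x\<bar> \<le> K" using test_bounded[OF test_function_deriv[OF p]] by metis
  have "\<bar>deriv (cutoff N) x\<bar> \<le> K / real (Suc N)" for N x
  proof -
    have "((\<lambda>x. x / real (Suc N)) has_real_derivative 1 / real (Suc N)) (at x)"
      by (rule DERIV_cdivide[OF DERIV_ident])
    from DERIV_chain2[OF smooth_DERIV[OF test_smooth[OF p]] this]
    have "deriv (cutoff N) x = deriv p (x / real (Suc N)) * (1 / real (Suc N))"
      unfolding cutoff_def[abs_def] p_def by (rule DERIV_imp_deriv)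
    then have "\<bar>deriv (cutoff N) x\<bar> = \<bar>deriv p (x / real (Suc N))\<bar> / real (Suc N)"
      by (simp add: abs_mult)
    also have "\<dots> \<le> K / real (Suc N)" by (rule divide_right_mono[OF K(2)]) simp
    finally show ?thesis .
  qed
  with K(1) show thesis by (rule that)
qed

lemma cutoff_eventually_1: "\<forall>\<^sub>F N in sequentially. cutoff N x = 1"
proof -
  obtain M where "\<bar>x\<bar> \<le> real M" using real_arch_simple by blast
  then show ?thesis unfolding eventually_sequentially by (intro exI[of _ M] allI impI cutoff_1) auto
qed

lemma l2norm_integral_bound:
  assumes u: "L2 u" and s: "\<And>x. R < \<bar>x\<bar> \<Longrightarrow> u x = 0" and R: "R \<ge> 0"
  shows "(\<integral>x. \<bar>u x\<bar> \<partial>lborel) \<le> sqrt (2 * R) * l2norm u"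
proof -
  have I: "L2 (indicator {-R..R})"
    using L2_loc_indicator[OF L2_loc_continuous[of "\<lambda>x. 1"], of "-R" R] by simp
  have "(\<integral>x. \<bar>u x\<bar> \<partial>lborel) = (\<integral>x. \<bar>indicator {-R..R} x * u x\<bar> \<partial>lborel)"
    by (rule Bochner_Integration.integral_cong) (use s in \<open>auto simp: indicator_def not_le abs_if\<close>)
  also have "\<dots> \<le> l2norm (indicator {-R..R}) * l2norm u" by (rule L2_Cauchy_Schwarz_abs[OF I u])
  also have "(\<integral>x. (indicator {-R..R} x)\<^sup>2 \<partial>lborel) = (\<integral>x. indicator {-R..R} x \<partial>lborel :: real)"
    by (rule Bochner_Integration.integral_cong) (auto simp: indicator_def)
  then have "l2norm (indicator {-R..R}) = sqrt (2 * R)" using R by (simp add: l2norm_def)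
  finally show ?thesis .
qed

lemma abs_cont_diff_bound:
  assumes F: "abs_cont F g" and G: "abs_cont G h" and i: "integrable lborel (\<lambda>x. g x - h x)"
    and a: "F a = G a"  and x: "a \<le> x"
  shows "\<bar>F x - G x\<bar> \<le> (\<integral>x. \<bar>g x - h x\<bar> \<partial>lborel)"
proof -
  have "F x - G x = (LBINT y:{a..x}. g y - h y)"
    using abs_contD(2)[OF abs_cont_diff[OF F G] x] a by simp
  then have "\<bar>F x - G x\<bar> \<le> (\<integral>y. \<bar>indicator {a..x} y * (g y - h y)\<bar> \<partial>lborel)"
    by (simp add: set_lebesgue_integral_def integral_abs_bound)
  also have "\<dots> \<le> (\<integral>x. \<bar>g x - h x\<bar> \<partial>lborel)"
    using integrable_real_mult_indicator[OF _ i, of "{a..x}"] i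
    by (intro integral_mono integrable_abs) (auto simp: indicator_def mult.commute)
  finally show ?thesis .
qed

text \<open>Approximating the derivative in \<open>L\<^sup>2\<close> and correcting its mean value gives an approximation
  of the function itself that is uniform and has supports in a fixed interval.\<close>

lemma compact_support_approx:
  assumes F: "abs_cont F g" and g: "L2 g" and R: "R \<ge> 0"
    and s: "\<And>x. R \<le> \<bar>x\<bar> \<Longrightarrow> F x = 0" "\<And>x. R < \<bar>x\<bar> \<Longrightarrow> g x = 0"
  obtains \<phi> :: "nat \<Rightarrow> real \<Rightarrow> real" and c where "\<And>n. test_function (\<phi> n)"
    "\<And>n x. R + 1 \<le> \<bar>x\<bar> \<Longrightarrow> \<phi> n x = 0"
    "(\<lambda>n. l2norm (\<lambda>x. deriv (\<phi> n) x - g x)) \<longlonglongrightarrow> 0"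
    "\<And>n x. \<bar>\<phi> n x - F x\<bar> \<le> c n" "c \<longlonglongrightarrow> 0"
proof -
  obtain \<theta> :: "nat \<Rightarrow> real \<Rightarrow> real" where \<theta>: "\<And>n. test_function (\<theta> n)" "\<And>n x. R + 1 \<le> \<bar>x\<bar> \<Longrightarrow> \<theta> n x = 0"
    "(\<lambda>n. l2norm (\<lambda>x. \<theta> n x - g x)) \<longlonglongrightarrow> 0"
    using L2_approx_support[OF g s(2) R] by metis
  obtain \<eta> where \<eta>: "test_function \<eta>" "(\<integral>x. \<eta> x \<partial>lborel) = 1" "\<And>x. 1 \<le> \<bar>x\<bar> \<Longrightarrow> \<eta> x = 0"
    using unit_test_function by metis
  define m where "m = (\<lambda>n. \<integral>x. \<theta> n x \<partial>lborel)"
  define k where "k = (\<lambda>n x. \<theta> n x - m n * \<eta> x)"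
  have g0: "(\<integral>x. g x \<partial>lborel) = 0" by (rule abs_cont_integral_0[OF F, of R]) (use s in auto)
  have gi: "integrable lborel g"
  proof -
    have "integrable lborel (\<lambda>x. indicator {-R..R} x * g x)"
      using loc_integrableD[OF abs_contD(1)[OF F], of "-R" R] by (simp add: set_integrable_def)
    also have "(\<lambda>x. indicator {-R..R} x * g x) = g"
    proof
      fix x show "indicator {-R..R} x * g x = g x"
        using s(2)[of x] by (cases "R < \<bar>x\<bar>") (auto simp: indicator_def)
    qed
    finally show ?thesis .
  qed
  have L2d: "L2 (\<lambda>x. \<theta> n x - g x)" for n by (intro L2_diff test_L2 \<theta> g)
  have m_le: "\<bar>m n\<bar> \<le> sqrt (2 * (R + 1)) * l2norm (\<lambda>x. \<theta> n x - g x)" for n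
  proof -
    have "m n = (\<integral>x. \<theta> n x - g x \<partial>lborel)"
      using g0 gi test_integrable[OF \<theta>(1)] by (simp add: m_def)
    also have "\<bar>\<dots>\<bar> \<le> (\<integral>x. \<bar>\<theta> n x - g x\<bar> \<partial>lborel)" by (rule integral_abs_bound)
    also have "\<dots> \<le> sqrt (2 * (R + 1)) * l2norm (\<lambda>x. \<theta> n x - g x)"
      by (rule l2norm_integral_bound[OF L2d]) (use \<theta>(2) s(2) R in auto)
    finally show ?thesis .
  qed
  have m0: "m \<longlonglongrightarrow> 0"
  proof (rule Lim_null_comparison[OF always_eventually[OF allI]])
    show "norm (m n) \<le> sqrt (2 * (R + 1)) * l2norm (\<lambda>x. \<theta> n x - g x)" for n
      unfolding real_norm_def by (rule m_le)
    show "(\<lambda>n. sqrt (2 * (R + 1)) * l2norm (\<lambda>x. \<theta> n x - g x)) \<longlonglongrightarrow> 0"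
      using tendsto_mult_left[OF \<theta>(3), of "sqrt (2 * (R + 1))"] by simp
  qed
  have kt: "test_function (k n)" for n
    unfolding k_def by (intro test_function_diff test_function_cmult \<theta> \<eta>)
  have ks: "k n x = 0" if "R + 1 \<le> \<bar>x\<bar>" for n x
    using \<theta>(2)[OF that] \<eta>(3)[of x] that R by (simp add: k_def)
  have k_int: "(\<integral>x. k n x \<partial>lborel) = 0" for n
    using \<eta> test_integrable[OF \<theta>(1)] test_integrable[OF \<eta>(1)] by (simp add: k_def m_def)
  have kg: "L2 (\<lambda>x. k n x - g x)" for n by (intro L2_diff test_L2 kt g)
  have k_le: "l2norm (\<lambda>x. k n x - g x) \<le> l2norm (\<lambda>x. \<theta> n x - g x) + \<bar>m n\<bar> * l2norm \<eta>" for n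
  proof -
    have "l2norm (\<lambda>x. (\<theta> n x - g x) + (- m n) * \<eta> x) \<le> l2norm (\<lambda>x. \<theta> n x - g x) + l2norm (\<lambda>x. (- m n) * \<eta> x)"
      by (intro l2norm_triangle L2d L2_cmult test_L2 \<eta>)
    then show ?thesis unfolding l2norm_cmult by (simp add: k_def algebra_simps)
  qed
  have k0: "(\<lambda>n. l2norm (\<lambda>x. k n x - g x)) \<longlonglongrightarrow> 0"
  proof (rule Lim_null_comparison[OF always_eventually[OF allI]])
    show "norm (l2norm (\<lambda>x. k n x - g x)) \<le> l2norm (\<lambda>x. \<theta> n x - g x) + \<bar>m n\<bar> * l2norm \<eta>" for n
      using k_le by simp
    have "(\<lambda>n. l2norm (\<lambda>x. \<theta> n x - g x) + \<bar>m n\<bar> * l2norm \<eta>) \<longlonglongrightarrow> 0 + \<bar>0\<bar> * l2norm \<eta>"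
      by (intro tendsto_intros \<theta> m0)
    then show "(\<lambda>n. l2norm (\<lambda>x. \<theta> n x - g x) + \<bar>m n\<bar> * l2norm \<eta>) \<longlonglongrightarrow> 0" by simp
  qed
  have "\<exists>\<phi>. test_function \<phi> \<and> deriv \<phi> = k n \<and> abs_cont \<phi> (k n) \<and> (\<forall>x. R + 1 \<le> \<bar>x\<bar> \<longrightarrow> \<phi> x = 0)" for n
  proof -
    have "\<And>x. R + 1 \<le> \<bar>x\<bar> \<Longrightarrow> k n x = 0" by (rule ks)
    from test_antideriv[OF kt k_int this] obtain \<phi> where "test_function \<phi>" "deriv \<phi> = k n" "abs_cont \<phi> (k n)"
      "\<And>x. R + 1 \<le> \<bar>x\<bar> \<Longrightarrow> \<phi> x = 0" by blast
    then show ?thesis by blast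
  qed
  then obtain \<phi> where \<phi>: "\<And>n. test_function (\<phi> n)" "\<And>n. deriv (\<phi> n) = k n" "\<And>n. abs_cont (\<phi> n) (k n)"
    "\<And>n x. R + 1 \<le> \<bar>x\<bar> \<Longrightarrow> \<phi> n x = 0" by metis
  define c where "c = (\<lambda>n. sqrt (2 * (R + 1)) * l2norm (\<lambda>x. k n x - g x))"
  have "\<bar>\<phi> n x - F x\<bar> \<le> c n" for n x
  proof (cases "-(R + 1) \<le> x")
    case True
    have "\<bar>\<phi> n x - F x\<bar> \<le> (\<integral>x. \<bar>k n x - g x\<bar> \<partial>lborel)"
    proof (rule abs_cont_diff_bound[OF \<phi>(3) F _ _ True])
      show "integrable lborel (\<lambda>x. k n x - g x)" by (intro Bochner_Integration.integrable_diff test_integrable kt gi)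
      show "\<phi> n (-(R + 1)) = F (-(R + 1))" using \<phi>(4)[of "-(R+1)" n] s(1)[of "-(R+1)"] R by auto
    qed
    also have "\<dots> \<le> c n" unfolding c_def
    proof (rule l2norm_integral_bound[OF kg])
      show "k n x - g x = 0" if "R + 1 < \<bar>x\<bar>" for x using ks[of x n] s(2)[of x] that by simp
    qed (use R in simp)
    finally show ?thesis .
  next
    case False
    then have "R + 1 \<le> \<bar>x\<bar>" using R by linarith
    then have "\<phi> n x = 0" "F x = 0" using \<phi>(4)[of x n] s(1)[of x] by auto
    then show ?thesis using R by (simp add: c_def)
  qed
  moreover have "c \<longlonglongrightarrow> 0" unfolding c_def using tendsto_mult_left[OF k0, of "sqrt (2 * (R + 1))"] by simp
  ultimately show thesis using \<phi> k0 by (intro that[of \<phi> c]) auto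
qed

text \<open>Cutting \<open>F\<close> off at a distance of the order of \<open>N\<close> costs a term \<open>cutoff' F\<close> in the derivative, of norm \<open>O(1 / N)\<close>; the
resulting function of compact support is covered by \<open>compact_support_approx\<close>.\<close>

lemma H1_pair_approx:
  assumes FG: "H1_pair F g" and e: "e > 0"
  obtains \<phi> where "test_function \<phi>" "l2norm (\<lambda>x. \<phi> x - F x) < e" "l2norm (\<lambda>x. deriv \<phi> x - g x) < e"
proof -
  note F = H1_pairD[OF FG]
  have [measurable]: "F \<in> borel_measurable borel" "g \<in> borel_measurable borel" using F by (auto intro: L2_measurable)
  obtain K where K: "K > 0" "\<And>N x. \<bar>deriv (cutoff N) x\<bar> \<le> K / real (Suc N)" using cutoff_deriv_bound by metis
  have [measurable]: "cutoff N \<in> borel_measurable borel" "deriv (cutoff N) \<in> borel_measurable borel" for N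
    by (intro test_measurable test_function_deriv test_function_cutoff)+
  have cut0: "(\<lambda>N. l2norm (\<lambda>x. cutoff N x * u x - u x)) \<longlonglongrightarrow> 0" 
    and cutL2: "L2 (\<lambda>x. cutoff N x * u x)" if u: "L2 u" for u and N
  proof -
    have [measurable]: "u \<in> borel_measurable borel" using u by (rule L2_measurable)
    have ui: "integrable lborel (\<lambda>x. (u x)\<^sup>2)" using u by (rule L2_integrable)
    have le: "\<bar>cutoff N x\<bar> \<le> 1" "\<bar>cutoff N x - 1\<bar> \<le> 1" for N x using cutoff_range[of N x] by auto
    have le2: "(cutoff N x * u x)\<^sup>2 \<le> (u x)\<^sup>2" "(cutoff N x * u x - u x)\<^sup>2 \<le> (u x)\<^sup>2" for N x
    proof -
      have "\<bar>cutoff N x * u x\<bar> \<le> \<bar>u x\<bar>" using mult_right_mono[OF le(1)[of N x], of "\<bar>u x\<bar>"] by (simp add: abs_mult)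
      then show "(cutoff N x * u x)\<^sup>2 \<le> (u x)\<^sup>2" by (simp add: abs_le_square_iff)
      have "\<bar>(cutoff N x - 1) * u x\<bar> \<le> \<bar>u x\<bar>" using mult_right_mono[OF le(2)[of N x], of "\<bar>u x\<bar>"] by (simp add: abs_mult)
      then show "(cutoff N x * u x - u x)\<^sup>2 \<le> (u x)\<^sup>2" by (simp add: abs_le_square_iff left_diff_distrib)
    qed
    show "L2 (\<lambda>x. cutoff N x * u x)"
      unfolding L2_def by (auto intro!: Bochner_Integration.integrable_bound[OF ui] le2)
    have "(\<lambda>N. \<integral>x. (cutoff N x * u x - u x)\<^sup>2 \<partial>lborel) \<longlonglongrightarrow> (\<integral>x. 0 \<partial>(lborel::real measure))"
    proof (rule integral_dominated_convergence[where w="\<lambda>x. (u x)\<^sup>2"])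
      show "AE x in lborel. (\<lambda>N. (cutoff N x * u x - u x)\<^sup>2) \<longlonglongrightarrow> 0"
      proof (rule AE_I2)
        fix x
        have "\<forall>\<^sub>F N in sequentially. 0 = (cutoff N x * u x - u x)\<^sup>2"
          using cutoff_eventually_1[of x] by eventually_elim simp
        then show "(\<lambda>N. (cutoff N x * u x - u x)\<^sup>2) \<longlonglongrightarrow> 0" by (rule Lim_transform_eventually[OF tendsto_const])
      qed
    qed (use ui le2 in auto)
    then have "(\<lambda>N. sqrt (\<integral>x. (cutoff N x * u x - u x)\<^sup>2 \<partial>lborel)) \<longlonglongrightarrow> sqrt 0" by (intro tendsto_intros) simp
    then show "(\<lambda>N. l2norm (\<lambda>x. cutoff N x * u x - u x)) \<longlonglongrightarrow> 0" by (simp add: l2norm_def)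
  qed
  define h where "h = (\<lambda>N x. cutoff N x * g x + deriv (cutoff N) x * F x)"
  have h_ac: "abs_cont (\<lambda>x. cutoff N x * F x) (h N)" for N
    unfolding h_def by (rule abs_cont_mult[OF abs_cont_smooth[OF cutoff_smooth] F(1)])
  have dL2: "L2 (\<lambda>x. deriv (cutoff N) x * F x)" and d_le: "l2norm (\<lambda>x. deriv (cutoff N) x * F x) \<le> K / real (Suc N) * l2norm F" for N
  proof -
    define B where "B = K / real (Suc N)"
    have B: "B > 0" using K(1) by (simp add: B_def)
    have i: "integrable lborel (\<lambda>x. (B * F x)\<^sup>2)" using L2_cmult[OF F(2)] by (rule L2_integrable)
    have le: "(deriv (cutoff N) x * F x)\<^sup>2 \<le> (B * F x)\<^sup>2" for x
    proof -
      have "\<bar>deriv (cutoff N) x * F x\<bar> \<le> \<bar>B * F x\<bar>"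
        unfolding abs_mult using order_trans[OF K(2)[of N x, folded B_def] abs_ge_self] by (rule mult_right_mono) simp
      then show ?thesis by (simp add: abs_le_square_iff)
    qed
    show L: "L2 (\<lambda>x. deriv (cutoff N) x * F x)"
      unfolding L2_def by (auto intro!: Bochner_Integration.integrable_bound[OF i] le)
    have "l2norm (\<lambda>x. deriv (cutoff N) x * F x) \<le> l2norm (\<lambda>x. B * F x)"
      unfolding l2norm_def by (intro real_sqrt_le_mono integral_mono i L2_integrable[OF L] le)
    then show "l2norm (\<lambda>x. deriv (cutoff N) x * F x) \<le> K / real (Suc N) * l2norm F"
      using B unfolding B_def[symmetric] by (simp add: l2norm_cmult)
  qed
  have hL2: "L2 (h N)" for N unfolding h_def by (intro L2_add cutL2 dL2 F)
  have "(\<lambda>N. l2norm (\<lambda>x. cutoff N x * g x - g x) + K / real (Suc N) * l2norm F) \<longlonglongrightarrow> 0 + 0 * l2norm F"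
    by (intro tendsto_intros cut0 F LIMSEQ_Suc[OF lim_const_over_n])
  then have lim: "(\<lambda>N. l2norm (\<lambda>x. cutoff N x * g x - g x) + K / real (Suc N) * l2norm F) \<longlonglongrightarrow> 0" by simp
  have "\<forall>\<^sub>F N in sequentially. l2norm (\<lambda>x. cutoff N x * F x - F x) < e / 2"
    using order_tendstoD(2)[OF cut0[OF F(2)], of "e/2"] e by simp
  moreover have "\<forall>\<^sub>F N in sequentially. l2norm (\<lambda>x. cutoff N x * g x - g x) + K / real (Suc N) * l2norm F < e / 2"
    using order_tendstoD(2)[OF lim, of "e/2"] e by simp
  ultimately have "\<forall>\<^sub>F N in sequentially. l2norm (\<lambda>x. cutoff N x * F x - F x) < e / 2 \<and>
      l2norm (\<lambda>x. cutoff N x * g x - g x) + K / real (Suc N) * l2norm F < e / 2" by eventually_elim simp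
  then obtain N where N: "l2norm (\<lambda>x. cutoff N x * F x - F x) < e / 2"
      "l2norm (\<lambda>x. cutoff N x * g x - g x) + K / real (Suc N) * l2norm F < e / 2"
    by (auto simp: eventually_sequentially)
  have N2: "l2norm (\<lambda>x. h N x - g x) < e / 2"
  proof -
    have "l2norm (\<lambda>x. (cutoff N x * g x - g x) + deriv (cutoff N) x * F x)
      \<le> l2norm (\<lambda>x. cutoff N x * g x - g x) + l2norm (\<lambda>x. deriv (cutoff N) x * F x)"
      by (intro l2norm_triangle L2_diff cutL2 dL2 F)
    also have "(\<lambda>x. (cutoff N x * g x - g x) + deriv (cutoff N) x * F x) = (\<lambda>x. h N x - g x)"
      by (auto simp: h_def)
    finally show ?thesis using N(2) d_le[of N] by linarith
  qed
  define R where "R = 2 * real (Suc N)"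
  have supp: "cutoff N x * F x = 0" if "R \<le> \<bar>x\<bar>" for x using cutoff_0[of N x] that by (simp add: R_def)
  have supp': "h N x = 0" if x: "R < \<bar>x\<bar>" for x
  proof -
    have "open {x. R < \<bar>x\<bar>}" by (intro open_Collect_less continuous_intros)
    then have "\<forall>\<^sub>F y in nhds x. cutoff N y = 0"
      by (rule eventually_mono[OF eventually_nhds_in_open]) (use x in \<open>auto simp: R_def intro!: cutoff_0\<close>)
    then have "(cutoff N has_real_derivative 0) (at x)" by (simp add: DERIV_cong_ev[OF refl _ refl])
    then have "deriv (cutoff N) x = 0" by (rule DERIV_imp_deriv)
    moreover have "cutoff N x = 0" using x by (intro cutoff_0) (simp add: R_def)
    ultimately show ?thesis by (simp add: h_def)
  qed
  have R0: "R \<ge> 0" by (simp add: R_def)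
  obtain \<phi> :: "nat \<Rightarrow> real \<Rightarrow> real" and c where \<phi>: "\<And>n. test_function (\<phi> n)"
    "\<And>n x. R + 1 \<le> \<bar>x\<bar> \<Longrightarrow> \<phi> n x = 0"
    "(\<lambda>n. l2norm (\<lambda>x. deriv (\<phi> n) x - h N x)) \<longlonglongrightarrow> 0"
    "\<And>n x. \<bar>\<phi> n x - cutoff N x * F x\<bar> \<le> c n" "c \<longlonglongrightarrow> 0"
    by (rule compact_support_approx[OF h_ac[of N] hL2[of N] R0 supp supp']) (assumption+, rule that)
  have I: "L2 (indicator {-(R+1)..R+1})"
    using L2_loc_indicator[OF L2_loc_continuous[of "\<lambda>x. 1"], of "-(R+1)" "R+1"] by simp
  have l2: "l2norm (\<lambda>x. \<phi> n x - cutoff N x * F x) \<le> c n * l2norm (indicator {-(R+1)..R+1})" for n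
  proof -
    have c: "c n \<ge> 0" using \<phi>(4)[of n 0] by linarith
    have "l2norm (\<lambda>x. \<phi> n x - cutoff N x * F x) \<le> l2norm (\<lambda>x. c n * indicator {-(R+1)..R+1} x)"
      unfolding l2norm_def
    proof (intro real_sqrt_le_mono integral_mono L2_integrable)
      show "L2 (\<lambda>x. \<phi> n x - cutoff N x * F x)" by (rule L2_diff[OF test_L2[OF \<phi>(1)] cutL2[OF F(2)]])
      show "L2 (\<lambda>x. c n * indicator {-(R+1)..R+1} x)" by (rule L2_cmult[OF I])
      fix x
      have "\<bar>\<phi> n x - cutoff N x * F x\<bar> \<le> \<bar>c n * indicator {-(R+1)..R+1} x\<bar>"
      proof (cases "R + 1 \<le> \<bar>x\<bar>")
        case True
        then have "\<phi> n x = 0" "cutoff N x * F x = 0" using \<phi>(2)[of x n] supp[of x] by auto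
        then show ?thesis by (simp only: diff_self abs_zero abs_ge_zero)
      next
        case False then show ?thesis using \<phi>(4)[of n x] c by (auto simp: indicator_def abs_if split: if_splits)
      qed
      then show "(\<phi> n x - cutoff N x * F x)\<^sup>2 \<le> (c n * indicator {-(R+1)..R+1} x)\<^sup>2" by (simp add: abs_le_square_iff)
    qed
    then show ?thesis using c by (simp add: l2norm_cmult)
  qed
  have "(\<lambda>n. c n * l2norm (indicator {-(R+1)..R+1})) \<longlonglongrightarrow> 0"
    using tendsto_mult_right[OF \<phi>(5), of "l2norm (indicator {-(R+1)..R+1})"] by simp
  from order_tendstoD(2)[OF this, of "e/2"] order_tendstoD(2)[OF \<phi>(3), of "e/2"] e
  have "\<forall>\<^sub>F n in sequentially. c n * l2norm (indicator {-(R+1)..R+1}) < e/2"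
     "\<forall>\<^sub>F n in sequentially. l2norm (\<lambda>x. deriv (\<phi> n) x - h N x) < e/2" by auto
  then have "\<forall>\<^sub>F n in sequentially. c n * l2norm (indicator {-(R+1)..R+1}) < e/2 \<and> l2norm (\<lambda>x. deriv (\<phi> n) x - h N x) < e/2"
    by eventually_elim simp
  then obtain n where n: "c n * l2norm (indicator {-(R+1)..R+1}) < e/2" "l2norm (\<lambda>x. deriv (\<phi> n) x - h N x) < e/2"
    by (auto simp: eventually_sequentially)
  show thesis
  proof
    show "test_function (\<phi> n)" by (rule \<phi>)
    show "l2norm (\<lambda>x. \<phi> n x - F x) < e"
      using l2norm_diff_triangle[OF test_L2[OF \<phi>(1)] cutL2[OF F(2)] F(2), of n N] l2[of n] n(1) N(1) by linarith
    show "l2norm (\<lambda>x. deriv (\<phi> n) x - g x) < e"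
      using l2norm_diff_triangle[OF test_L2[OF test_function_deriv[OF \<phi>(1)]] hL2 F(3), of n N] n(2) N2 by linarith
  qed
qed

lemma H1_norm_diff_test_le:
  assumes f: "H1 f" and F: "H1_pair F (weak_deriv f)" "AE x in lborel. f x = F x" and \<phi>: "test_function \<phi>"
  shows "H1_norm (\<lambda>x. \<phi> x - f x) \<le> l2norm (\<lambda>x. \<phi> x - F x) + l2norm (\<lambda>x. deriv \<phi> x - weak_deriv f x)"
proof -
  have meas: "\<phi> \<in> borel_measurable borel" "f \<in> borel_measurable borel" "F \<in> borel_measurable borel"
    "deriv \<phi> \<in> borel_measurable borel" "weak_deriv f \<in> borel_measurable borel"
    "weak_deriv \<phi> \<in> borel_measurable borel"
    using f F \<phi> by (auto intro: test_measurable test_function_deriv L2_measurable H1_L2 weak_deriv_props H1_test dest: H1_pairD)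
  note [measurable] = meas
  have "l2norm (\<lambda>x. \<phi> x - f x) = l2norm (\<lambda>x. \<phi> x - F x)"
    by (rule l2norm_cong_AE) (use F(2) in auto)
  moreover have "l2norm (weak_deriv (\<lambda>x. \<phi> x - f x)) = l2norm (\<lambda>x. weak_deriv \<phi> x - weak_deriv f x)"
    by (rule l2norm_weak_deriv_diff[OF H1_test[OF \<phi>] f])
  moreover have "\<dots> = l2norm (\<lambda>x. deriv \<phi> x - weak_deriv f x)"
    by (rule l2norm_cong_AE) (use weak_deriv_test[OF \<phi>] in auto)
  ultimately show ?thesis using H1_norm_le[of "\<lambda>x. \<phi> x - f x"] by simp
qed

theorem H1_dense:
  assumes f: "H1 f"
  obtains \<phi> where "\<And>n. test_function (\<phi> n)" "(\<lambda>n. H1_norm (\<lambda>x. \<phi> n x - f x)) \<longlonglongrightarrow> 0"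
proof -
  obtain F where F: "H1_pair F (weak_deriv f)" "AE x in lborel. f x = F x" by (rule H1_representative[OF f])
  have "\<exists>\<phi>. test_function \<phi> \<and> H1_norm (\<lambda>x. \<phi> x - f x) < 2 / real (Suc n)" for n
  proof -
    obtain \<phi> where \<phi>: "test_function \<phi>" "l2norm (\<lambda>x. \<phi> x - F x) < 1 / real (Suc n)"
      "l2norm (\<lambda>x. deriv \<phi> x - weak_deriv f x) < 1 / real (Suc n)"
      by (rule H1_pair_approx[OF F(1), of "1 / real (Suc n)"]) auto
    have "2 / real (Suc n) = 1 / real (Suc n) + 1 / real (Suc n)" by (simp add: field_simps)
    then show ?thesis using H1_norm_diff_test_le[OF f F \<phi>(1)] \<phi> by (intro exI[of _ \<phi>]) linarith
  qed
  then obtain \<phi> where \<phi>: "\<And>n. test_function (\<phi> n)" "\<And>n. H1_norm (\<lambda>x. \<phi> n x - f x) < 2 / real (Suc n)" by metis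
  have "(\<lambda>n. H1_norm (\<lambda>x. \<phi> n x - f x)) \<longlonglongrightarrow> 0"
    by (rule Lim_null_comparison[OF always_eventually[OF allI] LIMSEQ_Suc[OF lim_const_over_n[of 2]]])
       (use \<phi>(2) in \<open>auto intro: less_imp_le\<close>)
  with \<phi>(1) show thesis by (rule that)
qed

section \<open>\<open>H\<^sup>1\<close> is an algebra\<close>

text \<open>Between two points \<open>F\<^sup>2\<close> changes by at most the integral of \<open>2 \<bar>F g\<bar>\<close>, hence by at most the square of the
norm.  If \<open>F\<^sup>2\<close> exceeded this bound at a point, it would stay above a positive constant on a half
line.\<close>

lemma H1_pair_sup:
  assumes FG: "H1_pair F g"
  shows "\<bar>F x\<bar> \<le> sqrt ((l2norm F)\<^sup>2 + (l2norm g)\<^sup>2)"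
proof (rule ccontr)
  note F = H1_pairD[OF FG]
  define S where "S = (l2norm F)\<^sup>2 + (l2norm g)\<^sup>2"
  assume "\<not> \<bar>F x\<bar> \<le> sqrt ((l2norm F)\<^sup>2 + (l2norm g)\<^sup>2)"
  then have "sqrt S < \<bar>F x\<bar>" by (simp add: S_def)
  moreover have "0 \<le> S" by (simp add: S_def)
  ultimately have "S < \<bar>F x\<bar>\<^sup>2" by (metis abs_of_nonneg power_strict_mono real_sqrt_abs real_sqrt_ge_zero real_sqrt_pow2 zero_less_numeral)
  then have gt: "S < (F x)\<^sup>2" by simp
  define e where "e = (F x)\<^sup>2 - S"
  have e: "e > 0" using gt by (simp add: e_def)
  have Fi: "integrable lborel (\<lambda>x. (F x)\<^sup>2)" "integrable lborel (\<lambda>x. (g x)\<^sup>2)" using F by (auto intro: L2_integrable)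
  have ge: "e \<le> (F y)\<^sup>2" if "y \<le> x" for y
  proof -
    have "(F x)\<^sup>2 - (F y)\<^sup>2 = (LBINT t:{y..x}. 2 * F t * g t)"
      by (rule abs_contD(2)[OF abs_cont_square[OF F(1)] that])
    also have "\<dots> \<le> (\<integral>t. (F t)\<^sup>2 + (g t)\<^sup>2 \<partial>lborel)"
      unfolding set_lebesgue_integral_def
    proof (rule integral_mono)
      show "integrable lborel (\<lambda>t. indicator {y..x} t *\<^sub>R (2 * F t * g t))"
        using loc_integrableD[OF abs_contD(1)[OF abs_cont_square[OF F(1)]]] by (simp add: set_integrable_def)
      show "indicator {y..x} t *\<^sub>R (2 * F t * g t) \<le> (F t)\<^sup>2 + (g t)\<^sup>2" for t
        using sum_squares_bound[of "F t" "g t"] by (auto simp: indicator_def)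
    qed (use Fi in auto)
    also have "\<dots> = S" using Fi by (simp add: S_def l2norm_power2)
    finally show ?thesis by (simp add: e_def)
  qed
  obtain n :: nat where n: "S / e < real n" using reals_Archimedean2 by blast
  have "real n * e = (\<integral>t. e * indicator {x - real n..x} t \<partial>lborel)" by simp
  also have "\<dots> \<le> (\<integral>t. (F t)\<^sup>2 \<partial>lborel)"
    by (rule integral_mono[OF integrable_mult_right[OF integrable_indicator_Icc] Fi(1)])
       (use ge in \<open>auto simp: indicator_def\<close>)
  also have "\<dots> \<le> S" by (simp add: S_def l2norm_power2)
  finally show False using n e by (simp add: field_simps)
qed

lemma L2_bounded_mult:
  assumes f: "f \<in> borel_measurable borel" "\<And>x. \<bar>f x\<bar> \<le> B" and g: "L2 g"
  shows "L2 (\<lambda>x. f x * g x)" "l2norm (\<lambda>x. f x * g x) \<le> B * l2norm g"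
proof -
  note [measurable] = f(1) L2_measurable[OF g]
  have B: "0 \<le> B" using f(2)[of 0] by linarith
  have i: "integrable lborel (\<lambda>x. (B * g x)\<^sup>2)" using L2_cmult[OF g] by (rule L2_integrable)
  have le: "(f x * g x)\<^sup>2 \<le> (B * g x)\<^sup>2" for x
  proof -
    have "\<bar>f x * g x\<bar> \<le> \<bar>B * g x\<bar>"
      unfolding abs_mult using f(2)[of x] B by (intro mult_right_mono) auto
    then show ?thesis by (simp add: abs_le_square_iff)
  qed
  show L: "L2 (\<lambda>x. f x * g x)"
    unfolding L2_def by (auto intro!: Bochner_Integration.integrable_bound[OF i] le)
  have "l2norm (\<lambda>x. f x * g x) \<le> l2norm (\<lambda>x. B * g x)"
    unfolding l2norm_def by (intro real_sqrt_le_mono integral_mono i L2_integrable[OF L] le)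
  then show "l2norm (\<lambda>x. f x * g x) \<le> B * l2norm g" using B by (simp add: l2norm_cmult)
qed

lemma H1_pair_mult:
  assumes F: "H1_pair F g" and G: "H1_pair G h"
  defines "A \<equiv> sqrt ((l2norm F)\<^sup>2 + (l2norm g)\<^sup>2)" and "B \<equiv> sqrt ((l2norm G)\<^sup>2 + (l2norm h)\<^sup>2)"
  shows "H1_pair (\<lambda>x. F x * G x) (\<lambda>x. F x * h x + g x * G x)"
    and "sqrt ((l2norm (\<lambda>x. F x * G x))\<^sup>2 + (l2norm (\<lambda>x. F x * h x + g x * G x))\<^sup>2) \<le> 3 * A * B"
proof -
  have m: "F \<in> borel_measurable borel" "G \<in> borel_measurable borel"
    using F G by (auto dest: H1_pairD intro: L2_measurable)
  have sF: "\<bar>F x\<bar> \<le> A" and sG: "\<bar>G x\<bar> \<le> B" for x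
    unfolding A_def B_def by (rule H1_pair_sup[OF F] H1_pair_sup[OF G])+
  note L = L2_bounded_mult[OF m(1) sF]
  note L' = L2_bounded_mult[OF m(2) sG]
  have 1: "L2 (\<lambda>x. F x * G x)" "l2norm (\<lambda>x. F x * G x) \<le> A * l2norm G" using L H1_pairD(2)[OF G] by auto
  have 2: "L2 (\<lambda>x. F x * h x)" "l2norm (\<lambda>x. F x * h x) \<le> A * l2norm h" using L H1_pairD(3)[OF G] by auto
  have 3: "L2 (\<lambda>x. g x * G x)" "l2norm (\<lambda>x. g x * G x) \<le> B * l2norm g"
    using L'[OF H1_pairD(3)[OF F]] by (auto simp: mult.commute)
  show "H1_pair (\<lambda>x. F x * G x) (\<lambda>x. F x * h x + g x * G x)"
    using 1 2 3 by (auto simp: H1_pair_def intro!: abs_cont_mult L2_add H1_pairD(1)[OF F] H1_pairD(1)[OF G])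
  have nn: "0 \<le> A" "0 \<le> B" by (auto simp: A_def B_def)
  have le: "l2norm G \<le> B" "l2norm h \<le> B" "l2norm g \<le> A"
    by (auto simp: A_def B_def intro!: real_le_rsqrt)
  have "l2norm (\<lambda>x. F x * G x) \<le> A * B" using 1(2) mult_left_mono[OF le(1) nn(1)] by linarith
  moreover have "l2norm (\<lambda>x. F x * h x + g x * G x) \<le> A * B + B * A"
    using l2norm_triangle[OF 2(1) 3(1)] 2(2) 3(2) mult_left_mono[OF le(2) nn(1)] mult_left_mono[OF le(3) nn(2)] by linarith
  moreover have "sqrt ((l2norm (\<lambda>x. F x * G x))\<^sup>2 + (l2norm (\<lambda>x. F x * h x + g x * G x))\<^sup>2)
     \<le> l2norm (\<lambda>x. F x * G x) + l2norm (\<lambda>x. F x * h x + g x * G x)" by (rule sqrt_sum_squares_le_sum) auto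
  moreover have "A * B + (A * B + B * A) = 3 * A * B" by (simp add: algebra_simps)
  ultimately show "sqrt ((l2norm (\<lambda>x. F x * G x))\<^sup>2 + (l2norm (\<lambda>x. F x * h x + g x * G x))\<^sup>2) \<le> 3 * A * B"
    by linarith
qed

text \<open>The pairing in the quadratic form is evaluated at products of \<open>H\<^sup>1\<close> functions, which must therefore
lie in \<open>H\<^sup>1\<close> and depend continuously on the factors.\<close>

lemma H1_mult: "H1 f \<Longrightarrow> H1 h \<Longrightarrow> H1 (\<lambda>x. f x * h x)"
  and H1_norm_mult: "H1 f \<Longrightarrow> H1 h \<Longrightarrow> H1_norm (\<lambda>x. f x * h x) \<le> 3 * H1_norm f * H1_norm h"
proof -
  have "H1 (\<lambda>x. f x * h x) \<and> H1_norm (\<lambda>x. f x * h x) \<le> 3 * H1_norm f * H1_norm h" if f: "H1 f" and h: "H1 h"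
  proof -
    obtain F where F: "H1_pair F (weak_deriv f)" "AE x in lborel. f x = F x" by (rule H1_representative[OF f])
    obtain H where H: "H1_pair H (weak_deriv h)" "AE x in lborel. h x = H x" by (rule H1_representative[OF h])
    have m: "f \<in> borel_measurable borel" "h \<in> borel_measurable borel" using f h by (auto intro: L2_measurable H1_L2)
    then have m2: "(\<lambda>x. f x * h x) \<in> borel_measurable borel" by simp
    have ae: "AE x in lborel. f x * h x = F x * H x" using F(2) H(2) by eventually_elim simp
    show ?thesis
      using H1_I(1)[OF H1_pair_mult(1)[OF F(1) H(1)] m2 ae] H1_pair_norm[OF H1_pair_mult(1)[OF F(1) H(1)] m2 ae]
        H1_pair_mult(2)[OF F(1) H(1)] H1_pair_norm[OF F(1) m(1) F(2)] H1_pair_norm[OF H(1) m(2) H(2)] by simp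
  qed
  then show "H1 f \<Longrightarrow> H1 h \<Longrightarrow> H1 (\<lambda>x. f x * h x)"
    "H1 f \<Longrightarrow> H1 h \<Longrightarrow> H1_norm (\<lambda>x. f x * h x) \<le> 3 * H1_norm f * H1_norm h" by blast+
qed

section \<open>The duality pairing and the quadratic form\<close>

text \<open>Linearity and continuity on test functions in the norm of \<open>H\<^sup>1\<close>: under these conditions the
limit that defines \<open>pairing\<close> exists and is unique.\<close>

definition H1_bounded :: "distribution \<Rightarrow> bool" where
  "H1_bounded T \<longleftrightarrow>
     (\<forall>\<phi> \<theta> c. test_function \<phi> \<longrightarrow> test_function \<theta> \<longrightarrow> T (\<lambda>x. \<phi> x + c * \<theta> x) = T \<phi> + c * T \<theta>) \<and>
     (\<exists>K. \<forall>\<phi>. test_function \<phi> \<longrightarrow> \<bar>T \<phi>\<bar> \<le> K * H1_norm \<phi>)"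

lemma H1_boundedE:
  assumes "H1_bounded T"
  obtains K where "K \<ge> 0" "\<And>\<phi>. test_function \<phi> \<Longrightarrow> \<bar>T \<phi>\<bar> \<le> K * H1_norm \<phi>"
proof -
  obtain K where K: "\<And>\<phi>. test_function \<phi> \<Longrightarrow> \<bar>T \<phi>\<bar> \<le> K * H1_norm \<phi>"
    using assms by (auto simp: H1_bounded_def)
  show thesis
    by (rule that[of "\<bar>K\<bar>"]) (auto intro!: order_trans[OF K] mult_right_mono)
qed

lemma H1_bounded_lincomb:
  "H1_bounded T \<Longrightarrow> test_function \<phi> \<Longrightarrow> test_function \<theta> \<Longrightarrow> T (\<lambda>x. \<phi> x + c * \<theta> x) = T \<phi> + c * T \<theta>"
  unfolding H1_bounded_def by blast

lemma H1_norm_diff_triangle: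
  assumes "H1 f" "H1 g" "H1 h"
  shows "H1_norm (\<lambda>x. f x - g x) \<le> H1_norm (\<lambda>x. f x - h x) + H1_norm (\<lambda>x. g x - h x)"
proof -
  have "H1_norm (\<lambda>x. (f x - h x) + (h x - g x)) \<le> H1_norm (\<lambda>x. f x - h x) + H1_norm (\<lambda>x. h x - g x)"
    by (intro H1_norm_triangle H1_diff assms)
  then show ?thesis using H1_norm_minus_commute[OF assms(2,3)] by simp
qed

lemma pairing_tendsto:
  assumes T: "H1_bounded T" and h: "H1 h"
    and \<phi>: "\<And>n. test_function (\<phi> n)" "(\<lambda>n. H1_norm (\<lambda>x. \<phi> n x - h x)) \<longlonglongrightarrow> 0"
  shows "(\<lambda>n. T (\<phi> n)) \<longlonglongrightarrow> pairing T h"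
proof -
  obtain K where K: "K \<ge> 0" "\<And>\<phi>. test_function \<phi> \<Longrightarrow> \<bar>T \<phi>\<bar> \<le> K * H1_norm \<phi>" using H1_boundedE[OF T] by metis
  have diff: "\<bar>T u - T v\<bar> \<le> K * (H1_norm (\<lambda>x. u x - h x) + H1_norm (\<lambda>x. v x - h x))"
    if u: "test_function u" and v: "test_function v" for u v
  proof -
    have "T u - T v = T (\<lambda>x. u x + (-1) * v x)" using H1_bounded_lincomb[OF T u v, of "-1"] by simp
    also have "\<bar>\<dots>\<bar> \<le> K * H1_norm (\<lambda>x. u x + (-1) * v x)"
      by (intro K test_function_add test_function_cmult u v)
    also have "\<dots> \<le> K * (H1_norm (\<lambda>x. u x - h x) + H1_norm (\<lambda>x. v x - h x))"
      using H1_norm_diff_triangle[OF H1_test[OF u] H1_test[OF v] h] K(1) by (intro mult_left_mono) auto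
    finally show ?thesis .
  qed
  define a where "a = (\<lambda>n. H1_norm (\<lambda>x. \<phi> n x - h x))"
  have "Cauchy (\<lambda>n. T (\<phi> n))"
  proof (rule metric_CauchyI)
    fix e :: real assume e: "e > 0"
    have "(\<lambda>n. K * a n) \<longlonglongrightarrow> K * 0" unfolding a_def by (intro tendsto_intros \<phi>)
    then have "\<forall>\<^sub>F n in sequentially. K * a n < e / 2" using e by (intro order_tendstoD(2)) auto
    then obtain M where M: "\<And>n. n \<ge> M \<Longrightarrow> K * a n < e / 2" by (auto simp: eventually_sequentially)
    show "\<exists>M. \<forall>m\<ge>M. \<forall>n\<ge>M. dist (T (\<phi> m)) (T (\<phi> n)) < e"
    proof (intro exI[of _ M] allI impI)
      fix m n assume "m \<ge> M" "n \<ge> M"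
      then show "dist (T (\<phi> m)) (T (\<phi> n)) < e"
        using diff[OF \<phi>(1)[of m] \<phi>(1)[of n]] M[of m] M[of n] by (simp add: dist_real_def a_def distrib_left)
    qed
  qed
  then obtain l where l: "(\<lambda>n. T (\<phi> n)) \<longlonglongrightarrow> l" using real_Cauchy_convergent convergent_def by blast
  have all: "(\<lambda>n. T (\<theta> n)) \<longlonglongrightarrow> l" if \<theta>: "\<And>n. test_function (\<theta> n)" "(\<lambda>n. H1_norm (\<lambda>x. \<theta> n x - h x)) \<longlonglongrightarrow> 0" for \<theta>
  proof -
    have "(\<lambda>n. K * (H1_norm (\<lambda>x. \<theta> n x - h x) + H1_norm (\<lambda>x. \<phi> n x - h x))) \<longlonglongrightarrow> K * (0 + 0)"
      by (intro tendsto_intros \<theta> \<phi>)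
    then have "(\<lambda>n. K * (H1_norm (\<lambda>x. \<theta> n x - h x) + H1_norm (\<lambda>x. \<phi> n x - h x))) \<longlonglongrightarrow> 0" by simp
    then have "(\<lambda>n. T (\<theta> n) - T (\<phi> n)) \<longlonglongrightarrow> 0"
      by (rule Lim_null_comparison[rotated]) (use diff[OF \<theta>(1) \<phi>(1)] in auto)
    from tendsto_add[OF this l] show ?thesis by simp
  qed
  have "pairing T h = l"
    unfolding pairing_def
  proof (rule the_equality)
    fix l' assume "\<forall>\<phi>. (\<forall>n. test_function (\<phi> n)) \<and> (\<lambda>n. H1_norm (\<lambda>x. \<phi> n x - h x)) \<longlonglongrightarrow> 0 \<longrightarrow> (\<lambda>n. T (\<phi> n)) \<longlonglongrightarrow> l'"
    then have "(\<lambda>n. T (\<phi> n)) \<longlonglongrightarrow> l'" using \<phi> by blast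
    then show "l' = l" using l LIMSEQ_unique by blast
  qed (use all in blast)
  then show ?thesis using l by simp
qed

lemma pairing_test: 
  assumes T: "H1_bounded T" and \<phi>: "test_function \<phi>" shows "pairing T \<phi> = T \<phi>"
proof -
  have "H1_pair (\<lambda>x. 0 * \<phi> x) (\<lambda>x. 0 * deriv \<phi> x)" by (rule H1_pair_cmult[OF H1_pair_test[OF \<phi>]])
  from H1_pair_norm[OF this, of "\<lambda>x. \<phi> x - \<phi> x"] have "H1_norm (\<lambda>x. \<phi> x - \<phi> x) = 0" by (simp add: l2norm_def)
  then have "(\<lambda>n::nat. T \<phi>) \<longlonglongrightarrow> pairing T \<phi>"
    by (intro pairing_tendsto[OF T H1_test[OF \<phi>] \<phi>]) simp
  then show ?thesis by (simp add: LIMSEQ_const_iff)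
qed

lemma H1_norm_cmult: assumes "H1 f" shows "H1_norm (\<lambda>x. c * f x) = \<bar>c\<bar> * H1_norm f"
proof -
  have "l2norm (weak_deriv (\<lambda>x. c * f x)) = l2norm (\<lambda>x. c * weak_deriv f x)"
    by (rule l2norm_cong_AE[OF _ _ weak_deriv_cmult[OF assms]])
       (use assms in \<open>auto intro!: L2_measurable L2_cmult weak_deriv_props(1) H1_cmult\<close>)
  then show ?thesis
    by (simp add: H1_norm_def l2norm_cmult power_mult_distrib real_sqrt_mult flip: distrib_left)
qed

lemma pairing_lincomb:
  assumes T: "H1_bounded T" and h: "H1 h" and k: "H1 k"
  shows "pairing T (\<lambda>x. h x + c * k x) = pairing T h + c * pairing T k"
proof -
  obtain \<phi> where \<phi>: "\<And>n. test_function (\<phi> n)" "(\<lambda>n. H1_norm (\<lambda>x. \<phi> n x - h x)) \<longlonglongrightarrow> 0" using H1_dense[OF h] by metis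
  obtain \<theta> where \<theta>: "\<And>n. test_function (\<theta> n)" "(\<lambda>n. H1_norm (\<lambda>x. \<theta> n x - k x)) \<longlonglongrightarrow> 0" using H1_dense[OF k] by metis
  have "(\<lambda>n. T (\<lambda>x. \<phi> n x + c * \<theta> n x)) \<longlonglongrightarrow> pairing T (\<lambda>x. h x + c * k x)"
  proof (rule pairing_tendsto[OF T])
    show "H1 (\<lambda>x. h x + c * k x)" by (intro H1_add H1_cmult h k)
    show "test_function (\<lambda>x. \<phi> n x + c * \<theta> n x)" for n by (intro test_function_add test_function_cmult \<phi> \<theta>)
    have le: "H1_norm (\<lambda>x. (\<phi> n x + c * \<theta> n x) - (h x + c * k x))
        \<le> H1_norm (\<lambda>x. \<phi> n x - h x) + \<bar>c\<bar> * H1_norm (\<lambda>x. \<theta> n x - k x)" for n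
    proof -
      have "H1_norm (\<lambda>x. (\<phi> n x - h x) + c * (\<theta> n x - k x))
        \<le> H1_norm (\<lambda>x. \<phi> n x - h x) + H1_norm (\<lambda>x. c * (\<theta> n x - k x))"
        by (intro H1_norm_triangle H1_diff H1_cmult H1_test \<phi> \<theta> h k)
      also have "H1_norm (\<lambda>x. c * (\<theta> n x - k x)) = \<bar>c\<bar> * H1_norm (\<lambda>x. \<theta> n x - k x)"
        by (intro H1_norm_cmult H1_diff H1_test \<theta> k)
      also have "(\<lambda>x. (\<phi> n x - h x) + c * (\<theta> n x - k x)) = (\<lambda>x. (\<phi> n x + c * \<theta> n x) - (h x + c * k x))"
        by (auto simp: algebra_simps)
      finally show ?thesis .
    qed
    have "(\<lambda>n. H1_norm (\<lambda>x. \<phi> n x - h x) + \<bar>c\<bar> * H1_norm (\<lambda>x. \<theta> n x - k x)) \<longlonglongrightarrow> 0 + \<bar>c\<bar> * 0"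
      by (intro tendsto_intros \<phi> \<theta>)
    then have "(\<lambda>n. H1_norm (\<lambda>x. \<phi> n x - h x) + \<bar>c\<bar> * H1_norm (\<lambda>x. \<theta> n x - k x)) \<longlonglongrightarrow> 0" by simp
    then show "(\<lambda>n. H1_norm (\<lambda>x. (\<phi> n x + c * \<theta> n x) - (h x + c * k x))) \<longlonglongrightarrow> 0"
      by (rule Lim_null_comparison[rotated]) (use le in auto)
  qed
  moreover have "(\<lambda>n. T (\<lambda>x. \<phi> n x + c * \<theta> n x)) \<longlonglongrightarrow> pairing T h + c * pairing T k"
    unfolding H1_bounded_lincomb[OF T \<phi>(1) \<theta>(1)]
    by (intro tendsto_intros pairing_tendsto[OF T h \<phi>] pairing_tendsto[OF T k \<theta>])
  ultimately show ?thesis by (rule LIMSEQ_unique)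
qed

lemma form_commute: "schroedinger_form T \<psi> \<phi> = schroedinger_form T \<phi> \<psi>"
  by (simp add: schroedinger_form_def mult.commute)

lemma form_lincomb:
  assumes T: "H1_bounded T" and f: "H1 f" and g: "H1 g" and h: "H1 h"
  shows "schroedinger_form T (\<lambda>x. f x + c * g x) h = schroedinger_form T f h + c * schroedinger_form T g h"
proof -
  have [measurable]: "weak_deriv f \<in> borel_measurable borel" "weak_deriv g \<in> borel_measurable borel"
     "weak_deriv h \<in> borel_measurable borel" "weak_deriv (\<lambda>x. f x + c * g x) \<in> borel_measurable borel"
    by (intro L2_measurable weak_deriv_props H1_add H1_cmult f g h)+
  have ae: "AE x in lborel. weak_deriv (\<lambda>x. f x + c * g x) x = weak_deriv f x + c * weak_deriv g x"
    using weak_deriv_add[OF f H1_cmult[OF g, of c]] weak_deriv_cmult[OF g, of c] by eventually_elim simp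
  have "(\<integral>x. weak_deriv (\<lambda>x. f x + c * g x) x * weak_deriv h x \<partial>lborel)
    = (\<integral>x. weak_deriv f x * weak_deriv h x + c * (weak_deriv g x * weak_deriv h x) \<partial>lborel)"
  proof (rule integral_cong_AE)
    show "AE x in lborel. weak_deriv (\<lambda>x. f x + c * g x) x * weak_deriv h x =
        weak_deriv f x * weak_deriv h x + c * (weak_deriv g x * weak_deriv h x)"
      using ae by eventually_elim (simp add: algebra_simps)
  qed auto
  also have "\<dots> = (\<integral>x. weak_deriv f x * weak_deriv h x \<partial>lborel) + c * (\<integral>x. weak_deriv g x * weak_deriv h x \<partial>lborel)"
    using L2_mult_integrable[OF weak_deriv_props(1)[OF f] weak_deriv_props(1)[OF h]]
      L2_mult_integrable[OF weak_deriv_props(1)[OF g] weak_deriv_props(1)[OF h]] by simp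
  finally have 1: "(\<integral>x. weak_deriv (\<lambda>x. f x + c * g x) x * weak_deriv h x \<partial>lborel) = \<dots>" .
  have "(\<lambda>x. (f x + c * g x) * h x) = (\<lambda>x. f x * h x + c * (g x * h x))" by (auto simp: algebra_simps)
  then have "pairing T (\<lambda>x. (f x + c * g x) * h x) = pairing T (\<lambda>x. f x * h x) + c * pairing T (\<lambda>x. g x * h x)"
    using pairing_lincomb[OF T H1_mult[OF f h] H1_mult[OF g h]] by simp
  with 1 show ?thesis by (simp add: schroedinger_form_def algebra_simps)
qed

text \<open>On test functions the form is given by the distribution itself; every lower bound that
  holds there passes to \<open>H\<^sup>1\<close> by density.\<close>

lemma form_ge_of_test_functions:
  assumes T: "H1_bounded T" and \<psi>: "H1 \<psi>"
    and ge: "\<And>\<phi>. test_function \<phi> \<Longrightarrow> (\<integral>x. (deriv \<phi> x)\<^sup>2 \<partial>lborel) + T (\<lambda>x. \<phi> x * \<phi> x) \<ge> c * (l2norm \<phi>)\<^sup>2"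
  shows "schroedinger_form T \<psi> \<psi> \<ge> c * (l2norm \<psi>)\<^sup>2"
proof -
  obtain \<phi> where \<phi>: "\<And>n. test_function (\<phi> n)" "(\<lambda>n. H1_norm (\<lambda>x. \<phi> n x - \<psi> x)) \<longlonglongrightarrow> 0" using H1_dense[OF \<psi>] by metis
  have L: "L2 (weak_deriv \<psi>)" "L2 \<psi>" using \<psi> by (auto intro: weak_deriv_props H1_L2)
  have l2: "(\<lambda>n. l2norm (\<lambda>x. \<phi> n x - \<psi> x)) \<longlonglongrightarrow> 0"
    by (rule Lim_null_comparison[OF _ \<phi>(2)]) (auto simp: l2norm_le_H1_norm)
  have d2: "(\<lambda>n. l2norm (\<lambda>x. deriv (\<phi> n) x - weak_deriv \<psi> x)) \<longlonglongrightarrow> 0"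
  proof (rule Lim_null_comparison[OF always_eventually[OF allI] \<phi>(2)])
    fix n
    have [measurable]: "deriv (\<phi> n) \<in> borel_measurable borel" "weak_deriv \<psi> \<in> borel_measurable borel"
        "weak_deriv (\<phi> n) \<in> borel_measurable borel"
      by (intro test_measurable test_function_deriv \<phi> L2_measurable weak_deriv_props \<psi> H1_test)+
    have "l2norm (\<lambda>x. deriv (\<phi> n) x - weak_deriv \<psi> x) = l2norm (\<lambda>x. weak_deriv (\<phi> n) x - weak_deriv \<psi> x)"
      by (rule l2norm_cong_AE) (use weak_deriv_test[OF \<phi>(1)[of n]] in auto)
    also have "\<dots> = l2norm (weak_deriv (\<lambda>x. \<phi> n x - \<psi> x))"
      by (rule l2norm_weak_deriv_diff[OF H1_test[OF \<phi>(1)] \<psi>, symmetric])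
    finally show "norm (l2norm (\<lambda>x. deriv (\<phi> n) x - weak_deriv \<psi> x)) \<le> H1_norm (\<lambda>x. \<phi> n x - \<psi> x)"
      by (simp add: l2norm_le_H1_norm)
  qed
  have sq: "(\<lambda>n. H1_norm (\<lambda>x. \<phi> n x * \<phi> n x - \<psi> x * \<psi> x)) \<longlonglongrightarrow> 0"
  proof (rule Lim_null_comparison[OF always_eventually[OF allI]])
    fix n
    have d: "H1 (\<lambda>x. \<phi> n x - \<psi> x)" by (intro H1_diff H1_test \<phi> \<psi>)
    have "H1_norm (\<lambda>x. (\<phi> n x - \<psi> x) * (\<phi> n x - \<psi> x) + 2 * ((\<phi> n x - \<psi> x) * \<psi> x))
       \<le> H1_norm (\<lambda>x. (\<phi> n x - \<psi> x) * (\<phi> n x - \<psi> x)) + H1_norm (\<lambda>x. 2 * ((\<phi> n x - \<psi> x) * \<psi> x))"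
      by (intro H1_norm_triangle H1_mult H1_cmult d \<psi>)
    also have "\<dots> \<le> 3 * H1_norm (\<lambda>x. \<phi> n x - \<psi> x) * H1_norm (\<lambda>x. \<phi> n x - \<psi> x)
        + 2 * (3 * H1_norm (\<lambda>x. \<phi> n x - \<psi> x) * H1_norm \<psi>)"
      unfolding H1_norm_cmult[OF H1_mult[OF d \<psi>]]
      using H1_norm_mult[OF d d] H1_norm_mult[OF d \<psi>] by simp
    also have "(\<lambda>x. (\<phi> n x - \<psi> x) * (\<phi> n x - \<psi> x) + 2 * ((\<phi> n x - \<psi> x) * \<psi> x)) = (\<lambda>x. \<phi> n x * \<phi> n x - \<psi> x * \<psi> x)"
      by (auto simp: algebra_simps)
    finally show "norm (H1_norm (\<lambda>x. \<phi> n x * \<phi> n x - \<psi> x * \<psi> x)) \<le>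
      3 * H1_norm (\<lambda>x. \<phi> n x - \<psi> x) * H1_norm (\<lambda>x. \<phi> n x - \<psi> x)
        + 2 * (3 * H1_norm (\<lambda>x. \<phi> n x - \<psi> x) * H1_norm \<psi>)" by simp
  next
    have "(\<lambda>n. 3 * H1_norm (\<lambda>x. \<phi> n x - \<psi> x) * H1_norm (\<lambda>x. \<phi> n x - \<psi> x)
        + 2 * (3 * H1_norm (\<lambda>x. \<phi> n x - \<psi> x) * H1_norm \<psi>)) \<longlonglongrightarrow> 3 * 0 * 0 + 2 * (3 * 0 * H1_norm \<psi>)"
      by (intro tendsto_intros \<phi>)
    then show "(\<lambda>n. 3 * H1_norm (\<lambda>x. \<phi> n x - \<psi> x) * H1_norm (\<lambda>x. \<phi> n x - \<psi> x)
        + 2 * (3 * H1_norm (\<lambda>x. \<phi> n x - \<psi> x) * H1_norm \<psi>)) \<longlonglongrightarrow> 0" by simp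
  qed
  have "(\<lambda>n. (\<integral>x. (deriv (\<phi> n) x)\<^sup>2 \<partial>lborel) + T (\<lambda>x. \<phi> n x * \<phi> n x)) \<longlonglongrightarrow> schroedinger_form T \<psi> \<psi>"
    unfolding schroedinger_form_def power2_eq_square
    by (intro tendsto_add pairing_tendsto[OF T] H1_mult \<psi> test_function_mult \<phi> sq
        L2_tendsto_inner test_L2 test_function_deriv L d2)
  moreover have "(\<lambda>n. c * (l2norm (\<phi> n))\<^sup>2) \<longlonglongrightarrow> c * (l2norm \<psi>)\<^sup>2"
    unfolding l2norm_power2 by (intro tendsto_mult tendsto_const L2_tendsto_integral_square test_L2 \<phi> L l2)
  ultimately show ?thesis using ge[OF \<phi>(1)] by (intro LIMSEQ_le[of _ _ "\<lambda>n. (\<integral>x. (deriv (\<phi> n) x)\<^sup>2 \<partial>lborel) + T (\<lambda>x. \<phi> n x * \<phi> n x)"]) auto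
qed

lemma form_test:
  assumes T: "H1_bounded T" and \<phi>: "test_function \<phi>"
  shows "schroedinger_form T \<phi> \<phi> = (\<integral>x. (deriv \<phi> x)\<^sup>2 \<partial>lborel) + T (\<lambda>x. \<phi> x * \<phi> x)"
proof -
  have [measurable]: "deriv \<phi> \<in> borel_measurable borel" "weak_deriv \<phi> \<in> borel_measurable borel"
    by (intro test_measurable test_function_deriv \<phi> L2_measurable weak_deriv_props H1_test)+
  have "(\<integral>x. weak_deriv \<phi> x * weak_deriv \<phi> x \<partial>lborel) = (\<integral>x. (deriv \<phi> x)\<^sup>2 \<partial>lborel)"
    by (rule integral_cong_AE) (use weak_deriv_test[OF \<phi>] in \<open>auto simp: power2_eq_square\<close>)
  then show ?thesis by (simp add: schroedinger_form_def pairing_test[OF T test_function_mult[OF \<phi> \<phi>]])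
qed

section \<open>The bottom of the spectrum\<close>

lemma nonneg_form_Cauchy_Schwarz:
  fixes a b c :: real
  assumes "\<And>t. 0 \<le> a + 2 * t * b + t\<^sup>2 * c"
  shows "b\<^sup>2 \<le> a * c"
proof (cases "c = 0")
  case True
  have "b = 0"
  proof (rule ccontr)
    assume "b \<noteq> 0"
    then show False using assms[of "- (a + 1) / (2 * b)"] True by (simp add: field_simps)
  qed
  then show ?thesis using True by simp
next
  case False
  have "c > 0"
  proof (rule ccontr)
    assume "\<not> c > 0"
    then have c: "c < 0" using False by simp
    define t where "t = 1 + (\<bar>a\<bar> + 2 * \<bar>b\<bar>) / (- c)"
    have t: "t \<ge> 1" using c by (simp add: t_def field_simps)
    have "t * (- c) = - c + (\<bar>a\<bar> + 2 * \<bar>b\<bar>)" using c by (simp add: t_def field_simps)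
    then have "t * (t * (- c)) = t * (- c + (\<bar>a\<bar> + 2 * \<bar>b\<bar>))" by (simp only:)
    then have "t * t * (- c) = t * (- c) + t * (\<bar>a\<bar> + 2 * \<bar>b\<bar>)" by (simp only: mult.assoc distrib_left)
    moreover have "t * (- c) > 0" using t c by (simp add: mult_pos_neg)
    moreover have "1 * \<bar>a\<bar> \<le> t * \<bar>a\<bar>" using t by (intro mult_right_mono) auto
    moreover have "t * b \<le> t * \<bar>b\<bar>" using t by (intro mult_left_mono) auto
    ultimately have "a + 2 * t * b + t * t * c < 0" by (simp add: algebra_simps)
    then show False using assms[of t] by (simp add: power2_eq_square)
  qed
  then show ?thesis using assms[of "- b / c"] by (simp add: power2_eq_square field_simps)
qed

text \<open>If the bottom \<open>\<lambda>\<^sub>0\<close> of the form were in the resolvent set, then solving the equation with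
  right-hand side \<open>\<phi>\<close> and applying the Cauchy--Schwarz inequality of the nonnegative form would
  show that the form minus \<open>\<lambda>\<^sub>0\<close> is bounded below by a positive multiple of the square norm.  So
  \<open>\<lambda>\<^sub>0\<close> lies in the spectrum.\<close>

theorem form_ge_Inf_spectrum:
  assumes T: "H1_bounded T" and low: "\<And>\<psi>. H1 \<psi> \<Longrightarrow> schroedinger_form T \<psi> \<psi> \<ge> c * (l2norm \<psi>)\<^sup>2"
    and m: "is_infimum m (spectrum T)" and \<phi>0: "H1 \<phi>\<^sub>0"
  shows "schroedinger_form T \<phi>\<^sub>0 \<phi>\<^sub>0 \<ge> m * (l2norm \<phi>\<^sub>0)\<^sup>2"
proof (rule ccontr)
  let ?Q = "schroedinger_form T"
  assume "\<not> ?Q \<phi>\<^sub>0 \<phi>\<^sub>0 \<ge> m * (l2norm \<phi>\<^sub>0)\<^sup>2"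
  then have less: "?Q \<phi>\<^sub>0 \<phi>\<^sub>0 < m * (l2norm \<phi>\<^sub>0)\<^sup>2" by simp
  then have nz: "l2norm \<phi>\<^sub>0 \<noteq> 0" using low[OF \<phi>0] by auto
  define S where "S = {?Q \<psi> \<psi> / (l2norm \<psi>)\<^sup>2 | \<psi>. H1 \<psi> \<and> l2norm \<psi> \<noteq> 0}"
  \<comment> \<open>\<open>S\<close> is the set of Rayleigh quotients, so \<open>l0\<close> is the bottom of the form.\<close>
  define l0 where "l0 = Inf S"
  have S0: "?Q \<phi>\<^sub>0 \<phi>\<^sub>0 / (l2norm \<phi>\<^sub>0)\<^sup>2 \<in> S" using \<phi>0 nz by (auto simp: S_def)
  have bdd: "bdd_below S"
  proof (rule bdd_belowI)
    fix s assume "s \<in> S" then show "c \<le> s" using low by (auto simp: S_def field_simps)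
  qed
  have "l0 \<le> ?Q \<phi>\<^sub>0 \<phi>\<^sub>0 / (l2norm \<phi>\<^sub>0)\<^sup>2" unfolding l0_def by (rule cInf_lower[OF S0 bdd])
  also have "\<dots> < m" using less nz by (simp add: field_simps)
  finally have "l0 \<notin> spectrum T"
    using m cInf_lower[of l0 "spectrum T"] by (auto simp: is_infimum_def)
  then obtain C0 where C0: "\<And>\<psi> f. schroedinger_op T \<psi> f \<Longrightarrow> l2norm \<psi> \<le> C0 * l2norm (\<lambda>x. f x - l0 * \<psi> x)"
    and solve: "\<And>h. L2 h \<Longrightarrow> \<exists>\<psi> f. schroedinger_op T \<psi> f \<and> (AE x in lborel. f x - l0 * \<psi> x = h x)"
    unfolding spectrum_def resolvent_set_def by blast
  define C where "C = \<bar>C0\<bar> + 1"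
  have C: "C > 0" by (simp add: C_def)
  have C_bd: "l2norm \<psi> \<le> C * l2norm (\<lambda>x. f x - l0 * \<psi> x)" if "schroedinger_op T \<psi> f" for \<psi> f
    by (rule order_trans[OF C0[OF that]]) (auto simp: C_def intro!: mult_right_mono)
  have Q_ge: "l0 * (l2norm \<psi>)\<^sup>2 \<le> ?Q \<psi> \<psi>" if \<psi>: "H1 \<psi>" for \<psi>
  proof (cases "l2norm \<psi> = 0")
    case True then show ?thesis using low[OF \<psi>] by simp
  next
    case False
    then have "?Q \<psi> \<psi> / (l2norm \<psi>)\<^sup>2 \<in> S" using \<psi> by (auto simp: S_def)
    then have "l0 \<le> ?Q \<psi> \<psi> / (l2norm \<psi>)\<^sup>2" unfolding l0_def by (rule cInf_lower[OF _ bdd])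
    then show ?thesis using False by (simp add: field_simps)
  qed
  \<comment> \<open>With \<open>b = Q - l0\<close> and \<open>\<psi>\<close> the solution for the right-hand side \<open>\<phi>\<close>: \<open>b(\<psi>, \<phi>) = \<parallel>\<phi>\<parallel>\<^sup>2\<close> and
    \<open>b(\<psi>, \<psi>) \<le> C \<parallel>\<phi>\<parallel>\<^sup>2\<close>, and the Cauchy--Schwarz inequality gives \<open>\<parallel>\<phi>\<parallel>\<^sup>4 \<le> b(\<phi>, \<phi>) C \<parallel>\<phi>\<parallel>\<^sup>2\<close>.\<close>
  have key: "(l2norm \<phi>)\<^sup>2 \<le> C * (?Q \<phi> \<phi> - l0 * (l2norm \<phi>)\<^sup>2)" if \<phi>: "H1 \<phi>" for \<phi>
  proof -
    obtain \<psi> f where op: "schroedinger_op T \<psi> f" and ae: "AE x in lborel. f x - l0 * \<psi> x = \<phi> x"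
      using solve[OF H1_L2[OF \<phi>]] by blast
    have \<psi>: "H1 \<psi>" and f: "L2 f" and weak: "\<And>h. H1 h \<Longrightarrow> ?Q \<psi> h = (\<integral>x. f x * h x \<partial>lborel)"
      using op by (auto simp: schroedinger_op_def)
    note L = H1_L2[OF \<phi>] H1_L2[OF \<psi>] f
    note [measurable] = L[THEN L2_measurable]
    have B: "?Q \<psi> h - l0 * (\<integral>x. \<psi> x * h x \<partial>lborel) = (\<integral>x. \<phi> x * h x \<partial>lborel)" if h: "H1 h" for h
    proof -
      note [measurable] = L2_measurable[OF H1_L2[OF h]]
      have "?Q \<psi> h - l0 * (\<integral>x. \<psi> x * h x \<partial>lborel) = (\<integral>x. (f x - l0 * \<psi> x) * h x \<partial>lborel)"
        using L2_mult_integrable[OF f H1_L2[OF h]] L2_mult_integrable[OF H1_L2[OF \<psi>] H1_L2[OF h]]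
        by (simp add: weak[OF h] left_diff_distrib mult.assoc)
      also have "\<dots> = (\<integral>x. \<phi> x * h x \<partial>lborel)"
        by (rule integral_cong_AE) (use ae in auto)
      finally show ?thesis .
    qed
    define n2 where "n2 = (l2norm \<phi>)\<^sup>2"
    have b: "?Q \<psi> \<phi> - l0 * (\<integral>x. \<psi> x * \<phi> x \<partial>lborel) = n2"
      using B[OF \<phi>] unfolding n2_def l2norm_power2 by (simp only: power2_eq_square)
    have c: "?Q \<psi> \<psi> - l0 * (l2norm \<psi>)\<^sup>2 \<le> C * n2"
    proof -
      have "l2norm (\<lambda>x. f x - l0 * \<psi> x) = l2norm \<phi>" by (rule l2norm_cong_AE[OF _ _ ae]) auto
      then have le: "l2norm \<psi> \<le> C * l2norm \<phi>" using C_bd[OF op] by simp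
      have "?Q \<psi> \<psi> - l0 * (l2norm \<psi>)\<^sup>2 = (\<integral>x. \<phi> x * \<psi> x \<partial>lborel)"
        using B[OF \<psi>] unfolding l2norm_power2 by (simp only: power2_eq_square)
      also have "\<dots> \<le> l2norm \<phi> * l2norm \<psi>" using L2_Cauchy_Schwarz[OF L(1,2)] by simp
      also have "\<dots> \<le> l2norm \<phi> * (C * l2norm \<phi>)" using le by (intro mult_left_mono) auto
      finally show ?thesis by (simp add: n2_def power2_eq_square algebra_simps)
    qed
    have quad: "0 \<le> (?Q \<phi> \<phi> - l0 * n2) + 2 * t * n2 + t\<^sup>2 * (?Q \<psi> \<psi> - l0 * (l2norm \<psi>)\<^sup>2)" for t
    proof -
      let ?h = "\<lambda>x. \<phi> x + t * \<psi> x"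
      have h: "H1 ?h" by (intro H1_add H1_cmult \<phi> \<psi>)
      have "?Q ?h ?h = ?Q \<phi> \<phi> + 2 * t * ?Q \<psi> \<phi> + t\<^sup>2 * ?Q \<psi> \<psi>"
        using form_lincomb[OF T \<phi> \<psi> h, of t] form_lincomb[OF T \<phi> \<psi> \<phi>, of t] form_lincomb[OF T \<phi> \<psi> \<psi>, of t]
          form_commute[of T \<phi> ?h] form_commute[of T \<psi> ?h] form_commute[of T \<phi> \<psi>]
        by (simp add: power2_eq_square algebra_simps)
      moreover have "(l2norm ?h)\<^sup>2 = n2 + 2 * t * (\<integral>x. \<psi> x * \<phi> x \<partial>lborel) + t\<^sup>2 * (l2norm \<psi>)\<^sup>2"
      proof -
        have "(l2norm ?h)\<^sup>2 = (\<integral>x. (\<phi> x)\<^sup>2 + (2 * t) * (\<psi> x * \<phi> x) + t\<^sup>2 * (\<psi> x)\<^sup>2 \<partial>lborel)"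
          unfolding l2norm_power2 by (rule Bochner_Integration.integral_cong) (auto simp: power2_eq_square algebra_simps)
        then show ?thesis
          using L2_integrable[OF L(1)] L2_integrable[OF L(2)] L2_mult_integrable[OF L(2,1)]
          by (simp add: n2_def l2norm_power2)
      qed
      ultimately show ?thesis using Q_ge[OF h] b by (simp add: algebra_simps)
    qed
    have "n2\<^sup>2 \<le> (?Q \<phi> \<phi> - l0 * n2) * (?Q \<psi> \<psi> - l0 * (l2norm \<psi>)\<^sup>2)" by (rule nonneg_form_Cauchy_Schwarz[OF quad])
    also have "\<dots> \<le> (?Q \<phi> \<phi> - l0 * n2) * (C * n2)"
      by (rule mult_left_mono[OF c]) (use Q_ge[OF \<phi>] in \<open>simp add: n2_def\<close>)
    finally have "n2 * n2 \<le> (C * (?Q \<phi> \<phi> - l0 * n2)) * n2" by (simp add: power2_eq_square mult_ac)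
    moreover have "0 \<le> n2" by (simp add: n2_def)
    moreover have "0 \<le> C * (?Q \<phi> \<phi> - l0 * n2)" using C Q_ge[OF \<phi>] by (simp add: n2_def)
    ultimately have "n2 \<le> C * (?Q \<phi> \<phi> - l0 * n2)"
      by (metis less_eq_real_def mult_right_le_imp_le)
    then show ?thesis by (simp add: n2_def)
  qed
  have "l0 + 1 / C \<le> s" if "s \<in> S" for s
  proof -
    from that obtain \<psi> where \<psi>: "H1 \<psi>" "l2norm \<psi> \<noteq> 0" "s = ?Q \<psi> \<psi> / (l2norm \<psi>)\<^sup>2" by (auto simp: S_def)
    have "?Q \<psi> \<psi> = s * (l2norm \<psi>)\<^sup>2" using \<psi>(2,3) by simp
    then have "1 * (l2norm \<psi>)\<^sup>2 \<le> (C * (s - l0)) * (l2norm \<psi>)\<^sup>2" using key[OF \<psi>(1)] by (simp add: algebra_simps)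
    then have "1 \<le> C * (s - l0)" using \<psi>(2) by (subst (asm) mult_le_cancel_right) auto
    then show ?thesis using C by (simp add: field_simps)
  qed
  then have "l0 + 1 / C \<le> l0" unfolding l0_def using S0 by (intro cInf_greatest) auto
  then show False using C by simp
qed

section \<open>The Fourier transform of test functions\<close>

text \<open>The form of Fubini's theorem in which all exchanges of Fourier integrals are made: \<open>k\<close> will be
a character, and the integrability comes from the two amplitudes.\<close>

lemma Fubini_bounded_kernel:
  fixes a b :: "real \<Rightarrow> complex" and k :: "real \<Rightarrow> real \<Rightarrow> complex"
  assumes a: "integrable lborel a" and b: "integrable lborel b"
    and k [measurable]: "(\<lambda>(x, y). k x y) \<in> borel_measurable (borel \<Otimes>\<^sub>M borel)" and k1: "\<And>x y. cmod (k x y) \<le> 1"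
  shows "(\<integral>x. a x * (\<integral>y. k x y * b y \<partial>lborel) \<partial>lborel) = (\<integral>y. b y * (\<integral>x. k x y * a x \<partial>lborel) \<partial>lborel)"
proof -
  have [measurable]: "a \<in> borel_measurable borel" "b \<in> borel_measurable borel"
    using a b by (auto dest: borel_measurable_integrable)
  let ?f = "\<lambda>(x, y). a x * k x y * b y"
  have le: "cmod (a x * k x y * b y) \<le> cmod (a x) * cmod (b y)" for x y
    using mult_left_mono[OF k1[of x y], of "cmod (a x) * cmod (b y)"] by (simp add: norm_mult mult_ac)
  have iy: "integrable lborel (\<lambda>y. a x * k x y * b y)" for x
    by (rule Bochner_Integration.integrable_bound[of lborel "\<lambda>y. cmod (a x) * cmod (b y)"])
       (use b le in \<open>auto intro!: AE_I2\<close>)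
  have int: "integrable (lborel \<Otimes>\<^sub>M lborel) ?f"
  proof (rule lborel_pair.Fubini_integrable)
    have "integrable lborel (\<lambda>x. cmod (a x) * (\<integral>y. cmod (b y) \<partial>lborel))"
      using a by simp
    then show "integrable lborel (\<lambda>x. \<integral>y. norm (?f (x, y)) \<partial>lborel)"
    proof (rule Bochner_Integration.integrable_bound)
      show "AE x in lborel. norm (\<integral>y. norm (?f (x, y)) \<partial>lborel) \<le> norm (cmod (a x) * (\<integral>y. cmod (b y) \<partial>lborel))"
      proof (rule AE_I2)
        fix x
        have "(\<integral>y. norm (?f (x, y)) \<partial>lborel) \<le> (\<integral>y. cmod (a x) * cmod (b y) \<partial>lborel)"
          using iy[of x] b le by (intro integral_mono) auto
        also have "\<dots> = cmod (a x) * (\<integral>y. cmod (b y) \<partial>lborel)" using b by simp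
        finally show "norm (\<integral>y. norm (?f (x, y)) \<partial>lborel) \<le> norm (cmod (a x) * (\<integral>y. cmod (b y) \<partial>lborel))"
          by (simp add: abs_mult)
      qed
    qed measurable
  qed (use iy in auto)
  have "(\<integral>x. a x * (\<integral>y. k x y * b y \<partial>lborel) \<partial>lborel) = (\<integral>x. (\<integral>y. a x * k x y * b y \<partial>lborel) \<partial>lborel)"
    by (simp flip: integral_mult_right_zero add: mult.assoc)
  also have "\<dots> = (\<integral>y. (\<integral>x. a x * k x y * b y \<partial>lborel) \<partial>lborel)"
    using lborel_pair.Fubini_integral[OF int] by simp
  also have "\<dots> = (\<integral>y. b y * (\<integral>x. k x y * a x \<partial>lborel) \<partial>lborel)"
    by (simp flip: integral_mult_right_zero add: mult_ac)
  finally show ?thesis .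
qed

lemma cis_measurable [measurable]: "cis \<in> borel_measurable borel"
  by (intro borel_measurable_continuous_onI continuous_intros)

lemma cnj_measurable [measurable]: "cnj \<in> borel_measurable borel"
  by (intro borel_measurable_continuous_onI continuous_intros)

lemma fourier_measurable:
  assumes [measurable]: "f \<in> borel_measurable borel"
  shows "fourier f \<in> borel_measurable borel"
  unfolding fourier_def[abs_def] by measurable

lemma cis_integrable:
  assumes "integrable lborel (f :: real \<Rightarrow> real)"
  shows "integrable lborel (\<lambda>x. cis (t * x) * complex_of_real (f x))"
proof (rule Bochner_Integration.integrable_bound[OF assms])
  have [measurable]: "f \<in> borel_measurable borel" using assms by auto
  show "(\<lambda>x. cis (t * x) * complex_of_real (f x)) \<in> borel_measurable lborel" by measurable
qed (auto simp: norm_mult)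

lemma fourier_bound:
  assumes "integrable lborel f"
  shows "cmod (fourier f \<xi>) \<le> (\<integral>x. \<bar>f x\<bar> \<partial>lborel) / sqrt (2 * pi)"
proof -
  have "cmod (\<integral>x. cis (- (\<xi> * x)) * complex_of_real (f x) \<partial>lborel) \<le> (\<integral>x. cmod (cis (- (\<xi> * x)) * complex_of_real (f x)) \<partial>lborel)"
    by (rule integral_norm_bound)
  also have "\<dots> = (\<integral>x. \<bar>f x\<bar> \<partial>lborel)" by (simp add: norm_mult)
  finally show ?thesis by (simp add: fourier_def norm_divide divide_right_mono)
qed

lemma fourier_diff:
  assumes "integrable lborel f" "integrable lborel g"
  shows "fourier (\<lambda>x. f x - g x) \<xi> = fourier f \<xi> - fourier g \<xi>"
  using cis_integrable[OF assms(1), of "- \<xi>"] cis_integrable[OF assms(2), of "- \<xi>"]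
  by (simp add: fourier_def right_diff_distrib diff_divide_distrib)

lemma fourier_cos_sin:
  assumes f: "integrable lborel f"
  shows "(\<integral>x. cis (- (\<xi> * x)) * complex_of_real (f x) \<partial>lborel)
    = complex_of_real (\<integral>x. cos (\<xi> * x) * f x \<partial>lborel) - \<i> * complex_of_real (\<integral>x. sin (\<xi> * x) * f x \<partial>lborel)"
proof -
  have [measurable]: "f \<in> borel_measurable borel" using f by auto
  have b: "\<bar>cos t * y\<bar> \<le> \<bar>y\<bar>" "\<bar>sin t * y\<bar> \<le> \<bar>y\<bar>" for t y :: real
    by (simp_all add: abs_mult mult_left_le_one_le)
  have i: "integrable lborel (\<lambda>x. cos (\<xi> * x) * f x)" "integrable lborel (\<lambda>x. sin (\<xi> * x) * f x)"
    by (rule Bochner_Integration.integrable_bound[OF f]; use b in auto)+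
  have "(\<lambda>x. cis (- (\<xi> * x)) * complex_of_real (f x))
    = (\<lambda>x. complex_of_real (cos (\<xi> * x) * f x) - \<i> * complex_of_real (sin (\<xi> * x) * f x))"
    by (auto simp: complex_eq_iff)
  then show ?thesis using i by (simp del: of_real_mult)
qed

lemma fourier_deriv:
  assumes \<phi>: "test_function \<phi>"
  shows "fourier (deriv \<phi>) \<xi> = \<i> * \<xi> * fourier \<phi> \<xi>"
proof -
  have c: "abs_cont (\<lambda>x. cos (\<xi> * x)) (\<lambda>x. - \<xi> * sin (\<xi> * x))" and s: "abs_cont (\<lambda>x. sin (\<xi> * x)) (\<lambda>x. \<xi> * cos (\<xi> * x))"
    by (rule abs_cont_C1; auto intro!: derivative_eq_intros continuous_intros)+
  have "(\<integral>x. cos (\<xi> * x) * deriv \<phi> x \<partial>lborel) = \<xi> * (\<integral>x. sin (\<xi> * x) * \<phi> x \<partial>lborel)"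
    using abs_cont_by_parts[OF c \<phi>] by (simp add: mult.assoc)
  moreover have "(\<integral>x. sin (\<xi> * x) * deriv \<phi> x \<partial>lborel) = - \<xi> * (\<integral>x. cos (\<xi> * x) * \<phi> x \<partial>lborel)"
    using abs_cont_by_parts[OF s \<phi>] by (simp add: mult.assoc)
  ultimately show ?thesis
    unfolding fourier_def fourier_cos_sin[OF test_integrable[OF \<phi>]] fourier_cos_sin[OF test_integrable[OF test_function_deriv[OF \<phi>]]]
    by (simp add: algebra_simps flip: add_divide_distrib)
qed

lemma fourier_test_decay:
  assumes \<phi>: "test_function \<phi>"
  obtains C where "C > 0" "\<And>\<xi>. cmod (fourier \<phi> \<xi>) \<le> C / (1 + \<xi>\<^sup>2)"
proof -
  define \<phi>2 where "\<phi>2 = deriv (deriv \<phi>)"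
  have \<phi>2: "test_function \<phi>2" unfolding \<phi>2_def by (intro test_function_deriv \<phi>)
  define A B where "A = (\<integral>x. \<bar>\<phi> x\<bar> \<partial>lborel) / sqrt (2 * pi)" and "B = (\<integral>x. \<bar>\<phi>2 x\<bar> \<partial>lborel) / sqrt (2 * pi)"
  have "cmod (fourier \<phi> \<xi>) \<le> (A + B + 1) / (1 + \<xi>\<^sup>2)" for \<xi>
  proof -
    have "fourier \<phi>2 \<xi> = \<i> * \<xi> * (\<i> * \<xi> * fourier \<phi> \<xi>)"
      unfolding \<phi>2_def fourier_deriv[OF test_function_deriv[OF \<phi>]] fourier_deriv[OF \<phi>] ..
    then have "cmod (fourier \<phi>2 \<xi>) = \<xi>\<^sup>2 * cmod (fourier \<phi> \<xi>)"
      by (simp add: norm_mult power2_eq_square mult.assoc[symmetric])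
    then have "\<xi>\<^sup>2 * cmod (fourier \<phi> \<xi>) \<le> B" using fourier_bound[OF test_integrable[OF \<phi>2], of \<xi>] by (simp add: B_def)
    moreover have "cmod (fourier \<phi> \<xi>) \<le> A" using fourier_bound[OF test_integrable[OF \<phi>], of \<xi>] by (simp add: A_def)
    ultimately have "(1 + \<xi>\<^sup>2) * cmod (fourier \<phi> \<xi>) \<le> A + B + 1" by (simp add: algebra_simps)
    moreover have "1 + \<xi>\<^sup>2 > 0" by (simp add: add_pos_nonneg)
    ultimately show ?thesis by (simp add: pos_le_divide_eq mult.commute)
  qed
  moreover have "0 \<le> A" "0 \<le> B" by (auto simp: A_def B_def)
  ultimately show thesis by (intro that[of "A + B + 1"]) auto
qed

lemma inverse_quadratic_integrable:
  fixes \<tau> :: real assumes "\<tau> > 0"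
  shows "integrable lborel (\<lambda>\<xi>. 1 / (\<xi>\<^sup>2 + \<tau>\<^sup>2))" "(\<integral>\<xi>. 1 / (\<xi>\<^sup>2 + \<tau>\<^sup>2) \<partial>lborel) \<le> pi / \<tau>"
proof -
  have pos: "\<xi>\<^sup>2 + \<tau>\<^sup>2 > 0" for \<xi> using assms by (simp add: add_nonneg_pos)
  have c: "continuous_on UNIV (\<lambda>\<xi>. 1 / (\<xi>\<^sup>2 + \<tau>\<^sup>2))"
    using pos by (intro continuous_intros) (auto simp: less_le)
  have d: "((\<lambda>\<xi>. arctan (\<xi> / \<tau>) / \<tau>) has_real_derivative 1 / (\<xi>\<^sup>2 + \<tau>\<^sup>2)) (at \<xi>)" for \<xi>
  proof -
    have "((\<lambda>\<xi>. arctan (\<xi> / \<tau>) / \<tau>) has_real_derivative inverse (1 + (\<xi> / \<tau>)\<^sup>2) * (1 / \<tau>) / \<tau>) (at \<xi>)"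
      using assms by (auto intro!: derivative_eq_intros)
    moreover have "inverse (1 + (\<xi> / \<tau>)\<^sup>2) * (1 / \<tau>) / \<tau> = 1 / (\<xi>\<^sup>2 + \<tau>\<^sup>2)"
    proof -
      have "1 + (\<xi> / \<tau>)\<^sup>2 = (\<xi>\<^sup>2 + \<tau>\<^sup>2) / \<tau>\<^sup>2" using assms by (simp add: power_divide field_simps)
      then show ?thesis using assms pos[of \<xi>] by (simp add: power2_eq_square)
    qed
    ultimately show ?thesis by simp
  qed
  note ac = abs_cont_C1[OF d c]
  have bd: "(LBINT \<xi>:{- real n..real n}. 1 / (\<xi>\<^sup>2 + \<tau>\<^sup>2)) \<le> pi / \<tau>" for n :: nat
  proof -
    have "(LBINT \<xi>:{- real n..real n}. 1 / (\<xi>\<^sup>2 + \<tau>\<^sup>2)) = (arctan (real n / \<tau>) - arctan (- real n / \<tau>)) / \<tau>"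
      using abs_contD(2)[OF ac, of "- real n" "real n"] by (simp add: diff_divide_distrib)
    also have "\<dots> \<le> pi / \<tau>"
      using arctan_ubound[of "real n / \<tau>"] arctan_lbound[of "- real n / \<tau>"] assms by (intro divide_right_mono) auto
    finally show ?thesis .
  qed
  show "integrable lborel (\<lambda>\<xi>. 1 / (\<xi>\<^sup>2 + \<tau>\<^sup>2))" "(\<integral>\<xi>. 1 / (\<xi>\<^sup>2 + \<tau>\<^sup>2) \<partial>lborel) \<le> pi / \<tau>"
    using integrable_of_bounded_Icc[OF abs_contD(1)[OF ac] _ bd] pos by (auto simp: less_imp_le)
qed

lemma fourier_test_measurable: "test_function \<phi> \<Longrightarrow> fourier \<phi> \<in> borel_measurable borel"
  by (intro fourier_measurable test_measurable)

lemma fourier_test_integrable: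
  assumes \<phi>: "test_function \<phi>"
  shows "integrable lborel (fourier \<phi>)"
proof -
  obtain C where C: "C > 0" "\<And>\<xi>. cmod (fourier \<phi> \<xi>) \<le> C / (1 + \<xi>\<^sup>2)" using fourier_test_decay[OF \<phi>] by metis
  show ?thesis
  proof (rule Bochner_Integration.integrable_bound)
    show "integrable lborel (\<lambda>\<xi>. C * (1 / (\<xi>\<^sup>2 + 1\<^sup>2)))"
      by (intro integrable_mult_right inverse_quadratic_integrable) simp
    show "fourier \<phi> \<in> borel_measurable lborel" using fourier_test_measurable[OF \<phi>] by simp
  qed (use C in \<open>auto simp: add.commute\<close>)
qed

lemma Gaussian_transform:
  "integrable lborel (\<lambda>z. cis (t * z) * complex_of_real (std_normal_density z))"
  "(\<integral>z. cis (t * z) * complex_of_real (std_normal_density z) \<partial>lborel) = complex_of_real (exp (- t\<^sup>2 / 2))"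
proof -
  have N: "integrable lborel std_normal_density" by (rule integrable_normal_density) simp
  show "integrable lborel (\<lambda>z. cis (t * z) * complex_of_real (std_normal_density z))"
    by (rule cis_integrable[OF N])
  have "complex_of_real (exp (- t\<^sup>2 / 2)) = char std_normal_distribution t"
    by (simp add: char_std_normal_distribution)
  also have "\<dots> = (\<integral>z. std_normal_density z *\<^sub>R iexp (t * z) \<partial>lborel)"
    unfolding char_def by (rule integral_density) (auto intro: normal_density_nonneg)
  also have "\<dots> = (\<integral>z. cis (t * z) * complex_of_real (std_normal_density z) \<partial>lborel)"
    by (rule Bochner_Integration.integral_cong) (auto simp: cis_conv_exp scaleR_conv_of_real)
  finally show "(\<integral>z. cis (t * z) * complex_of_real (std_normal_density z) \<partial>lborel) = complex_of_real (exp (- t\<^sup>2 / 2))" ..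
qed

lemma std_normal_density_eq: "std_normal_density z = exp (- z\<^sup>2 / 2) / sqrt (2 * pi)"
  by (simp add: normal_density_def)

text \<open>Fourier inversion: damping the inverse transform by a Gaussian turns it into a convolution
  with a Gaussian approximate identity.\<close>

theorem fourier_inversion:
  assumes \<phi>: "test_function \<phi>"
  shows "(\<integral>\<xi>. cis (x * \<xi>) * fourier \<phi> \<xi> \<partial>lborel) = complex_of_real (sqrt (2 * pi)) * complex_of_real (\<phi> x)"
proof -
  have [measurable]: "\<phi> \<in> borel_measurable borel" "fourier \<phi> \<in> borel_measurable borel"
    using \<phi> by (auto intro: test_measurable fourier_test_measurable)
  let ?G = "\<lambda>t. exp (- t\<^sup>2 / 2) :: real"
  let ?c = "complex_of_real (sqrt (2 * pi))"
  have c0: "?c \<noteq> 0" by simp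
  have Ni: "integrable lborel std_normal_density" by (rule integrable_normal_density) simp
  have N1: "(\<integral>z. std_normal_density z \<partial>lborel) = 1" by (rule integral_normal_density) simp
  have scaled: "(\<integral>\<xi>. cis (t * \<xi>) * complex_of_real (?G (\<delta> * \<xi>)) \<partial>lborel) = ?c / \<delta> * complex_of_real (?G (t / \<delta>))"
      and scaled_int: "integrable lborel (\<lambda>\<xi>. ?G (\<delta> * \<xi>))" if \<delta>: "\<delta> > 0" for \<delta> t :: real
  proof -
    have "(\<integral>z. cis (t / \<delta> * z) * complex_of_real (std_normal_density z) \<partial>lborel)
        = \<bar>\<delta>\<bar> *\<^sub>R (\<integral>\<xi>. cis (t / \<delta> * (0 + \<delta> * \<xi>)) * complex_of_real (std_normal_density (0 + \<delta> * \<xi>)) \<partial>lborel)"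
      by (rule lborel_integral_real_affine) (use \<delta> in simp)
    also have "(\<lambda>\<xi>. cis (t / \<delta> * (0 + \<delta> * \<xi>)) * complex_of_real (std_normal_density (0 + \<delta> * \<xi>)))
        = (\<lambda>\<xi>. cis (t * \<xi>) * complex_of_real (?G (\<delta> * \<xi>)) / ?c)"
      using \<delta> by (auto simp: std_normal_density_eq)
    finally have "complex_of_real (?G (t / \<delta>)) = \<delta> * ((\<integral>\<xi>. cis (t * \<xi>) * complex_of_real (?G (\<delta> * \<xi>)) \<partial>lborel) / ?c)"
      using \<delta> Gaussian_transform(2)[of "t / \<delta>"] by (simp add: scaleR_conv_of_real)
    then show "(\<integral>\<xi>. cis (t * \<xi>) * complex_of_real (?G (\<delta> * \<xi>)) \<partial>lborel) = ?c / \<delta> * complex_of_real (?G (t / \<delta>))"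
      using \<delta> by (simp add: field_simps)
    have "integrable lborel (\<lambda>\<xi>. std_normal_density (0 + \<delta> * \<xi>))"
      using Ni by (rule lborel_integrable_real_affine) (use \<delta> in simp)
    from integrable_mult_right[OF this, of "sqrt (2 * pi)"]
    show "integrable lborel (\<lambda>\<xi>. ?G (\<delta> * \<xi>))" by (simp add: std_normal_density_eq)
  qed
  have damped: "(\<integral>\<xi>. complex_of_real (?G (\<delta> * \<xi>)) * (cis (x * \<xi>) * fourier \<phi> \<xi>) \<partial>lborel)
      = ?c * (\<integral>z. complex_of_real (std_normal_density z) * complex_of_real (\<phi> (x + \<delta> * z)) \<partial>lborel)" if \<delta>: "\<delta> > 0" for \<delta>
  proof -
    have Gi: "integrable lborel (\<lambda>\<xi>. cis (x * \<xi>) * complex_of_real (?G (\<delta> * \<xi>)))"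
      by (rule cis_integrable[OF scaled_int[OF \<delta>]])
    have \<phi>i: "integrable lborel (\<lambda>y. complex_of_real (\<phi> y))" using test_integrable[OF \<phi>] by simp
    define I where "I = (\<lambda>\<xi>. \<integral>y. cis (- (\<xi> * y)) * complex_of_real (\<phi> y) \<partial>lborel)"
    have "?c * (\<integral>\<xi>. complex_of_real (?G (\<delta> * \<xi>)) * (cis (x * \<xi>) * fourier \<phi> \<xi>) \<partial>lborel)
        = (\<integral>\<xi>. ?c * (complex_of_real (?G (\<delta> * \<xi>)) * (cis (x * \<xi>) * fourier \<phi> \<xi>)) \<partial>lborel)"
      by (rule integral_mult_right_zero[symmetric])
    also have "\<dots> = (\<integral>\<xi>. (cis (x * \<xi>) * complex_of_real (?G (\<delta> * \<xi>))) * I \<xi> \<partial>lborel)"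
    proof (rule Bochner_Integration.integral_cong[OF refl])
      fix \<xi>
      have "fourier \<phi> \<xi> = I \<xi> / ?c" by (simp add: fourier_def I_def)
      then show "?c * (complex_of_real (?G (\<delta> * \<xi>)) * (cis (x * \<xi>) * fourier \<phi> \<xi>)) = (cis (x * \<xi>) * complex_of_real (?G (\<delta> * \<xi>))) * I \<xi>"
        using c0 by (simp add: field_simps)
    qed
    also have "\<dots> = (\<integral>\<xi>. (cis (x * \<xi>) * complex_of_real (?G (\<delta> * \<xi>))) * (\<integral>y. cis (- (\<xi> * y)) * complex_of_real (\<phi> y) \<partial>lborel) \<partial>lborel)"
      unfolding I_def ..
    also have "\<dots> = (\<integral>y. complex_of_real (\<phi> y) * (\<integral>\<xi>. cis (- (\<xi> * y)) * (cis (x * \<xi>) * complex_of_real (?G (\<delta> * \<xi>))) \<partial>lborel) \<partial>lborel)"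
      by (rule Fubini_bounded_kernel[OF Gi \<phi>i]) auto
    also have "\<dots> = (\<integral>y. complex_of_real (\<phi> y) * (?c / \<delta> * complex_of_real (?G ((x - y) / \<delta>))) \<partial>lborel)"
    proof (rule Bochner_Integration.integral_cong[OF refl])
      fix y
      have "(\<lambda>\<xi>. cis (- (\<xi> * y)) * (cis (x * \<xi>) * complex_of_real (?G (\<delta> * \<xi>)))) = (\<lambda>\<xi>. cis ((x - y) * \<xi>) * complex_of_real (?G (\<delta> * \<xi>)))"
        by (auto simp: cis_mult mult.assoc[symmetric] algebra_simps)
      then show "complex_of_real (\<phi> y) * (\<integral>\<xi>. cis (- (\<xi> * y)) * (cis (x * \<xi>) * complex_of_real (?G (\<delta> * \<xi>))) \<partial>lborel)
         = complex_of_real (\<phi> y) * (?c / \<delta> * complex_of_real (?G ((x - y) / \<delta>)))"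
        using scaled[OF \<delta>, of "x - y"] by simp
    qed
    also have "\<dots> = \<bar>\<delta>\<bar> *\<^sub>R (\<integral>z. complex_of_real (\<phi> (x + \<delta> * z)) * (?c / \<delta> * complex_of_real (?G ((x - (x + \<delta> * z)) / \<delta>))) \<partial>lborel)"
      by (rule lborel_integral_real_affine) (use \<delta> in simp)
    also have "\<dots> = (\<integral>z. ?c * (?c * (complex_of_real (std_normal_density z) * complex_of_real (\<phi> (x + \<delta> * z)))) \<partial>lborel)"
      unfolding integral_scaleR_right[symmetric]
      by (rule Bochner_Integration.integral_cong[OF refl])
         (use \<delta> in \<open>auto simp: scaleR_conv_of_real std_normal_density_eq field_simps simp flip: of_real_mult\<close>)
    also have "\<dots> = ?c * (?c * (\<integral>z. complex_of_real (std_normal_density z) * complex_of_real (\<phi> (x + \<delta> * z)) \<partial>lborel))"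
      by simp
    finally show ?thesis using c0 by simp
  qed
  define \<delta> where "\<delta> = (\<lambda>n. 1 / real (Suc n))"
  have \<delta>: "\<delta> n > 0" for n by (simp add: \<delta>_def)
  have \<delta>0: "\<delta> \<longlonglongrightarrow> 0" unfolding \<delta>_def by (rule LIMSEQ_Suc[OF lim_1_over_n])
  obtain B where B: "B > 0" "\<And>x. \<bar>\<phi> x\<bar> \<le> B" using test_bounded[OF \<phi>] by metis
  have "(\<lambda>n. \<integral>\<xi>. complex_of_real (?G (\<delta> n * \<xi>)) * (cis (x * \<xi>) * fourier \<phi> \<xi>) \<partial>lborel)
      \<longlonglongrightarrow> (\<integral>\<xi>. cis (x * \<xi>) * fourier \<phi> \<xi> \<partial>lborel)"
  proof (rule integral_dominated_convergence[where w="\<lambda>\<xi>. cmod (fourier \<phi> \<xi>)"])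
    show "AE \<xi> in lborel. (\<lambda>n. complex_of_real (?G (\<delta> n * \<xi>)) * (cis (x * \<xi>) * fourier \<phi> \<xi>)) \<longlonglongrightarrow> cis (x * \<xi>) * fourier \<phi> \<xi>"
    proof (rule AE_I2)
      fix \<xi>
      have "(\<lambda>n. complex_of_real (?G (\<delta> n * \<xi>)) * (cis (x * \<xi>) * fourier \<phi> \<xi>))
          \<longlonglongrightarrow> complex_of_real (?G (0 * \<xi>)) * (cis (x * \<xi>) * fourier \<phi> \<xi>)"
        by (intro tendsto_intros \<delta>0) auto
      then show "(\<lambda>n. complex_of_real (?G (\<delta> n * \<xi>)) * (cis (x * \<xi>) * fourier \<phi> \<xi>)) \<longlonglongrightarrow> cis (x * \<xi>) * fourier \<phi> \<xi>" by simp
    qed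
    show "AE \<xi> in lborel. norm (complex_of_real (?G (\<delta> n * \<xi>)) * (cis (x * \<xi>) * fourier \<phi> \<xi>)) \<le> cmod (fourier \<phi> \<xi>)" for n
      by (rule AE_I2) (auto simp: norm_mult intro!: mult_left_le_one_le)
  qed (use fourier_test_integrable[OF \<phi>] in auto)
  moreover have "(\<lambda>n. \<integral>z. complex_of_real (std_normal_density z) * complex_of_real (\<phi> (x + \<delta> n * z)) \<partial>lborel)
      \<longlonglongrightarrow> (\<integral>z. complex_of_real (std_normal_density z) * complex_of_real (\<phi> x) \<partial>lborel)"
  proof (rule integral_dominated_convergence[where w="\<lambda>z. B * std_normal_density z"])
    show "AE z in lborel. (\<lambda>n. complex_of_real (std_normal_density z) * complex_of_real (\<phi> (x + \<delta> n * z)))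
        \<longlonglongrightarrow> complex_of_real (std_normal_density z) * complex_of_real (\<phi> x)"
    proof (rule AE_I2)
      fix z
      have "(\<lambda>n. x + \<delta> n * z) \<longlonglongrightarrow> x + 0 * z" by (intro tendsto_intros \<delta>0)
      moreover have "isCont \<phi> (x + 0 * z)" using test_continuous[OF \<phi>, of UNIV] by (simp add: continuous_on_eq_continuous_at)
      ultimately have "(\<lambda>n. \<phi> (x + \<delta> n * z)) \<longlonglongrightarrow> \<phi> (x + 0 * z)" by (rule isCont_tendsto_compose[rotated])
      then show "(\<lambda>n. complex_of_real (std_normal_density z) * complex_of_real (\<phi> (x + \<delta> n * z)))
        \<longlonglongrightarrow> complex_of_real (std_normal_density z) * complex_of_real (\<phi> x)" by (intro tendsto_intros) simp
    qed
    show "AE z in lborel. norm (complex_of_real (std_normal_density z) * complex_of_real (\<phi> (x + \<delta> n * z))) \<le> B * std_normal_density z" for n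
      unfolding mult.commute[of B] by (rule AE_I2) (auto simp: norm_mult intro!: mult_left_mono B(2))
  qed (use Ni in auto)
  then have "(\<lambda>n. ?c * (\<integral>z. complex_of_real (std_normal_density z) * complex_of_real (\<phi> (x + \<delta> n * z)) \<partial>lborel))
      \<longlonglongrightarrow> ?c * (\<integral>z. complex_of_real (std_normal_density z) * complex_of_real (\<phi> x) \<partial>lborel)"
    by (rule tendsto_mult_left)
  moreover have "(\<integral>z. complex_of_real (std_normal_density z) * complex_of_real (\<phi> x) \<partial>lborel) = complex_of_real (\<phi> x)"
    using N1 by simp
  ultimately have "(\<lambda>n. ?c * (\<integral>z. complex_of_real (std_normal_density z) * complex_of_real (\<phi> (x + \<delta> n * z)) \<partial>lborel))
      \<longlonglongrightarrow> (\<integral>\<xi>. cis (x * \<xi>) * fourier \<phi> \<xi> \<partial>lborel)"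
    "(\<lambda>n. ?c * (\<integral>z. complex_of_real (std_normal_density z) * complex_of_real (\<phi> (x + \<delta> n * z)) \<partial>lborel))
      \<longlonglongrightarrow> ?c * complex_of_real (\<phi> x)" unfolding damped[OF \<delta>] by (simp_all only:)
  then show ?thesis by (rule LIMSEQ_unique)
qed

text \<open>Inserting the definition of \<open>fourier u\<close> and exchanging the integrals leaves the inverse transform of
\<open>fourier \<phi>\<close>.  Only one factor has to be a test function, so that this applies to \<open>u = w\<^sup>2\<close>.\<close>

theorem fourier_Parseval:
  assumes u: "integrable lborel u" and \<phi>: "test_function \<phi>"
  shows "integrable lborel (\<lambda>\<xi>. fourier u \<xi> * cnj (fourier \<phi> \<xi>))"
    and "(\<integral>\<xi>. fourier u \<xi> * cnj (fourier \<phi> \<xi>) \<partial>lborel) = complex_of_real (\<integral>x. u x * \<phi> x \<partial>lborel)"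
proof -
  let ?c = "complex_of_real (sqrt (2 * pi))"
  have c0: "?c \<noteq> 0" by simp
  have [measurable]: "u \<in> borel_measurable borel" using u by auto
  have [measurable]: "fourier u \<in> borel_measurable borel" "fourier \<phi> \<in> borel_measurable borel"
    using \<phi> by (auto intro: fourier_measurable fourier_test_measurable)
  have \<phi>i: "integrable lborel (\<lambda>\<xi>. cnj (fourier \<phi> \<xi>))" using fourier_test_integrable[OF \<phi>] by simp
  define M where "M = (\<integral>x. \<bar>u x\<bar> \<partial>lborel) / sqrt (2 * pi)"
  show "integrable lborel (\<lambda>\<xi>. fourier u \<xi> * cnj (fourier \<phi> \<xi>))"
  proof (rule Bochner_Integration.integrable_bound)
    show "integrable lborel (\<lambda>\<xi>. M * cmod (fourier \<phi> \<xi>))" using fourier_test_integrable[OF \<phi>] by simp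
    show "AE \<xi> in lborel. norm (fourier u \<xi> * cnj (fourier \<phi> \<xi>)) \<le> norm (M * cmod (fourier \<phi> \<xi>))"
      using order_trans[OF fourier_bound[OF u, folded M_def] abs_ge_self]
      by (intro AE_I2) (auto simp: norm_mult abs_mult intro!: mult_right_mono)
  qed measurable
  have ui: "integrable lborel (\<lambda>x. complex_of_real (u x))" using u by simp
  define I where "I = (\<lambda>\<xi>. \<integral>x. cis (- (\<xi> * x)) * complex_of_real (u x) \<partial>lborel)"
  have "?c * (\<integral>\<xi>. fourier u \<xi> * cnj (fourier \<phi> \<xi>) \<partial>lborel) = (\<integral>\<xi>. ?c * (fourier u \<xi> * cnj (fourier \<phi> \<xi>)) \<partial>lborel)"
    by (rule integral_mult_right_zero[symmetric])
  also have "\<dots> = (\<integral>\<xi>. cnj (fourier \<phi> \<xi>) * I \<xi> \<partial>lborel)"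
  proof (rule Bochner_Integration.integral_cong[OF refl])
    fix \<xi>
    have "fourier u \<xi> = I \<xi> / ?c" by (simp add: fourier_def I_def)
    then show "?c * (fourier u \<xi> * cnj (fourier \<phi> \<xi>)) = cnj (fourier \<phi> \<xi>) * I \<xi>" using c0 by simp
  qed
  also have "\<dots> = (\<integral>\<xi>. cnj (fourier \<phi> \<xi>) * (\<integral>x. cis (- (\<xi> * x)) * complex_of_real (u x) \<partial>lborel) \<partial>lborel)"
    unfolding I_def ..
  also have "\<dots> = (\<integral>x. complex_of_real (u x) * (\<integral>\<xi>. cis (- (\<xi> * x)) * cnj (fourier \<phi> \<xi>) \<partial>lborel) \<partial>lborel)"
    by (rule Fubini_bounded_kernel[OF \<phi>i ui]) auto
  also have "\<dots> = (\<integral>x. complex_of_real (u x) * (?c * complex_of_real (\<phi> x)) \<partial>lborel)"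
  proof (rule Bochner_Integration.integral_cong[OF refl])
    fix x
    have "(\<integral>\<xi>. cis (- (\<xi> * x)) * cnj (fourier \<phi> \<xi>) \<partial>lborel) = (\<integral>\<xi>. cnj (cis (x * \<xi>) * fourier \<phi> \<xi>) \<partial>lborel)"
      by (rule Bochner_Integration.integral_cong[OF refl]) (simp add: cis_cnj mult.commute)
    also have "\<dots> = cnj (\<integral>\<xi>. cis (x * \<xi>) * fourier \<phi> \<xi> \<partial>lborel)" by (rule Bochner_Integration.integral_cnj)
    also have "\<dots> = ?c * complex_of_real (\<phi> x)" unfolding fourier_inversion[OF \<phi>] by simp
    finally show "complex_of_real (u x) * (\<integral>\<xi>. cis (- (\<xi> * x)) * cnj (fourier \<phi> \<xi>) \<partial>lborel)
      = complex_of_real (u x) * (?c * complex_of_real (\<phi> x))" by simp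
  qed
  also have "\<dots> = (\<integral>x. ?c * complex_of_real (u x * \<phi> x) \<partial>lborel)"
    by (rule Bochner_Integration.integral_cong[OF refl]) simp
  also have "\<dots> = ?c * (\<integral>x. complex_of_real (u x * \<phi> x) \<partial>lborel)"
    by (rule integral_mult_right_zero)
  finally show "(\<integral>\<xi>. fourier u \<xi> * cnj (fourier \<phi> \<xi>) \<partial>lborel) = complex_of_real (\<integral>x. u x * \<phi> x \<partial>lborel)"
    using c0 by (simp del: of_real_mult)
qed

corollary fourier_Plancherel:
  assumes \<phi>: "test_function \<phi>"
  shows "integrable lborel (\<lambda>\<xi>. (cmod (fourier \<phi> \<xi>))\<^sup>2)" "(\<integral>\<xi>. (cmod (fourier \<phi> \<xi>))\<^sup>2 \<partial>lborel) = (l2norm \<phi>)\<^sup>2"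
proof -
  note P = fourier_Parseval[OF test_integrable[OF \<phi>] \<phi>]
  have eq: "(\<lambda>\<xi>. fourier \<phi> \<xi> * cnj (fourier \<phi> \<xi>)) = (\<lambda>\<xi>. complex_of_real ((cmod (fourier \<phi> \<xi>))\<^sup>2))"
    by (intro ext) (rule complex_norm_square[symmetric])
  show "integrable lborel (\<lambda>\<xi>. (cmod (fourier \<phi> \<xi>))\<^sup>2)"
    using P(1) unfolding eq complex_of_real_integrable_eq .
  show "(\<integral>\<xi>. (cmod (fourier \<phi> \<xi>))\<^sup>2 \<partial>lborel) = (l2norm \<phi>)\<^sup>2"
    using P(2) unfolding eq integral_complex_of_real of_real_eq_iff l2norm_power2 by (simp add: power2_eq_square)
qed

lemma complex_Cauchy_Schwarz:
  fixes a b :: "real \<Rightarrow> complex"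
  assumes [measurable]: "a \<in> borel_measurable borel" "b \<in> borel_measurable borel"
    and "integrable lborel (\<lambda>x. (cmod (a x))\<^sup>2)" "integrable lborel (\<lambda>x. (cmod (b x))\<^sup>2)"
  shows "integrable lborel (\<lambda>x. a x * b x)"
    and "cmod (\<integral>x. a x * b x \<partial>lborel) \<le> sqrt (\<integral>x. (cmod (a x))\<^sup>2 \<partial>lborel) * sqrt (\<integral>x. (cmod (b x))\<^sup>2 \<partial>lborel)"
proof -
  have m: "(\<lambda>x. cmod (a x)) \<in> borel_measurable lborel" "(\<lambda>x. cmod (b x)) \<in> borel_measurable lborel" by auto
  note CS = Cauchy_Schwarz_integral[OF m assms(3,4)]
  show "integrable lborel (\<lambda>x. a x * b x)"
    by (rule Bochner_Integration.integrable_bound[OF CS(1)]) (auto simp: norm_mult)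
  have "cmod (\<integral>x. a x * b x \<partial>lborel) \<le> (\<integral>x. cmod (a x * b x) \<partial>lborel)" by (rule integral_norm_bound)
  also have "\<dots> = (\<integral>x. \<bar>cmod (a x) * cmod (b x)\<bar> \<partial>lborel)" by (simp add: norm_mult abs_mult)
  finally show "cmod (\<integral>x. a x * b x \<partial>lborel) \<le> sqrt (\<integral>x. (cmod (a x))\<^sup>2 \<partial>lborel) * sqrt (\<integral>x. (cmod (b x))\<^sup>2 \<partial>lborel)"
    using CS(2) by simp
qed

section \<open>The Fourier transform of square integrable functions\<close>

text \<open>A sequence of test functions that converges to \<open>w\<close> has transforms that form a Cauchy
  sequence in \<open>L\<^sup>2\<close>.  Multiplication by \<open>1 / (1 + \<xi>\<^sup>2)\<close> turns it into a Cauchy sequence in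
  \<open>L\<^sup>1\<close>, so that a subsequence converges almost everywhere, and Fatou's lemma identifies the
  limit.\<close>

theorem L2_fourier_exists:
  assumes w: "L2 w"
  obtains g where "g \<in> borel_measurable borel"
    "integrable lborel (\<lambda>\<xi>. (cmod (g \<xi>))\<^sup>2)" "(\<integral>\<xi>. (cmod (g \<xi>))\<^sup>2 \<partial>lborel) \<le> (l2norm w)\<^sup>2"
    "\<And>\<phi>. test_function \<phi> \<Longrightarrow> integrable lborel (\<lambda>\<xi>. g \<xi> * cnj (fourier \<phi> \<xi>))"
    "\<And>\<phi>. test_function \<phi> \<Longrightarrow> (\<integral>\<xi>. g \<xi> * cnj (fourier \<phi> \<xi>) \<partial>lborel) = complex_of_real (\<integral>x. w x * \<phi> x \<partial>lborel)"
proof -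
  have "\<exists>\<phi>. test_function \<phi> \<and> l2norm (\<lambda>x. w x - \<phi> x) < 1 / real (Suc n)" for n
    using L2_approx[OF w, of "1 / real (Suc n)"] by auto
  then obtain \<phi> where \<phi>: "\<And>n. test_function (\<phi> n)" "\<And>n. l2norm (\<lambda>x. w x - \<phi> n x) < 1 / real (Suc n)" by metis
  have [measurable]: "fourier (\<phi> n) \<in> borel_measurable borel" for n by (rule fourier_test_measurable[OF \<phi>(1)])
  have diff: "fourier (\<lambda>x. f x - g x) \<xi> = fourier f \<xi> - fourier g \<xi>" if "test_function f" "test_function g" for f g \<xi>
    using that by (intro fourier_diff test_integrable)
  define h :: "real \<Rightarrow> complex" where "h = (\<lambda>\<xi>. complex_of_real (1 / (\<xi>\<^sup>2 + 1)))"
  have [measurable]: "h \<in> borel_measurable borel" unfolding h_def by measurable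
  have hn: "cmod (h \<xi>) = 1 / (\<xi>\<^sup>2 + 1)" for \<xi> by (simp only: h_def norm_of_real) (simp add: abs_of_nonneg)
  have h0: "h \<xi> \<noteq> 0" for \<xi>
  proof -
    have "\<xi>\<^sup>2 + 1 > 0" by (simp add: add_nonneg_pos)
    then show ?thesis unfolding h_def of_real_eq_0_iff by simp
  qed
  have h2: "integrable lborel (\<lambda>\<xi>. (cmod (h \<xi>))\<^sup>2)"
  proof (rule Bochner_Integration.integrable_bound)
    show "integrable lborel (\<lambda>\<xi>::real. 1 / (\<xi>\<^sup>2 + 1\<^sup>2))" by (rule inverse_quadratic_integrable) simp
    show "AE \<xi> in lborel. norm ((cmod (h \<xi>))\<^sup>2) \<le> norm (1 / (\<xi>\<^sup>2 + 1\<^sup>2))"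
    proof (rule AE_I2)
      fix \<xi> :: real
      have "0 \<le> 1 / (\<xi>\<^sup>2 + 1)" "1 / (\<xi>\<^sup>2 + 1) \<le> 1" by (auto simp: divide_le_eq add_nonneg_pos)
      then have "(1 / (\<xi>\<^sup>2 + 1)) * (1 / (\<xi>\<^sup>2 + 1)) \<le> 1 * (1 / (\<xi>\<^sup>2 + 1))" by (intro mult_right_mono)
      then show "norm ((cmod (h \<xi>))\<^sup>2) \<le> norm (1 / (\<xi>\<^sup>2 + 1\<^sup>2))" by (simp add: hn power2_eq_square)
    qed
  qed measurable
  define H where "H = sqrt (\<integral>\<xi>. (cmod (h \<xi>))\<^sup>2 \<partial>lborel)"
  have H: "0 \<le> H" by (simp add: H_def)
  define u where "u = (\<lambda>n \<xi>. h \<xi> * fourier (\<phi> n) \<xi>)"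
  have ui: "integrable lborel (u n)" for n
    unfolding u_def by (rule complex_Cauchy_Schwarz(1)[OF _ _ h2 fourier_Plancherel(1)[OF \<phi>(1)]]) auto
  have udiff: "(\<integral>\<xi>. norm (u n \<xi> - u m \<xi>) \<partial>lborel) \<le> H * (1 / real (Suc n) + 1 / real (Suc m))" for n m
  proof -
    let ?d = "\<lambda>x. \<phi> n x - \<phi> m x"
    have d: "test_function ?d" by (intro test_function_diff \<phi>)
    have [measurable]: "fourier ?d \<in> borel_measurable borel" by (rule fourier_test_measurable[OF d])
    have "(\<integral>\<xi>. norm (u n \<xi> - u m \<xi>) \<partial>lborel) = (\<integral>\<xi>. \<bar>cmod (h \<xi>) * cmod (fourier ?d \<xi>)\<bar> \<partial>lborel)"
      by (simp add: u_def diff[OF \<phi>(1) \<phi>(1)] norm_mult abs_mult flip: right_diff_distrib)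
    also have "\<dots> \<le> sqrt (\<integral>\<xi>. (cmod (h \<xi>))\<^sup>2 \<partial>lborel) * sqrt (\<integral>\<xi>. (cmod (fourier ?d \<xi>))\<^sup>2 \<partial>lborel)"
      by (rule Cauchy_Schwarz_integral(2)[OF _ _ h2 fourier_Plancherel(1)[OF d]]) auto
    also have "\<dots> = H * l2norm ?d" by (simp add: H_def fourier_Plancherel(2)[OF d])
    also have "\<dots> \<le> H * (1 / real (Suc n) + 1 / real (Suc m))"
    proof (rule mult_left_mono[OF _ H])
      show "l2norm ?d \<le> 1 / real (Suc n) + 1 / real (Suc m)"
        using l2norm_diff_triangle[OF test_L2[OF \<phi>(1)] w test_L2[OF \<phi>(1)], of n m] \<phi>(2)[of n] \<phi>(2)[of m]
          l2norm_minus_commute[of w "\<phi> n"] by linarith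
    qed
    finally show ?thesis .
  qed
  have cauchy: "\<exists>N. \<forall>i\<ge>N. \<forall>j\<ge>N. (\<integral>\<xi>. norm (u i \<xi> - u j \<xi>) \<partial>lborel) < e" if e: "e > 0" for e
  proof -
    have "(\<lambda>n. H * (2 * (1 / real (Suc n)))) \<longlonglongrightarrow> H * (2 * 0)"
      by (intro tendsto_intros LIMSEQ_Suc[OF lim_1_over_n])
    then have "\<forall>\<^sub>F n in sequentially. H * (2 * (1 / real (Suc n))) < e" using e by (intro order_tendstoD(2)) auto
    then obtain N where N: "H * (2 * (1 / real (Suc N))) < e" by (auto simp: eventually_sequentially)
    show ?thesis
    proof (intro exI[of _ N] allI impI)
      fix i j assume "i \<ge> N" "j \<ge> N"
      then have "1 / real (Suc i) \<le> 1 / real (Suc N)" "1 / real (Suc j) \<le> 1 / real (Suc N)"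
        by (intro divide_left_mono; simp)+
      then have "H * (1 / real (Suc i) + 1 / real (Suc j)) \<le> H * (2 * (1 / real (Suc N)))" using H by (intro mult_left_mono) auto
      then show "(\<integral>\<xi>. norm (u i \<xi> - u j \<xi>) \<partial>lborel) < e" using udiff[of i j] N by linarith
    qed
  qed
  obtain r where r: "strict_mono r" "AE \<xi> in lborel. Cauchy (\<lambda>i. u (r i) \<xi>)"
    using cauchy_L1_AE_cauchy_subseq[OF ui cauchy] by metis
  define G where "G = (\<lambda>i. fourier (\<phi> (r i)))"
  have [measurable]: "G i \<in> borel_measurable borel" for i unfolding G_def by measurable
  define g where "g = (\<lambda>\<xi>. lim (\<lambda>i. G i \<xi>))"
  have gm [measurable]: "g \<in> borel_measurable borel" unfolding g_def by measurable
  have lim: "AE \<xi> in lborel. (\<lambda>i. G i \<xi>) \<longlonglongrightarrow> g \<xi>"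
    using r(2)
  proof eventually_elim
    fix \<xi> assume "Cauchy (\<lambda>i. u (r i) \<xi>)"
    then obtain l where "(\<lambda>i. u (r i) \<xi>) \<longlonglongrightarrow> l" using Cauchy_convergent convergent_def by blast
    then have "(\<lambda>i. u (r i) \<xi> / h \<xi>) \<longlonglongrightarrow> l / h \<xi>" by (intro tendsto_intros) (auto simp: h0)
    then have "(\<lambda>i. G i \<xi>) \<longlonglongrightarrow> l / h \<xi>" using h0[of \<xi>] by (simp add: u_def G_def)
    then show "(\<lambda>i. G i \<xi>) \<longlonglongrightarrow> g \<xi>" unfolding g_def by (simp add: limI)
  qed
  have main: "integrable lborel (\<lambda>\<xi>. (cmod (g \<xi> - fourier \<theta> \<xi>))\<^sup>2)"
      "(\<integral>\<xi>. (cmod (g \<xi> - fourier \<theta> \<xi>))\<^sup>2 \<partial>lborel) \<le> (l2norm (\<lambda>x. w x - \<theta> x))\<^sup>2" if \<theta>: "test_function \<theta>" for \<theta>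
  proof -
    have [measurable]: "fourier \<theta> \<in> borel_measurable borel" by (rule fourier_test_measurable[OF \<theta>])
    let ?d = "\<lambda>i x. \<phi> (r i) x - \<theta> x"
    have d: "test_function (?d i)" for i by (intro test_function_diff \<phi> \<theta>)
    have Gd: "G i \<xi> - fourier \<theta> \<xi> = fourier (?d i) \<xi>" for i \<xi> by (simp add: G_def diff[OF \<phi>(1) \<theta>])
    have "(\<integral>\<^sup>+\<xi>. ennreal ((cmod (g \<xi> - fourier \<theta> \<xi>))\<^sup>2) \<partial>lborel)
        = (\<integral>\<^sup>+\<xi>. liminf (\<lambda>i. ennreal ((cmod (G i \<xi> - fourier \<theta> \<xi>))\<^sup>2)) \<partial>lborel)"
    proof (rule nn_integral_cong_AE)
      show "AE \<xi> in lborel. ennreal ((cmod (g \<xi> - fourier \<theta> \<xi>))\<^sup>2) = liminf (\<lambda>i. ennreal ((cmod (G i \<xi> - fourier \<theta> \<xi>))\<^sup>2))"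
        using lim
      proof eventually_elim
        fix \<xi> assume "(\<lambda>i. G i \<xi>) \<longlonglongrightarrow> g \<xi>"
        then have "(\<lambda>i. ennreal ((cmod (G i \<xi> - fourier \<theta> \<xi>))\<^sup>2)) \<longlonglongrightarrow> ennreal ((cmod (g \<xi> - fourier \<theta> \<xi>))\<^sup>2)"
          by (intro tendsto_intros)
        then show "ennreal ((cmod (g \<xi> - fourier \<theta> \<xi>))\<^sup>2) = liminf (\<lambda>i. ennreal ((cmod (G i \<xi> - fourier \<theta> \<xi>))\<^sup>2))"
          by (rule lim_imp_Liminf[OF sequentially_bot, symmetric])
      qed
    qed
    also have "\<dots> \<le> liminf (\<lambda>i. \<integral>\<^sup>+\<xi>. ennreal ((cmod (G i \<xi> - fourier \<theta> \<xi>))\<^sup>2) \<partial>lborel)"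
      by (rule nn_integral_liminf) measurable
    also have "(\<lambda>i. \<integral>\<^sup>+\<xi>. ennreal ((cmod (G i \<xi> - fourier \<theta> \<xi>))\<^sup>2) \<partial>lborel) = (\<lambda>i. ennreal ((l2norm (?d i))\<^sup>2))"
      unfolding Gd fourier_Plancherel(2)[OF d, symmetric]
      by (intro ext nn_integral_eq_integral fourier_Plancherel(1)[OF d]) auto
    also have "liminf (\<lambda>i. ennreal ((l2norm (?d i))\<^sup>2)) = ennreal ((l2norm (\<lambda>x. w x - \<theta> x))\<^sup>2)"
    proof (rule lim_imp_Liminf)
      have lim0: "(\<lambda>i. l2norm (\<lambda>x. \<phi> (r i) x - w x)) \<longlonglongrightarrow> 0"
      proof (rule LIMSEQ_subseq_LIMSEQ[OF _ r(1), unfolded comp_def])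
        show "(\<lambda>n. l2norm (\<lambda>x. \<phi> n x - w x)) \<longlonglongrightarrow> 0"
          by (rule Lim_null_comparison[OF always_eventually[OF allI] LIMSEQ_Suc[OF lim_1_over_n]])
             (use \<phi>(2) l2norm_minus_commute[of w] in \<open>auto intro: less_imp_le\<close>)
      qed
      have "(\<lambda>i. l2norm (?d i) - l2norm (\<lambda>x. w x - \<theta> x)) \<longlonglongrightarrow> 0"
      proof (rule Lim_null_comparison[OF always_eventually[OF allI] lim0])
        fix i
        show "norm (l2norm (?d i) - l2norm (\<lambda>x. w x - \<theta> x)) \<le> l2norm (\<lambda>x. \<phi> (r i) x - w x)"
          using l2norm_diff_triangle[OF test_L2[OF \<phi>(1)] w test_L2[OF \<theta>], of "r i"]
            l2norm_diff_triangle[OF w test_L2[OF \<phi>(1)] test_L2[OF \<theta>], of "r i"] l2norm_minus_commute[of w "\<phi> (r i)"]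
          by simp
      qed
      then have "(\<lambda>i. l2norm (?d i)) \<longlonglongrightarrow> l2norm (\<lambda>x. w x - \<theta> x)" by (simp add: LIM_zero_iff)
      then show "(\<lambda>i. ennreal ((l2norm (?d i))\<^sup>2)) \<longlonglongrightarrow> ennreal ((l2norm (\<lambda>x. w x - \<theta> x))\<^sup>2)" by (intro tendsto_intros)
    qed simp
    finally have le: "(\<integral>\<^sup>+\<xi>. ennreal ((cmod (g \<xi> - fourier \<theta> \<xi>))\<^sup>2) \<partial>lborel) \<le> ennreal ((l2norm (\<lambda>x. w x - \<theta> x))\<^sup>2)" .
    have m: "(\<lambda>\<xi>. (cmod (g \<xi> - fourier \<theta> \<xi>))\<^sup>2) \<in> borel_measurable lborel" by measurable
    show i: "integrable lborel (\<lambda>\<xi>. (cmod (g \<xi> - fourier \<theta> \<xi>))\<^sup>2)"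
      by (rule integrableI_bounded[OF m]) (use le in \<open>auto intro: le_less_trans\<close>)
    show "(\<integral>\<xi>. (cmod (g \<xi> - fourier \<theta> \<xi>))\<^sup>2 \<partial>lborel) \<le> (l2norm (\<lambda>x. w x - \<theta> x))\<^sup>2"
      using le by (subst (asm) nn_integral_eq_integral[OF i]) auto
  qed
  have z: "test_function (\<lambda>x. 0)" using test_function_cmult[OF \<phi>(1)[of 0], of 0] by simp
  have f0: "fourier (\<lambda>x. 0) = (\<lambda>\<xi>. 0)" by (auto simp: fourier_def)
  have g2: "integrable lborel (\<lambda>\<xi>. (cmod (g \<xi>))\<^sup>2)" and g2le: "(\<integral>\<xi>. (cmod (g \<xi>))\<^sup>2 \<partial>lborel) \<le> (l2norm w)\<^sup>2"
    using main[OF z] by (simp_all add: f0)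
  have int: "integrable lborel (\<lambda>\<xi>. g \<xi> * cnj (fourier \<theta> \<xi>))" if \<theta>: "test_function \<theta>" for \<theta>
    by (rule complex_Cauchy_Schwarz(1)[OF gm _ g2])
       (use fourier_Plancherel(1)[OF \<theta>] fourier_test_measurable[OF \<theta>] in auto)
  have "(\<integral>\<xi>. g \<xi> * cnj (fourier \<theta> \<xi>) \<partial>lborel) = complex_of_real (\<integral>x. w x * \<theta> x \<partial>lborel)" if \<theta>: "test_function \<theta>" for \<theta>
  proof -
    have [measurable]: "fourier \<theta> \<in> borel_measurable borel" by (rule fourier_test_measurable[OF \<theta>])
    let ?E = "(\<integral>\<xi>. g \<xi> * cnj (fourier \<theta> \<xi>) \<partial>lborel) - complex_of_real (\<integral>x. w x * \<theta> x \<partial>lborel)"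
    have bd: "cmod ?E \<le> (1 / real (Suc n)) * (2 * l2norm \<theta>)" for n
    proof -
      have e1: "(\<integral>\<xi>. (g \<xi> - fourier (\<phi> n) \<xi>) * cnj (fourier \<theta> \<xi>) \<partial>lborel)
          = (\<integral>\<xi>. g \<xi> * cnj (fourier \<theta> \<xi>) \<partial>lborel) - complex_of_real (\<integral>x. \<phi> n x * \<theta> x \<partial>lborel)"
        using int[OF \<theta>] fourier_Parseval[OF test_integrable[OF \<phi>(1)] \<theta>, of n] by (simp add: left_diff_distrib)
      have e2: "(\<integral>x. (w x - \<phi> n x) * \<theta> x \<partial>lborel) = (\<integral>x. w x * \<theta> x \<partial>lborel) - (\<integral>x. \<phi> n x * \<theta> x \<partial>lborel)"
        using L2_mult_integrable[OF w test_L2[OF \<theta>]] L2_mult_integrable[OF test_L2[OF \<phi>(1)] test_L2[OF \<theta>], of n]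
        by (simp add: left_diff_distrib)
      define X where "X = (\<integral>\<xi>. (g \<xi> - fourier (\<phi> n) \<xi>) * cnj (fourier \<theta> \<xi>) \<partial>lborel)"
      define Y where "Y = (\<integral>x. (w x - \<phi> n x) * \<theta> x \<partial>lborel)"
      have "?E = X - complex_of_real Y" unfolding X_def Y_def e1 e2 by simp
      then have "cmod ?E \<le> cmod X + cmod (complex_of_real Y)" using norm_triangle_ineq4[of X "complex_of_real Y"] by (simp only:)
      then have "cmod ?E \<le> cmod X + \<bar>Y\<bar>" by (simp only: norm_of_real)
      also have "\<dots> \<le> l2norm (\<lambda>x. w x - \<phi> n x) * l2norm \<theta> + l2norm (\<lambda>x. w x - \<phi> n x) * l2norm \<theta>"
      proof (rule add_mono)
        show "\<bar>Y\<bar> \<le> l2norm (\<lambda>x. w x - \<phi> n x) * l2norm \<theta>"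
          unfolding Y_def by (intro L2_Cauchy_Schwarz L2_diff w test_L2 \<phi> \<theta>)
        have "cmod (\<integral>\<xi>. (g \<xi> - fourier (\<phi> n) \<xi>) * cnj (fourier \<theta> \<xi>) \<partial>lborel)
          \<le> sqrt (\<integral>\<xi>. (cmod (g \<xi> - fourier (\<phi> n) \<xi>))\<^sup>2 \<partial>lborel) * sqrt (\<integral>\<xi>. (cmod (cnj (fourier \<theta> \<xi>)))\<^sup>2 \<partial>lborel)"
          by (rule complex_Cauchy_Schwarz(2)) (use main(1)[OF \<phi>(1)] fourier_Plancherel(1)[OF \<theta>] in auto)
        also have "\<dots> \<le> l2norm (\<lambda>x. w x - \<phi> n x) * l2norm \<theta>"
          using main(2)[OF \<phi>(1), of n] fourier_Plancherel(2)[OF \<theta>]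
          by (intro mult_mono real_le_lsqrt) auto
        finally show "cmod X \<le> l2norm (\<lambda>x. w x - \<phi> n x) * l2norm \<theta>" unfolding X_def .
      qed
      also have "\<dots> = l2norm (\<lambda>x. w x - \<phi> n x) * (2 * l2norm \<theta>)" by simp
      also have "\<dots> \<le> (1 / real (Suc n)) * (2 * l2norm \<theta>)" using \<phi>(2)[of n] by (intro mult_right_mono) auto
      finally show ?thesis .
    qed
    have "(\<lambda>n. (1 / real (Suc n)) * (2 * l2norm \<theta>)) \<longlonglongrightarrow> 0 * (2 * l2norm \<theta>)"
      by (intro tendsto_intros LIMSEQ_Suc[OF lim_1_over_n])
    then have "cmod ?E \<le> 0 * (2 * l2norm \<theta>)" by (rule LIMSEQ_le_const) (use bd in auto)
    then show ?thesis by simp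
  qed
  with gm g2 g2le int show thesis by (intro that)
qed

section \<open>The norm of \<open>H\<^sup>-\<^sup>1\<close>\<close>

lemma weight_le: 
  fixes \<tau> \<xi> :: real assumes "\<tau> > 0"
  shows "1 / (\<xi>\<^sup>2 + \<tau>\<^sup>2) \<le> (1 + 1 / \<tau>\<^sup>2) * (1 / (\<xi>\<^sup>2 + 1))"
proof -
  have p: "\<xi>\<^sup>2 + 1 > 0" "\<xi>\<^sup>2 + \<tau>\<^sup>2 > 0" using assms by (auto simp: add_nonneg_pos)
  have "(1 + 1 / \<tau>\<^sup>2) * (\<xi>\<^sup>2 + \<tau>\<^sup>2) = \<xi>\<^sup>2 + \<tau>\<^sup>2 + \<xi>\<^sup>2 / \<tau>\<^sup>2 + 1" using assms by (simp add: field_simps)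
  moreover have "0 \<le> \<xi>\<^sup>2 / \<tau>\<^sup>2" "0 \<le> \<tau>\<^sup>2" by auto
  ultimately have "\<xi>\<^sup>2 + 1 \<le> (1 + 1 / \<tau>\<^sup>2) * (\<xi>\<^sup>2 + \<tau>\<^sup>2)" by linarith
  then show ?thesis using p by (simp add: divide_le_eq le_divide_eq mult.commute)
qed

lemma Hneg_weight_integrable:
  assumes g: "Hneg_transform T g" and \<tau>: "\<tau> > 0"
  shows "integrable lborel (\<lambda>\<xi>. (cmod (g \<xi>))\<^sup>2 / (\<xi>\<^sup>2 + \<tau>\<^sup>2))"
proof (rule Bochner_Integration.integrable_bound)
  have [measurable]: "g \<in> borel_measurable borel" using g by (simp add: Hneg_transform_def has_fourier_def)
  show "integrable lborel (\<lambda>\<xi>. (1 + 1 / \<tau>\<^sup>2) * ((cmod (g \<xi>))\<^sup>2 / (\<xi>\<^sup>2 + 1)))"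
    using g by (intro integrable_mult_right) (auto simp: Hneg_transform_def)
  show "AE \<xi> in lborel. norm ((cmod (g \<xi>))\<^sup>2 / (\<xi>\<^sup>2 + \<tau>\<^sup>2)) \<le> norm ((1 + 1 / \<tau>\<^sup>2) * ((cmod (g \<xi>))\<^sup>2 / (\<xi>\<^sup>2 + 1)))"
  proof (rule AE_I2)
    fix \<xi>
    have "(cmod (g \<xi>))\<^sup>2 * (1 / (\<xi>\<^sup>2 + \<tau>\<^sup>2)) \<le> (cmod (g \<xi>))\<^sup>2 * ((1 + 1 / \<tau>\<^sup>2) * (1 / (\<xi>\<^sup>2 + 1)))"
      by (rule mult_left_mono[OF weight_le[OF \<tau>]]) simp
    then have "(cmod (g \<xi>))\<^sup>2 / (\<xi>\<^sup>2 + \<tau>\<^sup>2) \<le> (1 + 1 / \<tau>\<^sup>2) * ((cmod (g \<xi>))\<^sup>2 / (\<xi>\<^sup>2 + 1))" by (simp add: mult_ac)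
    moreover have "0 \<le> (cmod (g \<xi>))\<^sup>2 / (\<xi>\<^sup>2 + \<tau>\<^sup>2)" by simp
    ultimately show "norm ((cmod (g \<xi>))\<^sup>2 / (\<xi>\<^sup>2 + \<tau>\<^sup>2)) \<le> norm ((1 + 1 / \<tau>\<^sup>2) * ((cmod (g \<xi>))\<^sup>2 / (\<xi>\<^sup>2 + 1)))"
      unfolding real_norm_def by linarith
  qed
qed (use g in \<open>auto simp: Hneg_transform_def has_fourier_def\<close>)

text \<open>The Cauchy--Schwarz inequality with the weight \<open>sqrt (\<xi>\<^sup>2 + \<tau>\<^sup>2)\<close> moved from one factor to the other; on
the side of \<open>\<phi>\<close> Plancherel's identity evaluates the norm.\<close>

lemma Hneg_transform_bound:
  assumes g: "Hneg_transform T g" and \<tau>: "\<tau> > 0" and \<phi>: "test_function \<phi>"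
  shows "\<bar>T \<phi>\<bar> \<le> sqrt (\<integral>\<xi>. (cmod (g \<xi>))\<^sup>2 / (\<xi>\<^sup>2 + \<tau>\<^sup>2) \<partial>lborel) * sqrt ((l2norm (deriv \<phi>))\<^sup>2 + \<tau>\<^sup>2 * (l2norm \<phi>)\<^sup>2)"
proof -
  have [measurable]: "g \<in> borel_measurable borel" using g by (simp add: Hneg_transform_def has_fourier_def)
  have [measurable]: "fourier \<phi> \<in> borel_measurable borel" by (rule fourier_test_measurable[OF \<phi>])
  have pos: "\<xi>\<^sup>2 + \<tau>\<^sup>2 > 0" for \<xi> using \<tau> by (simp add: add_nonneg_pos)
  define s where "s = (\<lambda>\<xi>. complex_of_real (sqrt (\<xi>\<^sup>2 + \<tau>\<^sup>2)))"
  have [measurable]: "s \<in> borel_measurable borel" unfolding s_def by measurable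
  have s0: "s \<xi> \<noteq> 0" and sn: "(cmod (s \<xi>))\<^sup>2 = \<xi>\<^sup>2 + \<tau>\<^sup>2" for \<xi>
    using pos[of \<xi>] by (auto simp: s_def norm_of_real)
  have a: "integrable lborel (\<lambda>\<xi>. (cmod (g \<xi> / s \<xi>))\<^sup>2)"
    using Hneg_weight_integrable[OF g \<tau>] by (simp add: norm_divide power_divide sn)
  note P = fourier_Plancherel[OF \<phi>] and P' = fourier_Plancherel[OF test_function_deriv[OF \<phi>]]
  have eq: "(cmod (s \<xi> * cnj (fourier \<phi> \<xi>)))\<^sup>2 = (cmod (fourier (deriv \<phi>) \<xi>))\<^sup>2 + \<tau>\<^sup>2 * (cmod (fourier \<phi> \<xi>))\<^sup>2" for \<xi>
    by (simp add: norm_mult power_mult_distrib sn fourier_deriv[OF \<phi>] distrib_right)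
  have b: "integrable lborel (\<lambda>\<xi>. (cmod (s \<xi> * cnj (fourier \<phi> \<xi>)))\<^sup>2)"
    "(\<integral>\<xi>. (cmod (s \<xi> * cnj (fourier \<phi> \<xi>)))\<^sup>2 \<partial>lborel) = (l2norm (deriv \<phi>))\<^sup>2 + \<tau>\<^sup>2 * (l2norm \<phi>)\<^sup>2"
    unfolding eq using P P' by auto
  have "complex_of_real (T \<phi>) = (\<integral>\<xi>. (g \<xi> / s \<xi>) * (s \<xi> * cnj (fourier \<phi> \<xi>)) \<partial>lborel)"
    using g \<phi> s0 by (simp add: Hneg_transform_def has_fourier_def)
  then have "\<bar>T \<phi>\<bar> = cmod (\<integral>\<xi>. (g \<xi> / s \<xi>) * (s \<xi> * cnj (fourier \<phi> \<xi>)) \<partial>lborel)"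
    by (metis norm_of_real)
  also have "\<dots> \<le> sqrt (\<integral>\<xi>. (cmod (g \<xi> / s \<xi>))\<^sup>2 \<partial>lborel) * sqrt (\<integral>\<xi>. (cmod (s \<xi> * cnj (fourier \<phi> \<xi>)))\<^sup>2 \<partial>lborel)"
    by (rule complex_Cauchy_Schwarz(2)[OF _ _ a b(1)]) measurable
  finally show ?thesis by (simp add: b(2) norm_divide power_divide sn)
qed

corollary Hneg_norm_bound:
  assumes T: "Hneg T" and \<tau>: "\<tau> > 0" and \<phi>: "test_function \<phi>"
  shows "\<bar>T \<phi>\<bar> \<le> Hneg_norm \<tau> T * sqrt ((l2norm (deriv \<phi>))\<^sup>2 + \<tau>\<^sup>2 * (l2norm \<phi>)\<^sup>2)"
proof -
  have "Hneg_transform T (SOME g. Hneg_transform T g)" using T unfolding Hneg_def by (rule someI_ex)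
  from Hneg_transform_bound[OF this \<tau> \<phi>] show ?thesis by (simp add: Hneg_norm_def Let_def)
qed

lemma H1_norm_test:
  assumes \<phi>: "test_function \<phi>" shows "H1_norm \<phi> = sqrt ((l2norm \<phi>)\<^sup>2 + (l2norm (deriv \<phi>))\<^sup>2)"
  by (rule H1_pair_norm[OF H1_pair_test[OF \<phi>] test_measurable[OF \<phi>]]) simp

lemma Hneg_imp_H1_bounded:
  assumes T: "Hneg T"
    and lin: "\<And>\<phi> \<theta> c. test_function \<phi> \<Longrightarrow> test_function \<theta> \<Longrightarrow> T (\<lambda>x. \<phi> x + c * \<theta> x) = T \<phi> + c * T \<theta>"
  shows "H1_bounded T"
  unfolding H1_bounded_def
proof (intro conjI allI impI lin exI)
  show "\<bar>T \<phi>\<bar> \<le> Hneg_norm 1 T * H1_norm \<phi>" if "test_function \<phi>" for \<phi>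
    using Hneg_norm_bound[OF T, of 1 \<phi>] that by (simp add: H1_norm_test add.commute)
qed

lemma fourier_translate:
  "fourier (\<lambda>x. f (x - y)) \<xi> = cis (- (\<xi> * y)) * fourier f \<xi>"
proof -
  have "(\<integral>x. cis (- (\<xi> * x)) * complex_of_real (f (x - y)) \<partial>lborel)
    = \<bar>1\<bar> *\<^sub>R (\<integral>x. cis (- (\<xi> * (y + 1 * x))) * complex_of_real (f ((y + 1 * x) - y)) \<partial>lborel)"
    by (rule lborel_integral_real_affine) simp
  also have "\<dots> = (\<integral>x. cis (- (\<xi> * y)) * (cis (- (\<xi> * x)) * complex_of_real (f x)) \<partial>lborel)"
    by (simp add: cis_mult mult.assoc[symmetric] distrib_left add.commute)
  also have "\<dots> = cis (- (\<xi> * y)) * (\<integral>x. cis (- (\<xi> * x)) * complex_of_real (f x) \<partial>lborel)" by simp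
  finally show ?thesis by (simp add: fourier_def)
qed

lemma test_function_translate: "test_function \<phi> \<Longrightarrow> test_function (\<lambda>x. \<phi> (x - y))"
proof -
  assume \<phi>: "test_function \<phi>"
  obtain R where R: "\<And>x. R \<le> \<bar>x\<bar> \<Longrightarrow> \<phi> x = 0" using test_function_support[OF \<phi>] by metis
  have "smooth (\<lambda>x. \<phi> (1 * x + - y))" by (intro smooth_affine test_smooth \<phi>)
  then show ?thesis unfolding test_function_iff by (auto intro!: exI[of _ "R + \<bar>y\<bar>"] R)
qed

text \<open>On the support of a bump that vanishes outside \<open>\<bar>x\<bar> \<le> 1 / (n + 1)\<close> the cosine \<open>cos (\<xi> x)\<close> is at least \<open>1 / 2\<close> for
\<open>\<bar>\<xi>\<bar> \<le> n\<close>, so the real part of the transform is positive.\<close>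

lemma fourier_bump_nonzero:
  obtains p :: "nat \<Rightarrow> real \<Rightarrow> real" where "\<And>n. test_function (p n)" "\<And>n \<xi>. \<bar>\<xi>\<bar> \<le> real n \<Longrightarrow> fourier (p n) \<xi> \<noteq> 0"
proof -
  define r where "r = (\<lambda>n. 1 / (2 * real (Suc n)))"
  have r: "r n > 0" for n by (simp add: r_def)
  define p where "p = (\<lambda>n. plateau (- r n) (r n) (r n))"
  have p: "test_function (p n)" for n using r by (simp add: p_def test_function_plateau)
  have "fourier (p n) \<xi> \<noteq> 0" if \<xi>: "\<bar>\<xi>\<bar> \<le> real n" for n \<xi>
  proof
    assume "fourier (p n) \<xi> = 0"
    then have "complex_of_real (\<integral>x. cos (\<xi> * x) * p n x \<partial>lborel) - \<i> * complex_of_real (\<integral>x. sin (\<xi> * x) * p n x \<partial>lborel) = 0"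
      unfolding fourier_cos_sin[OF test_integrable[OF p], symmetric] by (simp add: fourier_def)
    then have 0: "(\<integral>x. cos (\<xi> * x) * p n x \<partial>lborel) = 0" by (simp add: complex_eq_iff)
    have i: "integrable lborel (\<lambda>x. cos (\<xi> * x) * p n x)"
      by (intro integrable_loc_mult_test loc_integrable_continuous continuous_intros p)
    have half: "1 / 2 \<le> cos y" if "\<bar>y\<bar> \<le> 1" for y :: real
    proof -
      have "cos (pi / 3) \<le> cos \<bar>y\<bar>" using that pi_gt3 by (intro cos_monotone_0_pi_le) auto
      then show ?thesis by (simp add: cos_60)
    qed
    have "(\<integral>x. 1 / 2 * indicator {- r n..r n} x \<partial>lborel) \<le> (\<integral>x. cos (\<xi> * x) * p n x \<partial>lborel)"
    proof (rule integral_mono[OF integrable_mult_right[OF integrable_indicator_Icc] i])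
      fix x
      show "1 / 2 * indicator {- r n..r n} x \<le> cos (\<xi> * x) * p n x"
      proof (cases "\<bar>x\<bar> \<le> 2 * r n")
        case True
        have "\<bar>\<xi> * x\<bar> \<le> real n * (2 * r n)" unfolding abs_mult by (intro mult_mono \<xi> True) auto
        also have "\<dots> \<le> 1" by (simp add: r_def field_simps)
        finally have c: "1 / 2 \<le> cos (\<xi> * x)" by (rule half)
        have "indicator {- r n..r n} x \<le> p n x"
          using plateau_range[of "- r n" "r n" "r n" x] plateau_1[OF r[of n], of "- r n" x "r n"] by (auto simp: indicator_def p_def)
        then have "1 / 2 * indicator {- r n..r n} x \<le> 1 / 2 * p n x" by simp
        also have "\<dots> \<le> cos (\<xi> * x) * p n x" using c by (rule mult_right_mono) (simp add: p_def plateau_range)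
        finally show ?thesis .
      next
        case False
        then have "x \<le> - r n - r n \<or> r n + r n \<le> x" by linarith
        then have "p n x = 0" unfolding p_def by (rule plateau_0[OF r])
        moreover have "x \<notin> {- r n..r n}" using False r[of n] by auto
        ultimately show ?thesis by simp
      qed
    qed
    then show False using 0 r[of n] by simp
  qed
  with p show thesis by (rule that)
qed

text \<open>A test function can be translated, so the product of the difference of two transforms with
\<open>cnj (fourier \<phi> \<xi>)\<close> has vanishing inverse transform; and for every \<open>\<xi>\<close> there is a narrow bump whose
transform does not vanish at \<open>\<xi>\<close>.\<close>

lemma Hneg_transform_unique:
  assumes g: "Hneg_transform T g" and h: "Hneg_transform T h"
  shows "AE \<xi> in lborel. g \<xi> = h \<xi>"
proof -
  define k where "k = (\<lambda>\<xi>. g \<xi> - h \<xi>)"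
  have gm [measurable]: "g \<in> borel_measurable borel" "h \<in> borel_measurable borel" 
    using g h by (auto simp: Hneg_transform_def has_fourier_def)
  have [measurable]: "k \<in> borel_measurable borel" unfolding k_def by measurable
  have kw: "integrable lborel (\<lambda>\<xi>. (cmod (k \<xi>))\<^sup>2 / (\<xi>\<^sup>2 + 1))"
  proof (rule Bochner_Integration.integrable_bound)
    show "integrable lborel (\<lambda>\<xi>. 2 * ((cmod (g \<xi>))\<^sup>2 / (\<xi>\<^sup>2 + 1)) + 2 * ((cmod (h \<xi>))\<^sup>2 / (\<xi>\<^sup>2 + 1)))"
      using g h by (intro Bochner_Integration.integrable_add integrable_mult_right) (auto simp: Hneg_transform_def)
    show "AE \<xi> in lborel. norm ((cmod (k \<xi>))\<^sup>2 / (\<xi>\<^sup>2 + 1)) \<le> norm (2 * ((cmod (g \<xi>))\<^sup>2 / (\<xi>\<^sup>2 + 1)) + 2 * ((cmod (h \<xi>))\<^sup>2 / (\<xi>\<^sup>2 + 1)))"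
    proof (rule AE_I2)
      fix \<xi> :: real
      have "(cmod (k \<xi>))\<^sup>2 \<le> (cmod (g \<xi>) + cmod (h \<xi>))\<^sup>2"
        unfolding k_def by (intro power_mono norm_triangle_ineq4) auto
      also have "\<dots> \<le> 2 * (cmod (g \<xi>))\<^sup>2 + 2 * (cmod (h \<xi>))\<^sup>2"
        using sum_squares_bound[of "cmod (g \<xi>)" "cmod (h \<xi>)"] by (simp add: power2_sum)
      finally have "(cmod (k \<xi>))\<^sup>2 / (\<xi>\<^sup>2 + 1) \<le> (2 * (cmod (g \<xi>))\<^sup>2 + 2 * (cmod (h \<xi>))\<^sup>2) / (\<xi>\<^sup>2 + 1)"
        by (rule divide_right_mono) (simp add: add_nonneg_nonneg)
      moreover have "0 \<le> (cmod (k \<xi>))\<^sup>2 / (\<xi>\<^sup>2 + 1)" by simp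
      ultimately show "norm ((cmod (k \<xi>))\<^sup>2 / (\<xi>\<^sup>2 + 1)) \<le> norm (2 * ((cmod (g \<xi>))\<^sup>2 / (\<xi>\<^sup>2 + 1)) + 2 * ((cmod (h \<xi>))\<^sup>2 / (\<xi>\<^sup>2 + 1)))"
        by (simp add: add_divide_distrib)
    qed
  qed measurable
  have k0: "integrable lborel (\<lambda>\<xi>. k \<xi> * cnj (fourier \<phi> \<xi>))" "(\<integral>\<xi>. k \<xi> * cnj (fourier \<phi> \<xi>) \<partial>lborel) = 0" if "test_function \<phi>" for \<phi>
  proof -
    have "integrable lborel (\<lambda>\<xi>. g \<xi> * cnj (fourier \<phi> \<xi>))" "integrable lborel (\<lambda>\<xi>. h \<xi> * cnj (fourier \<phi> \<xi>))"
      "(\<integral>\<xi>. g \<xi> * cnj (fourier \<phi> \<xi>) \<partial>lborel) = (\<integral>\<xi>. h \<xi> * cnj (fourier \<phi> \<xi>) \<partial>lborel)"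
      using g h that unfolding Hneg_transform_def has_fourier_def by metis+
    then show "integrable lborel (\<lambda>\<xi>. k \<xi> * cnj (fourier \<phi> \<xi>))" "(\<integral>\<xi>. k \<xi> * cnj (fourier \<phi> \<xi>) \<partial>lborel) = 0"
      by (simp_all add: k_def left_diff_distrib)
  qed
  have prod0: "AE \<xi> in lborel. k \<xi> * cnj (fourier \<phi> \<xi>) = 0" if \<phi>: "test_function \<phi>" for \<phi>
  proof -
    have [measurable]: "fourier \<phi> \<in> borel_measurable borel" by (rule fourier_test_measurable[OF \<phi>])
    define u where "u = (\<lambda>\<xi>. k \<xi> * cnj (fourier \<phi> \<xi>))"
    have um [measurable]: "u \<in> borel_measurable borel" unfolding u_def by measurable
    have ui: "integrable lborel u" unfolding u_def by (rule k0(1)[OF \<phi>])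
    have tr: "(\<integral>\<xi>. cis (\<xi> * y) * u \<xi> \<partial>lborel) = 0" for y
      using k0(2)[OF test_function_translate[OF \<phi>, of y]] by (simp add: fourier_translate u_def cis_cnj mult_ac)
    have u\<theta>: "(\<integral>\<xi>. u \<xi> * complex_of_real (\<theta> \<xi>) \<partial>lborel) = 0" and u\<theta>i: "integrable lborel (\<lambda>\<xi>. u \<xi> * complex_of_real (\<theta> \<xi>))" 
      if \<theta>: "test_function \<theta>" for \<theta>
    proof -
      let ?c = "complex_of_real (sqrt (2 * pi))"
      have "?c * (\<integral>\<xi>. u \<xi> * complex_of_real (\<theta> \<xi>) \<partial>lborel) = (\<integral>\<xi>. u \<xi> * (\<integral>y. cis (\<xi> * y) * fourier \<theta> y \<partial>lborel) \<partial>lborel)"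
        unfolding fourier_inversion[OF \<theta>] by (simp flip: integral_mult_right_zero add: mult_ac)
      also have "\<dots> = (\<integral>y. fourier \<theta> y * (\<integral>\<xi>. cis (\<xi> * y) * u \<xi> \<partial>lborel) \<partial>lborel)"
        by (rule Fubini_bounded_kernel[OF ui fourier_test_integrable[OF \<theta>]]) auto
      also have "\<dots> = 0" by (simp add: tr)
      finally show "(\<integral>\<xi>. u \<xi> * complex_of_real (\<theta> \<xi>) \<partial>lborel) = 0" by simp
      obtain B where B: "\<And>x. \<bar>\<theta> x\<bar> \<le> B" using test_bounded[OF \<theta>] by metis
      have [measurable]: "\<theta> \<in> borel_measurable borel" by (rule test_measurable[OF \<theta>])
      show "integrable lborel (\<lambda>\<xi>. u \<xi> * complex_of_real (\<theta> \<xi>))"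
      proof (rule Bochner_Integration.integrable_bound)
        show "integrable lborel (\<lambda>\<xi>. B * cmod (u \<xi>))" using ui by simp
        show "AE \<xi> in lborel. norm (u \<xi> * complex_of_real (\<theta> \<xi>)) \<le> norm (B * cmod (u \<xi>))"
          using order_trans[OF B abs_ge_self] by (intro AE_I2) (auto simp: norm_mult abs_mult mult.commute intro!: mult_right_mono)
      qed measurable
    qed
    obtain C where C: "C > 0" "\<And>\<xi>. cmod (fourier \<phi> \<xi>) \<le> C / (1 + \<xi>\<^sup>2)" using fourier_test_decay[OF \<phi>] by metis
    \<comment> \<open>The decay of \<open>fourier \<phi>\<close> absorbs the weight of \<open>k\<close>, so that \<open>u\<close> is square integrable and the
      uniqueness lemma for real functions applies to its real and imaginary part.\<close>
    have u2: "integrable lborel (\<lambda>\<xi>. (cmod (u \<xi>))\<^sup>2)"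
    proof (rule Bochner_Integration.integrable_bound)
      show "integrable lborel (\<lambda>\<xi>. C\<^sup>2 * ((cmod (k \<xi>))\<^sup>2 / (\<xi>\<^sup>2 + 1)))" by (rule integrable_mult_right[OF kw])
      show "AE \<xi> in lborel. norm ((cmod (u \<xi>))\<^sup>2) \<le> norm (C\<^sup>2 * ((cmod (k \<xi>))\<^sup>2 / (\<xi>\<^sup>2 + 1)))"
      proof (rule AE_I2)
        fix \<xi> :: real
        define q where "q = 1 + \<xi>\<^sup>2"
        have q: "q \<ge> 1" by (simp add: q_def)
        have "(cmod (fourier \<phi> \<xi>))\<^sup>2 \<le> (C / q)\<^sup>2" unfolding q_def by (intro power_mono C(2)) auto
        also have "\<dots> \<le> C\<^sup>2 / q"
        proof -
          have "q \<le> q\<^sup>2" using q by (simp add: power2_eq_square)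
          then have "C\<^sup>2 / q\<^sup>2 \<le> C\<^sup>2 / q" using q by (intro divide_left_mono) auto
          then show ?thesis by (simp add: power_divide)
        qed
        finally have "(cmod (k \<xi>))\<^sup>2 * (cmod (fourier \<phi> \<xi>))\<^sup>2 \<le> (cmod (k \<xi>))\<^sup>2 * (C\<^sup>2 / q)" by (intro mult_left_mono) auto
        then show "norm ((cmod (u \<xi>))\<^sup>2) \<le> norm (C\<^sup>2 * ((cmod (k \<xi>))\<^sup>2 / (\<xi>\<^sup>2 + 1)))"
          using q by (simp add: u_def norm_mult power_mult_distrib q_def mult_ac add.commute)
      qed
    qed measurable
    have "(Re z)\<^sup>2 \<le> (cmod z)\<^sup>2" "(Im z)\<^sup>2 \<le> (cmod z)\<^sup>2" for z by (auto simp: cmod_power2)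
    then have "integrable lborel (\<lambda>\<xi>. (Re (u \<xi>))\<^sup>2)" "integrable lborel (\<lambda>\<xi>. (Im (u \<xi>))\<^sup>2)"
      by (auto intro!: Bochner_Integration.integrable_bound[OF u2])
    then have L: "L2_loc (\<lambda>\<xi>. Re (u \<xi>))" "L2_loc (\<lambda>\<xi>. Im (u \<xi>))"
      by (auto intro!: L2_imp_L2_loc simp: L2_def)
    have "AE \<xi> in lborel. Re (u \<xi>) = 0"
    proof (rule L2_loc_eq_0_AE[OF L(1)])
      fix \<theta> assume \<theta>: "test_function \<theta>"
      have "Re (\<integral>\<xi>. u \<xi> * complex_of_real (\<theta> \<xi>) \<partial>lborel) = (\<integral>\<xi>. Re (u \<xi> * complex_of_real (\<theta> \<xi>)) \<partial>lborel)"
        by (rule integral_Re[OF u\<theta>i[OF \<theta>], symmetric])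
      then show "(\<integral>\<xi>. Re (u \<xi>) * \<theta> \<xi> \<partial>lborel) = 0" by (simp add: u\<theta>[OF \<theta>])
    qed
    moreover have "AE \<xi> in lborel. Im (u \<xi>) = 0"
    proof (rule L2_loc_eq_0_AE[OF L(2)])
      fix \<theta> assume \<theta>: "test_function \<theta>"
      have "Im (\<integral>\<xi>. u \<xi> * complex_of_real (\<theta> \<xi>) \<partial>lborel) = (\<integral>\<xi>. Im (u \<xi> * complex_of_real (\<theta> \<xi>)) \<partial>lborel)"
        by (rule integral_Im[OF u\<theta>i[OF \<theta>], symmetric])
      then show "(\<integral>\<xi>. Im (u \<xi>) * \<theta> \<xi> \<partial>lborel) = 0" by (simp add: u\<theta>[OF \<theta>])
    qed
    ultimately show ?thesis 
    proof eventually_elim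
      fix \<xi> assume "Re (u \<xi>) = 0" "Im (u \<xi>) = 0"
      then have "u \<xi> = 0" by (simp add: complex_eq_iff)
      then show "k \<xi> * cnj (fourier \<phi> \<xi>) = 0" by (simp only: u_def)
    qed
  qed
  obtain p :: "nat \<Rightarrow> real \<Rightarrow> real" where p: "\<And>n. test_function (p n)" "\<And>n \<xi>. \<bar>\<xi>\<bar> \<le> real n \<Longrightarrow> fourier (p n) \<xi> \<noteq> 0"
    using fourier_bump_nonzero by metis
  have "AE \<xi> in lborel. \<forall>n. k \<xi> * cnj (fourier (p n) \<xi>) = 0"
    unfolding AE_all_countable using prod0[OF p(1)] by blast
  then show ?thesis
  proof eventually_elim
    fix \<xi> assume *: "\<forall>n. k \<xi> * cnj (fourier (p n) \<xi>) = 0"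
    obtain n where "\<bar>\<xi>\<bar> \<le> real n" using real_arch_simple by blast
    with * p(2) show "g \<xi> = h \<xi>" by (auto simp: k_def)
  qed
qed

lemma Hneg_norm_eq:
  assumes g: "Hneg_transform T g"
  shows "Hneg_norm \<tau> T = sqrt (\<integral>\<xi>. (cmod (g \<xi>))\<^sup>2 / (\<xi>\<^sup>2 + \<tau>\<^sup>2) \<partial>lborel)"
proof -
  define h where "h = (SOME g. Hneg_transform T g)"
  have h: "Hneg_transform T h" unfolding h_def by (rule someI[of "Hneg_transform T", OF g])
  have [measurable]: "g \<in> borel_measurable borel" "h \<in> borel_measurable borel" 
    using g h by (auto simp: Hneg_transform_def has_fourier_def)
  have "(\<integral>\<xi>. (cmod (h \<xi>))\<^sup>2 / (\<xi>\<^sup>2 + \<tau>\<^sup>2) \<partial>lborel) = (\<integral>\<xi>. (cmod (g \<xi>))\<^sup>2 / (\<xi>\<^sup>2 + \<tau>\<^sup>2) \<partial>lborel)"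
    by (rule integral_cong_AE) (use Hneg_transform_unique[OF h g] in auto)
  then show ?thesis by (simp add: Hneg_norm_def h_def Let_def)
qed

section \<open>The Miura distribution\<close>

lemma miura_integrable:
  assumes w: "L2_loc w" and \<phi>: "test_function \<phi>"
  shows "integrable lborel (\<lambda>x. w x * deriv \<phi> x)" "integrable lborel (\<lambda>x. (w x)\<^sup>2 * \<phi> x)" "integrable lborel (\<lambda>x. w x * \<phi> x)"
  by (intro integrable_loc_mult_test L2_loc_imp_loc_integrable L2_loc_square w test_function_deriv \<phi>)+

lemma miura_eq:
  assumes w: "L2_loc w" and \<phi>: "test_function \<phi>"
  shows "miura \<tau> w \<phi> = - (\<integral>x. w x * deriv \<phi> x \<partial>lborel) + (\<integral>x. (w x)\<^sup>2 * \<phi> x \<partial>lborel) + 2 * \<tau> * (\<integral>x. w x * \<phi> x \<partial>lborel)"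
  using miura_integrable[OF w \<phi>] by (simp add: miura_def ddx_def regular_def distrib_right mult.assoc)

lemma miura_lincomb:
  assumes w: "L2_loc w" and \<phi>: "test_function \<phi>" and \<theta>: "test_function \<theta>"
  shows "miura \<tau> w (\<lambda>x. \<phi> x + c * \<theta> x) = miura \<tau> w \<phi> + c * miura \<tau> w \<theta>"
proof -
  have t: "test_function (\<lambda>x. \<phi> x + c * \<theta> x)" by (intro test_function_add test_function_cmult \<phi> \<theta>)
  have d: "deriv (\<lambda>x. \<phi> x + c * \<theta> x) x = deriv \<phi> x + c * deriv \<theta> x" for x
    using deriv_add_smooth[OF test_smooth[OF \<phi>] test_smooth[OF test_function_cmult[OF \<theta>]], of c x]
      deriv_cmult_smooth[OF test_smooth[OF \<theta>], of c x] by simp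
  have "(\<lambda>x. w x * (deriv \<phi> x + c * deriv \<theta> x)) = (\<lambda>x. w x * deriv \<phi> x + c * (w x * deriv \<theta> x))"
    "(\<lambda>x. (w x)\<^sup>2 * (\<phi> x + c * \<theta> x)) = (\<lambda>x. (w x)\<^sup>2 * \<phi> x + c * ((w x)\<^sup>2 * \<theta> x))"
    "(\<lambda>x. w x * (\<phi> x + c * \<theta> x)) = (\<lambda>x. w x * \<phi> x + c * (w x * \<theta> x))" by (auto simp: algebra_simps)
  then show ?thesis
    unfolding miura_eq[OF w t] miura_eq[OF w \<phi>] miura_eq[OF w \<theta>] d
    using miura_integrable[OF w \<phi>] miura_integrable[OF w \<theta>] by (simp add: algebra_simps)
qed

lemma miura_H1_bounded: "L2_loc w \<Longrightarrow> Hneg (miura \<tau> w) \<Longrightarrow> H1_bounded (miura \<tau> w)"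
  by (intro Hneg_imp_H1_bounded miura_lincomb)

text \<open>With \<open>a = w + \<tau>\<close> the distribution plus \<open>\<tau>\<^sup>2\<close> is \<open>a' + a\<^sup>2\<close>, and the operator factors.\<close>

lemma miura_factorization:
  assumes w: "L2_loc w" and \<phi>: "test_function \<phi>"
  shows "(\<integral>x. (deriv \<phi> x)\<^sup>2 \<partial>lborel) + miura \<tau> w (\<lambda>x. \<phi> x * \<phi> x) + \<tau>\<^sup>2 * (l2norm \<phi>)\<^sup>2
      = (\<integral>x. (deriv \<phi> x - (w x + \<tau>) * \<phi> x)\<^sup>2 \<partial>lborel)"
    and "integrable lborel (\<lambda>x. (deriv \<phi> x - (w x + \<tau>) * \<phi> x)\<^sup>2)"
proof -
  have p: "test_function (\<lambda>x. \<phi> x * \<phi> x)" by (rule test_function_mult[OF \<phi> \<phi>])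
  have d: "deriv (\<lambda>x. \<phi> x * \<phi> x) x = 2 * (\<phi> x * deriv \<phi> x)" for x
    using deriv_mult_test[OF test_smooth[OF \<phi>] test_smooth[OF \<phi>], of x] by simp
  note i = miura_integrable[OF w p, unfolded d]
  have i0: "integrable lborel (\<lambda>x. \<phi> x * deriv \<phi> x)"
    by (intro test_integrable test_function_mult test_function_deriv \<phi>)
  have i1: "integrable lborel (\<lambda>x. (deriv \<phi> x)\<^sup>2)" "integrable lborel (\<lambda>x. (\<phi> x)\<^sup>2)"
    by (intro L2_integrable test_L2 test_function_deriv \<phi>)+
  have z: "(\<integral>x. \<phi> x * deriv \<phi> x \<partial>lborel) = 0"
    using abs_cont_by_parts[OF abs_cont_smooth[OF test_smooth[OF \<phi>]] \<phi>] by (simp add: mult.commute)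
  have eq: "(deriv \<phi> x - (w x + \<tau>) * \<phi> x)\<^sup>2 = (deriv \<phi> x)\<^sup>2 - w x * (2 * (\<phi> x * deriv \<phi> x)) + (w x)\<^sup>2 * (\<phi> x * \<phi> x)
      + 2 * \<tau> * (w x * (\<phi> x * \<phi> x)) + \<tau>\<^sup>2 * (\<phi> x)\<^sup>2 - 2 * \<tau> * (\<phi> x * deriv \<phi> x)" for x
    by (simp add: power2_eq_square algebra_simps)
  show "integrable lborel (\<lambda>x. (deriv \<phi> x - (w x + \<tau>) * \<phi> x)\<^sup>2)"
    unfolding eq by (intro Bochner_Integration.integrable_add Bochner_Integration.integrable_diff integrable_mult_right[of "2 * \<tau>"] 
        integrable_mult_right[of "\<tau>\<^sup>2"] i i0 i1)
  have "(\<integral>x. (deriv \<phi> x - (w x + \<tau>) * \<phi> x)\<^sup>2 \<partial>lborel)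
      = (\<integral>x. (deriv \<phi> x)\<^sup>2 \<partial>lborel) - (\<integral>x. w x * (2 * (\<phi> x * deriv \<phi> x)) \<partial>lborel) + (\<integral>x. (w x)\<^sup>2 * (\<phi> x * \<phi> x) \<partial>lborel)
      + 2 * \<tau> * (\<integral>x. w x * (\<phi> x * \<phi> x) \<partial>lborel) + \<tau>\<^sup>2 * (\<integral>x. (\<phi> x)\<^sup>2 \<partial>lborel) - 2 * \<tau> * (\<integral>x. \<phi> x * deriv \<phi> x \<partial>lborel)"
    unfolding eq using i i0 i1 by simp
  then show "(\<integral>x. (deriv \<phi> x)\<^sup>2 \<partial>lborel) + miura \<tau> w (\<lambda>x. \<phi> x * \<phi> x) + \<tau>\<^sup>2 * (l2norm \<phi>)\<^sup>2
      = (\<integral>x. (deriv \<phi> x - (w x + \<tau>) * \<phi> x)\<^sup>2 \<partial>lborel)"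
    unfolding miura_eq[OF w p] d z l2norm_power2 by simp
qed

section \<open>The upper bound\<close>

text \<open>The weight parameter \<open>s\<close> is separate from \<open>\<tau>\<close>: membership in \<open>H\<^sup>-\<^sup>1\<close> is tested with \<open>s = 1\<close>, the norm with
\<open>s = \<tau>\<close>.  The conditions on \<open>c\<close> make \<open>\<i> \<xi> + 2 \<tau>\<close> bounded by \<open>c sqrt (\<xi>\<^sup>2 + s\<^sup>2)\<close>.\<close>

lemma miura_transform_bound:
  fixes \<tau> s c :: real and a b :: "real \<Rightarrow> complex"
  assumes s: "s > 0" and c: "c \<ge> 0" "1 \<le> c\<^sup>2" "4 * \<tau>\<^sup>2 \<le> c\<^sup>2 * s\<^sup>2"
    and [measurable]: "a \<in> borel_measurable borel" "b \<in> borel_measurable borel"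
    and a: "integrable lborel (\<lambda>\<xi>. (cmod (a \<xi>))\<^sup>2)" and b: "\<And>\<xi>. cmod (b \<xi>) \<le> M"
  defines "g \<equiv> \<lambda>\<xi>::real. (\<i> * \<xi> + 2 * \<tau>) * a \<xi> + b \<xi>"
  shows "integrable lborel (\<lambda>\<xi>. (cmod (g \<xi>))\<^sup>2 / (\<xi>\<^sup>2 + s\<^sup>2))"
    and "sqrt (\<integral>\<xi>. (cmod (g \<xi>))\<^sup>2 / (\<xi>\<^sup>2 + s\<^sup>2) \<partial>lborel) \<le> c * sqrt (\<integral>\<xi>. (cmod (a \<xi>))\<^sup>2 \<partial>lborel) + M * sqrt (pi / s)"
proof -
  have M: "M \<ge> 0" using b[of 0] norm_ge_zero order_trans by blast
  have pos: "\<xi>\<^sup>2 + s\<^sup>2 > 0" for \<xi> using s by (simp add: add_nonneg_pos)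
  define A where "A = (\<lambda>\<xi>. c * cmod (a \<xi>))"
  define B where "B = (\<lambda>\<xi>::real. M * sqrt (1 / (\<xi>\<^sup>2 + s\<^sup>2)))"
  have A: "A \<in> borel_measurable lborel" "integrable lborel (\<lambda>\<xi>. (A \<xi>)\<^sup>2)" using a by (auto simp: A_def power_mult_distrib)
  have B2: "(B \<xi>)\<^sup>2 = M\<^sup>2 * (1 / (\<xi>\<^sup>2 + s\<^sup>2))" for \<xi>
    using pos[of \<xi>] by (simp add: B_def power_mult_distrib less_imp_le)
  have B: "B \<in> borel_measurable lborel" "integrable lborel (\<lambda>\<xi>. (B \<xi>)\<^sup>2)"
    unfolding B2 using integrable_mult_right[OF inverse_quadratic_integrable(1)[OF s], of "M\<^sup>2"] by (auto simp: B_def)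
  note AB = integrable_square_add[OF A(1) B(1) A(2) B(2)]
  have [measurable]: "g \<in> borel_measurable borel" unfolding g_def by measurable
  have le: "(cmod (g \<xi>))\<^sup>2 / (\<xi>\<^sup>2 + s\<^sup>2) \<le> (A \<xi> + B \<xi>)\<^sup>2" for \<xi>
  proof -
    define q where "q = sqrt (\<xi>\<^sup>2 + s\<^sup>2)"
    have q: "q > 0" "q\<^sup>2 = \<xi>\<^sup>2 + s\<^sup>2" using pos[of \<xi>] by (auto simp: q_def)
    have "(cmod (\<i> * \<xi> + 2 * \<tau>))\<^sup>2 = \<xi>\<^sup>2 + 4 * \<tau>\<^sup>2" by (simp add: cmod_power2)
    also have "\<dots> \<le> c\<^sup>2 * \<xi>\<^sup>2 + c\<^sup>2 * s\<^sup>2" using c mult_right_mono[OF c(2), of "\<xi>\<^sup>2"] by simp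
    also have "\<dots> = (c * q)\<^sup>2" by (simp add: power_mult_distrib q distrib_left)
    finally have "cmod (\<i> * \<xi> + 2 * \<tau>) \<le> c * q" by (rule power2_le_imp_le) (use c q in auto)
    then have "cmod ((\<i> * \<xi> + 2 * \<tau>) * a \<xi>) \<le> c * q * cmod (a \<xi>)" unfolding norm_mult by (rule mult_right_mono) simp
    then have "cmod (g \<xi>) \<le> c * q * cmod (a \<xi>) + M"
      unfolding g_def using norm_triangle_ineq[of "(\<i> * \<xi> + 2 * \<tau>) * a \<xi>" "b \<xi>"] b[of \<xi>] by linarith
    also have "\<dots> = q * (A \<xi> + B \<xi>)"
    proof -
      have "B \<xi> = M / q" by (simp add: B_def q_def real_sqrt_divide)
      then show ?thesis using q by (simp add: A_def distrib_left)
    qed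
    finally have "(cmod (g \<xi>))\<^sup>2 \<le> (q * (A \<xi> + B \<xi>))\<^sup>2" by (intro power_mono) auto
    then have "(cmod (g \<xi>))\<^sup>2 \<le> (\<xi>\<^sup>2 + s\<^sup>2) * (A \<xi> + B \<xi>)\<^sup>2" by (simp add: power_mult_distrib q)
    then show ?thesis using pos[of \<xi>] by (simp add: divide_le_eq mult.commute)
  qed
  show i: "integrable lborel (\<lambda>\<xi>. (cmod (g \<xi>))\<^sup>2 / (\<xi>\<^sup>2 + s\<^sup>2))"
  proof (rule Bochner_Integration.integrable_bound[OF AB])
    show "AE \<xi> in lborel. norm ((cmod (g \<xi>))\<^sup>2 / (\<xi>\<^sup>2 + s\<^sup>2)) \<le> norm ((A \<xi> + B \<xi>)\<^sup>2)"
      using le pos by (intro AE_I2) (simp add: less_imp_le)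
  qed measurable
  have "sqrt (\<integral>\<xi>. (cmod (g \<xi>))\<^sup>2 / (\<xi>\<^sup>2 + s\<^sup>2) \<partial>lborel) \<le> sqrt (\<integral>\<xi>. (A \<xi> + B \<xi>)\<^sup>2 \<partial>lborel)"
    by (intro real_sqrt_le_mono integral_mono i AB le)
  also have "\<dots> \<le> sqrt (\<integral>\<xi>. (A \<xi>)\<^sup>2 \<partial>lborel) + sqrt (\<integral>\<xi>. (B \<xi>)\<^sup>2 \<partial>lborel)"
    by (rule Minkowski_square[OF A(1) B(1) A(2) B(2)])
  also have "sqrt (\<integral>\<xi>. (A \<xi>)\<^sup>2 \<partial>lborel) = c * sqrt (\<integral>\<xi>. (cmod (a \<xi>))\<^sup>2 \<partial>lborel)"
    using c by (simp add: A_def power_mult_distrib real_sqrt_mult)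
  also have "(\<integral>\<xi>. (B \<xi>)\<^sup>2 \<partial>lborel) = M\<^sup>2 * (\<integral>\<xi>. 1 / (\<xi>\<^sup>2 + s\<^sup>2) \<partial>lborel)"
    unfolding B2 by (rule integral_mult_right_zero)
  also have "sqrt \<dots> = M * sqrt (\<integral>\<xi>. 1 / (\<xi>\<^sup>2 + s\<^sup>2) \<partial>lborel)" using M by (simp add: real_sqrt_mult)
  also have "M * sqrt (\<integral>\<xi>. 1 / (\<xi>\<^sup>2 + s\<^sup>2) \<partial>lborel) \<le> M * sqrt (pi / s)"
    using M by (intro mult_left_mono real_sqrt_le_mono inverse_quadratic_integrable s)
  finally show "sqrt (\<integral>\<xi>. (cmod (g \<xi>))\<^sup>2 / (\<xi>\<^sup>2 + s\<^sup>2) \<partial>lborel) \<le> c * sqrt (\<integral>\<xi>. (cmod (a \<xi>))\<^sup>2 \<partial>lborel) + M * sqrt (pi / s)"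
    by simp
qed

theorem miura_Hneg:
  assumes \<tau>: "\<tau> > 0" and w: "L2 w"
  shows "Hneg (miura \<tau> w)" "Hneg_norm \<tau> (miura \<tau> w) \<le> (2 + \<tau> powr (-1/2) * l2norm w) * l2norm w"
proof -
  obtain a where a [measurable]: "a \<in> borel_measurable borel" and a2:
    "integrable lborel (\<lambda>\<xi>. (cmod (a \<xi>))\<^sup>2)" "(\<integral>\<xi>. (cmod (a \<xi>))\<^sup>2 \<partial>lborel) \<le> (l2norm w)\<^sup>2"
    "\<And>\<phi>. test_function \<phi> \<Longrightarrow> integrable lborel (\<lambda>\<xi>. a \<xi> * cnj (fourier \<phi> \<xi>))"
    "\<And>\<phi>. test_function \<phi> \<Longrightarrow> (\<integral>\<xi>. a \<xi> * cnj (fourier \<phi> \<xi>) \<partial>lborel) = complex_of_real (\<integral>x. w x * \<phi> x \<partial>lborel)"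
    using L2_fourier_exists[OF w] by blast
  have [measurable]: "w \<in> borel_measurable borel" using w by (rule L2_measurable)
  have w2: "integrable lborel (\<lambda>x. (w x)\<^sup>2)" using w by (rule L2_integrable)
  define b where "b = fourier (\<lambda>x. (w x)\<^sup>2)"
  have b [measurable]: "b \<in> borel_measurable borel" unfolding b_def by (intro fourier_measurable) measurable
  define M where "M = (l2norm w)\<^sup>2 / sqrt (2 * pi)"
  have bM: "cmod (b \<xi>) \<le> M" for \<xi>
    using fourier_bound[OF w2, of \<xi>] by (simp add: b_def M_def l2norm_power2)
  define g where "g = (\<lambda>\<xi>::real. (\<i> * \<xi> + 2 * \<tau>) * a \<xi> + b \<xi>)"
  have gm: "g \<in> borel_measurable borel" unfolding g_def by measurable
  have four: "integrable lborel (\<lambda>\<xi>. g \<xi> * cnj (fourier \<phi> \<xi>)) \<and>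
        complex_of_real (miura \<tau> w \<phi>) = (\<integral>\<xi>. g \<xi> * cnj (fourier \<phi> \<xi>) \<partial>lborel)" if \<phi>: "test_function \<phi>" for \<phi>
  proof -
    have d: "test_function (deriv \<phi>)" by (rule test_function_deriv[OF \<phi>])
    have eq: "g \<xi> * cnj (fourier \<phi> \<xi>) = - (a \<xi> * cnj (fourier (deriv \<phi>) \<xi>)) + b \<xi> * cnj (fourier \<phi> \<xi>)
        + complex_of_real (2 * \<tau>) * (a \<xi> * cnj (fourier \<phi> \<xi>))" for \<xi>
      by (simp add: g_def fourier_deriv[OF \<phi>] algebra_simps)
    note P = fourier_Parseval[OF w2 \<phi>, folded b_def]
    have i: "integrable lborel (\<lambda>\<xi>. - (a \<xi> * cnj (fourier (deriv \<phi>) \<xi>)) + b \<xi> * cnj (fourier \<phi> \<xi>))"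
      using a2(3)[OF d] P(1) by (intro Bochner_Integration.integrable_add) auto
    have "integrable lborel (\<lambda>\<xi>. g \<xi> * cnj (fourier \<phi> \<xi>))"
      unfolding eq by (intro Bochner_Integration.integrable_add i integrable_mult_right a2(3) \<phi>)
    moreover have "(\<integral>\<xi>. g \<xi> * cnj (fourier \<phi> \<xi>) \<partial>lborel) = complex_of_real (miura \<tau> w \<phi>)"
      unfolding eq Bochner_Integration.integral_add[OF i integrable_mult_right[OF a2(3)[OF \<phi>]]]
      using a2(3)[OF d] P(1)
      by (simp add: P(2) a2(4)[OF d] a2(4)[OF \<phi>] miura_eq[OF L2_imp_L2_loc[OF w] \<phi>])
    ultimately show ?thesis by simp
  qed
  have "integrable lborel (\<lambda>\<xi>. (cmod (g \<xi>))\<^sup>2 / (\<xi>\<^sup>2 + 1\<^sup>2))"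
    unfolding g_def
  proof (rule miura_transform_bound(1)[where c="1 + 2 * \<tau>", OF _ _ _ _ a b a2(1) bM])
    show "1 \<le> (1 + 2 * \<tau>)\<^sup>2" using \<tau> by (intro one_le_power) simp
    show "4 * \<tau>\<^sup>2 \<le> (1 + 2 * \<tau>)\<^sup>2 * 1\<^sup>2" using \<tau> by (simp add: power2_eq_square algebra_simps)
  qed (use \<tau> in auto)
  then have tr: "Hneg_transform (miura \<tau> w) g"
    using gm four by (auto simp: Hneg_transform_def has_fourier_def)
  then show "Hneg (miura \<tau> w)" by (auto simp: Hneg_def)
  have "Hneg_norm \<tau> (miura \<tau> w) = sqrt (\<integral>\<xi>. (cmod (g \<xi>))\<^sup>2 / (\<xi>\<^sup>2 + \<tau>\<^sup>2) \<partial>lborel)" by (rule Hneg_norm_eq[OF tr])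
  also have "\<dots> \<le> 2 * sqrt (\<integral>\<xi>. (cmod (a \<xi>))\<^sup>2 \<partial>lborel) + M * sqrt (pi / \<tau>)"
    unfolding g_def by (rule miura_transform_bound(2)[where c=2, OF \<tau> _ _ _ a b a2(1) bM]) auto
  also have "\<dots> \<le> 2 * l2norm w + (l2norm w)\<^sup>2 * \<tau> powr (-1/2)"
  proof (rule add_mono)
    show "2 * sqrt (\<integral>\<xi>. (cmod (a \<xi>))\<^sup>2 \<partial>lborel) \<le> 2 * l2norm w" using a2(2) by (auto intro: real_le_lsqrt)
    have "M * sqrt (pi / \<tau>) = (l2norm w)\<^sup>2 * sqrt ((pi / \<tau>) / (2 * pi))"
      by (simp add: M_def real_sqrt_divide real_sqrt_mult)
    also have "(pi / \<tau>) / (2 * pi) = 1 / (2 * \<tau>)" by simp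
    also have "(l2norm w)\<^sup>2 * sqrt (1 / (2 * \<tau>)) \<le> (l2norm w)\<^sup>2 * sqrt (1 / \<tau>)"
      using \<tau> by (intro mult_left_mono real_sqrt_le_mono) (auto simp: field_simps)
    also have "sqrt (1 / \<tau>) = \<tau> powr (-1/2)"
      using \<tau> by (simp add: powr_minus powr_half_sqrt real_sqrt_divide inverse_eq_divide)
    finally show "M * sqrt (pi / \<tau>) \<le> (l2norm w)\<^sup>2 * \<tau> powr (-1/2)" .
  qed
  finally show "Hneg_norm \<tau> (miura \<tau> w) \<le> (2 + \<tau> powr (-1/2) * l2norm w) * l2norm w"
    by (simp add: power2_eq_square algebra_simps)
qed

section \<open>The lower bound for the energy\<close>

text \<open>Young's inequality for the one-sided exponential kernel, whose integral is \<open>1 / \<kappa>\<close>.  The bound of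
\<open>\<psi>\<close> is stated with the extended integral, which is meaningful before \<open>f\<close> is known to be integrable against
the kernel.\<close>

lemma exponential_kernel_L2:
  fixes f \<psi> :: "real \<Rightarrow> real"
  assumes \<kappa>: "\<kappa> > 0" and [measurable]: "f \<in> borel_measurable borel" "\<psi> \<in> borel_measurable borel"
    and f2: "integrable lborel (\<lambda>x. (f x)\<^sup>2)" and c: "c \<ge> 0"
    and le: "\<And>x. ennreal \<bar>\<psi> x\<bar> \<le> ennreal c * (\<integral>\<^sup>+y. ennreal (indicator {x..} y * exp (- \<kappa> * (y - x))) * ennreal \<bar>f y\<bar> \<partial>lborel)"
  shows "integrable lborel (\<lambda>x. (\<psi> x)\<^sup>2)" "\<kappa>\<^sup>2 * (\<integral>x. (\<psi> x)\<^sup>2 \<partial>lborel) \<le> c\<^sup>2 * (\<integral>x. (f x)\<^sup>2 \<partial>lborel)"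
proof -
  define K where "K = (\<lambda>s::real. if 0 \<le> s then exp (- \<kappa> * s) else 0)"
  have [measurable]: "K \<in> borel_measurable borel" unfolding K_def by measurable
  have K0: "0 \<le> K s" for s by (simp add: K_def)
  have Keq: "indicator {x..} y * exp (- \<kappa> * (y - x)) = K (y - x)" for x y by (auto simp: K_def indicator_def)
  have K1: "(\<integral>\<^sup>+s. ennreal (K s) \<partial>lborel) = ennreal (1 / \<kappa>)"
  proof -
    interpret prob_space "density lborel (exponential_density \<kappa>)" by (rule prob_space_exponential_density[OF \<kappa>])
    have "1 = (\<integral>\<^sup>+s. ennreal (exponential_density \<kappa> s) \<partial>lborel)"
      using emeasure_space_1 by (simp add: emeasure_density)
    also have "\<dots> = (\<integral>\<^sup>+s. ennreal \<kappa> * ennreal (K s) \<partial>lborel)"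
      using \<kappa> by (intro nn_integral_cong) (auto simp: exponential_density_def K_def ennreal_mult'[symmetric] mult_ac)
    also have "\<dots> = ennreal \<kappa> * (\<integral>\<^sup>+s. ennreal (K s) \<partial>lborel)" by (rule nn_integral_cmult) measurable
    finally have "ennreal (1 / \<kappa>) * 1 = ennreal (1 / \<kappa>) * (ennreal \<kappa> * (\<integral>\<^sup>+s. ennreal (K s) \<partial>lborel))" by simp
    also have "\<dots> = (\<integral>\<^sup>+s. ennreal (K s) \<partial>lborel)"
      using \<kappa> by (simp add: mult.assoc[symmetric] ennreal_mult'[symmetric])
    finally show ?thesis by simp
  qed
  have Ky: "(\<integral>\<^sup>+y. ennreal (K (y - x)) \<partial>lborel) = ennreal (1 / \<kappa>)" for x
    using nn_integral_real_affine[of "\<lambda>y. ennreal (K (y - x))" 1 x] K1 by simp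
  have Kx: "(\<integral>\<^sup>+x. ennreal (K (y - x)) \<partial>lborel) = ennreal (1 / \<kappa>)" for y
    using nn_integral_real_affine[of "\<lambda>x. ennreal (K (y - x))" "-1" y] K1 by simp
  \<comment> \<open>Schur's test: the kernel is split into two square roots, one of which is integrated out by the
    Cauchy--Schwarz inequality.\<close>
  have sq: "(ennreal \<bar>\<psi> x\<bar>)\<^sup>2 \<le> ennreal (c\<^sup>2 / \<kappa>) * (\<integral>\<^sup>+y. ennreal (K (y - x)) * ennreal ((f y)\<^sup>2) \<partial>lborel)" for x
  proof -
    let ?s = "\<lambda>y. ennreal (sqrt (K (y - x)))"
    have s2: "?s y * ?s y = ennreal (K (y - x))" for y
      using K0 by (simp add: ennreal_mult'[symmetric])
    have "(\<integral>\<^sup>+y. ennreal (K (y - x)) * ennreal \<bar>f y\<bar> \<partial>lborel) = (\<integral>\<^sup>+y. ?s y * (?s y * ennreal \<bar>f y\<bar>) \<partial>lborel)"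
      by (simp add: s2 flip: mult.assoc)
    then have "(\<integral>\<^sup>+y. ennreal (K (y - x)) * ennreal \<bar>f y\<bar> \<partial>lborel)\<^sup>2
        \<le> (\<integral>\<^sup>+y. (?s y)\<^sup>2 \<partial>lborel) * (\<integral>\<^sup>+y. (?s y * ennreal \<bar>f y\<bar>)\<^sup>2 \<partial>lborel)"
      using Cauchy_Schwarz_nn_integral[of ?s lborel "\<lambda>y. ?s y * ennreal \<bar>f y\<bar>"] by simp
    also have "(\<integral>\<^sup>+y. (?s y)\<^sup>2 \<partial>lborel) = ennreal (1 / \<kappa>)" unfolding power2_eq_square s2 Ky ..
    also have "(\<integral>\<^sup>+y. (?s y * ennreal \<bar>f y\<bar>)\<^sup>2 \<partial>lborel) = (\<integral>\<^sup>+y. ennreal (K (y - x)) * ennreal ((f y)\<^sup>2) \<partial>lborel)"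
      unfolding power_mult_distrib by (simp add: power2_eq_square s2 ennreal_mult'[symmetric])
    finally have CS: "(\<integral>\<^sup>+y. ennreal (K (y - x)) * ennreal \<bar>f y\<bar> \<partial>lborel)\<^sup>2
        \<le> ennreal (1 / \<kappa>) * (\<integral>\<^sup>+y. ennreal (K (y - x)) * ennreal ((f y)\<^sup>2) \<partial>lborel)" .
    have "(ennreal \<bar>\<psi> x\<bar>)\<^sup>2 \<le> (ennreal c * (\<integral>\<^sup>+y. ennreal (K (y - x)) * ennreal \<bar>f y\<bar> \<partial>lborel))\<^sup>2"
      using le[of x] unfolding Keq by (rule power_mono) simp
    also have "\<dots> \<le> (ennreal c)\<^sup>2 * (ennreal (1 / \<kappa>) * (\<integral>\<^sup>+y. ennreal (K (y - x)) * ennreal ((f y)\<^sup>2) \<partial>lborel))"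
      unfolding power_mult_distrib by (rule mult_left_mono[OF CS]) simp
    also have "\<dots> = ennreal (c\<^sup>2 / \<kappa>) * (\<integral>\<^sup>+y. ennreal (K (y - x)) * ennreal ((f y)\<^sup>2) \<partial>lborel)"
      using c \<kappa> by (simp add: mult.assoc[symmetric] ennreal_power ennreal_mult'[symmetric])
    finally show ?thesis .
  qed
  have "(\<integral>\<^sup>+x. ennreal ((\<psi> x)\<^sup>2) \<partial>lborel) = (\<integral>\<^sup>+x. (ennreal \<bar>\<psi> x\<bar>)\<^sup>2 \<partial>lborel)" by (simp add: ennreal_power)
  also have "\<dots> \<le> (\<integral>\<^sup>+x. ennreal (c\<^sup>2 / \<kappa>) * (\<integral>\<^sup>+y. ennreal (K (y - x)) * ennreal ((f y)\<^sup>2) \<partial>lborel) \<partial>lborel)"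
    by (intro nn_integral_mono sq)
  also have "\<dots> = ennreal (c\<^sup>2 / \<kappa>) * (\<integral>\<^sup>+x. (\<integral>\<^sup>+y. ennreal (K (y - x)) * ennreal ((f y)\<^sup>2) \<partial>lborel) \<partial>lborel)"
    by (rule nn_integral_cmult) measurable
  also have "(\<integral>\<^sup>+x. (\<integral>\<^sup>+y. ennreal (K (y - x)) * ennreal ((f y)\<^sup>2) \<partial>lborel) \<partial>lborel)
     = (\<integral>\<^sup>+y. (\<integral>\<^sup>+x. ennreal (K (y - x)) * ennreal ((f y)\<^sup>2) \<partial>lborel) \<partial>lborel)"
    by (rule lborel_pair.Fubini') measurable
  also have "\<dots> = (\<integral>\<^sup>+y. ennreal (1 / \<kappa>) * ennreal ((f y)\<^sup>2) \<partial>lborel)"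
    by (rule nn_integral_cong) (simp add: nn_integral_multc Kx)
  also have "\<dots> = ennreal (1 / \<kappa>) * (\<integral>\<^sup>+y. ennreal ((f y)\<^sup>2) \<partial>lborel)" by (rule nn_integral_cmult) measurable
  also have "(\<integral>\<^sup>+y. ennreal ((f y)\<^sup>2) \<partial>lborel) = ennreal (\<integral>y. (f y)\<^sup>2 \<partial>lborel)"
    by (rule nn_integral_eq_integral[OF f2]) simp
  finally have fin: "(\<integral>\<^sup>+x. ennreal ((\<psi> x)\<^sup>2) \<partial>lborel) \<le> ennreal (c\<^sup>2 / \<kappa>\<^sup>2 * (\<integral>y. (f y)\<^sup>2 \<partial>lborel))"
    using c \<kappa> by (simp add: ennreal_mult'[symmetric] power2_eq_square mult.assoc)
  show i: "integrable lborel (\<lambda>x. (\<psi> x)\<^sup>2)"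
    by (rule integrableI_bounded) (use fin in \<open>auto intro: le_less_trans\<close>)
  have "(\<integral>x. (\<psi> x)\<^sup>2 \<partial>lborel) \<le> c\<^sup>2 / \<kappa>\<^sup>2 * (\<integral>y. (f y)\<^sup>2 \<partial>lborel)"
    using fin by (subst (asm) nn_integral_eq_integral[OF i]) auto
  then show "\<kappa>\<^sup>2 * (\<integral>x. (\<psi> x)\<^sup>2 \<partial>lborel) \<le> c\<^sup>2 * (\<integral>x. (f x)\<^sup>2 \<partial>lborel)"
    using \<kappa> by (simp add: field_simps)
qed

text \<open>Integrate \<open>w + \<tau> \<ge> \<tau> / 2 - w\<^sup>2 / (2 \<tau>)\<close>, which is \<open>(w + \<tau>)\<^sup>2 \<ge> 0\<close>.\<close>

lemma primitive_growth:
  assumes \<tau>: "\<tau> > 0" and w: "L2_loc w" and W: "abs_cont W (\<lambda>x. w x + \<tau>)" and xy: "x \<le> y"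
  shows "\<tau> / 2 * (y - x) - (LBINT t:{x..y}. (w t)\<^sup>2) / (2 * \<tau>) \<le> W y - W x"
proof -
  have ws: "set_integrable lborel {x..y} (\<lambda>t. (w t)\<^sup>2 / (2 * \<tau>))"
    using loc_integrableD[OF L2_loc_square[OF w]] by simp
  have cs: "set_integrable lborel {x..y} (\<lambda>t. \<tau> / 2)" by (intro borel_integrable_atLeastAtMost') auto
  have "(LBINT t:{x..y}. \<tau> / 2) = \<tau> / 2 * (y - x)" using xy by (simp add: set_lebesgue_integral_def)
  then have "\<tau> / 2 * (y - x) - (LBINT t:{x..y}. (w t)\<^sup>2) / (2 * \<tau>) = (LBINT t:{x..y}. \<tau> / 2 - (w t)\<^sup>2 / (2 * \<tau>))"
    using set_integral_diff(2)[OF cs ws] by simp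
  also have "\<dots> \<le> (LBINT t:{x..y}. w t + \<tau>)"
  proof (rule set_integral_mono)
    show "set_integrable lborel {x..y} (\<lambda>t. \<tau> / 2 - (w t)\<^sup>2 / (2 * \<tau>))" by (rule set_integral_diff(1)[OF cs ws])
    show "set_integrable lborel {x..y} (\<lambda>t. w t + \<tau>)" by (rule loc_integrableD[OF abs_contD(1)[OF W]])
    fix t
    have "0 \<le> (w t + \<tau>)\<^sup>2 / (2 * \<tau>)" using \<tau> by simp
    also have "\<dots> = w t + \<tau> / 2 + (w t)\<^sup>2 / (2 * \<tau>)" using \<tau> by (simp add: field_simps power2_eq_square)
    finally show "\<tau> / 2 - (w t)\<^sup>2 / (2 * \<tau>) \<le> w t + \<tau>" using \<tau> by linarith
  qed
  also have "\<dots> = W y - W x" using abs_contD(2)[OF W xy] by simp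
  finally show ?thesis .
qed

text \<open>The equation \<open>\<phi>' - (w + \<tau>) \<phi> = f\<close> is solved from the right, where \<open>\<phi>\<close> vanishes.  The propagator
\<open>exp (W x - W y)\<close> is at most \<open>c exp (- \<tau> (y - x) / 2)\<close> for \<open>x \<le> y\<close> by \<open>primitive_growth\<close>.\<close>

lemma factor_lower_bound:
  assumes \<tau>: "\<tau> > 0" and w: "L2 w" and \<phi>: "test_function \<phi>"
  shows "\<tau>\<^sup>2 / 4 * exp (- (1 / \<tau>) * (l2norm w)\<^sup>2) * (l2norm \<phi>)\<^sup>2
    \<le> (\<integral>x. (deriv \<phi> x - (w x + \<tau>) * \<phi> x)\<^sup>2 \<partial>lborel)"
proof -
  have wl: "L2_loc w" using w by (rule L2_imp_L2_loc)
  have [measurable]: "w \<in> borel_measurable borel" using w by (rule L2_measurable)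
  have [measurable]: "\<phi> \<in> borel_measurable borel" "deriv \<phi> \<in> borel_measurable borel"
    using \<phi> by (auto intro: test_measurable test_function_deriv)
  define f where "f = (\<lambda>x. deriv \<phi> x - (w x + \<tau>) * \<phi> x)"
  have [measurable]: "f \<in> borel_measurable borel" unfolding f_def by measurable
  have f2: "integrable lborel (\<lambda>x. (f x)\<^sup>2)" unfolding f_def by (rule miura_factorization(2)[OF wl \<phi>])
  have al: "loc_integrable (\<lambda>x. w x + \<tau>)"
    by (intro loc_integrable_add L2_loc_imp_loc_integrable wl loc_integrable_continuous continuous_intros)
  obtain W where W: "abs_cont W (\<lambda>x. w x + \<tau>)" using abs_cont_exists[OF al] by blast
  have [measurable]: "W \<in> borel_measurable borel" by (rule abs_cont_measurable[OF W])
  have E: "abs_cont (\<lambda>x. exp (- W x)) (\<lambda>x. - exp (- W x) * (w x + \<tau>))"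
    by (rule abs_cont_chain[OF W, where H="\<lambda>y. exp (- y)" and H'="\<lambda>y. - exp (- y)"])
       (auto intro!: derivative_eq_intros continuous_intros)
  have P: "abs_cont (\<lambda>x. exp (- W x) * \<phi> x) (\<lambda>x. exp (- W x) * f x)"
    using abs_cont_mult[OF E abs_cont_smooth[OF test_smooth[OF \<phi>]]] by (simp add: f_def algebra_simps)
  obtain R where R: "\<And>x. R \<le> \<bar>x\<bar> \<Longrightarrow> \<phi> x = 0" using test_function_support[OF \<phi>] by metis
  define c where "c = exp ((l2norm w)\<^sup>2 / (2 * \<tau>))"
  have W_ge: "\<tau> / 2 * (y - x) - (l2norm w)\<^sup>2 / (2 * \<tau>) \<le> W y - W x" if "x \<le> y" for x y
  proof -
    have "(LBINT t:{x..y}. (w t)\<^sup>2) \<le> (\<integral>t. (w t)\<^sup>2 \<partial>lborel)"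
      unfolding set_lebesgue_integral_def using loc_integrableD[OF L2_loc_square[OF wl], of x y] L2_integrable[OF w]
      by (intro integral_mono) (auto simp: set_integrable_def indicator_def)
    then have "(LBINT t:{x..y}. (w t)\<^sup>2) / (2 * \<tau>) \<le> (l2norm w)\<^sup>2 / (2 * \<tau>)"
      using \<tau> by (simp add: l2norm_power2 divide_right_mono)
    then show ?thesis using primitive_growth[OF \<tau> wl W that] by linarith
  qed
  have le: "ennreal \<bar>\<phi> x\<bar> \<le> ennreal c * (\<integral>\<^sup>+y. ennreal (indicator {x..} y * exp (- (\<tau> / 2) * (y - x))) * ennreal \<bar>f y\<bar> \<partial>lborel)" for x
  proof -
    define b where "b = max x (\<bar>R\<bar>)"
    have xb: "x \<le> b" and "\<phi> b = 0" by (auto simp: b_def intro!: R)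
    then have eq: "exp (- W x) * \<phi> x = - (LBINT y:{x..b}. exp (- W y) * f y)"
      using abs_contD(2)[OF P xb] by simp
    have i: "set_integrable lborel {x..b} (\<lambda>y. exp (- W y) * f y)" by (rule loc_integrableD[OF abs_contD(1)[OF P]])
    have "\<phi> x = exp (W x) * (exp (- W x) * \<phi> x)" by (simp add: mult.assoc[symmetric] exp_minus_inverse)
    then have "\<bar>\<phi> x\<bar> = exp (W x) * \<bar>LBINT y:{x..b}. exp (- W y) * f y\<bar>" unfolding eq by (simp add: abs_mult)
    also have "\<dots> \<le> exp (W x) * (LBINT y:{x..b}. \<bar>exp (- W y) * f y\<bar>)"
      using integral_abs_bound[of lborel "\<lambda>y. indicator {x..b} y * (exp (- W y) * f y)"]
      by (intro mult_left_mono) (auto simp: set_lebesgue_integral_def abs_mult)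
    also have "\<dots> = (LBINT y:{x..b}. exp (W x - W y) * \<bar>f y\<bar>)"
      by (simp add: abs_mult exp_diff exp_minus divide_inverse mult.assoc flip: set_integral_mult_right)
    finally have le1: "\<bar>\<phi> x\<bar> \<le> (LBINT y:{x..b}. exp (W x - W y) * \<bar>f y\<bar>)" .
    have i2: "integrable lborel (\<lambda>y. indicator {x..b} y * (exp (W x - W y) * \<bar>f y\<bar>))"
    proof -
      have "set_integrable lborel {x..b} (\<lambda>y. exp (W x) * \<bar>exp (- W y) * f y\<bar>)" using set_integrable_abs[OF i] by simp
      then show ?thesis by (simp add: set_integrable_def abs_mult exp_diff exp_minus divide_inverse mult.assoc)
    qed
    have "ennreal \<bar>\<phi> x\<bar> \<le> ennreal (\<integral>y. indicator {x..b} y * (exp (W x - W y) * \<bar>f y\<bar>) \<partial>lborel)"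
      using le1 by (simp add: set_lebesgue_integral_def ennreal_leI)
    also have "\<dots> = (\<integral>\<^sup>+y. ennreal (indicator {x..b} y * (exp (W x - W y) * \<bar>f y\<bar>)) \<partial>lborel)"
      by (rule nn_integral_eq_integral[OF i2, symmetric]) auto
    also have "\<dots> \<le> (\<integral>\<^sup>+y. ennreal c * (ennreal (indicator {x..} y * exp (- (\<tau> / 2) * (y - x))) * ennreal \<bar>f y\<bar>) \<partial>lborel)"
    proof (rule nn_integral_mono)
      fix y
      have "indicator {x..b} y * (exp (W x - W y) * \<bar>f y\<bar>) \<le> c * (indicator {x..} y * exp (- (\<tau> / 2) * (y - x)) * \<bar>f y\<bar>)"
      proof (cases "y \<in> {x..b}")
        case True
        have "exp (W x - W y) \<le> exp ((l2norm w)\<^sup>2 / (2 * \<tau>) + - (\<tau> / 2) * (y - x))"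
          using W_ge[of x y] True by (simp add: algebra_simps)
        also have "\<dots> = c * exp (- (\<tau> / 2) * (y - x))" by (simp only: exp_add c_def)
        finally have "exp (W x - W y) * \<bar>f y\<bar> \<le> c * exp (- (\<tau> / 2) * (y - x)) * \<bar>f y\<bar>" by (rule mult_right_mono) simp
        then show ?thesis using True by (simp add: mult.assoc)
      next
        case False then show ?thesis by (simp add: c_def)
      qed
      then show "ennreal (indicator {x..b} y * (exp (W x - W y) * \<bar>f y\<bar>))
          \<le> ennreal c * (ennreal (indicator {x..} y * exp (- (\<tau> / 2) * (y - x))) * ennreal \<bar>f y\<bar>)"
        by (simp add: c_def ennreal_leI flip: ennreal_mult')
    qed
    also have "\<dots> = ennreal c * (\<integral>\<^sup>+y. ennreal (indicator {x..} y * exp (- (\<tau> / 2) * (y - x))) * ennreal \<bar>f y\<bar> \<partial>lborel)"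
      by (rule nn_integral_cmult) measurable
    finally show ?thesis .
  qed
  have "(\<tau> / 2)\<^sup>2 * (\<integral>x. (\<phi> x)\<^sup>2 \<partial>lborel) \<le> c\<^sup>2 * (\<integral>x. (f x)\<^sup>2 \<partial>lborel)"
    by (rule exponential_kernel_L2(2)[OF _ _ _ f2 _ le]) (use \<tau> in \<open>auto simp: c_def\<close>)
  moreover have c2: "c\<^sup>2 = exp ((1 / \<tau>) * (l2norm w)\<^sup>2)"
    using \<tau> by (simp add: c_def power2_eq_square field_simps flip: exp_add)
  ultimately have "exp (- (1 / \<tau>) * (l2norm w)\<^sup>2) * ((\<tau> / 2)\<^sup>2 * (l2norm \<phi>)\<^sup>2)
     \<le> exp (- (1 / \<tau>) * (l2norm w)\<^sup>2) * (exp ((1 / \<tau>) * (l2norm w)\<^sup>2) * (\<integral>x. (f x)\<^sup>2 \<partial>lborel))"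
    by (intro mult_left_mono) (auto simp: l2norm_power2)
  also have "\<dots> = (\<integral>x. (f x)\<^sup>2 \<partial>lborel)" by (simp add: mult.assoc[symmetric] flip: exp_add)
  finally show ?thesis by (simp add: f_def power_divide mult_ac)
qed

text \<open>The form is bounded below on test functions by the factorization and by \<open>factor_lower_bound\<close>, and
density extends the bound to \<open>H\<^sup>1\<close>.\<close>

theorem miura_form_ge:
  assumes \<tau>: "\<tau> > 0" and w: "L2 w" and \<psi>: "H1 \<psi>"
  shows "schroedinger_form (miura \<tau> w) \<psi> \<psi> + \<tau>\<^sup>2 * (l2norm \<psi>)\<^sup>2
    \<ge> \<tau>\<^sup>2 / 4 * exp (- (1 / \<tau>) * (l2norm w)\<^sup>2) * (l2norm \<psi>)\<^sup>2"
proof -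
  have wl: "L2_loc w" using w by (rule L2_imp_L2_loc)
  have "schroedinger_form (miura \<tau> w) \<psi> \<psi> \<ge> (\<tau>\<^sup>2 / 4 * exp (- (1 / \<tau>) * (l2norm w)\<^sup>2) - \<tau>\<^sup>2) * (l2norm \<psi>)\<^sup>2"
  proof (rule form_ge_of_test_functions[OF miura_H1_bounded[OF wl miura_Hneg(1)[OF \<tau> w]] \<psi>])
    fix \<phi> assume \<phi>: "test_function \<phi>"
    show "(\<tau>\<^sup>2 / 4 * exp (- (1 / \<tau>) * (l2norm w)\<^sup>2) - \<tau>\<^sup>2) * (l2norm \<phi>)\<^sup>2
      \<le> (\<integral>x. (deriv \<phi> x)\<^sup>2 \<partial>lborel) + miura \<tau> w (\<lambda>x. \<phi> x * \<phi> x)"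
      using factor_lower_bound[OF \<tau> w \<phi>] miura_factorization(1)[OF wl \<phi>, of \<tau>] by (simp add: left_diff_distrib)
  qed
  then show ?thesis by (simp add: left_diff_distrib)
qed

section \<open>The linear equation behind the \<open>H\<^sup>-\<^sup>1\<close> norm\<close>

lemma exp_half_line:
  fixes c x :: real
  assumes c: "c > 0"
  shows "integrable lborel (\<lambda>y. indicator {..x} y * exp (c * y))" "(\<integral>y. indicator {..x} y * exp (c * y) \<partial>lborel) \<le> exp (c * x) / c"
proof -
  let ?f = "\<lambda>y. indicator {..x} y * exp (c * y)"
  have e: "loc_integrable (\<lambda>y. exp (c * y))" by (intro loc_integrable_continuous continuous_intros)
  have f: "loc_integrable ?f"
    by (rule loc_integrable_bound[OF e]) (auto simp: indicator_def)
  have ac: "abs_cont (\<lambda>y. exp (c * y) / c) (\<lambda>y. exp (c * y))"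
    by (rule abs_cont_C1) (use c in \<open>auto intro!: derivative_eq_intros continuous_intros\<close>)
  have bd: "(LBINT y:{- real n..real n}. ?f y) \<le> exp (c * x) / c" for n
  proof (cases "- real n \<le> x")
    case True
    have "(LBINT y:{- real n..real n}. ?f y) = (LBINT y:{- real n..min (real n) x}. exp (c * y))"
      unfolding set_lebesgue_integral_def by (rule Bochner_Integration.integral_cong) (auto simp: indicator_def)
    also have "\<dots> = exp (c * min (real n) x) / c - exp (c * - real n) / c"
      using abs_contD(2)[OF ac, of "- real n" "min (real n) x"] True by simp
    also have "\<dots> \<le> exp (c * min (real n) x) / c" using c by simp
    also have "\<dots> \<le> exp (c * x) / c" using c by (intro divide_right_mono) auto
    finally show ?thesis .
  next
    case False
    then have "(LBINT y:{- real n..real n}. ?f y) = 0"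
      unfolding set_lebesgue_integral_def by (intro integral_eq_zero_AE AE_I2) (auto simp: indicator_def)
    then show ?thesis using c by simp
  qed
  show "integrable lborel ?f" "(\<integral>y. ?f y \<partial>lborel) \<le> exp (c * x) / c"
    using integrable_of_bounded_Icc[OF f _ bd] by auto
qed

lemma half_line_integrable:
  assumes f: "loc_integrable f" and 0: "set_integrable lborel {..0::real} f"
  shows "set_integrable lborel {..x} f"
proof -
  have "set_integrable lborel ({..0} \<union> {0..x}) f"
    using 0 loc_integrableD[OF f] by (rule set_integrable_Un) auto
  then show ?thesis by (rule set_integrable_subset) auto
qed

lemma half_line_tendsto_0:
  assumes f: "loc_integrable f" and 0: "set_integrable lborel {..0::real} f"
  shows "((\<lambda>x. LBINT y:{..x}. f y) \<longlongrightarrow> 0) at_bot"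
proof -
  have lim: "((\<lambda>x. LBINT y:{x..0}. f y) \<longlongrightarrow> (LBINT y:{..0}. f y)) at_bot"
    by (rule tendsto_set_lebesgue_integral_at_bot[OF _ 0]) auto
  have "(LBINT y:{..0}. f y) - (LBINT y:{x..0}. f y) = (LBINT y:{..x}. f y)" if "x \<le> 0" for x
  proof -
    have "(LBINT y:{..x} \<union> {x..0}. f y) = (LBINT y:{..x}. f y) + (LBINT y:{x..0}. f y)"
    proof (rule set_integral_Un_AE)
      have "AE y in lborel. y \<noteq> x" by (rule AE_lborel_singleton)
      then show "AE y in lborel. \<not> (y \<in> {..x} \<and> y \<in> {x..0})" by eventually_elim auto
    qed (use half_line_integrable[OF assms] loc_integrableD[OF f] in auto)
    moreover have "{..x} \<union> {x..0} = {..0}" using that by auto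
    ultimately show ?thesis by simp
  qed
  then have "\<forall>\<^sub>F x in at_bot. (LBINT y:{..0}. f y) - (LBINT y:{x..0}. f y) = (LBINT y:{..x}. f y)"
    unfolding eventually_at_bot_linorder by blast
  moreover have "((\<lambda>x. (LBINT y:{..0}. f y) - (LBINT y:{x..0}. f y)) \<longlongrightarrow> (LBINT y:{..0}. f y) - (LBINT y:{..0}. f y)) at_bot"
    by (intro tendsto_intros lim)
  ultimately show ?thesis by (simp add: Lim_transform_eventually)
qed

text \<open>The variable \<open>z\<close> solves \<open>z' + \<tau> z = w\<^sup>2 + \<tau> w\<close> and decays at \<open>-\<infinity>\<close>.  Then
  \<open>v = w + z\<close> satisfies \<open>v' + \<tau> v = w' + w\<^sup>2 + 2 \<tau> w\<close>, so \<open>v\<close> carries the \<open>H\<^sup>-\<^sup>1\<close> norm.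
  The square integrability of \<open>w\<close> on the left half line makes the Duhamel integral from \<open>-\<infinity>\<close>
  converge and tend to \<open>0\<close>.\<close>

lemma duhamel_solution:
  assumes \<tau>: "\<tau> > 0" and w: "L2_loc w" and w0: "set_integrable lborel {..0} (\<lambda>x. (w x)\<^sup>2)"
  obtains z where "abs_cont z (\<lambda>x. (w x)\<^sup>2 + \<tau> * w x - \<tau> * z x)" "(z \<longlongrightarrow> 0) at_bot"
proof -
  have [measurable]: "w \<in> borel_measurable borel" using w by (rule L2_loc_measurable)
  define p where "p = (\<lambda>y. (w y)\<^sup>2 + \<tau> * w y)"
  have p: "loc_integrable p" unfolding p_def
    by (intro loc_integrable_add loc_integrable_cmult L2_loc_square L2_loc_imp_loc_integrable w)
  have [measurable]: "p \<in> borel_measurable borel" using p by (rule loc_integrable_measurable)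
  have ep: "loc_integrable (\<lambda>y. exp (\<tau> * y) * p y)"
    by (intro loc_integrable_continuous_mult p continuous_intros)
  have w2: "set_integrable lborel {..x} (\<lambda>y. (w y)\<^sup>2)" for x by (rule half_line_integrable[OF L2_loc_square[OF w] w0])
  define \<Omega> where "\<Omega> = (\<lambda>x. LBINT y:{..x}. (w y)\<^sup>2)"
  \<comment> \<open>The linear term is split by \<open>E \<bar>w\<bar> \<le> s E\<^sup>2 / 2 + w\<^sup>2 / (2 s)\<close>.  The free parameter \<open>s\<close> is taken as
    the tolerance in the limit at \<open>-\<infinity>\<close>.\<close>
  have ptw: "exp (\<tau> * y) * \<bar>p y\<bar> \<le> exp (\<tau> * x) * ((w y)\<^sup>2 + \<tau> * (s / 2 * (exp (- 2 * \<tau> * x) * exp (2 * \<tau> * y)) + (w y)\<^sup>2 / (2 * s)))"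
    if s: "s > 0" and yx: "y \<le> x" for s x y
  proof -
    define E where "E = exp (\<tau> * (y - x))"
    have E: "0 < E" "E \<le> 1" using \<tau> yx by (auto simp: E_def mult_nonneg_nonpos)
    have E2: "exp (- 2 * \<tau> * x) * exp (2 * \<tau> * y) = E * E" by (simp add: E_def algebra_simps flip: exp_add)
    have "0 \<le> (s * E - \<bar>w y\<bar>)\<^sup>2 / (2 * s)" using s by simp
    also have "\<dots> = s / 2 * (E * E) + (w y)\<^sup>2 / (2 * s) - E * \<bar>w y\<bar>"
      using s by (simp add: power2_diff field_simps power2_eq_square)
    finally have 1: "E * \<bar>w y\<bar> \<le> s / 2 * (E * E) + (w y)\<^sup>2 / (2 * s)" by simp
    have "E * \<bar>p y\<bar> \<le> E * ((w y)\<^sup>2 + \<tau> * \<bar>w y\<bar>)"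
      unfolding p_def using \<tau> E by (intro mult_left_mono order_trans[OF abs_triangle_ineq]) (auto simp: abs_mult)
    also have "\<dots> = E * (w y)\<^sup>2 + \<tau> * (E * \<bar>w y\<bar>)" by (simp add: algebra_simps)
    also have "\<dots> \<le> 1 * (w y)\<^sup>2 + \<tau> * (s / 2 * (E * E) + (w y)\<^sup>2 / (2 * s))"
      using \<tau> 1 E by (intro add_mono mult_right_mono mult_left_mono) auto
    finally have "exp (\<tau> * x) * (E * \<bar>p y\<bar>) \<le> exp (\<tau> * x) * ((w y)\<^sup>2 + \<tau> * (s / 2 * (E * E) + (w y)\<^sup>2 / (2 * s)))"
      by (intro mult_left_mono) auto
    moreover have "exp (\<tau> * x) * E = exp (\<tau> * y)" by (simp add: E_def algebra_simps flip: exp_add)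
    ultimately show ?thesis unfolding E2 by (simp add: mult.assoc[symmetric])
  qed
  have dom: "set_integrable lborel {..x} (\<lambda>y. exp (\<tau> * x) * ((w y)\<^sup>2 + \<tau> * (s / 2 * (exp (- 2 * \<tau> * x) * exp (2 * \<tau> * y)) + (w y)\<^sup>2 / (2 * s))))"
    and dom_le: "(LBINT y:{..x}. exp (\<tau> * x) * ((w y)\<^sup>2 + \<tau> * (s / 2 * (exp (- 2 * \<tau> * x) * exp (2 * \<tau> * y)) + (w y)\<^sup>2 / (2 * s))))
      \<le> exp (\<tau> * x) * (\<Omega> x + s / 4 + \<tau> * \<Omega> x / (2 * s))" if s: "s > 0" for s x
  proof -
    have e: "set_integrable lborel {..x} (\<lambda>y. exp (2 * \<tau> * y))"
      using exp_half_line(1)[of "2 * \<tau>" x] \<tau> by (simp add: set_integrable_def)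
    have ele: "(LBINT y:{..x}. exp (2 * \<tau> * y)) \<le> exp (2 * \<tau> * x) / (2 * \<tau>)"
      using exp_half_line(2)[of "2 * \<tau>" x] \<tau> by (simp add: set_lebesgue_integral_def)
    have eq: "exp (\<tau> * x) * ((w y)\<^sup>2 + \<tau> * (s / 2 * (exp (- 2 * \<tau> * x) * exp (2 * \<tau> * y)) + (w y)\<^sup>2 / (2 * s)))
       = (exp (\<tau> * x) * (1 + \<tau> / (2 * s))) * (w y)\<^sup>2 + (exp (\<tau> * x) * \<tau> * s / 2 * exp (- 2 * \<tau> * x)) * exp (2 * \<tau> * y)" for y
      by (simp add: algebra_simps)
    have i: "set_integrable lborel {..x} (\<lambda>y. (exp (\<tau> * x) * (1 + \<tau> / (2 * s))) * (w y)\<^sup>2)"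
       "set_integrable lborel {..x} (\<lambda>y. (exp (\<tau> * x) * \<tau> * s / 2 * exp (- 2 * \<tau> * x)) * exp (2 * \<tau> * y))"
      using w2[of x] e by (simp_all only: set_integrable_mult_right)
    show "set_integrable lborel {..x} (\<lambda>y. exp (\<tau> * x) * ((w y)\<^sup>2 + \<tau> * (s / 2 * (exp (- 2 * \<tau> * x) * exp (2 * \<tau> * y)) + (w y)\<^sup>2 / (2 * s))))"
      unfolding eq by (rule set_integral_add(1)[OF i])
    have "(LBINT y:{..x}. exp (\<tau> * x) * ((w y)\<^sup>2 + \<tau> * (s / 2 * (exp (- 2 * \<tau> * x) * exp (2 * \<tau> * y)) + (w y)\<^sup>2 / (2 * s))))
      = exp (\<tau> * x) * (1 + \<tau> / (2 * s)) * \<Omega> x + exp (\<tau> * x) * \<tau> * s / 2 * exp (- 2 * \<tau> * x) * (LBINT y:{..x}. exp (2 * \<tau> * y))"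
      unfolding eq set_integral_add(2)[OF i] set_integral_mult_right \<Omega>_def ..
    also have "\<dots> \<le> exp (\<tau> * x) * (1 + \<tau> / (2 * s)) * \<Omega> x + exp (\<tau> * x) * \<tau> * s / 2 * exp (- 2 * \<tau> * x) * (exp (2 * \<tau> * x) / (2 * \<tau>))"
      using \<tau> s ele by (intro add_left_mono mult_left_mono) auto
    also have "\<dots> = exp (\<tau> * x) * (\<Omega> x + s / 4 + \<tau> * \<Omega> x / (2 * s))"
    proof -
      have "exp (- 2 * \<tau> * x) * exp (2 * \<tau> * x) = 1" by (simp flip: exp_add)
      then have "exp (\<tau> * x) * \<tau> * s / 2 * exp (- 2 * \<tau> * x) * (exp (2 * \<tau> * x) / (2 * \<tau>)) = exp (\<tau> * x) * \<tau> * s / 2 * (1 / (2 * \<tau>))"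
        by (simp add: mult.assoc)
      then show ?thesis using \<tau> by (simp add: algebra_simps)
    qed
    finally show "(LBINT y:{..x}. exp (\<tau> * x) * ((w y)\<^sup>2 + \<tau> * (s / 2 * (exp (- 2 * \<tau> * x) * exp (2 * \<tau> * y)) + (w y)\<^sup>2 / (2 * s))))
      \<le> exp (\<tau> * x) * (\<Omega> x + s / 4 + \<tau> * \<Omega> x / (2 * s))" .
  qed
  have int: "set_integrable lborel {..x} (\<lambda>y. exp (\<tau> * y) * p y)" for x
  proof (rule set_integrable_bound[OF dom[of 1 x]])
    show "AE y in lborel. y \<in> {..x} \<longrightarrow> norm (exp (\<tau> * y) * p y)
      \<le> norm (exp (\<tau> * x) * ((w y)\<^sup>2 + \<tau> * (1 / 2 * (exp (- 2 * \<tau> * x) * exp (2 * \<tau> * y)) + (w y)\<^sup>2 / (2 * 1))))"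
    proof (intro AE_I2 impI)
      fix y assume "y \<in> {..x}"
      then show "norm (exp (\<tau> * y) * p y)
        \<le> norm (exp (\<tau> * x) * ((w y)\<^sup>2 + \<tau> * (1 / 2 * (exp (- 2 * \<tau> * x) * exp (2 * \<tau> * y)) + (w y)\<^sup>2 / (2 * 1))))"
        unfolding real_norm_def using ptw[of 1 y x] by (intro order_trans[OF _ abs_ge_self]) (auto simp: abs_mult)
    qed
  qed (auto simp: set_borel_measurable_def)
  define Y where "Y = (\<lambda>x. LBINT y:{..x}. exp (\<tau> * y) * p y)"
  have Y: "abs_cont Y (\<lambda>y. exp (\<tau> * y) * p y)"
    unfolding abs_cont_def
  proof (intro conjI allI impI ep)
    fix a b :: real assume ab: "a \<le> b"
    have "(LBINT y:{..a} \<union> {a..b}. exp (\<tau> * y) * p y) = (LBINT y:{..a}. exp (\<tau> * y) * p y) + (LBINT y:{a..b}. exp (\<tau> * y) * p y)"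
    proof (rule set_integral_Un_AE)
      have "AE y in lborel. y \<noteq> a" by (rule AE_lborel_singleton)
      then show "AE y in lborel. \<not> (y \<in> {..a} \<and> y \<in> {a..b})" by eventually_elim auto
    qed (use int loc_integrableD[OF ep] in auto)
    moreover have "{..a} \<union> {a..b} = {..b}" using ab by auto
    ultimately show "Y b - Y a = (LBINT y:{a..b}. exp (\<tau> * y) * p y)" by (simp add: Y_def)
  qed
  have E: "abs_cont (\<lambda>x. exp (- \<tau> * x)) (\<lambda>x. - \<tau> * exp (- \<tau> * x))"
    by (rule abs_cont_C1) (auto intro!: derivative_eq_intros continuous_intros)
  define z where "z = (\<lambda>x. exp (- \<tau> * x) * Y x)"
  have "abs_cont z (\<lambda>x. exp (- \<tau> * x) * (exp (\<tau> * x) * p x) + - \<tau> * exp (- \<tau> * x) * Y x)"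
    unfolding z_def by (rule abs_cont_mult[OF E Y])
  also have "(\<lambda>x. exp (- \<tau> * x) * (exp (\<tau> * x) * p x) + - \<tau> * exp (- \<tau> * x) * Y x) = (\<lambda>x. (w x)\<^sup>2 + \<tau> * w x - \<tau> * z x)"
    by (auto simp: z_def p_def mult.assoc[symmetric] simp flip: exp_add)
  finally have ac: "abs_cont z (\<lambda>x. (w x)\<^sup>2 + \<tau> * w x - \<tau> * z x)" .
  have zle: "\<bar>z x\<bar> \<le> \<Omega> x + s / 4 + \<tau> * \<Omega> x / (2 * s)" if s: "s > 0" for s x
  proof -
    have "\<bar>Y x\<bar> \<le> (LBINT y:{..x}. exp (\<tau> * y) * \<bar>p y\<bar>)"
      using integral_abs_bound[of lborel "\<lambda>y. indicator {..x} y * (exp (\<tau> * y) * p y)"]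
      by (simp add: Y_def set_lebesgue_integral_def abs_mult)
    also have "\<dots> \<le> (LBINT y:{..x}. exp (\<tau> * x) * ((w y)\<^sup>2 + \<tau> * (s / 2 * (exp (- 2 * \<tau> * x) * exp (2 * \<tau> * y)) + (w y)\<^sup>2 / (2 * s))))"
    proof (rule set_integral_mono[OF _ dom[OF s]])
      show "set_integrable lborel {..x} (\<lambda>y. exp (\<tau> * y) * \<bar>p y\<bar>)" using set_integrable_abs[OF int[of x]] by (simp add: abs_mult)
    qed (use ptw[OF s] in auto)
    also have "\<dots> \<le> exp (\<tau> * x) * (\<Omega> x + s / 4 + \<tau> * \<Omega> x / (2 * s))" by (rule dom_le[OF s])
    finally have "exp (- \<tau> * x) * \<bar>Y x\<bar> \<le> exp (- \<tau> * x) * (exp (\<tau> * x) * (\<Omega> x + s / 4 + \<tau> * \<Omega> x / (2 * s)))"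
      by (intro mult_left_mono) auto
    then show ?thesis by (simp add: z_def abs_mult mult.assoc[symmetric] flip: exp_add)
  qed
  have \<Omega>0: "(\<Omega> \<longlongrightarrow> 0) at_bot" unfolding \<Omega>_def by (rule half_line_tendsto_0[OF L2_loc_square[OF w] w0])
  have "(z \<longlongrightarrow> 0) at_bot"
  proof (rule tendstoI)
    fix e :: real assume e: "e > 0"
    have "((\<lambda>x. \<Omega> x + e / 4 + \<tau> * \<Omega> x / (2 * e)) \<longlongrightarrow> 0 + e / 4 + \<tau> * 0 / (2 * e)) at_bot"
      using e by (intro tendsto_intros \<Omega>0) auto
    from order_tendstoD(2)[OF this, of e]
    have "\<forall>\<^sub>F x in at_bot. \<Omega> x + e / 4 + \<tau> * \<Omega> x / (2 * e) < e" using e by simp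
    then show "\<forall>\<^sub>F x in at_bot. dist (z x) 0 < e"
    proof eventually_elim
      case (elim x) then show ?case using zle[OF e, of x] by (simp add: dist_real_def)
    qed
  qed
  with ac show thesis by (rule that)
qed

text \<open>The cross term is the integral of the derivative of \<open>\<phi>\<^sup>2\<close>; so \<open>\<tau> - \<partial>\<close> maps the weighted norm of
\<open>H\<^sup>1\<close> isometrically to \<open>L\<^sup>2\<close>.\<close>

lemma test_L2_tau_norm:
  assumes \<phi>: "test_function \<phi>"
  shows "(l2norm (deriv \<phi>))\<^sup>2 + \<tau>\<^sup>2 * (l2norm \<phi>)\<^sup>2 = (l2norm (\<lambda>x. \<tau> * \<phi> x - deriv \<phi> x))\<^sup>2"
proof -
  have i0: "integrable lborel (\<lambda>x. \<phi> x * deriv \<phi> x)"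
    by (intro test_integrable test_function_mult test_function_deriv \<phi>)
  have i1: "integrable lborel (\<lambda>x. (deriv \<phi> x)\<^sup>2)" "integrable lborel (\<lambda>x. (\<phi> x)\<^sup>2)"
    by (intro L2_integrable test_L2 test_function_deriv \<phi>)+
  have z: "(\<integral>x. \<phi> x * deriv \<phi> x \<partial>lborel) = 0"
    using abs_cont_by_parts[OF abs_cont_smooth[OF test_smooth[OF \<phi>]] \<phi>] by (simp add: mult.commute)
  have "(\<tau> * \<phi> x - deriv \<phi> x)\<^sup>2 = \<tau>\<^sup>2 * (\<phi> x)\<^sup>2 - 2 * \<tau> * (\<phi> x * deriv \<phi> x) + (deriv \<phi> x)\<^sup>2" for x
    by (simp add: power2_eq_square algebra_simps)
  then show ?thesis unfolding l2norm_power2 using i0 i1 z by simp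
qed

text \<open>The norm of \<open>v\<close> is recovered by duality.  A given test function \<open>\<theta>\<close> equals
  \<open>\<tau> \<phi> - \<phi>'\<close>, where \<open>\<phi>\<close> vanishes on the right and decays exponentially on the left;
  cutting \<open>\<phi>\<close> off changes the identity by a vanishing amount.\<close>

lemma duhamel_norm:
  assumes \<tau>: "\<tau> > 0" and w: "L2_loc w" and w0: "set_integrable lborel {..0} (\<lambda>x. (w x)\<^sup>2)"
    and z: "abs_cont z (\<lambda>x. (w x)\<^sup>2 + \<tau> * w x - \<tau> * z x)" and z0: "(z \<longlongrightarrow> 0) at_bot"
    and N: "N \<ge> 0" and T: "\<And>\<phi>. test_function \<phi> \<Longrightarrow> \<bar>miura \<tau> w \<phi>\<bar> \<le> N * sqrt ((l2norm (deriv \<phi>))\<^sup>2 + \<tau>\<^sup>2 * (l2norm \<phi>)\<^sup>2)"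
  shows "L2 (\<lambda>x. w x + z x)" "l2norm (\<lambda>x. w x + z x) \<le> N"
proof -
  let ?v = "\<lambda>x. w x + z x"
  have zc: "continuous_on S z" for S by (rule abs_cont_continuous[OF z])
  have zl: "L2_loc z" by (rule L2_loc_continuous[OF zc])
  have vl: "L2_loc ?v" by (rule L2_loc_add[OF w zl])
  have [measurable]: "w \<in> borel_measurable borel" "z \<in> borel_measurable borel" using w zl by (auto intro: L2_loc_measurable)
  \<comment> \<open>This is \<open>v' + \<tau> v = T\<close> tested against \<open>\<phi>\<close>.\<close>
  have rep: "miura \<tau> w \<phi> = (\<integral>x. ?v x * (\<tau> * \<phi> x - deriv \<phi> x) \<partial>lborel)" if \<phi>: "test_function \<phi>" for \<phi>
  proof -
    note i = miura_integrable[OF w \<phi>]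
    have iz: "integrable lborel (\<lambda>x. z x * \<phi> x)" "integrable lborel (\<lambda>x. z x * deriv \<phi> x)"
      by (intro integrable_loc_mult_test loc_integrable_continuous zc \<phi> test_function_deriv)+
    have "(\<integral>x. ((w x)\<^sup>2 + \<tau> * w x - \<tau> * z x) * \<phi> x \<partial>lborel) = - (\<integral>x. z x * deriv \<phi> x \<partial>lborel)"
      by (rule abs_cont_by_parts[OF z \<phi>])
    moreover have "(\<integral>x. ((w x)\<^sup>2 + \<tau> * w x - \<tau> * z x) * \<phi> x \<partial>lborel)
        = (\<integral>x. (w x)\<^sup>2 * \<phi> x \<partial>lborel) + \<tau> * (\<integral>x. w x * \<phi> x \<partial>lborel) - \<tau> * (\<integral>x. z x * \<phi> x \<partial>lborel)"
      using i iz by (simp add: left_diff_distrib distrib_right mult.assoc)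
    moreover have "(\<integral>x. ?v x * (\<tau> * \<phi> x - deriv \<phi> x) \<partial>lborel)
       = \<tau> * (\<integral>x. w x * \<phi> x \<partial>lborel) + \<tau> * (\<integral>x. z x * \<phi> x \<partial>lborel) - (\<integral>x. w x * deriv \<phi> x \<partial>lborel) - (\<integral>x. z x * deriv \<phi> x \<partial>lborel)"
    proof -
      have eq: "?v x * (\<tau> * \<phi> x - deriv \<phi> x) = \<tau> * (w x * \<phi> x) + \<tau> * (z x * \<phi> x) - w x * deriv \<phi> x - z x * deriv \<phi> x" for x
        by (simp add: algebra_simps)
      show ?thesis unfolding eq using i iz by simp
    qed
    ultimately show ?thesis unfolding miura_eq[OF w \<phi>] by linarith
  qed
  have dual: "(\<integral>x. ?v x * \<theta> x \<partial>lborel) \<le> N * l2norm \<theta>" if \<theta>: "test_function \<theta>" for \<theta>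
  proof -
    obtain R where R: "R > 0" "\<And>x. R \<le> \<bar>x\<bar> \<Longrightarrow> \<theta> x = 0" using test_function_support[OF \<theta>] by metis
    have s\<theta>: "smooth (\<lambda>x. exp (- \<tau> * x) * \<theta> x)" by (intro smooth_mult smooth_exp test_smooth \<theta>)
    obtain F0 where F0: "abs_cont F0 (\<lambda>x. exp (- \<tau> * x) * \<theta> x)"
      using abs_cont_exists[OF loc_integrable_continuous[OF smooth_continuous[OF s\<theta>]]] by blast
    define F where "F = (\<lambda>x. F0 x - F0 R)"
    have F: "abs_cont F (\<lambda>x. exp (- \<tau> * x) * \<theta> x)" using F0 by (simp add: abs_cont_def F_def)
    have FD: "(F has_real_derivative exp (- \<tau> * x) * \<theta> x) (at x)" for x
      by (rule abs_cont_DERIV[OF F smooth_continuous[OF s\<theta>]])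
    have sF: "smooth F" by (rule smooth_antideriv[OF FD s\<theta>])
    have F_right: "F x = 0" if "R \<le> x" for x
    proof -
      have "(LBINT y:{R..x}. exp (- \<tau> * y) * \<theta> y) = (LBINT y:{R..x}. 0)"
        by (rule set_lebesgue_integral_cong) (auto intro!: R)
      then show ?thesis using abs_contD(2)[OF F that] by (simp add: F_def)
    qed
    have F_left: "F x = F (- R)" if "x \<le> - R" for x
    proof -
      have "(LBINT y:{x..- R}. exp (- \<tau> * y) * \<theta> y) = (LBINT y:{x..- R}. 0)"
        by (rule set_lebesgue_integral_cong) (use R(1) in \<open>auto intro!: R(2)\<close>)
      then show ?thesis using abs_contD(2)[OF F that] by simp
    qed
    have "compact (F ` {- R..R})" by (intro compact_continuous_image smooth_continuous[OF sF]) auto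
    then obtain B where B: "\<And>x. x \<in> {- R..R} \<Longrightarrow> \<bar>F x\<bar> \<le> B"
      by (fastforce simp: bounded_real dest!: compact_imp_bounded)
    have FB: "\<bar>F x\<bar> \<le> B * indicator {..R} x" for x
    proof (cases "R \<le> x")
      case True
      then show ?thesis using F_right[OF True] order_trans[OF abs_ge_zero B[of R]] R(1) by (auto simp: indicator_def)
    next
      case False
      then show ?thesis using B[of x] B[of "- R"] F_left[of x] R(1) by (cases "- R \<le> x") auto
    qed
    \<comment> \<open>The solution of \<open>\<tau> \<phi> - \<phi>' = \<theta>\<close> that vanishes to the right of the support of \<open>\<theta>\<close>; to the left it is
      a multiple of \<open>exp (\<tau> x)\<close>.\<close>
    define \<phi> where "\<phi> = (\<lambda>x. exp (\<tau> * x) * ((-1) * F x))"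
    have s\<phi>: "smooth \<phi>" unfolding \<phi>_def by (intro smooth_mult smooth_exp smooth_const sF)
    have [measurable]: "\<phi> \<in> borel_measurable borel" by (intro borel_measurable_continuous_onI smooth_continuous s\<phi>)
    have d\<phi>: "deriv \<phi> x = \<tau> * \<phi> x - \<theta> x" for x
    proof -
      have "(\<phi> has_real_derivative exp (\<tau> * x) * \<tau> * ((-1) * F x) + ((-1) * (exp (- \<tau> * x) * \<theta> x)) * exp (\<tau> * x)) (at x)"
        unfolding \<phi>_def by (intro DERIV_mult DERIV_cmult FD) (auto intro!: derivative_eq_intros)
      then have "deriv \<phi> x = exp (\<tau> * x) * \<tau> * ((-1) * F x) + ((-1) * (exp (- \<tau> * x) * \<theta> x)) * exp (\<tau> * x)"
        by (rule DERIV_imp_deriv)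
      also have "((-1) * (exp (- \<tau> * x) * \<theta> x)) * exp (\<tau> * x) = - \<theta> x * (exp (- \<tau> * x) * exp (\<tau> * x))" by simp
      also have "exp (- \<tau> * x) * exp (\<tau> * x) = 1" by (simp flip: exp_add)
      finally show ?thesis by (simp add: \<phi>_def)
    qed
    have \<phi>le: "(\<phi> x)\<^sup>2 \<le> B\<^sup>2 * (indicator {..R} x * exp ((2 * \<tau>) * x))" for x
    proof -
      have "(F x)\<^sup>2 \<le> (B * indicator {..R} x)\<^sup>2" using power_mono[OF FB[of x], of 2] by simp
      then have "exp (2 * \<tau> * x) * (F x)\<^sup>2 \<le> exp (2 * \<tau> * x) * (B * indicator {..R} x)\<^sup>2" by (intro mult_left_mono) auto
      moreover have "(\<phi> x)\<^sup>2 = exp (2 * \<tau> * x) * (F x)\<^sup>2"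
        by (simp add: \<phi>_def power_mult_distrib power2_eq_square mult_ac flip: exp_add)
      moreover have "exp (2 * \<tau> * x) * (B * indicator {..R} x)\<^sup>2 = B\<^sup>2 * (indicator {..R} x * exp ((2 * \<tau>) * x))"
        by (simp add: power_mult_distrib indicator_def)
      ultimately show ?thesis by simp
    qed
    have \<phi>2: "integrable lborel (\<lambda>x. (\<phi> x)\<^sup>2)"
    proof (rule Bochner_Integration.integrable_bound)
      show "integrable lborel (\<lambda>x. B\<^sup>2 * (indicator {..R} x * exp ((2 * \<tau>) * x)))"
        using \<tau> by (intro integrable_mult_right exp_half_line(1)) simp
      show "AE x in lborel. norm ((\<phi> x)\<^sup>2) \<le> norm (B\<^sup>2 * (indicator {..R} x * exp ((2 * \<tau>) * x)))"
        using \<phi>le by (intro AE_I2) (auto simp: abs_mult)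
    qed measurable
    then have L\<phi>: "L2 \<phi>" by (simp add: L2_def)
    have \<phi>1: "integrable lborel \<phi>"
    proof (rule Bochner_Integration.integrable_bound)
      show "integrable lborel (\<lambda>x. B * (indicator {..R} x * exp (\<tau> * x)))"
        using \<tau> by (intro integrable_mult_right exp_half_line(1)) simp
      show "AE x in lborel. norm (\<phi> x) \<le> norm (B * (indicator {..R} x * exp (\<tau> * x)))"
      proof (rule AE_I2)
        fix x
        have "exp (\<tau> * x) * \<bar>F x\<bar> \<le> exp (\<tau> * x) * (B * indicator {..R} x)" by (intro mult_left_mono FB) simp
        then show "norm (\<phi> x) \<le> norm (B * (indicator {..R} x * exp (\<tau> * x)))"
          unfolding real_norm_def by (intro order_trans[OF _ abs_ge_self]) (simp add: \<phi>_def abs_mult mult_ac)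
      qed
    qed measurable
    have \<phi>0: "\<phi> x = 0" if "R \<le> x" for x using F_right[OF that] by (simp add: \<phi>_def)
    have w\<phi>: "integrable lborel (\<lambda>x. w x * \<phi> x)"
    proof (rule Bochner_Integration.integrable_bound)
      show "integrable lborel (\<lambda>x. indicator {..R} x *\<^sub>R (w x)\<^sup>2 + (\<phi> x)\<^sup>2)"
        using half_line_integrable[OF L2_loc_square[OF w] w0, of R] \<phi>2 by (simp add: set_integrable_def)
      show "AE x in lborel. norm (w x * \<phi> x) \<le> norm (indicator {..R} x *\<^sub>R (w x)\<^sup>2 + (\<phi> x)\<^sup>2)"
      proof (rule AE_I2)
        fix x
        have "2 * (\<bar>w x\<bar> * \<bar>\<phi> x\<bar>) \<le> (w x)\<^sup>2 + (\<phi> x)\<^sup>2" using sum_squares_bound[of "\<bar>w x\<bar>" "\<bar>\<phi> x\<bar>"] by (simp add: mult.assoc)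
        moreover have "0 \<le> \<bar>w x\<bar> * \<bar>\<phi> x\<bar>" by simp
        ultimately have "\<bar>w x\<bar> * \<bar>\<phi> x\<bar> \<le> (w x)\<^sup>2 + (\<phi> x)\<^sup>2" by linarith
        then show "norm (w x * \<phi> x) \<le> norm (indicator {..R} x *\<^sub>R (w x)\<^sup>2 + (\<phi> x)\<^sup>2)"
          using \<phi>0[of x] by (cases "x \<le> R") (auto simp: abs_mult indicator_def)
      qed
    qed measurable
    obtain Bz where Bz: "\<And>x. x \<le> R \<Longrightarrow> \<bar>z x\<bar> \<le> Bz"
    proof -
      have "\<forall>\<^sub>F x in at_bot. dist (z x) 0 < 1" using tendstoD[OF z0, of 1] by simp
      then obtain a where a: "\<And>x. x \<le> a \<Longrightarrow> \<bar>z x\<bar> < 1" by (auto simp: eventually_at_bot_linorder)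
      have "compact (z ` {a..R})" by (intro compact_continuous_image zc) auto
      then obtain B' where B': "\<And>x. x \<in> {a..R} \<Longrightarrow> \<bar>z x\<bar> \<le> B'"
        by (fastforce simp: bounded_real dest!: compact_imp_bounded)
      have "\<bar>z x\<bar> \<le> max 1 B'" if "x \<le> R" for x
        using a[of x] B'[of x] that by (cases "x \<le> a") auto
      then show thesis by (rule that)
    qed
    have z\<phi>: "integrable lborel (\<lambda>x. z x * \<phi> x)"
    proof (rule Bochner_Integration.integrable_bound)
      show "integrable lborel (\<lambda>x. Bz * \<phi> x)" using \<phi>1 by simp
      show "AE x in lborel. norm (z x * \<phi> x) \<le> norm (Bz * \<phi> x)"
      proof (rule AE_I2)
        fix x show "norm (z x * \<phi> x) \<le> norm (Bz * \<phi> x)"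
          using order_trans[OF Bz[of x] abs_ge_self] \<phi>0[of x] by (cases "x \<le> R") (auto simp: abs_mult intro!: mult_right_mono)
      qed
    qed measurable
    have v\<phi>: "integrable lborel (\<lambda>x. ?v x * \<phi> x)" using w\<phi> z\<phi> by (simp add: distrib_right)
    define I where "I = (\<integral>x. \<bar>?v x * \<phi> x\<bar> \<partial>lborel)"
    obtain K where K: "K > 0" "\<And>n x. \<bar>deriv (cutoff n) x\<bar> \<le> K / real (Suc n)" using cutoff_deriv_bound by metis
    have bound: "(\<integral>x. ?v x * \<theta> x \<partial>lborel) \<le> N * (l2norm \<theta> + K / real (Suc n) * l2norm \<phi>) + K / real (Suc n) * I" if n: "R \<le> real (Suc n)" for n
    proof -
      let ?\<phi> = "\<lambda>x. cutoff n x * \<phi> x"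
      have t: "test_function ?\<phi>"
        using test_function_smooth_mult[OF s\<phi> test_function_cutoff[of n]] by (simp add: mult.commute)
      have [measurable]: "deriv (cutoff n) \<in> borel_measurable borel" by (intro test_measurable test_function_deriv test_function_cutoff)
      have c\<theta>: "cutoff n x * \<theta> x = \<theta> x" for x
        using R(2)[of x] cutoff_1[of x n] n by (cases "R \<le> \<bar>x\<bar>") auto
      have d: "\<tau> * ?\<phi> x - deriv ?\<phi> x = \<theta> x - deriv (cutoff n) x * \<phi> x" for x
      proof -
        have "deriv ?\<phi> x = cutoff n x * deriv \<phi> x + deriv (cutoff n) x * \<phi> x" by (rule deriv_mult_test[OF cutoff_smooth s\<phi>])
        then have "\<tau> * ?\<phi> x - deriv ?\<phi> x = cutoff n x * \<theta> x - deriv (cutoff n) x * \<phi> x" by (simp add: d\<phi> algebra_simps)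
        then show ?thesis by (simp only: c\<theta>)
      qed
      note Lc = L2_bounded_mult[OF _ K(2) L\<phi>, of n]
      have Lc1: "L2 (\<lambda>x. deriv (cutoff n) x * \<phi> x)" "l2norm (\<lambda>x. deriv (cutoff n) x * \<phi> x) \<le> K / real (Suc n) * l2norm \<phi>"
        using Lc by auto
      have norm: "l2norm (\<lambda>x. \<theta> x - deriv (cutoff n) x * \<phi> x) \<le> l2norm \<theta> + K / real (Suc n) * l2norm \<phi>"
      proof -
        have "l2norm (\<lambda>x. \<theta> x + (-1) * (deriv (cutoff n) x * \<phi> x)) \<le> l2norm \<theta> + l2norm (\<lambda>x. (-1) * (deriv (cutoff n) x * \<phi> x))"
          by (intro l2norm_triangle test_L2 \<theta> L2_cmult Lc1)
        then show ?thesis using Lc1(2) unfolding l2norm_cmult by simp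
      qed
      have vi: "integrable lborel (\<lambda>x. ?v x * (deriv (cutoff n) x * \<phi> x))"
        and vle: "\<bar>\<integral>x. ?v x * (deriv (cutoff n) x * \<phi> x) \<partial>lborel\<bar> \<le> K / real (Suc n) * I"
      proof -
        have le: "\<bar>?v x * (deriv (cutoff n) x * \<phi> x)\<bar> \<le> K / real (Suc n) * \<bar>?v x * \<phi> x\<bar>" for x
          using mult_right_mono[OF K(2)[of n x], of "\<bar>?v x * \<phi> x\<bar>"] by (simp add: abs_mult mult_ac)
        have i: "integrable lborel (\<lambda>x. K / real (Suc n) * \<bar>?v x * \<phi> x\<bar>)" using v\<phi> by (intro integrable_mult_right integrable_abs)
        show vi: "integrable lborel (\<lambda>x. ?v x * (deriv (cutoff n) x * \<phi> x))"
        proof (rule Bochner_Integration.integrable_bound[OF i])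
          show "AE x in lborel. norm (?v x * (deriv (cutoff n) x * \<phi> x)) \<le> norm (K / real (Suc n) * \<bar>?v x * \<phi> x\<bar>)"
            unfolding real_norm_def by (intro AE_I2 order_trans[OF le abs_ge_self])
        qed measurable
        have "\<bar>\<integral>x. ?v x * (deriv (cutoff n) x * \<phi> x) \<partial>lborel\<bar> \<le> (\<integral>x. \<bar>?v x * (deriv (cutoff n) x * \<phi> x)\<bar> \<partial>lborel)" by (rule integral_abs_bound)
        also have "\<dots> \<le> (\<integral>x. K / real (Suc n) * \<bar>?v x * \<phi> x\<bar> \<partial>lborel)" by (rule integral_mono[OF integrable_abs[OF vi] i le])
        also have "\<dots> = K / real (Suc n) * I" unfolding I_def by (rule integral_mult_right_zero)
        finally show "\<bar>\<integral>x. ?v x * (deriv (cutoff n) x * \<phi> x) \<partial>lborel\<bar> \<le> K / real (Suc n) * I" .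
      qed
      have v\<theta>: "integrable lborel (\<lambda>x. ?v x * \<theta> x)" by (intro integrable_loc_mult_test L2_loc_imp_loc_integrable vl \<theta>)
      have "miura \<tau> w ?\<phi> = (\<integral>x. ?v x * \<theta> x - ?v x * (deriv (cutoff n) x * \<phi> x) \<partial>lborel)"
        unfolding rep[OF t] d by (simp only: right_diff_distrib)
      also have "\<dots> = (\<integral>x. ?v x * \<theta> x \<partial>lborel) - (\<integral>x. ?v x * (deriv (cutoff n) x * \<phi> x) \<partial>lborel)"
        by (rule Bochner_Integration.integral_diff[OF v\<theta> vi])
      finally have eq: "(\<integral>x. ?v x * \<theta> x \<partial>lborel) = miura \<tau> w ?\<phi> + (\<integral>x. ?v x * (deriv (cutoff n) x * \<phi> x) \<partial>lborel)" by simp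
      have "\<bar>miura \<tau> w ?\<phi>\<bar> \<le> N * l2norm (\<lambda>x. \<theta> x - deriv (cutoff n) x * \<phi> x)"
        using T[OF t] unfolding test_L2_tau_norm[OF t] d by simp
      also have "\<dots> \<le> N * (l2norm \<theta> + K / real (Suc n) * l2norm \<phi>)" by (rule mult_left_mono[OF norm N])
      finally show ?thesis using vle unfolding eq by linarith
    qed
    have "(\<lambda>n. N * (l2norm \<theta> + K / real (Suc n) * l2norm \<phi>) + K / real (Suc n) * I) \<longlonglongrightarrow> N * (l2norm \<theta> + 0 * l2norm \<phi>) + 0 * I"
      by (intro tendsto_intros LIMSEQ_Suc[OF lim_const_over_n])
    then have "(\<integral>x. ?v x * \<theta> x \<partial>lborel) \<le> N * (l2norm \<theta> + 0 * l2norm \<phi>) + 0 * I"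
    proof (rule LIMSEQ_le_const)
      obtain m where m: "R \<le> real m" using real_arch_simple by blast
      show "\<exists>M. \<forall>n\<ge>M. (\<integral>x. ?v x * \<theta> x \<partial>lborel) \<le> N * (l2norm \<theta> + K / real (Suc n) * l2norm \<phi>) + K / real (Suc n) * I"
        by (intro exI[of _ m] allI impI bound) (use m in linarith)
    qed
    then show ?thesis by simp
  qed
  show "L2 ?v" "l2norm ?v \<le> N" using L2_loc_dual_bound[OF vl N dual] by auto
qed

section \<open>The Riccati equation and its Lyapunov function\<close>

text \<open>The right-hand side \<open>G\<close> satisfies \<open>G' \<ge> c G\<^sup>2\<close>, so \<open>- 1 / G\<close> gains \<open>1 / e\<close>, all that is
available, over the distance \<open>1 / (c e)\<close>.\<close>

lemma blowup:
  fixes Y :: "real \<Rightarrow> real"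
  assumes Y: "continuous_on UNIV Y" and e: "e > 0" and c: "c > 0"
    and ge: "\<And>x. b \<le> x \<Longrightarrow> Y x \<ge> e + c * (LBINT t:{b..x}. (Y t)\<^sup>2)"
  shows False
proof -
  have Y2: "continuous_on UNIV (\<lambda>t. (Y t)\<^sup>2)" by (intro continuous_intros Y)
  obtain A where A: "abs_cont A (\<lambda>t. (Y t)\<^sup>2)" using abs_cont_exists[OF loc_integrable_continuous[OF Y2]] by blast
  have AD: "(A has_real_derivative (Y x)\<^sup>2) (at x)" for x by (rule abs_cont_DERIV[OF A Y2])
  define G where "G = (\<lambda>x. e + c * (A x - A b))"
  have GD: "(G has_real_derivative c * (Y x)\<^sup>2) (at x)" for x
    unfolding G_def by (auto intro!: derivative_eq_intros AD)
  have YG: "G x \<le> Y x" if "b \<le> x" for x using ge[OF that] abs_contD(2)[OF A that] by (simp add: G_def)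
  have Ge: "e \<le> G x" if "b \<le> x" for x
  proof -
    have "0 \<le> (LBINT t:{b..x}. (Y t)\<^sup>2)" unfolding set_lebesgue_integral_def by (intro integral_nonneg_AE) auto
    then show ?thesis using abs_contD(2)[OF A that] c by (simp add: G_def)
  qed
  define x1 where "x1 = b + 1 / (c * e)"
  have bx: "b \<le> x1" using c e by (simp add: x1_def)
  have "- (1 / G b) - c * b \<le> - (1 / G x1) - c * x1"
  proof (rule DERIV_nonneg_imp_nondecreasing[OF bx])
    fix x assume x: "b \<le> x" "x \<le> x1"
    have G0: "G x > 0" using Ge[OF x(1)] e by simp
    have "((\<lambda>x. - (1 / G x) - c * x) has_real_derivative (c * (Y x)\<^sup>2) / (G x)\<^sup>2 - c) (at x)"
      using G0 by (auto intro!: derivative_eq_intros GD simp: power2_eq_square)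
    moreover have "(G x)\<^sup>2 \<le> (Y x)\<^sup>2" using YG[OF x(1)] G0 by (intro power_mono) auto
    then have "c * (G x)\<^sup>2 \<le> c * (Y x)\<^sup>2" using c by (intro mult_left_mono) auto
    then have "0 \<le> (c * (Y x)\<^sup>2) / (G x)\<^sup>2 - c" using G0 by (simp add: pos_le_divide_eq)
    ultimately show "\<exists>y. ((\<lambda>x. - (1 / G x) - c * x) has_real_derivative y) (at x) \<and> 0 \<le> y" by blast
  qed
  moreover have "G b = e" by (simp add: G_def)
  moreover have "c * (x1 - b) = 1 / e" using c e by (simp add: x1_def)
  moreover have "G x1 > 0" using Ge[OF bx] e by simp
  then have "1 / G x1 > 0" by simp
  ultimately show False by (simp add: algebra_simps)
qed

text \<open>A primitive of \<open>- y (y + 2 \<tau>) / ((y + \<tau>)\<^sup>2 + \<tau>\<^sup>2)\<close>, which is the right-hand side of the unforced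
equation \<open>y' = - y (y + 2 \<tau>)\<close> divided by a positive quadratic.  The division makes the gradient bounded,
so that the forcing \<open>v\<^sup>2\<close> is admissible, and leaves linear growth at infinity.\<close>

definition lyap :: "real \<Rightarrow> real \<Rightarrow> real" where
  "lyap \<tau> y = - y + 2 * \<tau> * arctan ((y + \<tau>) / \<tau>)"

definition lyap_den :: "real \<Rightarrow> real \<Rightarrow> real" where
  "lyap_den \<tau> y = (y + \<tau>)\<^sup>2 + \<tau>\<^sup>2"

text \<open>The increase of the Lyapunov function along the unforced flow.  It is comparable to the squared
distance of \<open>y\<close> from the nearer one of the equilibria \<open>0\<close> and \<open>-2 \<tau>\<close>.\<close>

definition dissip :: "real \<Rightarrow> real \<Rightarrow> real" where
  "dissip \<tau> y = (y * (y + 2 * \<tau>))\<^sup>2 / lyap_den \<tau> y"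

lemma lyap_den_pos: "\<tau> > 0 \<Longrightarrow> lyap_den \<tau> y > 0"
  by (simp add: lyap_den_def add_nonneg_pos)

lemma lyap_DERIV:
  assumes \<tau>: "\<tau> > 0"
  shows "(lyap \<tau> has_real_derivative - (y * (y + 2 * \<tau>)) / lyap_den \<tau> y) (at y)"
proof -
  have "(lyap \<tau> has_real_derivative - 1 + 2 * \<tau> * (inverse (1 + ((y + \<tau>) / \<tau>)\<^sup>2) * (1 / \<tau>))) (at y)"
    unfolding lyap_def[abs_def] using \<tau> by (auto intro!: derivative_eq_intros)
  moreover have "- 1 + 2 * \<tau> * (inverse (1 + ((y + \<tau>) / \<tau>)\<^sup>2) * (1 / \<tau>)) = - (y * (y + 2 * \<tau>)) / lyap_den \<tau> y"
  proof -
    have "1 + ((y + \<tau>) / \<tau>)\<^sup>2 = lyap_den \<tau> y / \<tau>\<^sup>2" using \<tau> by (simp add: lyap_den_def power_divide field_simps)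
    then have "2 * \<tau> * (inverse (1 + ((y + \<tau>) / \<tau>)\<^sup>2) * (1 / \<tau>)) = 2 * \<tau>\<^sup>2 / lyap_den \<tau> y" using \<tau> by simp
    moreover have "- lyap_den \<tau> y + 2 * \<tau>\<^sup>2 = - (y * (y + 2 * \<tau>))" by (simp add: lyap_den_def power2_eq_square algebra_simps)
    moreover have "- 1 + 2 * \<tau>\<^sup>2 / lyap_den \<tau> y = (- lyap_den \<tau> y + 2 * \<tau>\<^sup>2) / lyap_den \<tau> y"
      using lyap_den_pos[OF \<tau>, of y] by (simp add: field_simps)
    ultimately show ?thesis by simp
  qed
  ultimately show ?thesis by simp
qed

lemma lyap_continuous: "\<tau> > 0 \<Longrightarrow> continuous_on UNIV (lyap \<tau>)"
  using lyap_DERIV DERIV_isCont by (auto simp: continuous_on_eq_continuous_at intro: DERIV_isCont)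

lemma dissip_nonneg: "\<tau> > 0 \<Longrightarrow> 0 \<le> dissip \<tau> y"
  using lyap_den_pos[of \<tau> y] by (simp add: dissip_def)

lemma dissip_continuous: "\<tau> > 0 \<Longrightarrow> continuous_on UNIV (dissip \<tau>)"
  unfolding dissip_def[abs_def]
  by (intro continuous_intros) (auto simp: lyap_den_def less_le[symmetric] dest: lyap_den_pos intro!: continuous_intros)

lemma dissip_ge_near_0:
  assumes \<tau>: "\<tau> > 0" and y: "- \<tau> \<le> y"
  shows "y\<^sup>2 \<le> dissip \<tau> y"
proof -
  have "lyap_den \<tau> y \<le> (y + 2 * \<tau>)\<^sup>2" using \<tau> mult_nonneg_nonneg[of "2 * \<tau>" "y + \<tau>"] y
    by (simp add: lyap_den_def power2_eq_square algebra_simps)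
  then have "y\<^sup>2 * lyap_den \<tau> y \<le> y\<^sup>2 * (y + 2 * \<tau>)\<^sup>2" by (intro mult_left_mono) auto
  then show ?thesis using lyap_den_pos[OF \<tau>, of y] by (simp add: dissip_def pos_le_divide_eq power_mult_distrib)
qed

lemma dissip_ge_near_2\<tau>:
  assumes \<tau>: "\<tau> > 0" and y: "y \<le> - \<tau>"
  shows "(y + 2 * \<tau>)\<^sup>2 \<le> dissip \<tau> y"
proof -
  have "lyap_den \<tau> y \<le> y\<^sup>2" using \<tau> mult_nonneg_nonneg[of "2 * \<tau>" "- \<tau> - y"] y
    by (simp add: lyap_den_def power2_eq_square algebra_simps)
  then have "(y + 2 * \<tau>)\<^sup>2 * lyap_den \<tau> y \<le> (y + 2 * \<tau>)\<^sup>2 * y\<^sup>2" by (intro mult_left_mono) auto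
  then show ?thesis using lyap_den_pos[OF \<tau>, of y] by (simp add: dissip_def pos_le_divide_eq power_mult_distrib mult.commute)
qed

lemma dissip_ge_left:
  assumes \<tau>: "\<tau> > 0" and y: "y \<le> - \<tau> / 2"
  shows "(y + 2 * \<tau>)\<^sup>2 \<le> 5 * dissip \<tau> y"
proof -
  have "0 \<le> 2 * ((- 2 * y - \<tau>) * (- y + \<tau>))" using \<tau> y by (intro mult_nonneg_nonneg) auto
  then have "lyap_den \<tau> y \<le> 5 * y\<^sup>2" by (simp add: lyap_den_def power2_eq_square algebra_simps)
  then have "(y + 2 * \<tau>)\<^sup>2 * lyap_den \<tau> y \<le> (y + 2 * \<tau>)\<^sup>2 * (5 * y\<^sup>2)" by (intro mult_left_mono) auto
  then show ?thesis using lyap_den_pos[OF \<tau>, of y] by (simp add: dissip_def pos_le_divide_eq power_mult_distrib mult_ac)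
qed

text \<open>With \<open>P = y (y + 2 \<tau>)\<close>, \<open>D\<close> the denominator and \<open>s = 2 y + \<tau>\<close>, the right-hand side is
\<open>(P\<^sup>2 + P s v + P v\<^sup>2) / D\<close>.  Half of \<open>P\<^sup>2\<close> absorbs \<open>P s v\<close> up to \<open>s\<^sup>2 v\<^sup>2 / 2 \<le> 5 D v\<^sup>2 / 2\<close>, and
\<open>P \<ge> - D\<close>; together this makes \<open>7 / 2\<close>.\<close>

lemma lyap_dissipation:
  assumes \<tau>: "\<tau> > 0"
  shows "dissip \<tau> y / 2 - 7 / 2 * v\<^sup>2
    \<le> (- (y * (y + 2 * \<tau>)) / lyap_den \<tau> y) * - (y * (y + 2 * \<tau>) + (2 * y + \<tau>) * v + v\<^sup>2)"
proof -
  define D where "D = lyap_den \<tau> y"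
  define P where "P = y * (y + 2 * \<tau>)"
  define s where "s = 2 * y + \<tau>"
  have D: "D > 0" unfolding D_def by (rule lyap_den_pos[OF \<tau>])
  have P1: "- D \<le> P" unfolding D_def P_def lyap_den_def
    using zero_le_power2[of "y + \<tau>"] by (simp add: power2_eq_square algebra_simps)
  have s5: "s\<^sup>2 \<le> 5 * D"
  proof -
    have "5 * D - s\<^sup>2 = (y + \<tau> + 2 * \<tau>)\<^sup>2" by (simp add: D_def s_def lyap_den_def power2_eq_square algebra_simps)
    then show ?thesis by (metis diff_ge_0_iff_ge zero_le_power2)
  qed
  have "0 \<le> (P + s * v)\<^sup>2" by simp
  then have 1: "- (P\<^sup>2 / 2) - s\<^sup>2 * v\<^sup>2 / 2 \<le> P * (s * v)" by (simp add: power2_eq_square algebra_simps)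
  have 2: "s\<^sup>2 * v\<^sup>2 \<le> 5 * D * v\<^sup>2" by (rule mult_right_mono[OF s5]) simp
  have 3: "- D * v\<^sup>2 \<le> P * v\<^sup>2" by (rule mult_right_mono[OF P1]) simp
  have "P\<^sup>2 / 2 - 7 / 2 * (D * v\<^sup>2) \<le> P\<^sup>2 + P * (s * v) + P * v\<^sup>2" using 1 2 3 by (simp add: algebra_simps)
  then have "(P\<^sup>2 / 2 - 7 / 2 * (D * v\<^sup>2)) / D \<le> (P\<^sup>2 + P * (s * v) + P * v\<^sup>2) / D" using D by (intro divide_right_mono) auto
  moreover have "(P\<^sup>2 / 2 - 7 / 2 * (D * v\<^sup>2)) / D = dissip \<tau> y / 2 - 7 / 2 * v\<^sup>2"
    using D unfolding dissip_def D_def[symmetric] P_def[symmetric] by (simp add: field_simps)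
  moreover have "(P\<^sup>2 + P * (s * v) + P * v\<^sup>2) / D = (- P / D) * - (P + s * v + v\<^sup>2)"
    by (simp add: power2_eq_square algebra_simps add_divide_distrib)
  ultimately show ?thesis by (simp only: P_def D_def s_def)
qed

text \<open>The Lyapunov function has a local maximum at \<open>0\<close> and a minimum at \<open>-2 \<tau>\<close>, and it exceeds its value at \<open>0\<close>
only far to the left of \<open>-2 \<tau>\<close>.\<close>

lemma lyap_le_0:
  assumes \<tau>: "\<tau> > 0" and y: "- 2 * \<tau> \<le> y"
  shows "lyap \<tau> y \<le> lyap \<tau> 0"
proof (cases "y \<le> 0")
  case True
  show ?thesis
  proof (rule DERIV_nonneg_imp_nondecreasing[OF True])
    fix x assume x: "y \<le> x" "x \<le> 0"
    then have "0 \<le> - (x * (x + 2 * \<tau>))" using y by (simp add: mult_nonpos_nonneg)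
    then have "0 \<le> - (x * (x + 2 * \<tau>)) / lyap_den \<tau> x" by (rule divide_nonneg_pos[OF _ lyap_den_pos[OF \<tau>]])
    then show "\<exists>d. (lyap \<tau> has_real_derivative d) (at x) \<and> 0 \<le> d" using lyap_DERIV[OF \<tau>] by blast
  qed
next
  case False
  then have "0 \<le> y" by simp
  then show ?thesis
  proof (rule DERIV_nonpos_imp_nonincreasing)
    fix x assume x: "0 \<le> x" "x \<le> y"
    then have "- (x * (x + 2 * \<tau>)) \<le> 0" using \<tau> by simp
    then have "- (x * (x + 2 * \<tau>)) / lyap_den \<tau> x \<le> 0" by (rule divide_nonpos_pos[OF _ lyap_den_pos[OF \<tau>]])
    then show "\<exists>d. (lyap \<tau> has_real_derivative d) (at x) \<and> d \<le> 0" using lyap_DERIV[OF \<tau>] by blast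
  qed
qed

lemma lyap_left:
  assumes \<tau>: "\<tau> > 0" and y: "y < - 2 * \<tau>"
  shows "lyap \<tau> y - lyap \<tau> 0 \<le> - 2 * \<tau> - y"
proof -
  have "(y + \<tau>) / \<tau> \<le> - 1" using \<tau> y by (simp add: divide_le_eq)
  then have "arctan ((y + \<tau>) / \<tau>) \<le> arctan (- 1)" by (rule arctan_monotone')
  also have "\<dots> = - (pi / 4)" by (simp add: arctan_minus arctan_one)
  finally have "2 * \<tau> * arctan ((y + \<tau>) / \<tau>) \<le> 2 * \<tau> * - (pi / 4)" using \<tau> by (intro mult_left_mono) auto
  moreover have "lyap \<tau> 0 = 2 * \<tau> * (pi / 4)" using \<tau> by (simp add: lyap_def arctan_one)
  moreover have "2 * \<tau> \<le> pi * \<tau>" using \<tau> pi_gt3 by (intro mult_right_mono) auto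
  ultimately show ?thesis by (simp add: lyap_def)
qed

text \<open>The difference is \<open>\<tau> (2 arctan (1 / 2) - 1 / 2)\<close>, and \<open>arctan (1 / 2) \<ge> 2 / 5\<close> by the mean value
theorem.\<close>

lemma lyap_drop:
  assumes \<tau>: "\<tau> > 0"
  shows "3 / 10 * \<tau> \<le> lyap \<tau> (- \<tau> / 2) - lyap \<tau> (- \<tau>)"
proof -
  obtain x where x: "0 < x" "x < (1/2::real)" "arctan (1/2) - arctan 0 = (1/2 - 0) * inverse (1 + x\<^sup>2)"
    using MVT2[of 0 "1/2::real" arctan "\<lambda>x. inverse (1 + x\<^sup>2)"] DERIV_arctan by auto
  have "x\<^sup>2 \<le> (1/2)\<^sup>2" using x by (intro power_mono) auto
  then have "1 + x\<^sup>2 \<le> 5 / 4" by (simp add: power2_eq_square)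
  moreover have "0 < 1 + x\<^sup>2" by (simp add: add_pos_nonneg)
  ultimately have "inverse (5 / 4) \<le> inverse (1 + x\<^sup>2)" by (rule le_imp_inverse_le)
  then have "4 / 5 \<le> inverse (1 + x\<^sup>2)" by simp
  then have "2 / 5 \<le> arctan (1/2)" using x(3) by simp
  then have "2 * \<tau> * (2 / 5) \<le> 2 * \<tau> * arctan (1/2)" using \<tau> by (intro mult_left_mono) auto
  moreover have "(- \<tau> / 2 + \<tau>) / \<tau> = 1 / 2" using \<tau> by (simp add: field_simps)
  ultimately show ?thesis using \<tau> by (simp add: lyap_def)
qed

text \<open>A solution of the Riccati equation \<open>q' = - q (q + 2 \<tau>) - (2 q + \<tau>) v - v\<^sup>2\<close> that starts
  at the equilibrium \<open>0\<close> and exists on the whole line.\<close>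

locale riccati =
  fixes \<tau> :: real and q v :: "real \<Rightarrow> real"
  assumes tau_pos: "\<tau> > 0" and v: "L2 v"
    and q: "abs_cont q (\<lambda>x. - (q x * (q x + 2 * \<tau>) + (2 * q x + \<tau>) * v x + (v x)\<^sup>2))"
    and q_at_bot: "(q \<longlongrightarrow> 0) at_bot"
begin

lemma q_continuous: "continuous_on S q"
  by (rule abs_cont_continuous[OF q])

lemma dissip_q: "continuous_on UNIV (\<lambda>x. dissip \<tau> (q x))"
  by (rule continuous_on_compose2[OF dissip_continuous[OF tau_pos] q_continuous]) simp

lemma dissip_loc: "loc_integrable (\<lambda>x. dissip \<tau> (q x))"
  by (rule loc_integrable_continuous[OF dissip_q])

lemma v2_loc: "loc_integrable (\<lambda>x. (v x)\<^sup>2)"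
  by (rule L2_loc_square[OF L2_imp_L2_loc[OF v]])

lemma v2_le: "(LBINT x:{a..b}. (v x)\<^sup>2) \<le> (l2norm v)\<^sup>2"
  unfolding set_lebesgue_integral_def l2norm_power2
  using loc_integrableD[OF v2_loc, of a b] L2_integrable[OF v]
  by (intro integral_mono) (auto simp: set_integrable_def indicator_def)

lemma lyap_increase:
  assumes ab: "a \<le> b"
  shows "(LBINT x:{a..b}. dissip \<tau> (q x)) / 2 - 7 / 2 * (LBINT x:{a..b}. (v x)\<^sup>2) \<le> lyap \<tau> (q b) - lyap \<tau> (q a)"
proof -
  have c: "continuous_on UNIV (\<lambda>y. - (y * (y + 2 * \<tau>)) / lyap_den \<tau> y)"
    unfolding lyap_den_def using lyap_den_pos[OF tau_pos]
    by (intro continuous_intros) (auto simp: lyap_den_def less_le)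
  note H = abs_cont_chain[OF q lyap_DERIV[OF tau_pos] c]
  have i: "set_integrable lborel {a..b} (\<lambda>x. dissip \<tau> (q x) / 2)" "set_integrable lborel {a..b} (\<lambda>x. 7 / 2 * (v x)\<^sup>2)"
    using loc_integrableD[OF dissip_loc] loc_integrableD[OF v2_loc] by simp_all
  have "(LBINT x:{a..b}. dissip \<tau> (q x)) / 2 - 7 / 2 * (LBINT x:{a..b}. (v x)\<^sup>2)
    = (LBINT x:{a..b}. dissip \<tau> (q x) / 2 - 7 / 2 * (v x)\<^sup>2)"
    using set_integral_diff(2)[OF i] by simp
  also have "\<dots> \<le> (LBINT x:{a..b}. (- (q x * (q x + 2 * \<tau>)) / lyap_den \<tau> (q x)) * - (q x * (q x + 2 * \<tau>) + (2 * q x + \<tau>) * v x + (v x)\<^sup>2))"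
    by (intro set_integral_mono set_integral_diff(1)[OF i] loc_integrableD[OF abs_contD(1)[OF H]] lyap_dissipation[OF tau_pos])
  also have "\<dots> = lyap \<tau> (q b) - lyap \<tau> (q a)" using abs_contD(2)[OF H ab] by simp
  finally show ?thesis .
qed

text \<open>Let \<open>Y\<close> be the Lyapunov function along \<open>q\<close> minus its value at \<open>0\<close>.  If \<open>Y\<close> exceeds
\<open>7 \<parallel>v\<parallel>\<^sup>2 / 2\<close> by \<open>e\<close> at a point, then by \<open>lyap_increase\<close> it stays at least \<open>e\<close> to the right of
it.  Positivity of \<open>Y\<close> forces \<open>q < - 2 \<tau>\<close>, and there \<open>Y\<^sup>2\<close> is at most the dissipation.  So \<open>Y\<close> is at least
\<open>e\<close> plus half the integral of \<open>Y\<^sup>2\<close>, and it would become infinite at a finite point.\<close>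

lemma lyap_bounded: "lyap \<tau> (q b) \<le> lyap \<tau> 0 + 7 / 2 * (l2norm v)\<^sup>2"
proof (rule ccontr)
  assume neg: "\<not> lyap \<tau> (q b) \<le> lyap \<tau> 0 + 7 / 2 * (l2norm v)\<^sup>2"
  define e where "e = lyap \<tau> (q b) - lyap \<tau> 0 - 7 / 2 * (l2norm v)\<^sup>2"
  have e: "e > 0" using neg by (simp add: e_def)
  define Y where "Y = (\<lambda>x. lyap \<tau> (q x) - lyap \<tau> 0)"
  have cY: "continuous_on UNIV Y" unfolding Y_def
    by (intro continuous_intros continuous_on_compose2[OF lyap_continuous[OF tau_pos] q_continuous]) simp
  have Y1: "e + (LBINT x:{b..x}. dissip \<tau> (q x)) / 2 \<le> Y x" if "b \<le> x" for x
    using lyap_increase[OF that] v2_le[of b x] by (simp add: Y_def e_def)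
  have nn: "0 \<le> (LBINT x:{b..x}. dissip \<tau> (q x))" for x
    unfolding set_lebesgue_integral_def by (intro integral_nonneg_AE) (auto simp: dissip_nonneg[OF tau_pos])
  have Y2: "(Y x)\<^sup>2 \<le> dissip \<tau> (q x)" if "b \<le> x" for x
  proof -
    have pos: "Y x > 0" using Y1[OF that] nn[of x] e by linarith
    then have "q x < - 2 * \<tau>" using lyap_le_0[OF tau_pos, of "q x"] by (force simp: Y_def)
    moreover from this have "Y x \<le> - 2 * \<tau> - q x" using lyap_left[OF tau_pos] by (simp add: Y_def)
    ultimately have "(Y x)\<^sup>2 \<le> (- 2 * \<tau> - q x)\<^sup>2" and "q x \<le> - \<tau>" using pos tau_pos by (auto intro: power_mono)
    moreover have "(- 2 * \<tau> - q x)\<^sup>2 = (q x + 2 * \<tau>)\<^sup>2" by (simp add: power2_eq_square algebra_simps)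
    ultimately show ?thesis using dissip_ge_near_2\<tau>[OF tau_pos] by fastforce
  qed
  have "e + 1 / 2 * (LBINT t:{b..x}. (Y t)\<^sup>2) \<le> Y x" if "b \<le> x" for x
  proof -
    have "(LBINT t:{b..x}. (Y t)\<^sup>2) \<le> (LBINT t:{b..x}. dissip \<tau> (q t))"
      by (intro set_integral_mono loc_integrableD[OF dissip_loc] loc_integrableD[OF loc_integrable_continuous] continuous_intros cY)
         (auto intro: Y2)
    then show ?thesis using Y1[OF that] by linarith
  qed
  then show False using blowup[OF cY e, of "1/2" b] by simp
qed

text \<open>The increase of the Lyapunov function from its value at \<open>0\<close>, which is the limit at \<open>-\<infinity>\<close>, is at
most \<open>7 \<parallel>v\<parallel>\<^sup>2 / 2\<close>, and \<open>lyap_increase\<close> loses another \<open>7 \<parallel>v\<parallel>\<^sup>2 / 2\<close>.  Doubling gives \<open>14\<close>.\<close>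

lemma dissip_integrable: "integrable lborel (\<lambda>x. dissip \<tau> (q x))"
  and dissip_integral: "(\<integral>x. dissip \<tau> (q x) \<partial>lborel) \<le> 14 * (l2norm v)\<^sup>2"
proof -
  have "(LBINT x:{- real n..real n}. dissip \<tau> (q x)) \<le> 14 * (l2norm v)\<^sup>2" for n
  proof -
    have "isCont (lyap \<tau>) 0" using lyap_DERIV[OF tau_pos] by (rule DERIV_isCont)
    from isCont_tendsto_compose[OF this q_at_bot]
    have "((\<lambda>a. 14 * (l2norm v)\<^sup>2 + 2 * (lyap \<tau> 0 - lyap \<tau> (q a))) \<longlongrightarrow> 14 * (l2norm v)\<^sup>2 + 2 * (lyap \<tau> 0 - lyap \<tau> 0)) at_bot"
      by (intro tendsto_intros)
    moreover have "\<forall>\<^sub>F a in at_bot. (LBINT x:{- real n..real n}. dissip \<tau> (q x)) \<le> 14 * (l2norm v)\<^sup>2 + 2 * (lyap \<tau> 0 - lyap \<tau> (q a))"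
      unfolding eventually_at_bot_linorder
    proof (intro exI[of _ "- real n"] allI impI)
      fix a assume a: "a \<le> - real n"
      have "(LBINT x:{- real n..real n}. dissip \<tau> (q x)) \<le> (LBINT x:{a..real n}. dissip \<tau> (q x))"
        unfolding set_lebesgue_integral_def
        using loc_integrableD[OF dissip_loc, of "- real n" "real n"] loc_integrableD[OF dissip_loc, of a "real n"] a
        by (intro integral_mono) (auto simp: set_integrable_def indicator_def dissip_nonneg[OF tau_pos])
      also have "\<dots> \<le> 14 * (l2norm v)\<^sup>2 + 2 * (lyap \<tau> 0 - lyap \<tau> (q a))"
        using lyap_increase[of a "real n"] a lyap_bounded[of "real n"] v2_le[of a "real n"] by simp
      finally show "(LBINT x:{- real n..real n}. dissip \<tau> (q x)) \<le> 14 * (l2norm v)\<^sup>2 + 2 * (lyap \<tau> 0 - lyap \<tau> (q a))" .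
    qed
    ultimately have "(LBINT x:{- real n..real n}. dissip \<tau> (q x)) \<le> 14 * (l2norm v)\<^sup>2 + 2 * (lyap \<tau> 0 - lyap \<tau> 0)"
      by (intro tendsto_lowerbound[of _ _ at_bot]) auto
    then show ?thesis by simp
  qed
  from integrable_of_bounded_Icc[OF dissip_loc dissip_nonneg[OF tau_pos] this]
  show "integrable lborel (\<lambda>x. dissip \<tau> (q x))" "(\<integral>x. dissip \<tau> (q x) \<partial>lborel) \<le> 14 * (l2norm v)\<^sup>2" by auto
qed

text \<open>Between \<open>- \<tau> / 2\<close> and \<open>- \<tau>\<close> the Lyapunov function drops by \<open>3 \<tau> / 10\<close>, while by
\<open>lyap_increase\<close> it can lose at most \<open>7 / 2 \<cdot> \<tau> / 20\<close> for the given cost.\<close>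

lemma stays_left:
  assumes q0: "q x < - \<tau>" and cost: "(LBINT t:{a..x}. (v t)\<^sup>2) < \<tau> / 20" and y: "a \<le> y" "y \<le> x"
  shows "q y \<le> - \<tau> / 2"
proof (rule ccontr)
  assume "\<not> q y \<le> - \<tau> / 2"
  then have qy: "- \<tau> / 2 \<le> q y" by simp
  have "\<exists>s\<ge>y. s \<le> x \<and> q s = - \<tau> / 2"
    by (rule IVT2'[OF _ qy y(2) q_continuous]) (use q0 tau_pos in simp)
  then obtain s where s: "y \<le> s" "s \<le> x" "q s = - \<tau> / 2" by blast
  have "\<exists>r\<ge>s. r \<le> x \<and> q r = - \<tau>"
    by (rule IVT2'[OF _ _ s(2) q_continuous]) (use q0 tau_pos s(3) in auto)
  then obtain r where r: "s \<le> r" "r \<le> x" "q r = - \<tau>" by blast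
  have "0 \<le> (LBINT t:{s..r}. dissip \<tau> (q t))"
    unfolding set_lebesgue_integral_def by (intro integral_nonneg_AE) (auto simp: dissip_nonneg[OF tau_pos])
  moreover have "(LBINT t:{s..r}. (v t)\<^sup>2) \<le> (LBINT t:{a..x}. (v t)\<^sup>2)"
    unfolding set_lebesgue_integral_def
    using loc_integrableD[OF v2_loc, of s r] loc_integrableD[OF v2_loc, of a x] s r y
    by (intro integral_mono) (auto simp: set_integrable_def indicator_def)
  ultimately show False using lyap_increase[OF r(1)] lyap_drop[OF tau_pos] cost tau_pos unfolding s(3) r(3) by linarith
qed

end

section \<open>The weighted Hardy inequality\<close>

lemma L2_loc_continuous_mult:
  assumes f: "continuous_on UNIV f" and g: "L2_loc g"
  shows "L2_loc (\<lambda>x. f x * g x)"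
proof -
  have "loc_integrable (\<lambda>x. (f x)\<^sup>2 * (g x)\<^sup>2)"
    by (intro loc_integrable_continuous_mult continuous_intros f L2_loc_square g)
  moreover have "(\<lambda>x. f x * g x) \<in> borel_measurable borel"
    using f g by (intro borel_measurable_times borel_measurable_continuous_onI L2_loc_measurable)
  ultimately show ?thesis by (simp add: L2_loc_def loc_integrable_def power_mult_distrib)
qed

lemma L2_of_support:
  assumes f: "L2_loc f" and R: "\<And>x. R < \<bar>x\<bar> \<Longrightarrow> f x = 0"
  shows "L2 f"
proof -
  have "(\<lambda>x. indicator {-R..R} x * f x) = f"
  proof
    fix x show "indicator {-R..R} x * f x = f x"
      using R[of x] by (cases "R < \<bar>x\<bar>") (auto simp: indicator_def)
  qed
  then show ?thesis using L2_loc_indicator[OF f, of "-R" R] by simp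
qed

text \<open>The lower bound of the form on test functions extends to absolutely continuous functions of compact
support.  The approximation must be uniform, since the form contains the product of \<open>F\<close> with the
locally square integrable function \<open>w\<close>.\<close>

lemma factor_ge_compact_support:
  assumes w: "L2_loc w" 
    and ge: "\<And>\<phi>. test_function \<phi> \<Longrightarrow> \<delta> * (l2norm \<phi>)\<^sup>2 \<le> (\<integral>x. (deriv \<phi> x - (w x + \<tau>) * \<phi> x)\<^sup>2 \<partial>lborel)"
    and F: "abs_cont F g" and g: "L2_loc g"
    and s: "\<And>x. R \<le> \<bar>x\<bar> \<Longrightarrow> F x = 0" "\<And>x. R < \<bar>x\<bar> \<Longrightarrow> g x = 0" and R: "R \<ge> 0"
  shows "\<delta> * (l2norm F)\<^sup>2 \<le> (\<integral>x. (g x - (w x + \<tau>) * F x)\<^sup>2 \<partial>lborel)"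
proof -
  have gL: "L2 g" by (rule L2_of_support[OF g s(2)])
  have FL: "L2 F" by (rule L2_of_support[OF L2_loc_continuous[OF abs_cont_continuous[OF F]], of R]) (simp add: s(1))
  obtain \<phi> :: "nat \<Rightarrow> real \<Rightarrow> real" and c where \<phi>: "\<And>n. test_function (\<phi> n)"
    "\<And>n x. R + 1 \<le> \<bar>x\<bar> \<Longrightarrow> \<phi> n x = 0"
    "(\<lambda>n. l2norm (\<lambda>x. deriv (\<phi> n) x - g x)) \<longlonglongrightarrow> 0"
    "\<And>n x. \<bar>\<phi> n x - F x\<bar> \<le> c n" "c \<longlonglongrightarrow> 0"
    using compact_support_approx[OF F gL R s] by blast
  let ?I = "indicator {-(R+1)..R+1} :: real \<Rightarrow> real"
  define a where "a = (\<lambda>x. ?I x * (w x + \<tau>))"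
  have aL: "L2 a" unfolding a_def by (intro L2_loc_indicator L2_loc_add w L2_loc_continuous continuous_intros)
  have IL: "L2 ?I" using L2_loc_indicator[OF L2_loc_continuous[of "\<lambda>x. 1"], of "-(R+1)" "R+1"] by simp
  have m: "(\<lambda>x. \<phi> n x - F x) \<in> borel_measurable borel" for n
    by (intro borel_measurable_diff test_measurable[OF \<phi>(1)] abs_cont_measurable[OF F])
  have supp: "(\<phi> n x - F x) * ?I x = \<phi> n x - F x" and supp\<phi>: "a x * \<phi> n x = (w x + \<tau>) * \<phi> n x" and suppF: "a x * F x = (w x + \<tau>) * F x" for n x
    using \<phi>(2)[of x n] s(1)[of x] by (cases "R + 1 \<le> \<bar>x\<bar>"; auto simp: a_def indicator_def)+
  have d1: "l2norm (\<lambda>x. \<phi> n x - F x) \<le> c n * l2norm ?I" for n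
    using L2_bounded_mult(2)[OF m \<phi>(4) IL, of n] by (simp only: supp)
  have d2: "L2 (\<lambda>x. (\<phi> n x - F x) * a x)" "l2norm (\<lambda>x. (\<phi> n x - F x) * a x) \<le> c n * l2norm a" for n
    using L2_bounded_mult[OF m \<phi>(4) aL, of n] by auto
  have lim1: "(\<lambda>n. l2norm (\<lambda>x. \<phi> n x - F x)) \<longlonglongrightarrow> 0"
    by (rule Lim_null_comparison[of _ "\<lambda>n. c n * l2norm ?I"]) (use d1 tendsto_mult_right[OF \<phi>(5), of "l2norm ?I"] in auto)
  have cL: "L2 (\<lambda>x. F x * a x)"
  proof -
    obtain B where B: "\<And>x. \<bar>\<phi> 0 x\<bar> \<le> B" using test_bounded[OF \<phi>(1)] by metis
    have "\<bar>F x\<bar> \<le> B + c 0" for x using B[of x] \<phi>(4)[of 0 x] by linarith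
    then show ?thesis by (rule L2_bounded_mult(1)[OF abs_cont_measurable[OF F] _ aL])
  qed
  have U: "L2 (\<lambda>x. g x - (w x + \<tau>) * F x)"
    using L2_diff[OF gL cL] by (simp add: suppF mult.commute[of "F _"])
  have Un: "L2 (\<lambda>x. deriv (\<phi> n) x - (w x + \<tau>) * \<phi> n x)" for n
  proof -
    have "L2 (\<lambda>x. deriv (\<phi> n) x - ((\<phi> n x - F x) * a x + F x * a x))"
      by (intro L2_diff L2_add test_L2 test_function_deriv \<phi> d2 cL)
    moreover have "(\<phi> n x - F x) * a x + F x * a x = (w x + \<tau>) * \<phi> n x" for x
      unfolding supp\<phi>[symmetric] by (simp add: algebra_simps)
    ultimately show ?thesis by simp
  qed
  have lim2: "(\<lambda>n. l2norm (\<lambda>x. (deriv (\<phi> n) x - (w x + \<tau>) * \<phi> n x) - (g x - (w x + \<tau>) * F x))) \<longlonglongrightarrow> 0"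
  proof (rule Lim_null_comparison[OF always_eventually[OF allI]])
    fix n
    have eq: "(deriv (\<phi> n) x - (w x + \<tau>) * \<phi> n x) - (g x - (w x + \<tau>) * F x) = (deriv (\<phi> n) x - g x) + (-1) * ((\<phi> n x - F x) * a x)" for x
      by (simp only: supp\<phi>[symmetric] suppF[symmetric]) (simp add: algebra_simps)
    have "l2norm (\<lambda>x. (deriv (\<phi> n) x - g x) + (-1) * ((\<phi> n x - F x) * a x)) \<le> l2norm (\<lambda>x. deriv (\<phi> n) x - g x) + l2norm (\<lambda>x. (-1) * ((\<phi> n x - F x) * a x))"
      by (intro l2norm_triangle L2_diff L2_cmult test_L2 test_function_deriv \<phi> gL d2)
    then show "norm (l2norm (\<lambda>x. (deriv (\<phi> n) x - (w x + \<tau>) * \<phi> n x) - (g x - (w x + \<tau>) * F x)))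
      \<le> l2norm (\<lambda>x. deriv (\<phi> n) x - g x) + c n * l2norm a"
      using d2(2)[of n] unfolding eq l2norm_cmult by simp
  next
    have "(\<lambda>n. l2norm (\<lambda>x. deriv (\<phi> n) x - g x) + c n * l2norm a) \<longlonglongrightarrow> 0 + 0 * l2norm a" by (intro tendsto_intros \<phi>)
    then show "(\<lambda>n. l2norm (\<lambda>x. deriv (\<phi> n) x - g x) + c n * l2norm a) \<longlonglongrightarrow> 0" by simp
  qed
  have "(\<lambda>n. \<integral>x. (deriv (\<phi> n) x - (w x + \<tau>) * \<phi> n x)\<^sup>2 \<partial>lborel) \<longlonglongrightarrow> (\<integral>x. (g x - (w x + \<tau>) * F x)\<^sup>2 \<partial>lborel)"
    by (rule L2_tendsto_integral_square[OF Un U lim2])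
  moreover have "(\<lambda>n. \<delta> * (l2norm (\<phi> n))\<^sup>2) \<longlonglongrightarrow> \<delta> * (l2norm F)\<^sup>2"
    unfolding l2norm_power2 by (intro tendsto_mult tendsto_const L2_tendsto_integral_square test_L2 \<phi> FL lim1)
  ultimately show ?thesis using ge[OF \<phi>(1)] by (intro LIMSEQ_le[of "\<lambda>n. \<delta> * (l2norm (\<phi> n))\<^sup>2"]) auto
qed

text \<open>With \<open>W' = w + \<tau>\<close> the substitution \<open>\<phi> = exp W \<cdot> h\<close> turns the lower bound into a Hardy
  inequality with weight \<open>exp (2 W)\<close>.\<close>

lemma Hardy_weighted:
  assumes w: "L2_loc w" and W: "abs_cont W (\<lambda>x. w x + \<tau>)"
    and ge: "\<And>\<phi>. test_function \<phi> \<Longrightarrow> \<delta> * (l2norm \<phi>)\<^sup>2 \<le> (\<integral>x. (deriv \<phi> x - (w x + \<tau>) * \<phi> x)\<^sup>2 \<partial>lborel)"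
    and h: "test_function h"
  shows "\<delta> * (\<integral>x. exp (2 * W x) * (h x)\<^sup>2 \<partial>lborel) \<le> (\<integral>x. exp (2 * W x) * (deriv h x)\<^sup>2 \<partial>lborel)"
proof -
  have E: "abs_cont (\<lambda>x. exp (W x)) (\<lambda>x. exp (W x) * (w x + \<tau>))"
    by (rule abs_cont_chain[OF W, where H=exp and H'=exp]) (auto intro!: derivative_eq_intros continuous_intros)
  have cE: "continuous_on UNIV (\<lambda>x. exp (W x))" by (rule abs_cont_continuous[OF E])
  obtain R where R: "R > 0" "\<And>x. R \<le> \<bar>x\<bar> \<Longrightarrow> h x = 0" "\<And>x. R \<le> \<bar>x\<bar> \<Longrightarrow> deriv h x = 0"
    using test_function_support[OF h] by metis
  define g where "g = (\<lambda>x. exp (W x) * deriv h x + exp (W x) * (w x + \<tau>) * h x)"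
  have F: "abs_cont (\<lambda>x. exp (W x) * h x) g"
    unfolding g_def by (rule abs_cont_mult[OF E abs_cont_smooth[OF test_smooth[OF h]]])
  have "L2_loc (\<lambda>x. exp (W x) * deriv h x + (exp (W x) * h x) * (w x + \<tau>))"
    by (intro L2_loc_add L2_loc_continuous_mult w L2_loc_continuous continuous_intros cE test_continuous test_function_deriv h)
  then have gl: "L2_loc g" by (simp add: g_def mult_ac)
  have "\<delta> * (l2norm (\<lambda>x. exp (W x) * h x))\<^sup>2 \<le> (\<integral>x. (g x - (w x + \<tau>) * (exp (W x) * h x))\<^sup>2 \<partial>lborel)"
    by (rule factor_ge_compact_support[OF w ge F gl, of R]) (use R in \<open>auto simp: g_def\<close>)
  also have "(\<lambda>x. g x - (w x + \<tau>) * (exp (W x) * h x)) = (\<lambda>x. exp (W x) * deriv h x)"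
    by (simp add: g_def)
  finally show ?thesis unfolding l2norm_power2 by (simp add: power_mult_distrib exp_double)
qed

lemma smooth_step_deriv:
  obtains K where "K \<ge> 1" "\<And>x. \<bar>deriv smooth_step x\<bar> \<le> K" "\<And>x. x \<notin> {0..1} \<Longrightarrow> deriv smooth_step x = 0"
proof -
  have out: "deriv smooth_step x = 0" if x: "x \<notin> {0..1}" for x
  proof -
    have "\<forall>\<^sub>F y in nhds x. smooth_step y = (if x < 0 then 0 else 1)"
    proof (cases "x < 0")
      case True
      show ?thesis by (rule eventually_mono[OF eventually_nhds_in_open[of "{..<0}"]]) (use True in \<open>auto simp: smooth_step_0\<close>)
    next
      case False
      show ?thesis by (rule eventually_mono[OF eventually_nhds_in_open[of "{1<..}"]]) (use False x in \<open>auto simp: smooth_step_1\<close>)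
    qed
    then have "(smooth_step has_real_derivative 0) (at x)" by (simp only: DERIV_cong_ev[OF refl _ refl] DERIV_const)
    then show ?thesis by (rule DERIV_imp_deriv)
  qed
  have "compact (deriv smooth_step ` {0..1})"
    by (intro compact_continuous_image smooth_continuous smooth_deriv smooth_smooth_step) simp
  then obtain B where B: "\<And>x. x \<in> {0..1} \<Longrightarrow> \<bar>deriv smooth_step x\<bar> \<le> B"
    by (fastforce simp: bounded_real dest!: compact_imp_bounded)
  have "\<bar>deriv smooth_step x\<bar> \<le> max 1 B" for x using B[of x] out[of x] by (cases "x \<in> {0..1}") auto
  with out show thesis by (intro that[of "max 1 B"]) auto
qed

text \<open>The test function rises from \<open>0\<close> to \<open>1\<close> far to the left, equals \<open>1\<close> on the left interval and falls
back to \<open>0\<close> across the right interval.  Since \<open>w\<close> is square integrable on the left half line,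
\<open>primitive_growth\<close> bounds the weight \<open>exp (2 W)\<close> by a multiple of \<open>exp (\<tau> x)\<close> there, so that the contribution of
the rise disappears as it is moved to \<open>-\<infinity>\<close>.\<close>

lemma Hardy_two_intervals:
  assumes \<tau>: "\<tau> > 0" and w: "L2_loc w" and w0: "set_integrable lborel {..0} (\<lambda>x. (w x)\<^sup>2)"
    and W: "abs_cont W (\<lambda>x. w x + \<tau>)" and \<delta>: "\<delta> \<ge> 0"
    and ge: "\<And>\<phi>. test_function \<phi> \<Longrightarrow> \<delta> * (l2norm \<phi>)\<^sup>2 \<le> (\<integral>x. (deriv \<phi> x - (w x + \<tau>) * \<phi> x)\<^sup>2 \<partial>lborel)"
    and K: "K \<ge> 1" "\<And>x. \<bar>deriv smooth_step x\<bar> \<le> K" "\<And>x. x \<notin> {0..1} \<Longrightarrow> deriv smooth_step x = 0"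
    and \<alpha>\<beta>: "\<alpha> + 1 / \<tau> < \<beta> - 1 / \<tau>"
  shows "\<delta> * (LBINT x:{\<alpha>..\<alpha> + 1 / \<tau>}. exp (2 * W x)) \<le> K\<^sup>2 * \<tau>\<^sup>2 * (LBINT x:{\<beta> - 1 / \<tau>..\<beta>}. exp (2 * W x))"
proof -
  have cE: "continuous_on UNIV (\<lambda>x. exp (2 * W x))" by (intro continuous_intros abs_cont_continuous[OF W])
  have [measurable]: "(\<lambda>x. exp (2 * W x)) \<in> borel_measurable borel" by (rule borel_measurable_continuous_onI[OF cE])
  have Ei: "set_integrable lborel {a..b} (\<lambda>x. exp (2 * W x))" for a b
    by (rule loc_integrableD[OF loc_integrable_continuous[OF cE]])
  define A where "A = (LBINT x:{\<alpha>..\<alpha> + 1 / \<tau>}. exp (2 * W x))"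
  define B where "B = (LBINT x:{\<beta> - 1 / \<tau>..\<beta>}. exp (2 * W x))"
  define \<Omega> where "\<Omega> = (LBINT x:{..0}. (w x)\<^sup>2)"
  have W_le: "W x \<le> W 0 + \<Omega> / (2 * \<tau>) + \<tau> / 2 * x" if x: "x \<le> 0" for x
  proof -
    have "(LBINT t:{x..0}. (w t)\<^sup>2) \<le> \<Omega>"
      unfolding \<Omega>_def set_lebesgue_integral_def
      using loc_integrableD[OF L2_loc_square[OF w], of x 0] w0
      by (intro integral_mono) (auto simp: set_integrable_def indicator_def)
    then have "(LBINT t:{x..0}. (w t)\<^sup>2) / (2 * \<tau>) \<le> \<Omega> / (2 * \<tau>)" using \<tau> by (intro divide_right_mono) auto
    then show ?thesis using primitive_growth[OF \<tau> w W x] by (simp add: algebra_simps)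
  qed
  define M where "M = exp (2 * W 0 + \<Omega> / \<tau>)"
  have R_bound: "\<delta> * A \<le> K\<^sup>2 * (M * exp (- \<tau> * R)) + K\<^sup>2 * \<tau>\<^sup>2 * B" if R: "R \<ge> 0" "- R \<le> \<alpha>" for R
  proof -
    define h where "h = (\<lambda>x. smooth_step (1 * x + (R + 1)) * smooth_step ((- \<tau>) * x + \<tau> * \<beta>))"
    have sm: "smooth (\<lambda>x. smooth_step (1 * x + (R + 1)))" "smooth (\<lambda>x. smooth_step ((- \<tau>) * x + \<tau> * \<beta>))"
      by (intro smooth_affine smooth_smooth_step)+
    have h0: "h x = 0" if "x \<notin> {-(R + 1)..\<beta>}" for x
    proof (cases "x < - (R + 1)")
      case True then show ?thesis by (simp add: h_def smooth_step_0)
    next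
      case False
      then have "\<tau> * \<beta> \<le> \<tau> * x" using that \<tau> by (intro mult_left_mono) auto
      then show ?thesis by (simp add: h_def smooth_step_0)
    qed
    have h: "test_function h"
      unfolding test_function_iff
    proof (intro conjI exI allI impI)
      show "smooth h" unfolding h_def by (rule smooth_mult[OF sm])
      fix x assume "\<bar>R + 1\<bar> + \<bar>\<beta>\<bar> < \<bar>x\<bar>" then show "h x = 0" by (intro h0) auto
    qed
    have h1: "h x = 1" if x: "- R \<le> x" "x \<le> \<beta> - 1 / \<tau>" for x
    proof -
      have "\<tau> * x \<le> \<tau> * (\<beta> - 1 / \<tau>)" using \<tau> x by (intro mult_left_mono) auto
      then have "(- \<tau>) * x + \<tau> * \<beta> \<ge> 1" using \<tau> by (simp add: right_diff_distrib)
      then show ?thesis using x by (simp add: h_def smooth_step_1)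
    qed
    have dh: "deriv h x = smooth_step (1 * x + (R + 1)) * (deriv smooth_step ((- \<tau>) * x + \<tau> * \<beta>) * (- \<tau>)) + deriv smooth_step (1 * x + (R + 1)) * 1 * smooth_step ((- \<tau>) * x + \<tau> * \<beta>)" for x
    proof -
      have 1: "((\<lambda>x. smooth_step (1 * x + (R + 1))) has_real_derivative deriv smooth_step (1 * x + (R + 1)) * 1) (at x)"
        by (rule DERIV_chain2[OF smooth_DERIV[OF smooth_smooth_step]]) (auto intro!: derivative_eq_intros)
      have 2: "((\<lambda>x. smooth_step ((- \<tau>) * x + \<tau> * \<beta>)) has_real_derivative deriv smooth_step ((- \<tau>) * x + \<tau> * \<beta>) * (- \<tau>)) (at x)"
        by (rule DERIV_chain2[OF smooth_DERIV[OF smooth_smooth_step]]) (auto intro!: derivative_eq_intros)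
      show ?thesis unfolding h_def by (rule DERIV_imp_deriv) (use DERIV_mult[OF 1 2] in \<open>simp add: algebra_simps\<close>)
    qed
    have dh_le: "(deriv h x)\<^sup>2 \<le> K\<^sup>2 * indicator {- R - 1..- R} x + K\<^sup>2 * \<tau>\<^sup>2 * indicator {\<beta> - 1 / \<tau>..\<beta>} x" for x
    proof -
      define p where "p = deriv smooth_step (1 * x + (R + 1)) * 1 * smooth_step ((- \<tau>) * x + \<tau> * \<beta>)"
      define r where "r = smooth_step (1 * x + (R + 1)) * (deriv smooth_step ((- \<tau>) * x + \<tau> * \<beta>) * (- \<tau>))"
      have p: "\<bar>p\<bar> \<le> K" "x \<notin> {- R - 1..- R} \<Longrightarrow> p = 0"
      proof -
        have "\<bar>p\<bar> \<le> K * 1" unfolding p_def abs_mult using K(1) smooth_step_range by (intro mult_mono) (auto intro: K(2))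
        then show "\<bar>p\<bar> \<le> K" by simp
        show "p = 0" if "x \<notin> {- R - 1..- R}" using K(3)[of "1 * x + (R + 1)"] that by (auto simp: p_def)
      qed
      have r: "\<bar>r\<bar> \<le> K * \<tau>" "x \<notin> {\<beta> - 1 / \<tau>..\<beta>} \<Longrightarrow> r = 0"
      proof -
        have "\<bar>r\<bar> \<le> 1 * (K * \<tau>)" unfolding r_def abs_mult using K(1) \<tau> smooth_step_range by (intro mult_mono) (auto intro: K(2))
        then show "\<bar>r\<bar> \<le> K * \<tau>" by simp
        show "r = 0" if x: "x \<notin> {\<beta> - 1 / \<tau>..\<beta>}"
        proof -
          have "(- \<tau>) * x + \<tau> * \<beta> \<notin> {0..1}"
          proof
            assume "(- \<tau>) * x + \<tau> * \<beta> \<in> {0..1}"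
            then have "0 \<le> \<tau> * (\<beta> - x)" "\<tau> * (\<beta> - x) \<le> 1" by (auto simp: algebra_simps)
            then have "0 \<le> \<beta> - x" "\<beta> - x \<le> 1 / \<tau>" using \<tau> by (auto simp: zero_le_mult_iff pos_le_divide_eq mult.commute)
            then show False using x by auto
          qed
          then show ?thesis using K(3) by (simp add: r_def)
        qed
      qed
      have disj: "p = 0 \<or> r = 0"
      proof (cases "r = 0")
        case False
        then have "\<beta> - 1 / \<tau> \<le> x" using r(2) by auto
        moreover have "0 < 1 / \<tau>" using \<tau> by simp
        ultimately have "- R < x" using \<alpha>\<beta> R by linarith
        then show ?thesis using p(2) by simp
      qed simp
      have d: "deriv h x = r + p" unfolding dh p_def r_def ..
      have p2: "p\<^sup>2 \<le> K\<^sup>2" using power_mono[OF p(1), of 2] by simp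
      have r2: "r\<^sup>2 \<le> K\<^sup>2 * \<tau>\<^sup>2" using power_mono[OF r(1), of 2] by (simp add: power_mult_distrib)
      have "p\<^sup>2 \<le> K\<^sup>2 * indicator {- R - 1..- R} x" using p2 p(2) by (cases "x \<in> {- R - 1..- R}") auto
      moreover have "r\<^sup>2 \<le> K\<^sup>2 * \<tau>\<^sup>2 * indicator {\<beta> - 1 / \<tau>..\<beta>} x" using r2 r(2) by (cases "x \<in> {\<beta> - 1 / \<tau>..\<beta>}") auto
      moreover have "(r + p)\<^sup>2 = p\<^sup>2 + r\<^sup>2" using disj by auto
      ultimately show ?thesis unfolding d by linarith
    qed
    have ih: "integrable lborel (\<lambda>x. exp (2 * W x) * (h x)\<^sup>2)" "integrable lborel (\<lambda>x. exp (2 * W x) * (deriv h x)\<^sup>2)"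
      unfolding power2_eq_square
      by (intro integrable_loc_mult_test loc_integrable_continuous cE test_function_mult test_function_deriv h)+
    have "A \<le> (\<integral>x. exp (2 * W x) * (h x)\<^sup>2 \<partial>lborel)"
      unfolding A_def set_lebesgue_integral_def
    proof (rule integral_mono[OF _ ih(1)])
      show "integrable lborel (\<lambda>x. indicator {\<alpha>..\<alpha> + 1 / \<tau>} x *\<^sub>R exp (2 * W x))" using Ei by (simp add: set_integrable_def)
      show "indicator {\<alpha>..\<alpha> + 1 / \<tau>} x *\<^sub>R exp (2 * W x) \<le> exp (2 * W x) * (h x)\<^sup>2" for x
        using h1[of x] R \<alpha>\<beta> by (auto simp: indicator_def)
    qed
    then have "\<delta> * A \<le> \<delta> * (\<integral>x. exp (2 * W x) * (h x)\<^sup>2 \<partial>lborel)" by (rule mult_left_mono[OF _ \<delta>])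
    also have "\<dots> \<le> (\<integral>x. exp (2 * W x) * (deriv h x)\<^sup>2 \<partial>lborel)" by (rule Hardy_weighted[OF w W ge h])
    also have "\<dots> \<le> (\<integral>x. K\<^sup>2 * (indicator {- R - 1..- R} x *\<^sub>R exp (2 * W x)) + K\<^sup>2 * \<tau>\<^sup>2 * (indicator {\<beta> - 1 / \<tau>..\<beta>} x *\<^sub>R exp (2 * W x)) \<partial>lborel)"
    proof (rule integral_mono[OF ih(2)])
      show "integrable lborel (\<lambda>x. K\<^sup>2 * (indicator {- R - 1..- R} x *\<^sub>R exp (2 * W x)) + K\<^sup>2 * \<tau>\<^sup>2 * (indicator {\<beta> - 1 / \<tau>..\<beta>} x *\<^sub>R exp (2 * W x)))"
        using Ei unfolding set_integrable_def by (intro Bochner_Integration.integrable_add integrable_mult_right) auto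
      show "exp (2 * W x) * (deriv h x)\<^sup>2 \<le> K\<^sup>2 * (indicator {- R - 1..- R} x *\<^sub>R exp (2 * W x)) + K\<^sup>2 * \<tau>\<^sup>2 * (indicator {\<beta> - 1 / \<tau>..\<beta>} x *\<^sub>R exp (2 * W x))" for x
        using mult_left_mono[OF dh_le[of x], of "exp (2 * W x)"] by (simp add: algebra_simps)
    qed
    also have "\<dots> = K\<^sup>2 * (LBINT x:{- R - 1..- R}. exp (2 * W x)) + K\<^sup>2 * \<tau>\<^sup>2 * B"
      unfolding B_def set_lebesgue_integral_def
      unfolding Bochner_Integration.integral_add[OF integrable_mult_right[OF Ei[unfolded set_integrable_def]]
          integrable_mult_right[OF Ei[unfolded set_integrable_def]]] integral_mult_right_zero ..
    also have "(LBINT x:{- R - 1..- R}. exp (2 * W x)) \<le> (LBINT x:{- R - 1..- R}. M * exp (- \<tau> * R))"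
    proof (rule set_integral_mono[OF Ei])
      show "set_integrable lborel {- R - 1..- R} (\<lambda>x. M * exp (- \<tau> * R))" by (intro borel_integrable_atLeastAtMost') auto
      fix x assume x: "x \<in> {- R - 1..- R}"
      have "2 * W x \<le> 2 * (W 0 + \<Omega> / (2 * \<tau>) + \<tau> / 2 * x)" using W_le[of x] x R by simp
      also have "\<dots> = (2 * W 0 + \<Omega> / \<tau>) + \<tau> * x" using \<tau> by (simp add: field_simps)
      also have "\<dots> \<le> (2 * W 0 + \<Omega> / \<tau>) + - \<tau> * R" using mult_left_mono[of x "- R" \<tau>] x \<tau> by simp
      finally show "exp (2 * W x) \<le> M * exp (- \<tau> * R)" unfolding M_def exp_add[symmetric] by simp
    qed
    also have "(LBINT x:{- R - 1..- R}. M * exp (- \<tau> * R)) = M * exp (- \<tau> * R)" by (simp add: set_lebesgue_integral_def)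
    finally show ?thesis by (simp add: mult_left_mono)
  qed
  have "((\<lambda>R. K\<^sup>2 * (M * exp (- \<tau> * R)) + K\<^sup>2 * \<tau>\<^sup>2 * B) \<longlongrightarrow> K\<^sup>2 * (M * 0) + K\<^sup>2 * \<tau>\<^sup>2 * B) at_top"
  proof (intro tendsto_intros)
    have "filterlim (\<lambda>R. - \<tau> * R) at_bot at_top"
      by (rule filterlim_tendsto_neg_mult_at_bot[OF tendsto_const _ filterlim_ident]) (use \<tau> in simp)
    then show "((\<lambda>R. exp (- \<tau> * R)) \<longlongrightarrow> 0) at_top" by (rule filterlim_compose[OF exp_at_bot])
  qed
  moreover have "\<forall>\<^sub>F R in at_top. \<delta> * A \<le> K\<^sup>2 * (M * exp (- \<tau> * R)) + K\<^sup>2 * \<tau>\<^sup>2 * B"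
    unfolding eventually_at_top_linorder by (intro exI[of _ "\<bar>\<alpha>\<bar>"] allI impI R_bound) auto
  ultimately have "\<delta> * A \<le> K\<^sup>2 * (M * 0) + K\<^sup>2 * \<tau>\<^sup>2 * B" by (intro tendsto_lowerbound[of _ _ at_top]) auto
  then show ?thesis by (simp add: A_def B_def)
qed

section \<open>The length of the excursions\<close>

context riccati
begin

text \<open>To the left of a point with \<open>q < - \<tau>\<close> there is either a definite cost within distance
  \<open>\<Lambda>\<close>, or the weight \<open>exp (2 W)\<close> decays exponentially over the distance \<open>\<Lambda>\<close>, which the Hardy
  inequality forbids.\<close>

lemma cost_before_left:
  assumes W: "abs_cont W (\<lambda>x. (q x + v x) + \<tau>)"
    and Hardy: "\<And>\<alpha> \<beta>. \<alpha> + 1 / \<tau> < \<beta> - 1 / \<tau> \<Longrightarrow>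
      \<delta> * (LBINT t:{\<alpha>..\<alpha> + 1 / \<tau>}. exp (2 * W t)) \<le> L * (LBINT t:{\<beta> - 1 / \<tau>..\<beta>}. exp (2 * W t))"
    and L: "L \<ge> 0" and \<Lambda>: "\<tau> * \<Lambda> \<ge> 3" "L * exp (5 / 2 - \<tau> * \<Lambda>) < \<delta>"
    and x: "q x < - \<tau>"
  shows "\<tau> / 20 \<le> (LBINT t:{x - \<Lambda>..x}. (v t)\<^sup>2 + dissip \<tau> (q t))"
proof (rule ccontr)
  let ?f = "\<lambda>t. (v t)\<^sup>2 + dissip \<tau> (q t)"
  assume "\<not> \<tau> / 20 \<le> (LBINT t:{x - \<Lambda>..x}. ?f t)"
  then have small: "(LBINT t:{x - \<Lambda>..x}. ?f t) < \<tau> / 20" by simp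
  have \<tau>: "\<tau> > 0" by (rule tau_pos)
  have floc: "loc_integrable ?f" by (rule loc_integrable_add[OF v2_loc dissip_loc])
  have f0: "0 \<le> ?f t" for t using dissip_nonneg[OF \<tau>] by simp
  have "(LBINT t:{x - \<Lambda>..x}. (v t)\<^sup>2) \<le> (LBINT t:{x - \<Lambda>..x}. ?f t)"
    by (intro set_integral_mono loc_integrableD v2_loc floc) (simp add: dissip_nonneg[OF \<tau>])
  then have "(LBINT t:{x - \<Lambda>..x}. (v t)\<^sup>2) < \<tau> / 20" using small by linarith
  from stays_left[OF x this] have left: "q y \<le> - \<tau> / 2" if "x - \<Lambda> \<le> y" "y \<le> x" for y using that by blast
  have decay: "2 * W b - 2 * W a \<le> - \<tau> * (b - a) + 1 / 2" if ab: "x - \<Lambda> \<le> a" "a \<le> b" "b \<le> x" for a b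
  proof -
    have i: "set_integrable lborel {a..b} (\<lambda>t. - \<tau> / 2)" "set_integrable lborel {a..b} (\<lambda>t. 5 / \<tau> * ?f t)"
      by (rule borel_integrable_atLeastAtMost'[OF continuous_on_const])
         (rule set_integrable_mult_right, rule loc_integrableD[OF floc])
    have "W b - W a = (LBINT t:{a..b}. (q t + v t) + \<tau>)" by (rule abs_contD(2)[OF W ab(2)])
    also have "\<dots> \<le> (LBINT t:{a..b}. - \<tau> / 2 + 5 / \<tau> * ?f t)"
    proof (intro set_integral_mono set_integral_add(1)[OF i] loc_integrableD[OF abs_contD(1)[OF W]])
      fix t assume t: "t \<in> {a..b}"
      define s where "s = q t + 2 * \<tau>"
      have am: "y \<le> \<tau> / 4 + y\<^sup>2 / \<tau>" for y
      proof -
        have "0 \<le> (y - \<tau> / 2)\<^sup>2 / \<tau>" using \<tau> by simp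
        also have "\<dots> = y\<^sup>2 / \<tau> - y + \<tau> / 4" using \<tau> by (simp add: power2_diff field_simps power2_eq_square)
        finally show ?thesis by simp
      qed
      \<comment> \<open>With \<open>s\<close> the displacement of \<open>q\<close> from \<open>-2 \<tau>\<close> the integrand is \<open>s + v - \<tau>\<close>; each of \<open>s\<close> and \<open>v\<close> is at most
        \<open>\<tau> / 4\<close> plus its square over \<open>\<tau>\<close>.\<close>
      have "s\<^sup>2 \<le> 5 * dissip \<tau> (q t)" unfolding s_def using left[of t] t ab by (intro dissip_ge_left[OF \<tau>]) auto
      then have "s\<^sup>2 + (v t)\<^sup>2 \<le> 5 * ?f t" using zero_le_power2[of "v t"] unfolding distrib_left by linarith
      then have "(s\<^sup>2 + (v t)\<^sup>2) / \<tau> \<le> 5 * ?f t / \<tau>" using \<tau> by (intro divide_right_mono) auto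
      moreover have "(q t + v t) + \<tau> = s + v t - \<tau>" by (simp add: s_def)
      ultimately show "(q t + v t) + \<tau> \<le> - \<tau> / 2 + 5 / \<tau> * ?f t"
        using am[of s] am[of "v t"] by (simp add: add_divide_distrib)
    qed
    also have "\<dots> = (LBINT t:{a..b}. - \<tau> / 2) + 5 / \<tau> * (LBINT t:{a..b}. ?f t)"
      by (simp only: set_integral_add(2)[OF i] set_integral_mult_right)
    also have "(LBINT t:{a..b}. - \<tau> / 2) = - \<tau> / 2 * (b - a)" using ab by (simp add: set_lebesgue_integral_def)
    finally have W1: "W b - W a \<le> - \<tau> / 2 * (b - a) + 5 / \<tau> * (LBINT t:{a..b}. ?f t)" .
    have "(LBINT t:{a..b}. ?f t) \<le> (LBINT t:{x - \<Lambda>..x}. ?f t)"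
      unfolding set_lebesgue_integral_def
      using loc_integrableD[OF floc, of a b] loc_integrableD[OF floc, of "x - \<Lambda>" x] ab f0
      by (intro integral_mono) (auto simp: set_integrable_def indicator_def)
    then have "5 / \<tau> * (LBINT t:{a..b}. ?f t) \<le> 5 / \<tau> * (\<tau> / 20)" using small \<tau> by (intro mult_left_mono) auto
    also have "\<dots> = 1 / 4" using \<tau> by simp
    finally show ?thesis using W1 by simp
  qed
  define \<alpha> \<beta> where "\<alpha> = x - \<Lambda>" and "\<beta> = x"
  have \<Lambda>\<tau>: "\<Lambda> \<ge> 3 / \<tau>" using \<Lambda>(1) \<tau> by (simp add: divide_le_eq mult.commute)
  have pos: "1 / \<tau> > 0" using \<tau> by simp
  have "2 / \<tau> < 3 / \<tau>" using \<tau> by (simp add: divide_strict_right_mono)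
  then have sep: "\<alpha> + 1 / \<tau> < \<beta> - 1 / \<tau>" using \<Lambda>\<tau> by (simp add: \<alpha>_def \<beta>_def)
  have cE: "continuous_on UNIV (\<lambda>x. exp (2 * W x))" by (intro continuous_intros abs_cont_continuous[OF W])
  have Ei: "set_integrable lborel {a..b} (\<lambda>x. exp (2 * W x))" for a b
    by (rule loc_integrableD[OF loc_integrable_continuous[OF cE]])
  define A B where "A = (LBINT t:{\<alpha>..\<alpha> + 1 / \<tau>}. exp (2 * W t))" and "B = (LBINT t:{\<beta> - 1 / \<tau>..\<beta>}. exp (2 * W t))"
  define c where "c = exp (5 / 2 - \<tau> * \<Lambda>)"
  \<comment> \<open>The two intervals have length \<open>1 / \<tau>\<close>, so their points are at least \<open>\<Lambda> - 2 / \<tau>\<close> apart; together with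
    the error \<open>1 / 2\<close> in \<open>decay\<close> this is the \<open>5 / 2\<close> in the exponent.\<close>
  have ab: "exp (2 * W b) \<le> c * exp (2 * W a)" if "a \<in> {\<alpha>..\<alpha> + 1 / \<tau>}" "b \<in> {\<beta> - 1 / \<tau>..\<beta>}" for a b
  proof -
    have "2 * W b - 2 * W a \<le> - \<tau> * (b - a) + 1 / 2" using that sep by (intro decay) (auto simp: \<alpha>_def \<beta>_def)
    also have "\<Lambda> - 2 / \<tau> \<le> b - a" using that by (auto simp: \<alpha>_def \<beta>_def)
    then have "\<tau> * (\<Lambda> - 2 / \<tau>) \<le> \<tau> * (b - a)" using \<tau> by (intro mult_left_mono) auto
    then have "- \<tau> * (b - a) + 1 / 2 \<le> 5 / 2 - \<tau> * \<Lambda>" using \<tau> by (simp add: right_diff_distrib)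
    finally have "exp (2 * W b) \<le> exp ((5 / 2 - \<tau> * \<Lambda>) + 2 * W a)" by simp
    then show ?thesis by (simp only: exp_add c_def)
  qed
  have b1: "1 / \<tau> * exp (2 * W b) \<le> c * A" if b: "b \<in> {\<beta> - 1 / \<tau>..\<beta>}" for b
  proof -
    have "1 / \<tau> * exp (2 * W b) = (LBINT a:{\<alpha>..\<alpha> + 1 / \<tau>}. exp (2 * W b))" using \<tau> by (simp add: set_lebesgue_integral_def)
    also have "\<dots> \<le> (LBINT a:{\<alpha>..\<alpha> + 1 / \<tau>}. c * exp (2 * W a))"
      by (intro set_integral_mono borel_integrable_atLeastAtMost' set_integrable_mult_right Ei ab b) auto
    finally show ?thesis by (simp add: A_def)
  qed
  have "1 / \<tau> * B = (LBINT b:{\<beta> - 1 / \<tau>..\<beta>}. 1 / \<tau> * exp (2 * W b))" by (simp add: B_def)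
  also have "\<dots> \<le> (LBINT b:{\<beta> - 1 / \<tau>..\<beta>}. c * A)"
    by (intro set_integral_mono borel_integrable_atLeastAtMost' set_integrable_mult_right Ei b1) (auto intro: Ei)
  also have "\<dots> = 1 / \<tau> * (c * A)" using \<tau> by (simp add: set_lebesgue_integral_def)
  finally have BA: "B \<le> c * A" using \<tau> by (simp add: divide_le_cancel)
  have A: "A > 0"
  proof -
    have cW: "compact (W ` {\<alpha>..\<alpha> + 1 / \<tau>})" by (intro compact_continuous_image abs_cont_continuous[OF W]) auto
    then obtain M where M: "\<And>t. t \<in> {\<alpha>..\<alpha> + 1 / \<tau>} \<Longrightarrow> \<bar>W t\<bar> \<le> M"
      by (fastforce simp: bounded_real dest!: compact_imp_bounded)
    have "1 / \<tau> * exp (- 2 * M) = (LBINT t:{\<alpha>..\<alpha> + 1 / \<tau>}. exp (- 2 * M))" using \<tau> by (simp add: set_lebesgue_integral_def)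
    also have "\<dots> \<le> A" unfolding A_def
    proof (intro set_integral_mono borel_integrable_atLeastAtMost' Ei)
      fix t assume "t \<in> {\<alpha>..\<alpha> + 1 / \<tau>}" then show "exp (- 2 * M) \<le> exp (2 * W t)" using M[of t] by (simp add: abs_le_iff)
    qed (auto intro: continuous_on_subset[OF cE])
    finally show ?thesis using \<tau> by (smt (verit) exp_gt_zero mult_pos_pos pos)
  qed
  have "\<delta> * A \<le> L * B" unfolding A_def B_def by (rule Hardy[OF sep])
  also have "\<dots> \<le> L * (c * A)" by (rule mult_left_mono[OF BA L])
  finally have "\<delta> * A \<le> (L * c) * A" by simp
  then have "\<delta> \<le> L * c" using A by simp
  then show False using \<Lambda>(2) by (simp add: c_def)
qed

text \<open>Integrate the lower bound of the cost over the set and exchange the integrals: each \<open>t\<close> is counted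
for the points \<open>x\<close> of an interval of length \<open>\<Lambda>\<close>.  The total cost is at most \<open>(1 + 14) \<parallel>v\<parallel>\<^sup>2\<close>, and
\<open>20 \<cdot> 15 = 300\<close>.\<close>

lemma left_set_measure:
  assumes \<Lambda>: "\<Lambda> \<ge> 0" and cost: "\<And>x. q x < - \<tau> \<Longrightarrow> \<tau> / 20 \<le> (LBINT t:{x - \<Lambda>..x}. (v t)\<^sup>2 + dissip \<tau> (q t))"
  shows "integrable lborel (\<lambda>x. indicator {x. q x < - \<tau>} x :: real)"
    "\<tau> * (\<integral>x. indicator {x. q x < - \<tau>} x \<partial>lborel) \<le> 300 * \<Lambda> * (l2norm v)\<^sup>2"
proof -
  let ?f = "\<lambda>t. (v t)\<^sup>2 + dissip \<tau> (q t)"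
  have \<tau>: "\<tau> > 0" by (rule tau_pos)
  have [measurable]: "q \<in> borel_measurable borel" by (rule abs_cont_measurable[OF q])
  have [measurable]: "v \<in> borel_measurable borel" by (rule L2_measurable[OF v])
  have [measurable]: "(\<lambda>t. dissip \<tau> (q t)) \<in> borel_measurable borel" by (rule borel_measurable_continuous_onI[OF dissip_q])
  have f0: "0 \<le> ?f t" for t using dissip_nonneg[OF \<tau>] by simp
  have fi: "integrable lborel ?f" by (intro Bochner_Integration.integrable_add L2_integrable v dissip_integrable)
  have fle: "(\<integral>t. ?f t \<partial>lborel) \<le> 15 * (l2norm v)\<^sup>2"
    using dissip_integral dissip_integrable L2_integrable[OF v] by (simp add: l2norm_power2)
  define S where "S = {x. q x < - \<tau>}"
  have Sm [measurable]: "S \<in> sets borel" unfolding S_def by measurable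
  have ptw: "ennreal (\<tau> / 20) * indicator S x \<le> (\<integral>\<^sup>+t. ennreal (?f t) * indicator {x - \<Lambda>..x} t \<partial>lborel)" for x
  proof (cases "x \<in> S")
    case True
    have i: "integrable lborel (\<lambda>t. ?f t * indicator {x - \<Lambda>..x} t)" by (rule integrable_real_mult_indicator[OF _ fi]) simp
    have "ennreal (\<tau> / 20) \<le> ennreal (\<integral>t. ?f t * indicator {x - \<Lambda>..x} t \<partial>lborel)"
      using cost[of x] True by (intro ennreal_leI) (simp add: S_def set_lebesgue_integral_def mult.commute)
    also have "\<dots> = (\<integral>\<^sup>+t. ennreal (?f t * indicator {x - \<Lambda>..x} t) \<partial>lborel)"
      by (rule nn_integral_eq_integral[OF i, symmetric]) (use f0 in auto)
    also have "\<dots> = (\<integral>\<^sup>+t. ennreal (?f t) * indicator {x - \<Lambda>..x} t \<partial>lborel)"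
      by (intro nn_integral_cong) (auto simp: indicator_def)
    finally show ?thesis using True by simp
  qed simp
  have "ennreal (\<tau> / 20) * emeasure lborel S = (\<integral>\<^sup>+x. ennreal (\<tau> / 20) * indicator S x \<partial>lborel)"
    by (simp add: nn_integral_cmult_indicator)
  also have "\<dots> \<le> (\<integral>\<^sup>+x. (\<integral>\<^sup>+t. ennreal (?f t) * indicator {x - \<Lambda>..x} t \<partial>lborel) \<partial>lborel)"
    by (intro nn_integral_mono ptw)
  also have "\<dots> = (\<integral>\<^sup>+t. (\<integral>\<^sup>+x. ennreal (?f t) * indicator {x - \<Lambda>..x} t \<partial>lborel) \<partial>lborel)"
  proof (rule lborel_pair.Fubini')
    have "(\<lambda>(t, x). indicator {x - \<Lambda>..x} t :: ennreal) = indicator {p. snd p - \<Lambda> \<le> fst p \<and> fst p \<le> snd p}"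
      by (auto simp: indicator_def)
    moreover have "{p. snd p - \<Lambda> \<le> fst p \<and> fst p \<le> snd p} \<in> sets (lborel \<Otimes>\<^sub>M lborel :: (real \<times> real) measure)"
    proof -
      have "closed {p :: real \<times> real. snd p - \<Lambda> \<le> fst p \<and> fst p \<le> snd p}"
        by (intro closed_Collect_conj closed_Collect_le continuous_intros)
      then have "{p. snd p - \<Lambda> \<le> fst p \<and> fst p \<le> snd p} \<in> sets (borel :: (real \<times> real) measure)" by (rule borel_closed)
      moreover have "sets (lborel \<Otimes>\<^sub>M lborel) = sets (borel :: (real \<times> real) measure)" by (metis lborel_prod sets_lborel)
      ultimately show ?thesis by (simp only:)
    qed
    ultimately have [measurable]: "(\<lambda>(t, x). indicator {x - \<Lambda>..x} t :: ennreal) \<in> borel_measurable (lborel \<Otimes>\<^sub>M lborel)"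
      by simp
    show "(\<lambda>(t, x). ennreal (?f t) * indicator {x - \<Lambda>..x} t) \<in> borel_measurable (lborel \<Otimes>\<^sub>M lborel)" by measurable
  qed
  also have "\<dots> = (\<integral>\<^sup>+t. ennreal (?f t) * ennreal \<Lambda> \<partial>lborel)"
  proof (rule nn_integral_cong)
    fix t
    have "(\<integral>\<^sup>+x. ennreal (?f t) * indicator {x - \<Lambda>..x} t \<partial>lborel) = (\<integral>\<^sup>+x. ennreal (?f t) * indicator {t..t + \<Lambda>} x \<partial>lborel)"
      by (intro nn_integral_cong) (auto simp: indicator_def)
    also have "\<dots> = ennreal (?f t) * ennreal \<Lambda>" using \<Lambda> by (simp add: nn_integral_cmult_indicator)
    finally show "(\<integral>\<^sup>+x. ennreal (?f t) * indicator {x - \<Lambda>..x} t \<partial>lborel) = ennreal (?f t) * ennreal \<Lambda>" .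
  qed
  also have "\<dots> = (\<integral>\<^sup>+t. ennreal (?f t) \<partial>lborel) * ennreal \<Lambda>" by (rule nn_integral_multc) measurable
  also have "(\<integral>\<^sup>+t. ennreal (?f t) \<partial>lborel) = ennreal (\<integral>t. ?f t \<partial>lborel)" by (rule nn_integral_eq_integral[OF fi]) (use f0 in auto)
  also have "ennreal (\<integral>t. ?f t \<partial>lborel) * ennreal \<Lambda> \<le> ennreal (15 * (l2norm v)\<^sup>2 * \<Lambda>)"
    using fle \<Lambda> by (simp add: ennreal_mult''[symmetric] ennreal_leI mult_right_mono)
  finally have le: "ennreal (\<tau> / 20) * emeasure lborel S \<le> ennreal (15 * (l2norm v)\<^sup>2 * \<Lambda>)" .
  have fin: "emeasure lborel S < \<infinity>"
  proof (rule ccontr)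
    assume "\<not> emeasure lborel S < \<infinity>"
    then have "emeasure lborel S = \<infinity>" by (simp add: less_top[symmetric])
    then show False using le \<tau> by (simp add: ennreal_mult_top top_unique)
  qed
  have i: "integrable lborel (indicator S :: real \<Rightarrow> real)" using fin by (intro integrable_real_indicator) auto
  then show "integrable lborel (\<lambda>x. indicator {x. q x < - \<tau>} x :: real)" by (simp add: S_def)
  have em: "emeasure lborel S = ennreal (measure lborel S)" using fin by (intro emeasure_eq_ennreal_measure) auto
  have "\<tau> / 20 * measure lborel S \<le> 15 * (l2norm v)\<^sup>2 * \<Lambda>"
    using le \<tau> \<Lambda> unfolding em by (simp add: ennreal_mult'[symmetric])
  then have "\<tau> * measure lborel S \<le> 300 * \<Lambda> * (l2norm v)\<^sup>2" by (simp add: mult_ac)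
  then show "\<tau> * (\<integral>x. indicator {x. q x < - \<tau>} x \<partial>lborel) \<le> 300 * \<Lambda> * (l2norm v)\<^sup>2"
    unfolding S_def[symmetric] using Sm by (simp add: mult_ac)
qed

text \<open>Pointwise \<open>q\<^sup>2\<close> is controlled by the dissipation, except for \<open>8 \<tau>\<^sup>2\<close> on the set where \<open>q\<close> is closer to
\<open>-2 \<tau>\<close>.  The constants are \<open>58 = 4 \<cdot> 14 + 2\<close> and \<open>4800 = 16 \<cdot> 300\<close>.\<close>

lemma w_bound:
  assumes "\<Lambda> \<ge> 0" and "\<And>x. q x < - \<tau> \<Longrightarrow> \<tau> / 20 \<le> (LBINT t:{x - \<Lambda>..x}. (v t)\<^sup>2 + dissip \<tau> (q t))"
  shows "L2 (\<lambda>x. q x + v x)" "(l2norm (\<lambda>x. q x + v x))\<^sup>2 \<le> (58 + 4800 * (\<tau> * \<Lambda>)) * (l2norm v)\<^sup>2"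
proof -
  note S = left_set_measure[OF assms]
  have \<tau>: "\<tau> > 0" by (rule tau_pos)
  have [measurable]: "q \<in> borel_measurable borel" by (rule abs_cont_measurable[OF q])
  have [measurable]: "v \<in> borel_measurable borel" by (rule L2_measurable[OF v])
  have ptw: "(q x + v x)\<^sup>2 \<le> 4 * dissip \<tau> (q x) + 16 * \<tau>\<^sup>2 * indicator {x. q x < - \<tau>} x + 2 * (v x)\<^sup>2" for x
  proof -
    have "0 \<le> (q x - v x)\<^sup>2" by simp
    then have 1: "(q x + v x)\<^sup>2 \<le> 2 * (q x)\<^sup>2 + 2 * (v x)\<^sup>2" by (simp add: power2_eq_square algebra_simps)
    have "(q x)\<^sup>2 \<le> 2 * dissip \<tau> (q x) + 8 * \<tau>\<^sup>2 * indicator {x. q x < - \<tau>} x"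
    proof (cases "q x < - \<tau>")
      case True
      have "0 \<le> (q x + 2 * \<tau> + 2 * \<tau>)\<^sup>2" by simp
      then have "(q x)\<^sup>2 \<le> 2 * (q x + 2 * \<tau>)\<^sup>2 + 8 * \<tau>\<^sup>2" by (simp add: power2_eq_square algebra_simps)
      then show ?thesis using dissip_ge_near_2\<tau>[OF \<tau>, of "q x"] True by simp
    next
      case False
      then show ?thesis using dissip_ge_near_0[OF \<tau>, of "q x"] dissip_nonneg[OF \<tau>, of "q x"] by simp
    qed
    with 1 show ?thesis by linarith
  qed
  have i: "integrable lborel (\<lambda>x. 4 * dissip \<tau> (q x) + 16 * \<tau>\<^sup>2 * indicator {x. q x < - \<tau>} x + 2 * (v x)\<^sup>2)"
    by (intro Bochner_Integration.integrable_add integrable_mult_right dissip_integrable S(1) L2_integrable v)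
  have i2: "integrable lborel (\<lambda>x. (q x + v x)\<^sup>2)"
  proof (rule Bochner_Integration.integrable_bound[OF i])
    show "AE x in lborel. norm ((q x + v x)\<^sup>2) \<le> norm (4 * dissip \<tau> (q x) + 16 * \<tau>\<^sup>2 * indicator {x. q x < - \<tau>} x + 2 * (v x)\<^sup>2)"
      unfolding real_norm_def abs_power2 by (intro AE_I2 order_trans[OF ptw abs_ge_self])
  qed measurable
  then show "L2 (\<lambda>x. q x + v x)" by (simp add: L2_def)
  have "(l2norm (\<lambda>x. q x + v x))\<^sup>2 \<le> (\<integral>x. 4 * dissip \<tau> (q x) + 16 * \<tau>\<^sup>2 * indicator {x. q x < - \<tau>} x + 2 * (v x)\<^sup>2 \<partial>lborel)"
    unfolding l2norm_power2 by (rule integral_mono[OF i2 i ptw])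
  also have "\<dots> = 4 * (\<integral>x. dissip \<tau> (q x) \<partial>lborel) + 16 * \<tau>\<^sup>2 * (\<integral>x. indicator {x. q x < - \<tau>} x \<partial>lborel) + 2 * (l2norm v)\<^sup>2"
    using dissip_integrable S(1) L2_integrable[OF v] by (simp add: l2norm_power2)
  also have "\<dots> \<le> 4 * (14 * (l2norm v)\<^sup>2) + 16 * \<tau> * (300 * \<Lambda> * (l2norm v)\<^sup>2) + 2 * (l2norm v)\<^sup>2"
  proof -
    define I where "I = (\<integral>x. indicator {x. q x < - \<tau>} x \<partial>lborel :: real)"
    have "16 * \<tau> * (\<tau> * I) \<le> 16 * \<tau> * (300 * \<Lambda> * (l2norm v)\<^sup>2)"
      unfolding I_def using S(2) \<tau> by (intro mult_left_mono) auto
    moreover have "16 * \<tau>\<^sup>2 * I = 16 * \<tau> * (\<tau> * I)" by (simp add: power2_eq_square)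
    ultimately show ?thesis using dissip_integral unfolding I_def[symmetric] by linarith
  qed
  finally show "(l2norm (\<lambda>x. q x + v x))\<^sup>2 \<le> (58 + 4800 * (\<tau> * \<Lambda>)) * (l2norm v)\<^sup>2" by (simp add: algebra_simps)
qed

end

section \<open>The lower bound for the \<open>H\<^sup>-\<^sup>1\<close> norm\<close>

text \<open>The estimate \<open>w_bound\<close> is applied to \<open>q = - z\<close> and \<open>v = w + z\<close>.  The slope bound \<open>K\<close> of one fixed smooth step
is a parameter here, so that the constant is seen to be the same for all \<open>\<tau>\<close>, \<open>\<tau>\<^sub>1\<close> and \<open>w\<close>.\<close>

theorem L2_bound_by_Hneg_norm:
  assumes K: "K \<ge> 1" "\<And>x. \<bar>deriv smooth_step x\<bar> \<le> K" "\<And>x. x \<notin> {0..1} \<Longrightarrow> deriv smooth_step x = 0"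
    and \<tau>: "\<tau> > 0" and w: "L2_loc w" and w0: "set_integrable lborel {..0} (\<lambda>x. (w x)\<^sup>2)"
    and T: "Hneg (miura \<tau> w)" and \<tau>1: "0 \<le> \<tau>\<^sub>1" "\<tau>\<^sub>1 < \<tau>"
    and inf: "is_infimum (- (\<tau>\<^sub>1\<^sup>2)) (spectrum (miura \<tau> w))"
  shows "L2 w" "(l2norm w)\<^sup>2 \<le> (58 + 4800 * (3 + 2 * ln K)) * (1 + ln (\<tau> / (\<tau> - \<tau>\<^sub>1))) * (Hneg_norm \<tau> (miura \<tau> w))\<^sup>2"
proof -
  let ?T = "miura \<tau> w"
  define N where "N = Hneg_norm \<tau> ?T"
  have N: "N \<ge> 0" by (simp add: N_def Hneg_norm_def Let_def)
  have bd: "H1_bounded ?T" by (rule miura_H1_bounded[OF w T])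
  define \<delta> where "\<delta> = \<tau>\<^sup>2 - \<tau>\<^sub>1\<^sup>2"
  have \<delta>: "\<tau> * (\<tau> - \<tau>\<^sub>1) \<le> \<delta>"
  proof -
    have "\<delta> = (\<tau> + \<tau>\<^sub>1) * (\<tau> - \<tau>\<^sub>1)" by (simp add: \<delta>_def power2_eq_square algebra_simps)
    then show ?thesis using \<tau>1 by (simp add: mult_right_mono)
  qed
  have \<delta>0: "\<delta> > 0" using \<delta> \<tau> \<tau>1 by (smt (verit) mult_pos_pos)
  have low: "schroedinger_form ?T \<psi> \<psi> \<ge> - \<tau>\<^sup>2 * (l2norm \<psi>)\<^sup>2" if \<psi>: "H1 \<psi>" for \<psi>
  proof (rule form_ge_of_test_functions[OF bd \<psi>])
    fix \<phi> assume \<phi>: "test_function \<phi>"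
    have "0 \<le> (\<integral>x. (deriv \<phi> x - (w x + \<tau>) * \<phi> x)\<^sup>2 \<partial>lborel)" by (rule integral_nonneg_AE) simp
    then show "- \<tau>\<^sup>2 * (l2norm \<phi>)\<^sup>2 \<le> (\<integral>x. (deriv \<phi> x)\<^sup>2 \<partial>lborel) + ?T (\<lambda>x. \<phi> x * \<phi> x)"
      using miura_factorization(1)[OF w \<phi>, of \<tau>] unfolding mult_minus_left by linarith
  qed
  have ge: "\<delta> * (l2norm \<phi>)\<^sup>2 \<le> (\<integral>x. (deriv \<phi> x - (w x + \<tau>) * \<phi> x)\<^sup>2 \<partial>lborel)" if \<phi>: "test_function \<phi>" for \<phi>
    using form_ge_Inf_spectrum[OF bd low inf H1_test[OF \<phi>]] miura_factorization(1)[OF w \<phi>, of \<tau>]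
    unfolding form_test[OF bd \<phi>] by (simp add: \<delta>_def left_diff_distrib)
  obtain z where z: "abs_cont z (\<lambda>x. (w x)\<^sup>2 + \<tau> * w x - \<tau> * z x)" "(z \<longlongrightarrow> 0) at_bot"
    by (rule duhamel_solution[OF \<tau> w w0])
  define v where "v = (\<lambda>x. w x + z x)"
  have vN: "L2 v" "l2norm v \<le> N"
    unfolding v_def N_def by (rule duhamel_norm[OF \<tau> w w0 z N[unfolded N_def] Hneg_norm_bound[OF T \<tau>]]; assumption)+
  define q where "q = (\<lambda>x. - z x)"
  interpret riccati \<tau> q v
  proof
    have "abs_cont (\<lambda>x. (-1) * z x) (\<lambda>x. (-1) * ((w x)\<^sup>2 + \<tau> * w x - \<tau> * z x))" by (rule abs_cont_cmult[OF z(1)])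
    moreover have "(-1) * ((w x)\<^sup>2 + \<tau> * w x - \<tau> * z x) = - (q x * (q x + 2 * \<tau>) + (2 * q x + \<tau>) * v x + (v x)\<^sup>2)" for x
      by (simp add: q_def v_def power2_eq_square algebra_simps)
    ultimately show "abs_cont q (\<lambda>x. - (q x * (q x + 2 * \<tau>) + (2 * q x + \<tau>) * v x + (v x)\<^sup>2))" by (simp add: q_def)
    show "(q \<longlongrightarrow> 0) at_bot" unfolding q_def using tendsto_minus[OF z(2)] by simp
  qed (use \<tau> vN in auto)
  have qv: "q x + v x = w x" for x by (simp add: q_def v_def)
  obtain W where W: "abs_cont W (\<lambda>x. w x + \<tau>)"
    using abs_cont_exists loc_integrable_add[OF L2_loc_imp_loc_integrable[OF w] loc_integrable_continuous[OF continuous_on_const]] by blast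
  define l where "l = ln (\<tau> / (\<tau> - \<tau>\<^sub>1))"
  have l: "l \<ge> 0" unfolding l_def using \<tau> \<tau>1 by (intro ln_ge_zero) (simp add: le_divide_eq)
  have K0: "ln K \<ge> 0" using K(1) by simp
  \<comment> \<open>\<open>\<Lambda>\<close> is chosen to make the constant \<open>K\<^sup>2 \<tau>\<^sup>2 exp (5 / 2 - \<tau> \<Lambda>)\<close> equal to
    \<open>exp (- 1 / 2) \<tau> (\<tau> - \<tau>\<^sub>1)\<close>, which is below \<open>\<delta>\<close>.\<close>
  define \<Lambda> where "\<Lambda> = (3 + 2 * ln K + l) / \<tau>"
  have \<tau>\<Lambda>: "\<tau> * \<Lambda> = 3 + 2 * ln K + l" using \<tau> by (simp add: \<Lambda>_def)
  have \<Lambda>0: "\<Lambda> \<ge> 0" using \<tau> l K0 by (simp add: \<Lambda>_def)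
  have exp_small: "K\<^sup>2 * \<tau>\<^sup>2 * exp (5 / 2 - \<tau> * \<Lambda>) < \<delta>"
  proof -
    have "5 / 2 - \<tau> * \<Lambda> = - 1 / 2 - 2 * ln K - l" by (simp add: \<tau>\<Lambda>)
    then have "exp (5 / 2 - \<tau> * \<Lambda>) = exp (- 1 / 2) / exp (2 * ln K) / exp l" by (simp only: exp_diff)
    also have "exp (2 * ln K) = K\<^sup>2" using K(1) by (simp add: exp_double)
    also have "exp l = \<tau> / (\<tau> - \<tau>\<^sub>1)" unfolding l_def using \<tau> \<tau>1 by simp
    finally have e: "exp (5 / 2 - \<tau> * \<Lambda>) = exp (- 1 / 2) / K\<^sup>2 / (\<tau> / (\<tau> - \<tau>\<^sub>1))" .
    have "K\<^sup>2 * \<tau>\<^sup>2 * exp (5 / 2 - \<tau> * \<Lambda>) = exp (- 1 / 2) * (\<tau> * (\<tau> - \<tau>\<^sub>1))"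
      unfolding e using K(1) \<tau> by (simp add: power2_eq_square)
    also have "\<dots> < 1 * (\<tau> * (\<tau> - \<tau>\<^sub>1))" using \<tau> \<tau>1 by (intro mult_strict_right_mono) auto
    finally show ?thesis using \<delta> by simp
  qed
  have cost: "\<tau> / 20 \<le> (LBINT t:{x - \<Lambda>..x}. (v t)\<^sup>2 + dissip \<tau> (q t))" if "q x < - \<tau>" for x
  proof (rule cost_before_left[OF _ _ _ _ exp_small that])
    show "abs_cont W (\<lambda>x. q x + v x + \<tau>)" using W by (simp only: qv)
    show "\<delta> * (LBINT t:{\<alpha>..\<alpha> + 1 / \<tau>}. exp (2 * W t)) \<le> K\<^sup>2 * \<tau>\<^sup>2 * (LBINT t:{\<beta> - 1 / \<tau>..\<beta>}. exp (2 * W t))"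
      if "\<alpha> + 1 / \<tau> < \<beta> - 1 / \<tau>" for \<alpha> \<beta>
      by (rule Hardy_two_intervals[OF \<tau> w w0 W less_imp_le[OF \<delta>0] ge K that])
    show "3 \<le> \<tau> * \<Lambda>" using l K0 by (simp add: \<tau>\<Lambda>)
  qed (use \<tau> in auto)
  note B = w_bound[OF \<Lambda>0 cost, unfolded qv]
  show "L2 w" using B(1) by simp
  have "(l2norm w)\<^sup>2 \<le> (58 + 4800 * (\<tau> * \<Lambda>)) * (l2norm v)\<^sup>2" using B(2) by simp
  also have "\<dots> \<le> ((58 + 4800 * (3 + 2 * ln K)) * (1 + l)) * N\<^sup>2"
  proof (rule mult_mono)
    have "0 \<le> l * (58 + 4800 * (2 + 2 * ln K))" using l K0 by simp
    then show "58 + 4800 * (\<tau> * \<Lambda>) \<le> (58 + 4800 * (3 + 2 * ln K)) * (1 + l)" unfolding \<tau>\<Lambda> by (simp add: algebra_simps)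
    show "(l2norm v)\<^sup>2 \<le> N\<^sup>2" using vN(2) by (intro power_mono) auto
  qed (use l K0 in auto)
  finally show "(l2norm w)\<^sup>2 \<le> (58 + 4800 * (3 + 2 * ln K)) * (1 + ln (\<tau> / (\<tau> - \<tau>\<^sub>1))) * (Hneg_norm \<tau> ?T)\<^sup>2"
    by (simp only: l_def N_def)
qed

theorem lemma4p2:
  "(\<forall>(\<tau>::real) w. \<tau> > 0 \<and> L2 w \<longrightarrow>
      Hneg (miura \<tau> w) \<and>
      Hneg_norm \<tau> (miura \<tau> w) \<le> (2 + \<tau> powr (-1/2) * l2norm w) * l2norm w)
   \<and> (\<forall>(\<tau>::real) w \<psi>. \<tau> > 0 \<and> L2 w \<and> H1 \<psi> \<longrightarrow>
      schroedinger_form (miura \<tau> w) \<psi> \<psi> + \<tau>\<^sup>2 * (l2norm \<psi>)\<^sup>2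
        \<ge> \<tau>\<^sup>2 / 4 * exp (- (1 / \<tau>) * (l2norm w)\<^sup>2) * (l2norm \<psi>)\<^sup>2)
   \<and> (\<exists>C>0. \<forall>(\<tau>::real) (\<tau>\<^sub>1::real) w.
      \<tau> > 0 \<and> L2_loc w \<and> set_integrable lborel {..0} (\<lambda>x. (w x)\<^sup>2) \<and>
      Hneg (miura \<tau> w) \<and> 0 \<le> \<tau>\<^sub>1 \<and> \<tau>\<^sub>1 < \<tau> \<and>
      is_infimum (- (\<tau>\<^sub>1\<^sup>2)) (spectrum (miura \<tau> w)) \<longrightarrow>
      L2 w \<and>
      l2norm w \<le> C * sqrt (1 + ln (\<tau> / (\<tau> - \<tau>\<^sub>1))) * Hneg_norm \<tau> (miura \<tau> w))"
proof (intro conjI)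
  show "\<forall>(\<tau>::real) w. \<tau> > 0 \<and> L2 w \<longrightarrow>
      Hneg (miura \<tau> w) \<and>
      Hneg_norm \<tau> (miura \<tau> w) \<le> (2 + \<tau> powr (-1/2) * l2norm w) * l2norm w"
    using miura_Hneg by blast
  show "\<forall>(\<tau>::real) w \<psi>. \<tau> > 0 \<and> L2 w \<and> H1 \<psi> \<longrightarrow>
      schroedinger_form (miura \<tau> w) \<psi> \<psi> + \<tau>\<^sup>2 * (l2norm \<psi>)\<^sup>2
        \<ge> \<tau>\<^sup>2 / 4 * exp (- (1 / \<tau>) * (l2norm w)\<^sup>2) * (l2norm \<psi>)\<^sup>2"
    using miura_form_ge by blast
  obtain K where K: "K \<ge> 1" "\<And>x. \<bar>deriv smooth_step x\<bar> \<le> K" "\<And>x. x \<notin> {0..1} \<Longrightarrow> deriv smooth_step x = 0"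
    using smooth_step_deriv by blast
  define c where "c = 58 + 4800 * (3 + 2 * ln K)"
  have c: "c > 0" using K(1) by (simp add: c_def add_pos_nonneg)
  have "L2 w \<and> l2norm w \<le> sqrt c * sqrt (1 + ln (\<tau> / (\<tau> - \<tau>\<^sub>1))) * Hneg_norm \<tau> (miura \<tau> w)"
    if "\<tau> > 0 \<and> L2_loc w \<and> set_integrable lborel {..0} (\<lambda>x. (w x)\<^sup>2) \<and>
      Hneg (miura \<tau> w) \<and> 0 \<le> \<tau>\<^sub>1 \<and> \<tau>\<^sub>1 < \<tau> \<and>
      is_infimum (- (\<tau>\<^sub>1\<^sup>2)) (spectrum (miura \<tau> w))" for \<tau> \<tau>\<^sub>1 :: real and w
  proof
    note B = L2_bound_by_Hneg_norm[OF K, of \<tau> w \<tau>\<^sub>1]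
    show "L2 w" using B(1) that by blast
    let ?N = "Hneg_norm \<tau> (miura \<tau> w)"
    have N: "?N \<ge> 0" by (simp add: Hneg_norm_def Let_def)
    have le: "(l2norm w)\<^sup>2 \<le> c * (1 + ln (\<tau> / (\<tau> - \<tau>\<^sub>1))) * ?N\<^sup>2" unfolding c_def using B(2) that by blast
    have "l2norm w \<le> sqrt (c * (1 + ln (\<tau> / (\<tau> - \<tau>\<^sub>1))) * ?N\<^sup>2)" using le by (rule real_le_rsqrt)
    then show "l2norm w \<le> sqrt c * sqrt (1 + ln (\<tau> / (\<tau> - \<tau>\<^sub>1))) * ?N" using N by (simp add: real_sqrt_mult)
  qed
  then show "\<exists>C>0. \<forall>(\<tau>::real) (\<tau>\<^sub>1::real) w.
      \<tau> > 0 \<and> L2_loc w \<and> set_integrable lborel {..0} (\<lambda>x. (w x)\<^sup>2) \<and>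
      Hneg (miura \<tau> w) \<and> 0 \<le> \<tau>\<^sub>1 \<and> \<tau>\<^sub>1 < \<tau> \<and>
      is_infimum (- (\<tau>\<^sub>1\<^sup>2)) (spectrum (miura \<tau> w)) \<longrightarrow>
      L2 w \<and>
      l2norm w \<le> C * sqrt (1 + ln (\<tau> / (\<tau> - \<tau>\<^sub>1))) * Hneg_norm \<tau> (miura \<tau> w)"
    using c by (intro exI[of _ "sqrt c"]) auto
qed

end
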